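(* Let $C$ be a right semiperfect coalgebra over a field $K$. Let $\mathscr R:\mathscr X\longrightarrow\mathscr Ent_C$ be an entwined $C$-representation of a small category $\mathscr X$. Then the category $Mod^C-\mathscr R$ of entwined modules over $\mathscr R$ is a Grothendieck category.
   Context: Conventions. $\otimes=\otimes_K$; coalgebras are coassociative counital $K$-coalgebras; $\Delta_C(c)=c_1\otimes c_2$ and comodule coactions are written $m\mapsto m_0\otimes m_1$ (summation suppressed). For a small $K$-linear category $\mathcal R$, a right $\mathcal R$-module is a $K$-linear functor $\mathcal R^{op}\to Vect_K$; for $m\in\mathcal M(r)$, $f\in\mathcal R(s,r)$ write $mf:=\mathcal M(f)(m)\in\mathcal M(s)$. $C$ is right semiperfect if the category $Comod-C$ of right $C$-comodules has enough projectives. Entwining structure. $(\mathcal R,C,\psi)$ consists of a small $K$-linear category $\mathcal R$, a $K$-coalgebra $C$ and $K$-linear maps $\psi_{rs}:C\otimes\mathcal R(r,s)\to\mathcal R(r,s)\otimes C$, written $\psi(c\otimes f)=f_\psi\otimes c^\psi$, such that for $f\in\mathcal R(r,s)$, $g\in\mathcal R(s,t)$, $c\in C$: $(gf)_\psi\otimes c^\psi=g_\psi f_\psi\otimes {c^\psi}^\psi$ ($\psi$ is first applied to $c\otimes g$, then to $c^\psi\otimes f$); $\varepsilon_C(c^\psi)f_\psi=\varepsilon_C(c)f$; $f_\psi\otimes\Delta_C(c^\psi)={f_\psi}_\psi\otimes {c_1}^\psi\otimes {c_2}^\psi$ ($\psi$ is first applied to $c_2\otimes f$, then to $c_1\otimes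 f_\psi$); $\psi(c\otimes id_r)=id_r\otimes c$. Entwined modules. $\mathbf M_{\mathcal R}^C(\psi)$ has as objects right $\mathcal R$-modules $\mathcal M$ with a right $C$-comodule structure on each $\mathcal M(s)$ such that $(mf)_0\otimes(mf)_1=m_0f_\psi\otimes {m_1}^\psi$ for $f\in\mathcal R(s,r)$, $m\in\mathcal M(r)$; morphisms are morphisms of right $\mathcal R$-modules that are $C$-colinear at each object. Representations. $\mathscr Ent_C$ is the category of entwining structures $(\mathcal R,C,\psi)$ with $C$ fixed; a morphism $\alpha:(\mathcal R,C,\psi)\to(\mathcal S,C,\psi')$ is a $K$-linear functor $\alpha:\mathcal R\to\mathcal S$ with $\alpha(f_\psi)\otimes c^\psi=\alpha(f)_{\psi'}\otimes c^{\psi'}$. It induces the restriction functor $\alpha_\ast:\mathbf M_{\mathcal S}^C(\psi')\to\mathbf M_{\mathcal R}^C(\psi)$, $(\alpha_\ast\mathcal N)(r)=\mathcal N(\alpha(r))$ with the same coaction and $\mathcal R$ acting through $\alpha$. An entwined $C$-representation of $\mathscr X$ is a functor $\mathscr R:\mathscr X\to\mathscr Ent_C$, $x\mapsto(\mathscr R_x,C,\psi_x)$; for $\alpha:x\to y$ in $\mathscr X$ write $\alpha_\ast$ for $\mathscr R_{\alpha\ast}$. Modules over $\mathscr R$. An object $\mathscr M$ of $Mod^C-\mathscr R$ consists of $\mathscr M_x\in\mathbf M^C_{\mathscr R_x}(\psi_x)$ for each $x\in\mathscr X$ and morphisms $\mathscr M_\alpha:\mathscr M_x\to\alpha_\ast\mathscr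 M_y$ in $\mathbf M^C_{\mathscr R_x}(\psi_x)$ for each $\alpha:x\to y$, with $\mathscr M_{id_x}=id$ and $\mathscr M_{\beta\alpha}=\alpha_\ast(\mathscr M_\beta)\circ\mathscr M_\alpha$. A morphism $\eta:\mathscr M\to\mathscr N$ consists of morphisms $\eta_x:\mathscr M_x\to\mathscr N_x$ in $\mathbf M^C_{\mathscr R_x}(\psi_x)$ with $\mathscr N_\alpha\circ\eta_x=\alpha_\ast(\eta_y)\circ\mathscr M_\alpha$. *)

theory Defs
  imports "HOL-Algebra.Module" "HOL-Algebra.AbelCoset" "HOL-Library.FuncSet"
begin

unbundle cardinal_syntax

section \<open>Size\<close>

text \<open>
  A type \<open>'u\<close> whose cardinality is regular and uncountable plays the role of the universe: a set
  is small if it has fewer elements than \<open>'u\<close>.  If the cardinality of \<open>'u\<close> is strongly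
  inaccessible, these are (up to bijection) the elements of a Grothendieck universe.  Only
  regularity is required, so that such types can be constructed inside HOL.
\<close>

definition universe :: "'u itself \<Rightarrow> bool" where
  "universe (U :: 'u itself) \<longleftrightarrow> natLeq <o |UNIV :: 'u set| \<and> regularCard |UNIV :: 'u set|"

definition small :: "'u itself \<Rightarrow> 'a set \<Rightarrow> bool" where
  "small (U :: 'u itself) A \<longleftrightarrow> |A| <o |UNIV :: 'u set|"


section \<open>Categories\<close>

text \<open>
  Hom-sets need not be disjoint, so composition takes the three objects as arguments:
  \<open>cmp C A B D g f\<close> is the composite of \<open>f : A \<rightarrow> B\<close> and \<open>g : B \<rightarrow> D\<close>.
\<close>

record ('o, 'a) cat =
  obj :: "'o set"
  arr :: "'o \<Rightarrow> 'o \<Rightarrow> 'a set"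
  ident :: "'o \<Rightarrow> 'a"
  cmp :: "'o \<Rightarrow> 'o \<Rightarrow> 'o \<Rightarrow> 'a \<Rightarrow> 'a \<Rightarrow> 'a"

locale category =
  fixes C :: "('o, 'a) cat"
  assumes ident_arr: "A \<in> obj C \<Longrightarrow> ident C A \<in> arr C A A"
    and cmp_arr: "\<lbrakk>A \<in> obj C; B \<in> obj C; D \<in> obj C; f \<in> arr C A B; g \<in> arr C B D\<rbrakk>
      \<Longrightarrow> cmp C A B D g f \<in> arr C A D"
    and cmp_ident_right: "\<lbrakk>A \<in> obj C; B \<in> obj C; f \<in> arr C A B\<rbrakk>
      \<Longrightarrow> cmp C A A B f (ident C A) = f"
    and cmp_ident_left: "\<lbrakk>A \<in> obj C; B \<in> obj C; f \<in> arr C A B\<rbrakk>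
      \<Longrightarrow> cmp C A B B (ident C B) f = f"
    and cmp_assoc: "\<lbrakk>A \<in> obj C; B \<in> obj C; D \<in> obj C; E \<in> obj C;
        f \<in> arr C A B; g \<in> arr C B D; h \<in> arr C D E\<rbrakk>
      \<Longrightarrow> cmp C A D E h (cmp C A B D g f) = cmp C A B E (cmp C B D E h g) f"

definition small_category :: "'u itself \<Rightarrow> ('o, 'a) cat \<Rightarrow> bool" where
  "small_category U C \<longleftrightarrow> category C \<and> small U (obj C) \<and>
     (\<forall>A\<in>obj C. \<forall>B\<in>obj C. small U (arr C A B))"

record ('o, 'a, 'p, 'b) cfunctor =
  fob :: "'o \<Rightarrow> 'p"
  farr :: "'o \<Rightarrow> 'o \<Rightarrow> 'a \<Rightarrow> 'b"

definition is_functor :: "('o, 'a) cat \<Rightarrow> ('p, 'b) cat \<Rightarrow> ('o, 'a, 'p, 'b) cfunctor \<Rightarrow> bool" where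
  "is_functor C D F \<longleftrightarrow>
     fob F \<in> obj C \<rightarrow> obj D \<and>
     (\<forall>A\<in>obj C. \<forall>B\<in>obj C. farr F A B \<in> arr C A B \<rightarrow> arr D (fob F A) (fob F B)) \<and>
     (\<forall>A\<in>obj C. farr F A A (ident C A) = ident D (fob F A)) \<and>
     (\<forall>A\<in>obj C. \<forall>B\<in>obj C. \<forall>E\<in>obj C. \<forall>f\<in>arr C A B. \<forall>g\<in>arr C B E.
        farr F A E (cmp C A B E g f)
          = cmp D (fob F A) (fob F B) (fob F E) (farr F B E g) (farr F A B f))"

definition nat_trans :: "('o, 'a) cat \<Rightarrow> ('p, 'b) cat \<Rightarrow> ('o, 'a, 'p, 'b) cfunctor
    \<Rightarrow> ('o, 'a, 'p, 'b) cfunctor \<Rightarrow> ('o \<Rightarrow> 'b) \<Rightarrow> bool" where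
  "nat_trans J C F G t \<longleftrightarrow>
     (\<forall>i\<in>obj J. t i \<in> arr C (fob F i) (fob G i)) \<and>
     (\<forall>i\<in>obj J. \<forall>j\<in>obj J. \<forall>u\<in>arr J i j.
        cmp C (fob F i) (fob G i) (fob G j) (farr G i j u) (t i)
          = cmp C (fob F i) (fob F j) (fob G j) (t j) (farr F i j u))"

definition monic :: "('o, 'a) cat \<Rightarrow> 'o \<Rightarrow> 'o \<Rightarrow> 'a \<Rightarrow> bool" where
  "monic C A B f \<longleftrightarrow> f \<in> arr C A B \<and>
     (\<forall>T\<in>obj C. \<forall>g\<in>arr C T A. \<forall>h\<in>arr C T A. cmp C T A B f g = cmp C T A B f h \<longrightarrow> g = h)"

definition epic :: "('o, 'a) cat \<Rightarrow> 'o \<Rightarrow> 'o \<Rightarrow> 'a \<Rightarrow> bool" where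
  "epic C A B f \<longleftrightarrow> f \<in> arr C A B \<and>
     (\<forall>T\<in>obj C. \<forall>g\<in>arr C B T. \<forall>h\<in>arr C B T. cmp C A B T g f = cmp C A B T h f \<longrightarrow> g = h)"

definition projective :: "('o, 'a) cat \<Rightarrow> 'o \<Rightarrow> bool" where
  "projective C P \<longleftrightarrow> P \<in> obj C \<and>
     (\<forall>A\<in>obj C. \<forall>B\<in>obj C. \<forall>e f. epic C A B e \<and> f \<in> arr C P B \<longrightarrow>
        (\<exists>g\<in>arr C P A. cmp C P A B e g = f))"

definition enough_projectives :: "('o, 'a) cat \<Rightarrow> bool" where
  "enough_projectives C \<longleftrightarrow> (\<forall>A\<in>obj C. \<exists>P e. projective C P \<and> epic C P A e)"

definition zero_object :: "('o, 'a) cat \<Rightarrow> 'o \<Rightarrow> bool" where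
  "zero_object C Z \<longleftrightarrow> Z \<in> obj C \<and>
     (\<forall>A\<in>obj C. (\<exists>!f. f \<in> arr C Z A) \<and> (\<exists>!f. f \<in> arr C A Z))"

definition zero_arrow :: "('o, 'a) cat \<Rightarrow> 'o \<Rightarrow> 'o \<Rightarrow> 'a \<Rightarrow> bool" where
  "zero_arrow C A B f \<longleftrightarrow>
     (\<exists>Z. zero_object C Z \<and> (\<exists>u\<in>arr C A Z. \<exists>v\<in>arr C Z B. f = cmp C A Z B v u))"

definition is_kernel :: "('o, 'a) cat \<Rightarrow> 'o \<Rightarrow> 'o \<Rightarrow> 'a \<Rightarrow> 'o \<Rightarrow> 'a \<Rightarrow> bool" where
  "is_kernel C A B f N k \<longleftrightarrow> N \<in> obj C \<and> k \<in> arr C N A \<and> zero_arrow C N B (cmp C N A B f k) \<and>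
     (\<forall>T\<in>obj C. \<forall>t\<in>arr C T A. zero_arrow C T B (cmp C T A B f t) \<longrightarrow>
        (\<exists>!u. u \<in> arr C T N \<and> cmp C T N A k u = t))"

definition is_cokernel :: "('o, 'a) cat \<Rightarrow> 'o \<Rightarrow> 'o \<Rightarrow> 'a \<Rightarrow> 'o \<Rightarrow> 'a \<Rightarrow> bool" where
  "is_cokernel C A B f Q q \<longleftrightarrow> Q \<in> obj C \<and> q \<in> arr C B Q \<and> zero_arrow C A Q (cmp C A B Q q f) \<and>
     (\<forall>T\<in>obj C. \<forall>t\<in>arr C B T. zero_arrow C A T (cmp C A B T t f) \<longrightarrow>
        (\<exists>!u. u \<in> arr C Q T \<and> cmp C B Q T u q = t))"

text \<open>Exactness of \<open>0 \<rightarrow> A \<rightarrow> B \<rightarrow> D \<rightarrow> 0\<close>.\<close>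

definition short_exact :: "('o, 'a) cat \<Rightarrow> 'o \<Rightarrow> 'o \<Rightarrow> 'o \<Rightarrow> 'a \<Rightarrow> 'a \<Rightarrow> bool" where
  "short_exact C A B D f g \<longleftrightarrow> is_kernel C B D g A f \<and> is_cokernel C A B f D g"

definition preadditive :: "('o, 'a) cat \<Rightarrow> ('o \<Rightarrow> 'o \<Rightarrow> 'a \<Rightarrow> 'a \<Rightarrow> 'a) \<Rightarrow> ('o \<Rightarrow> 'o \<Rightarrow> 'a) \<Rightarrow> bool" where
  "preadditive C hadd hzero \<longleftrightarrow>
     (\<forall>A\<in>obj C. \<forall>B\<in>obj C.
        comm_group \<lparr>carrier = arr C A B, monoid.mult = hadd A B, one = hzero A B\<rparr>) \<and>
     (\<forall>A\<in>obj C. \<forall>B\<in>obj C. \<forall>D\<in>obj C. \<forall>f\<in>arr C A B. \<forall>f'\<in>arr C A B. \<forall>g\<in>arr C B D. \<forall>g'\<in>arr C B D.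
        cmp C A B D g (hadd A B f f') = hadd A D (cmp C A B D g f) (cmp C A B D g f') \<and>
        cmp C A B D (hadd B D g g') f = hadd A D (cmp C A B D g f) (cmp C A B D g' f))"

definition is_biproduct :: "('o, 'a) cat \<Rightarrow> ('o \<Rightarrow> 'o \<Rightarrow> 'a \<Rightarrow> 'a \<Rightarrow> 'a) \<Rightarrow> 'o \<Rightarrow> 'o \<Rightarrow> 'o
    \<Rightarrow> 'a \<Rightarrow> 'a \<Rightarrow> 'a \<Rightarrow> 'a \<Rightarrow> bool" where
  "is_biproduct C hadd A B S i1 i2 p1 p2 \<longleftrightarrow> S \<in> obj C \<and>
     i1 \<in> arr C A S \<and> i2 \<in> arr C B S \<and> p1 \<in> arr C S A \<and> p2 \<in> arr C S B \<and>
     cmp C A S A p1 i1 = ident C A \<and> cmp C B S B p2 i2 = ident C B \<and>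
     hadd S S (cmp C S A S i1 p1) (cmp C S B S i2 p2) = ident C S"

definition abelian_category :: "('o, 'a) cat \<Rightarrow> bool" where
  "abelian_category C \<longleftrightarrow> category C \<and>
     (\<exists>hadd hzero. preadditive C hadd hzero \<and>
        (\<forall>A\<in>obj C. \<forall>B\<in>obj C. \<exists>S i1 i2 p1 p2. is_biproduct C hadd A B S i1 i2 p1 p2)) \<and>
     (\<exists>Z. zero_object C Z) \<and>
     (\<forall>A\<in>obj C. \<forall>B\<in>obj C. \<forall>f\<in>arr C A B.
        (\<exists>N k. is_kernel C A B f N k) \<and> (\<exists>Q q. is_cokernel C A B f Q q)) \<and>
     (\<forall>A\<in>obj C. \<forall>B\<in>obj C. \<forall>f. monic C A B f \<longrightarrow>
        (\<exists>D\<in>obj C. \<exists>g\<in>arr C B D. is_kernel C B D g A f)) \<and>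
     (\<forall>A\<in>obj C. \<forall>B\<in>obj C. \<forall>f. epic C A B f \<longrightarrow>
        (\<exists>D\<in>obj C. \<exists>g\<in>arr C D A. is_cokernel C D A g B f))"

definition is_coproduct :: "('o, 'a) cat \<Rightarrow> 'i set \<Rightarrow> ('i \<Rightarrow> 'o) \<Rightarrow> 'o \<Rightarrow> ('i \<Rightarrow> 'a) \<Rightarrow> bool" where
  "is_coproduct C I F S inc \<longleftrightarrow> S \<in> obj C \<and> (\<forall>i\<in>I. inc i \<in> arr C (F i) S) \<and>
     (\<forall>T\<in>obj C. \<forall>t. (\<forall>i\<in>I. t i \<in> arr C (F i) T) \<longrightarrow>
        (\<exists>!u. u \<in> arr C S T \<and> (\<forall>i\<in>I. cmp C (F i) S T u (inc i) = t i)))"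

definition AB3 :: "'u itself \<Rightarrow> ('o, 'a) cat \<Rightarrow> bool" where
  "AB3 U C \<longleftrightarrow> abelian_category C \<and>
     (\<forall>(I :: 'u set) F. small U I \<and> F \<in> I \<rightarrow> obj C \<longrightarrow> (\<exists>S inc. is_coproduct C I F S inc))"

definition filtered :: "('o, 'a) cat \<Rightarrow> bool" where
  "filtered J \<longleftrightarrow> obj J \<noteq> {} \<and>
     (\<forall>i\<in>obj J. \<forall>j\<in>obj J. \<exists>k\<in>obj J. arr J i k \<noteq> {} \<and> arr J j k \<noteq> {}) \<and>
     (\<forall>i\<in>obj J. \<forall>j\<in>obj J. \<forall>u\<in>arr J i j. \<forall>v\<in>arr J i j.
        \<exists>k\<in>obj J. \<exists>w\<in>arr J j k. cmp J i j k w u = cmp J i j k w v)"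

definition cocone :: "('i, 'e) cat \<Rightarrow> ('o, 'a) cat \<Rightarrow> ('i, 'e, 'o, 'a) cfunctor
    \<Rightarrow> 'o \<Rightarrow> ('i \<Rightarrow> 'a) \<Rightarrow> bool" where
  "cocone J C F L l \<longleftrightarrow> L \<in> obj C \<and> (\<forall>i\<in>obj J. l i \<in> arr C (fob F i) L) \<and>
     (\<forall>i\<in>obj J. \<forall>j\<in>obj J. \<forall>u\<in>arr J i j.
        cmp C (fob F i) (fob F j) L (l j) (farr F i j u) = l i)"

definition is_colimit :: "('i, 'e) cat \<Rightarrow> ('o, 'a) cat \<Rightarrow> ('i, 'e, 'o, 'a) cfunctor
    \<Rightarrow> 'o \<Rightarrow> ('i \<Rightarrow> 'a) \<Rightarrow> bool" where
  "is_colimit J C F L l \<longleftrightarrow> cocone J C F L l \<and>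
     (\<forall>T t. cocone J C F T t \<longrightarrow>
        (\<exists>!u. u \<in> arr C L T \<and> (\<forall>i\<in>obj J. cmp C (fob F i) L T u (l i) = t i)))"

text \<open>Filtered colimits, which exist by AB3, are exact.\<close>

definition AB5 :: "'u itself \<Rightarrow> ('o, 'a) cat \<Rightarrow> bool" where
  "AB5 (U :: 'u itself) C \<longleftrightarrow> AB3 U C \<and>
     (\<forall>(J :: ('u, 'u) cat) F G H s t L l M m N n f g.
        small_category U J \<and> filtered J \<and>
        is_functor J C F \<and> is_functor J C G \<and> is_functor J C H \<and>
        nat_trans J C F G s \<and> nat_trans J C G H t \<and>
        (\<forall>j\<in>obj J. short_exact C (fob F j) (fob G j) (fob H j) (s j) (t j)) \<and>
        is_colimit J C F L l \<and> is_colimit J C G M m \<and> is_colimit J C H N n \<and>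
        f \<in> arr C L M \<and>
        (\<forall>j\<in>obj J. cmp C (fob F j) L M f (l j) = cmp C (fob F j) (fob G j) M (m j) (s j)) \<and>
        g \<in> arr C M N \<and>
        (\<forall>j\<in>obj J. cmp C (fob G j) M N g (m j) = cmp C (fob G j) (fob H j) N (n j) (t j))
        \<longrightarrow> short_exact C L M N f g)"

definition generator :: "('o, 'a) cat \<Rightarrow> 'o \<Rightarrow> bool" where
  "generator C G \<longleftrightarrow> G \<in> obj C \<and>
     (\<forall>A\<in>obj C. \<forall>B\<in>obj C. \<forall>f\<in>arr C A B. \<forall>g\<in>arr C A B.
        f \<noteq> g \<longrightarrow> (\<exists>h\<in>arr C G A. cmp C G A B f h \<noteq> cmp C G A B g h))"

definition grothendieck_category :: "'u itself \<Rightarrow> ('o, 'a) cat \<Rightarrow> bool" where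
  "grothendieck_category U C \<longleftrightarrow> AB5 U C \<and> (\<exists>G. generator C G)"


section \<open>Tensor products of vector spaces\<close>

text \<open>
  A vector space over a field \<open>K\<close> is a \<^locale>\<open>module\<close> over \<open>K\<close>.  The fields \<open>mult\<close> and \<open>one\<close>
  of the record \<^type>\<open>module\<close> carry no meaning.
\<close>

definition linear_map :: "'k ring \<Rightarrow> ('k, 'v, 'm) module_scheme \<Rightarrow> ('k, 'w, 'n) module_scheme
    \<Rightarrow> ('v \<Rightarrow> 'w) \<Rightarrow> bool" where
  "linear_map K V W f \<longleftrightarrow> f \<in> carrier V \<rightarrow> carrier W \<and>
     (\<forall>x\<in>carrier V. \<forall>y\<in>carrier V. f (x \<oplus>\<^bsub>V\<^esub> y) = f x \<oplus>\<^bsub>W\<^esub> f y) \<and>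
     (\<forall>a\<in>carrier K. \<forall>x\<in>carrier V. f (a \<odot>\<^bsub>V\<^esub> x) = a \<odot>\<^bsub>W\<^esub> f x)"

definition base_module :: "'k ring \<Rightarrow> ('k, 'k) module" where
  "base_module K = \<lparr>carrier = carrier K, monoid.mult = monoid.mult K, one = \<one>\<^bsub>K\<^esub>,
     zero = \<zero>\<^bsub>K\<^esub>, add = add K, smult = monoid.mult K\<rparr>"

definition free_module :: "'k ring \<Rightarrow> 's set \<Rightarrow> ('k, 's \<Rightarrow> 'k) module" where
  "free_module K S =
     \<lparr>carrier = {f. (\<forall>s\<in>S. f s \<in> carrier K) \<and> (\<forall>s. s \<notin> S \<longrightarrow> f s = \<zero>\<^bsub>K\<^esub>) \<and> finite {s. f s \<noteq> \<zero>\<^bsub>K\<^esub>}},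
      monoid.mult = undefined, one = undefined,
      zero = (\<lambda>_. \<zero>\<^bsub>K\<^esub>), add = (\<lambda>f g s. f s \<oplus>\<^bsub>K\<^esub> g s), smult = (\<lambda>a f s. a \<otimes>\<^bsub>K\<^esub> f s)\<rparr>"

definition basis_vec :: "'k ring \<Rightarrow> 's \<Rightarrow> 's \<Rightarrow> 'k" where
  "basis_vec K s = (\<lambda>t. if t = s then \<one>\<^bsub>K\<^esub> else \<zero>\<^bsub>K\<^esub>)"

definition quotient_module :: "'k ring \<Rightarrow> ('k, 'v, 'm) module_scheme \<Rightarrow> 'v set \<Rightarrow> ('k, 'v set) module" where
  "quotient_module K V N =
     \<lparr>carrier = a_rcosets\<^bsub>V\<^esub> N, monoid.mult = undefined, one = undefined,
      zero = N, add = set_add V, smult = (\<lambda>a A. \<Union>x\<in>A. N +>\<^bsub>V\<^esub> (a \<odot>\<^bsub>V\<^esub> x))\<rparr>"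

definition bilinear_relators :: "'k ring \<Rightarrow> ('k, 'v, 'm) module_scheme \<Rightarrow> ('k, 'w, 'n) module_scheme
    \<Rightarrow> ('v \<times> 'w \<Rightarrow> 'k) set" where
  "bilinear_relators K V W =
    (let F = free_module K (carrier V \<times> carrier W); e = basis_vec K in
      {e (v \<oplus>\<^bsub>V\<^esub> v', w) \<ominus>\<^bsub>F\<^esub> (e (v, w) \<oplus>\<^bsub>F\<^esub> e (v', w)) | v v' w.
         v \<in> carrier V \<and> v' \<in> carrier V \<and> w \<in> carrier W} \<union>
      {e (v, w \<oplus>\<^bsub>W\<^esub> w') \<ominus>\<^bsub>F\<^esub> (e (v, w) \<oplus>\<^bsub>F\<^esub> e (v, w')) | v w w'.
         v \<in> carrier V \<and> w \<in> carrier W \<and> w' \<in> carrier W} \<union>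
      {e (a \<odot>\<^bsub>V\<^esub> v, w) \<ominus>\<^bsub>F\<^esub> a \<odot>\<^bsub>F\<^esub> e (v, w) | a v w.
         a \<in> carrier K \<and> v \<in> carrier V \<and> w \<in> carrier W} \<union>
      {e (v, a \<odot>\<^bsub>W\<^esub> w) \<ominus>\<^bsub>F\<^esub> a \<odot>\<^bsub>F\<^esub> e (v, w) | a v w.
         a \<in> carrier K \<and> v \<in> carrier V \<and> w \<in> carrier W})"

definition tensor_null :: "'k ring \<Rightarrow> ('k, 'v, 'm) module_scheme \<Rightarrow> ('k, 'w, 'n) module_scheme
    \<Rightarrow> ('v \<times> 'w \<Rightarrow> 'k) set" where
  "tensor_null K V W = \<Inter>{N. submodule N K (free_module K (carrier V \<times> carrier W)) \<and>
     bilinear_relators K V W \<subseteq> N}"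

type_synonym ('v, 'w, 'k) tens = "('v \<times> 'w \<Rightarrow> 'k) set"

definition tensor :: "'k ring \<Rightarrow> ('k, 'v, 'm) module_scheme \<Rightarrow> ('k, 'w, 'n) module_scheme
    \<Rightarrow> ('k, ('v, 'w, 'k) tens) module" where
  "tensor K V W =
     quotient_module K (free_module K (carrier V \<times> carrier W)) (tensor_null K V W)"

definition pure :: "'k ring \<Rightarrow> ('k, 'v, 'm) module_scheme \<Rightarrow> ('k, 'w, 'n) module_scheme
    \<Rightarrow> 'v \<Rightarrow> 'w \<Rightarrow> ('v, 'w, 'k) tens" where
  "pure K V W v w =
     tensor_null K V W +>\<^bsub>free_module K (carrier V \<times> carrier W)\<^esub> basis_vec K (v, w)"

text \<open>
  \<open>tensor_lift K V W U b t\<close> is the value at \<open>t\<close> of the linear map \<open>V \<otimes> W \<rightarrow> U\<close> induced by the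
  bilinear map \<open>b\<close>; the choice of the representative \<open>f\<close> of \<open>t\<close> is immaterial for bilinear \<open>b\<close>.
  It renders sumless Sweedler notation: for \<open>t = t\<^sub>0 \<otimes> t\<^sub>1\<close> (summation suppressed),
  \<open>tensor_lift K V W U (\<lambda>t\<^sub>0 t\<^sub>1. b t\<^sub>0 t\<^sub>1) t\<close> is \<open>b t\<^sub>0 t\<^sub>1\<close>.
\<close>

definition tensor_lift :: "'k ring \<Rightarrow> ('k, 'v, 'm) module_scheme \<Rightarrow> ('k, 'w, 'n) module_scheme
    \<Rightarrow> ('k, 'x, 'l) module_scheme \<Rightarrow> ('v \<Rightarrow> 'w \<Rightarrow> 'x) \<Rightarrow> ('v, 'w, 'k) tens \<Rightarrow> 'x" where
  "tensor_lift K V W U b t =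
     (let f = (SOME f. f \<in> t) in
        \<Oplus>\<^bsub>U\<^esub>p\<in>{p. f p \<noteq> \<zero>\<^bsub>K\<^esub>}. f p \<odot>\<^bsub>U\<^esub> b (fst p) (snd p))"

definition tensor_map :: "'k ring \<Rightarrow> ('k, 'v, 'm) module_scheme \<Rightarrow> ('k, 'w, 'n) module_scheme
    \<Rightarrow> ('k, 'v2, 'm2) module_scheme \<Rightarrow> ('k, 'w2, 'n2) module_scheme
    \<Rightarrow> ('v \<Rightarrow> 'v2) \<Rightarrow> ('w \<Rightarrow> 'w2) \<Rightarrow> ('v, 'w, 'k) tens \<Rightarrow> ('v2, 'w2, 'k) tens" where
  "tensor_map K V W V' W' f g =
     tensor_lift K V W (tensor K V' W') (\<lambda>v w. pure K V' W' (f v) (g w))"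

text \<open>The associator \<open>(V \<otimes> W) \<otimes> U \<rightarrow> V \<otimes> (W \<otimes> U)\<close>.\<close>

definition tensor_assoc :: "'k ring \<Rightarrow> ('k, 'v, 'm) module_scheme \<Rightarrow> ('k, 'w, 'n) module_scheme
    \<Rightarrow> ('k, 'x, 'l) module_scheme \<Rightarrow> (('v, 'w, 'k) tens, 'x, 'k) tens
    \<Rightarrow> ('v, ('w, 'x, 'k) tens, 'k) tens" where
  "tensor_assoc K V W U =
     tensor_lift K (tensor K V W) U (tensor K V (tensor K W U))
       (\<lambda>t u. tensor_lift K V W (tensor K V (tensor K W U))
          (\<lambda>v w. pure K V (tensor K W U) v (pure K W U w u)) t)"


section \<open>Coalgebras and comodules\<close>

record ('k, 'c) coalgebra = "('k, 'c) module" +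
  comult :: "'c \<Rightarrow> ('c, 'c, 'k) tens"
  counit :: "'c \<Rightarrow> 'k"

locale coalgebra =
  fixes K :: "'k ring" and C :: "('k, 'c) coalgebra"
  assumes module: "module K C"
    and comult_linear: "linear_map K C (tensor K C C) (comult C)"
    and counit_linear: "linear_map K C (base_module K) (counit C)"
    and coassoc: "c \<in> carrier C \<Longrightarrow>
      tensor_assoc K C C C (tensor_map K C C (tensor K C C) C (comult C) id (comult C c))
        = tensor_map K C C C (tensor K C C) id (comult C) (comult C c)"
    and counit_left: "c \<in> carrier C \<Longrightarrow>
      tensor_lift K C C C (\<lambda>c1 c2. counit C c1 \<odot>\<^bsub>C\<^esub> c2) (comult C c) = c"
    and counit_right: "c \<in> carrier C \<Longrightarrow>
      tensor_lift K C C C (\<lambda>c1 c2. counit C c2 \<odot>\<^bsub>C\<^esub> c1) (comult C c) = c"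

record ('k, 'u, 'c) comodule = "('k, 'u) module" +
  coact :: "'u \<Rightarrow> ('u, 'c, 'k) tens"

locale comodule =
  fixes K :: "'k ring" and C :: "('k, 'c) coalgebra" and M :: "('k, 'u, 'c) comodule"
  assumes module: "module K M"
    and coact_linear: "linear_map K M (tensor K M C) (coact M)"
    and coact_coassoc: "m \<in> carrier M \<Longrightarrow>
      tensor_assoc K M C C (tensor_map K M C (tensor K M C) C (coact M) id (coact M m))
        = tensor_map K M C M (tensor K C C) id (comult C) (coact M m)"
    and coact_counit: "m \<in> carrier M \<Longrightarrow>
      tensor_lift K M C M (\<lambda>m0 m1. counit C m1 \<odot>\<^bsub>M\<^esub> m0) (coact M m) = m"

definition colinear_map :: "'k ring \<Rightarrow> ('k, 'c) coalgebra \<Rightarrow> ('k, 'u, 'c) comodule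
    \<Rightarrow> ('k, 'v, 'c) comodule \<Rightarrow> ('u \<Rightarrow> 'v) \<Rightarrow> bool" where
  "colinear_map K C M N f \<longleftrightarrow> linear_map K M N f \<and>
     (\<forall>m\<in>carrier M. coact N (f m) = tensor_map K M C N C f id (coact M m))"

text \<open>
  In all the concrete categories below arrows are functions that are \<^const>\<open>undefined\<close> outside the
  relevant carriers, so that equality of arrows is equality of maps.
\<close>

definition Comod_cat :: "'u itself \<Rightarrow> 'k ring \<Rightarrow> ('k, 'c) coalgebra
    \<Rightarrow> (('k, 'u, 'c) comodule, 'u \<Rightarrow> 'u) cat" where
  "Comod_cat U K C =
     \<lparr>obj = {M. comodule K C M \<and> small U (carrier M)},
      arr = (\<lambda>M N. {f \<in> carrier M \<rightarrow>\<^sub>E carrier N. colinear_map K C M N f}),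
      ident = (\<lambda>M. \<lambda>m\<in>carrier M. m),
      cmp = (\<lambda>M N P g f. compose (carrier M) g f)\<rparr>"

text \<open>
  Restricting to small comodules does not change the notion when \<open>K\<close> and \<open>C\<close> are small: a
  subcomodule generated by a small set is small, so projectivity can be tested on small comodules,
  and a small comodule over a semiperfect coalgebra is a quotient of a small direct sum of
  finite-dimensional projectives.
\<close>

definition right_semiperfect :: "'u itself \<Rightarrow> 'k ring \<Rightarrow> ('k, 'c) coalgebra \<Rightarrow> bool" where
  "right_semiperfect U K C \<longleftrightarrow> enough_projectives (Comod_cat U K C)"


section \<open>Entwining structures\<close>

text \<open>\<open>lcmp R r s t g f\<close> is the composite of \<open>f \<in> R(r, s)\<close> and \<open>g \<in> R(s, t)\<close>.\<close>

record ('o, 'f, 'k) lincat =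
  lobj :: "'o set"
  lhom :: "'o \<Rightarrow> 'o \<Rightarrow> ('k, 'f) module"
  lid :: "'o \<Rightarrow> 'f"
  lcmp :: "'o \<Rightarrow> 'o \<Rightarrow> 'o \<Rightarrow> 'f \<Rightarrow> 'f \<Rightarrow> 'f"

definition underlying :: "('o, 'f, 'k, 'm) lincat_scheme \<Rightarrow> ('o, 'f) cat" where
  "underlying R =
     \<lparr>obj = lobj R, arr = (\<lambda>r s. carrier (lhom R r s)), ident = lid R, cmp = lcmp R\<rparr>"

locale linear_category =
  fixes K :: "'k ring" and R :: "('o, 'f, 'k, 'm) lincat_scheme"
  assumes underlying_category: "category (underlying R)"
    and hom_module: "\<lbrakk>r \<in> lobj R; s \<in> lobj R\<rbrakk> \<Longrightarrow> module K (lhom R r s)"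
    and lcmp_linear_right: "\<lbrakk>r \<in> lobj R; s \<in> lobj R; t \<in> lobj R; g \<in> carrier (lhom R s t)\<rbrakk>
      \<Longrightarrow> linear_map K (lhom R r s) (lhom R r t) (\<lambda>f. lcmp R r s t g f)"
    and lcmp_linear_left: "\<lbrakk>r \<in> lobj R; s \<in> lobj R; t \<in> lobj R; f \<in> carrier (lhom R r s)\<rbrakk>
      \<Longrightarrow> linear_map K (lhom R s t) (lhom R r t) (\<lambda>g. lcmp R r s t g f)"

record ('o, 'f, 'k, 'c) entwining = "('o, 'f, 'k) lincat" +
  entw :: "'o \<Rightarrow> 'o \<Rightarrow> ('c, 'f, 'k) tens \<Rightarrow> ('f, 'c, 'k) tens"

abbreviation psi :: "'k ring \<Rightarrow> ('k, 'c) coalgebra \<Rightarrow> ('o, 'f, 'k, 'c) entwining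
    \<Rightarrow> 'o \<Rightarrow> 'o \<Rightarrow> 'c \<Rightarrow> 'f \<Rightarrow> ('f, 'c, 'k) tens" where
  "psi K C E r s c f \<equiv> entw E r s (pure K C (lhom E r s) c f)"

text \<open>
  In \<open>entw_lcmp\<close>, \<open>g'\<close> and \<open>c'\<close> stand for \<open>g\<^sub>\<psi>\<close> and \<open>c\<^sup>\<psi>\<close>; in \<open>entw_comult\<close>, \<open>f'\<close> and \<open>d2\<close> stand
  for \<open>f\<^sub>\<psi>\<close> and \<open>c\<^sub>2\<^sup>\<psi>\<close>, and \<open>f''\<close> and \<open>d1\<close> for \<open>f\<^sub>\<psi>\<^sub>\<psi>\<close> and \<open>c\<^sub>1\<^sup>\<psi>\<close>.
\<close>

locale entwining = linear_category K E
  for K :: "'k ring" and C :: "('k, 'c) coalgebra" and E :: "('o, 'f, 'k, 'c) entwining" +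
  assumes entw_linear: "\<lbrakk>r \<in> lobj E; s \<in> lobj E\<rbrakk>
      \<Longrightarrow> linear_map K (tensor K C (lhom E r s)) (tensor K (lhom E r s) C) (entw E r s)"
    and entw_lcmp: "\<lbrakk>r \<in> lobj E; s \<in> lobj E; t \<in> lobj E;
        f \<in> carrier (lhom E r s); g \<in> carrier (lhom E s t); c \<in> carrier C\<rbrakk>
      \<Longrightarrow> psi K C E r t c (lcmp E r s t g f)
        = tensor_lift K (lhom E s t) C (tensor K (lhom E r t) C)
            (\<lambda>g' c'. tensor_map K (lhom E r s) C (lhom E r t) C (\<lambda>f'. lcmp E r s t g' f') id
               (psi K C E r s c' f))
            (psi K C E s t c g)"
    and entw_counit: "\<lbrakk>r \<in> lobj E; s \<in> lobj E; f \<in> carrier (lhom E r s); c \<in> carrier C\<rbrakk>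
      \<Longrightarrow> tensor_lift K (lhom E r s) C (lhom E r s) (\<lambda>f' c'. counit C c' \<odot>\<^bsub>lhom E r s\<^esub> f')
            (psi K C E r s c f)
        = counit C c \<odot>\<^bsub>lhom E r s\<^esub> f"
    and entw_comult: "\<lbrakk>r \<in> lobj E; s \<in> lobj E; f \<in> carrier (lhom E r s); c \<in> carrier C\<rbrakk>
      \<Longrightarrow> tensor_map K (lhom E r s) C (lhom E r s) (tensor K C C) id (comult C)
            (psi K C E r s c f)
        = tensor_lift K C C (tensor K (lhom E r s) (tensor K C C))
            (\<lambda>c1 c2. tensor_lift K (lhom E r s) C (tensor K (lhom E r s) (tensor K C C))
               (\<lambda>f' d2. tensor_lift K (lhom E r s) C (tensor K (lhom E r s) (tensor K C C))
                  (\<lambda>f'' d1. pure K (lhom E r s) (tensor K C C) f'' (pure K C C d1 d2))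
                  (psi K C E r s c1 f'))
               (psi K C E r s c2 f))
            (comult C c)"
    and entw_lid: "\<lbrakk>r \<in> lobj E; c \<in> carrier C\<rbrakk>
      \<Longrightarrow> psi K C E r r c (lid E r) = pure K (lhom E r r) C (lid E r) c"

definition entwining_morphism :: "'k ring \<Rightarrow> ('k, 'c) coalgebra \<Rightarrow> ('o, 'f, 'k, 'c) entwining
    \<Rightarrow> ('o, 'f, 'k, 'c) entwining \<Rightarrow> ('o, 'f, 'o, 'f) cfunctor \<Rightarrow> bool" where
  "entwining_morphism K C E E' F \<longleftrightarrow>
     is_functor (underlying E) (underlying E') F \<and>
     (\<forall>r\<in>lobj E. \<forall>s\<in>lobj E.
        linear_map K (lhom E r s) (lhom E' (fob F r) (fob F s)) (farr F r s)) \<and>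
     (\<forall>r\<in>lobj E. \<forall>s\<in>lobj E. \<forall>f\<in>carrier (lhom E r s). \<forall>c\<in>carrier C.
        tensor_map K (lhom E r s) C (lhom E' (fob F r) (fob F s)) C (farr F r s) id
            (psi K C E r s c f)
          = psi K C E' (fob F r) (fob F s) c (farr F r s f))"

definition Ent_cat :: "'u itself \<Rightarrow> 'k ring \<Rightarrow> ('k, 'c) coalgebra
    \<Rightarrow> (('o, 'f, 'k, 'c) entwining, ('o, 'f, 'o, 'f) cfunctor) cat" where
  "Ent_cat U K C =
     \<lparr>obj = {E. entwining K C E \<and> small_category U (underlying E)},
      arr = (\<lambda>E E'. {F. entwining_morphism K C E E' F \<and> fob F \<in> extensional (lobj E) \<and>
        farr F \<in> (\<Pi>\<^sub>E r\<in>lobj E. \<Pi>\<^sub>E s\<in>lobj E. extensional (carrier (lhom E r s)))}),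
      ident = (\<lambda>E. \<lparr>fob = (\<lambda>r\<in>lobj E. r),
        farr = (\<lambda>r\<in>lobj E. \<lambda>s\<in>lobj E. \<lambda>f\<in>carrier (lhom E r s). f)\<rparr>),
      cmp = (\<lambda>E E' E'' G F. \<lparr>fob = compose (lobj E) (fob G) (fob F),
        farr = (\<lambda>r\<in>lobj E. \<lambda>s\<in>lobj E.
          compose (carrier (lhom E r s)) (farr G (fob F r) (fob F s)) (farr F r s))\<rparr>)\<rparr>"


section \<open>Entwined modules\<close>

text \<open>For \<open>f \<in> E(s, r)\<close> and \<open>m \<in> M(r)\<close>, \<open>eact M s r f m\<close> is \<open>m f \<in> M(s)\<close>.\<close>

record ('o, 'f, 'k, 'u, 'c) entmod =
  espace :: "'o \<Rightarrow> ('k, 'u, 'c) comodule"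
  eact :: "'o \<Rightarrow> 'o \<Rightarrow> 'f \<Rightarrow> 'u \<Rightarrow> 'u"

locale entwined_module =
  fixes K :: "'k ring" and C :: "('k, 'c) coalgebra" and E :: "('o, 'f, 'k, 'c) entwining"
    and M :: "('o, 'f, 'k, 'u, 'c) entmod"
  assumes comodule: "r \<in> lobj E \<Longrightarrow> comodule K C (espace M r)"
    and eact_linear: "\<lbrakk>s \<in> lobj E; r \<in> lobj E; f \<in> carrier (lhom E s r)\<rbrakk>
      \<Longrightarrow> linear_map K (espace M r) (espace M s) (eact M s r f)"
    and eact_linear_arr: "\<lbrakk>s \<in> lobj E; r \<in> lobj E; m \<in> carrier (espace M r)\<rbrakk>
      \<Longrightarrow> linear_map K (lhom E s r) (espace M s) (\<lambda>f. eact M s r f m)"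
    and eact_lid: "\<lbrakk>r \<in> lobj E; m \<in> carrier (espace M r)\<rbrakk> \<Longrightarrow> eact M r r (lid E r) m = m"
    and eact_lcmp: "\<lbrakk>t \<in> lobj E; s \<in> lobj E; r \<in> lobj E;
        g \<in> carrier (lhom E t s); f \<in> carrier (lhom E s r); m \<in> carrier (espace M r)\<rbrakk>
      \<Longrightarrow> eact M t r (lcmp E t s r f g) m = eact M t s g (eact M s r f m)"
    and coact_eact: "\<lbrakk>s \<in> lobj E; r \<in> lobj E; f \<in> carrier (lhom E s r); m \<in> carrier (espace M r)\<rbrakk>
      \<Longrightarrow> coact (espace M s) (eact M s r f m)
        = tensor_lift K (espace M r) C (tensor K (espace M s) C)
            (\<lambda>m0 m1. tensor_map K (lhom E s r) C (espace M s) C (\<lambda>f'. eact M s r f' m0) id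
               (psi K C E s r m1 f))
            (coact (espace M r) m)"

definition entwined_module_map :: "'k ring \<Rightarrow> ('k, 'c) coalgebra \<Rightarrow> ('o, 'f, 'k, 'c) entwining
    \<Rightarrow> ('o, 'f, 'k, 'u, 'c) entmod \<Rightarrow> ('o, 'f, 'k, 'u, 'c) entmod \<Rightarrow> ('o \<Rightarrow> 'u \<Rightarrow> 'u) \<Rightarrow> bool" where
  "entwined_module_map K C E M N h \<longleftrightarrow>
     (\<forall>r\<in>lobj E. colinear_map K C (espace M r) (espace N r) (h r)) \<and>
     (\<forall>s\<in>lobj E. \<forall>r\<in>lobj E. \<forall>f\<in>carrier (lhom E s r). \<forall>m\<in>carrier (espace M r).
        h s (eact M s r f m) = eact N s r f (h r m))"

definition Entmod_cat :: "'u itself \<Rightarrow> 'k ring \<Rightarrow> ('k, 'c) coalgebra \<Rightarrow> ('o, 'f, 'k, 'c) entwining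
    \<Rightarrow> (('o, 'f, 'k, 'u, 'c) entmod, 'o \<Rightarrow> 'u \<Rightarrow> 'u) cat" where
  "Entmod_cat U K C E =
     \<lparr>obj = {M. entwined_module K C E M \<and> (\<forall>r\<in>lobj E. small U (carrier (espace M r)))},
      arr = (\<lambda>M N. {h \<in> (\<Pi>\<^sub>E r\<in>lobj E. carrier (espace M r) \<rightarrow>\<^sub>E carrier (espace N r)).
        entwined_module_map K C E M N h}),
      ident = (\<lambda>M. \<lambda>r\<in>lobj E. \<lambda>m\<in>carrier (espace M r). m),
      cmp = (\<lambda>M N P g h. \<lambda>r\<in>lobj E. compose (carrier (espace M r)) (g r) (h r))\<rparr>"

text \<open>Restriction along a morphism of entwining structures, on objects and on arrows.\<close>

definition restr_obj :: "('o, 'f, 'o, 'f) cfunctor \<Rightarrow> ('o, 'f, 'k, 'u, 'c) entmod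
    \<Rightarrow> ('o, 'f, 'k, 'u, 'c) entmod" where
  "restr_obj F N =
     \<lparr>espace = (\<lambda>r. espace N (fob F r)),
      eact = (\<lambda>s r f. eact N (fob F s) (fob F r) (farr F s r f))\<rparr>"

definition restr_arr :: "('o, 'f, 'k, 'c) entwining \<Rightarrow> ('o, 'f, 'o, 'f) cfunctor
    \<Rightarrow> ('o \<Rightarrow> 'u \<Rightarrow> 'u) \<Rightarrow> 'o \<Rightarrow> 'u \<Rightarrow> 'u" where
  "restr_arr E F h = (\<lambda>r\<in>lobj E. h (fob F r))"


section \<open>Entwined modules over a representation\<close>

type_synonym ('x, 'a, 'o, 'f, 'k, 'c) representation =
  "('x, 'a, ('o, 'f, 'k, 'c) entwining, ('o, 'f, 'o, 'f) cfunctor) cfunctor"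

definition is_representation :: "'u itself \<Rightarrow> 'k ring \<Rightarrow> ('k, 'c) coalgebra \<Rightarrow> ('x, 'a) cat
    \<Rightarrow> ('x, 'a, 'o, 'f, 'k, 'c) representation \<Rightarrow> bool" where
  "is_representation U K C X R \<longleftrightarrow> is_functor X (Ent_cat U K C) R"

record ('x, 'a, 'o, 'f, 'k, 'u, 'c) repmod =
  rspace :: "'x \<Rightarrow> ('o, 'f, 'k, 'u, 'c) entmod"
  rmap :: "'x \<Rightarrow> 'x \<Rightarrow> 'a \<Rightarrow> 'o \<Rightarrow> 'u \<Rightarrow> 'u"

definition module_over :: "'u itself \<Rightarrow> 'k ring \<Rightarrow> ('k, 'c) coalgebra \<Rightarrow> ('x, 'a) cat
    \<Rightarrow> ('x, 'a, 'o, 'f, 'k, 'c) representation \<Rightarrow> ('x, 'a, 'o, 'f, 'k, 'u, 'c) repmod \<Rightarrow> bool" where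
  "module_over U K C X R M \<longleftrightarrow>
     (\<forall>x\<in>obj X. rspace M x \<in> obj (Entmod_cat U K C (fob R x))) \<and>
     (\<forall>x\<in>obj X. \<forall>y\<in>obj X. \<forall>\<alpha>\<in>arr X x y.
        rmap M x y \<alpha> \<in> arr (Entmod_cat U K C (fob R x))
          (rspace M x) (restr_obj (farr R x y \<alpha>) (rspace M y))) \<and>
     (\<forall>x\<in>obj X. rmap M x x (ident X x) = ident (Entmod_cat U K C (fob R x)) (rspace M x)) \<and>
     (\<forall>x\<in>obj X. \<forall>y\<in>obj X. \<forall>z\<in>obj X. \<forall>\<alpha>\<in>arr X x y. \<forall>\<beta>\<in>arr X y z.
        rmap M x z (cmp X x y z \<beta> \<alpha>)
          = cmp (Entmod_cat U K C (fob R x)) (rspace M x)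
              (restr_obj (farr R x y \<alpha>) (rspace M y))
              (restr_obj (farr R x y \<alpha>) (restr_obj (farr R y z \<beta>) (rspace M z)))
              (restr_arr (fob R x) (farr R x y \<alpha>) (rmap M y z \<beta>)) (rmap M x y \<alpha>))"

definition module_over_map :: "'u itself \<Rightarrow> 'k ring \<Rightarrow> ('k, 'c) coalgebra \<Rightarrow> ('x, 'a) cat
    \<Rightarrow> ('x, 'a, 'o, 'f, 'k, 'c) representation \<Rightarrow> ('x, 'a, 'o, 'f, 'k, 'u, 'c) repmod
    \<Rightarrow> ('x, 'a, 'o, 'f, 'k, 'u, 'c) repmod \<Rightarrow> ('x \<Rightarrow> 'o \<Rightarrow> 'u \<Rightarrow> 'u) \<Rightarrow> bool" where
  "module_over_map U K C X R M N h \<longleftrightarrow>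
     (\<forall>x\<in>obj X. h x \<in> arr (Entmod_cat U K C (fob R x)) (rspace M x) (rspace N x)) \<and>
     (\<forall>x\<in>obj X. \<forall>y\<in>obj X. \<forall>\<alpha>\<in>arr X x y.
        cmp (Entmod_cat U K C (fob R x)) (rspace M x) (rspace N x)
            (restr_obj (farr R x y \<alpha>) (rspace N y)) (rmap N x y \<alpha>) (h x)
          = cmp (Entmod_cat U K C (fob R x)) (rspace M x)
              (restr_obj (farr R x y \<alpha>) (rspace M y)) (restr_obj (farr R x y \<alpha>) (rspace N y))
              (restr_arr (fob R x) (farr R x y \<alpha>) (h y)) (rmap M x y \<alpha>))"

definition Mod_cat :: "'u itself \<Rightarrow> 'k ring \<Rightarrow> ('k, 'c) coalgebra \<Rightarrow> ('x, 'a) cat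
    \<Rightarrow> ('x, 'a, 'o, 'f, 'k, 'c) representation
    \<Rightarrow> (('x, 'a, 'o, 'f, 'k, 'u, 'c) repmod, 'x \<Rightarrow> 'o \<Rightarrow> 'u \<Rightarrow> 'u) cat" where
  "Mod_cat U K C X R =
     \<lparr>obj = {M. module_over U K C X R M},
      arr = (\<lambda>M N. {h \<in> extensional (obj X). module_over_map U K C X R M N h}),
      ident = (\<lambda>M. \<lambda>x\<in>obj X. ident (Entmod_cat U K C (fob R x)) (rspace M x)),
      cmp = (\<lambda>M N P g h. \<lambda>x\<in>obj X.
        cmp (Entmod_cat U K C (fob R x)) (rspace M x) (rspace N x) (rspace P x) (g x) (h x))\<rparr>"

end

theory Submission
  imports Defs
begin

text \<open>
  Fix a basis \<open>B\<close> of \<open>C\<close>.  A coaction on \<open>M\<close> amounts to linear coordinate operators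
  \<open>m \<mapsto> m\<^sub>b\<close> (\<open>b \<in> B\<close>), only finitely many of which are nonzero at each element.  An
  entwined module over \<open>\<R>\<close> thus becomes a family of vector spaces indexed by the pairs \<open>(x, r)\<close>
  with linear operators for the arrows of \<open>\<R>\<^sub>x\<close>, for the structure maps and for the coordinates,
  and a morphism becomes a family of linear maps commuting with all operators.  The axioms pass to
  surjective images, and to any such family that has finitely many nonzero coordinates at each
  element and is separated by its homomorphisms into objects.  Kernels, cokernels, coproducts and
  filtered colimits can therefore be formed and compared elementwise.

  The generator rests on a finiteness property: the entwining map and the comultiplication send a
  finite set \<open>D \<subseteq> B\<close> of coordinates into a finite set depending only on \<open>D\<close> and the operator.
  So the module presented by one generator of sort \<open>(x, r)\<close> with coordinates in \<open>D\<close>, subject to all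
  relations holding in every object, again has finitely many nonzero coordinates at each
  element.  The coproduct of these modules over all \<open>(x, r)\<close> and all finite \<open>D\<close> is a generator.
\<close>

section \<open>Linear maps\<close>

text \<open>Kernels are delicate in tensor form: for a subspace \<open>N\<close> of a comodule
  \<open>M\<close> one must know that \<open>N \<otimes> C\<close> embeds in
  \<open>M \<otimes> C\<close>. In coordinates a subcomodule is a subspace stable under operators,
  and an equation in \<open>M \<otimes> C\<close> or \<open>M \<otimes> (C \<otimes> C)\<close>
  becomes a family of equations in \<open>M\<close>, which any separating family of linear maps can
  test.

  The price is the finiteness condition, which infinite products and free constructions violate.

  The other obstacle is size. Carriers are subsets of the single type \<open>'u\<close>, whereas
  cosets and functions on evaluations live in larger types; smallness supplies an injection into
  \<open>'u\<close>, and the structure is transported along it. Regularity of the cardinal serves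
  for unions, its uncountability for finite words.

  Colimits are given by their universal property alone, so their elements are studied by mapping
  into suitable quotients.\<close>

lemma linear_mapI:
  assumes "\<And>x. x \<in> carrier V \<Longrightarrow> f x \<in> carrier W"
    and "\<And>x y. \<lbrakk>x \<in> carrier V; y \<in> carrier V\<rbrakk> \<Longrightarrow> f (x \<oplus>\<^bsub>V\<^esub> y) = f x \<oplus>\<^bsub>W\<^esub> f y"
    and "\<And>a x. \<lbrakk>a \<in> carrier K; x \<in> carrier V\<rbrakk> \<Longrightarrow> f (a \<odot>\<^bsub>V\<^esub> x) = a \<odot>\<^bsub>W\<^esub> f x"
  shows "linear_map K V W f"
  using assms by (auto simp: linear_map_def)

lemma linear_map_closed: "linear_map K V W f \<Longrightarrow> x \<in> carrier V \<Longrightarrow> f x \<in> carrier W"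
  by (auto simp: linear_map_def)

lemma linear_map_add: "linear_map K V W f \<Longrightarrow> x \<in> carrier V \<Longrightarrow> y \<in> carrier V
    \<Longrightarrow> f (x \<oplus>\<^bsub>V\<^esub> y) = f x \<oplus>\<^bsub>W\<^esub> f y"
  by (auto simp: linear_map_def)

lemma linear_map_smult: "linear_map K V W f \<Longrightarrow> a \<in> carrier K \<Longrightarrow> x \<in> carrier V
    \<Longrightarrow> f (a \<odot>\<^bsub>V\<^esub> x) = a \<odot>\<^bsub>W\<^esub> f x"
  by (auto simp: linear_map_def)

lemma linear_map_zero:
  assumes "module K V" "module K W" "linear_map K V W f"
  shows "f \<zero>\<^bsub>V\<^esub> = \<zero>\<^bsub>W\<^esub>"
proof -
  interpret V: module K V by fact
  interpret W: module K W by fact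
  have "f (\<zero>\<^bsub>K\<^esub> \<odot>\<^bsub>V\<^esub> \<zero>\<^bsub>V\<^esub>) = \<zero>\<^bsub>K\<^esub> \<odot>\<^bsub>W\<^esub> f \<zero>\<^bsub>V\<^esub>"
    using assms(3) by (intro linear_map_smult) auto
  then show ?thesis
    using linear_map_closed[OF assms(3), of "\<zero>\<^bsub>V\<^esub>"] by simp
qed

lemma minus_zeroD:
  assumes "module K V" "x \<ominus>\<^bsub>V\<^esub> y = \<zero>\<^bsub>V\<^esub>" "x \<in> carrier V" "y \<in> carrier V"
  shows "x = y"
proof -
  interpret V: module K V by fact
  have "x = x \<oplus>\<^bsub>V\<^esub> (\<ominus>\<^bsub>V\<^esub> y \<oplus>\<^bsub>V\<^esub> y)" using assms(3,4) by (simp add: V.M.l_neg)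
  also have "\<dots> = (x \<ominus>\<^bsub>V\<^esub> y) \<oplus>\<^bsub>V\<^esub> y"
    using assms(3,4) unfolding a_minus_def by (subst V.M.a_assoc) auto
  finally show ?thesis using assms by simp
qed

lemma linear_map_uminus:
  assumes "module K V" "module K W" "linear_map K V W f" "x \<in> carrier V"
  shows "f (\<ominus>\<^bsub>V\<^esub> x) = \<ominus>\<^bsub>W\<^esub> f x"
proof -
  interpret V: module K V by fact
  interpret W: module K W by fact
  have c: "f x \<in> carrier W" "f (\<ominus>\<^bsub>V\<^esub> x) \<in> carrier W"
    using linear_map_closed[OF assms(3)] assms(4) by auto
  have "f (\<ominus>\<^bsub>V\<^esub> x) \<oplus>\<^bsub>W\<^esub> f x = f (\<ominus>\<^bsub>V\<^esub> x \<oplus>\<^bsub>V\<^esub> x)"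
    using linear_map_add[OF assms(3)] assms(4) by simp
  also have "\<dots> = \<zero>\<^bsub>W\<^esub>"
    using assms(4) linear_map_zero[OF assms(1-3)] by (simp add: V.M.l_neg)
  finally show ?thesis using c W.M.minus_equality by auto
qed

lemma linear_map_minus:
  assumes "module K V" "module K W" "linear_map K V W f" "x \<in> carrier V" "y \<in> carrier V"
  shows "f (x \<ominus>\<^bsub>V\<^esub> y) = f x \<ominus>\<^bsub>W\<^esub> f y"
proof -
  interpret V: module K V by fact
  show ?thesis
    using assms linear_map_uminus[OF assms(1-3,5)] linear_map_add[OF assms(3,4), of "\<ominus>\<^bsub>V\<^esub> y"]
    by (simp add: a_minus_def)
qed

lemma linear_map_finsum:
  assumes "module K V" "module K W" "linear_map K V W f"
    and "finite A" "\<And>a. a \<in> A \<Longrightarrow> g a \<in> carrier V"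
  shows "f (\<Oplus>\<^bsub>V\<^esub>a\<in>A. g a) = (\<Oplus>\<^bsub>W\<^esub>a\<in>A. f (g a))"
proof -
  interpret V: module K V by fact
  interpret W: module K W by fact
  note lin = linear_map_closed[OF assms(3)] linear_map_add[OF assms(3)]
  show ?thesis using assms(4,5)
  proof (induction A)
    case empty then show ?case using linear_map_zero[OF assms(1-3)] by simp
  next
    case (insert a A)
    have "g \<in> A \<rightarrow> carrier V" "(\<lambda>a. f (g a)) \<in> A \<rightarrow> carrier W" using insert lin by auto
    then show ?case using insert by (simp add: lin)
  qed
qed

lemma linear_map_comp:
  "linear_map K V W f \<Longrightarrow> linear_map K W U g \<Longrightarrow> linear_map K V U (\<lambda>x. g (f x))"
  by (auto simp: linear_map_def Pi_def)

lemma linear_map_cong: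
  assumes "module K V" "\<And>x. x \<in> carrier V \<Longrightarrow> f x = g x"
  shows "linear_map K V W f \<longleftrightarrow> linear_map K V W g"
proof -
  interpret V: module K V by fact
  show ?thesis using assms(2) by (auto simp: linear_map_def Pi_def)
qed

lemma linear_map_congI:
  assumes "module K V" "linear_map K V W g" "\<And>x. x \<in> carrier V \<Longrightarrow> f x = g x"
  shows "linear_map K V W f"
  using assms(2) by (simp only: linear_map_cong[OF assms(1,3)])

lemma linear_map_ident: "linear_map K V V (\<lambda>x. x)" "linear_map K V V id"
  by (auto simp: linear_map_def)

lemma linear_map_null: "module K W \<Longrightarrow> linear_map K V W (\<lambda>x. \<zero>\<^bsub>W\<^esub>)"
proof -
  assume "module K W"
  then interpret W: module K W .
  show ?thesis by (intro linear_mapI) auto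
qed

lemma linear_map_plus:
  assumes "module K W" "linear_map K V W f" "linear_map K V W g"
  shows "linear_map K V W (\<lambda>x. f x \<oplus>\<^bsub>W\<^esub> g x)"
proof -
  interpret W: module K W by fact
  note lin = linear_map_closed[OF assms(2)] linear_map_add[OF assms(2)] linear_map_smult[OF assms(2)]
    linear_map_closed[OF assms(3)] linear_map_add[OF assms(3)] linear_map_smult[OF assms(3)]
  show ?thesis
    by (intro linear_mapI) (simp_all add: lin W.M.a_ac W.smult_r_distr)
qed

lemma linear_map_scale:
  assumes "module K W" "linear_map K V W f" "a \<in> carrier K"
  shows "linear_map K V W (\<lambda>x. a \<odot>\<^bsub>W\<^esub> f x)"
proof -
  interpret W: module K W by fact
  note lin = linear_map_closed[OF assms(2)] linear_map_add[OF assms(2)] linear_map_smult[OF assms(2)]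
  show ?thesis using assms(3)
    by (intro linear_mapI)
      (simp_all add: lin W.smult_r_distr W.R.m_comm flip: W.smult_assoc1)
qed

lemma base_module_simps [simp]:
  "carrier (base_module K) = carrier K" "zero (base_module K) = zero K"
  "add (base_module K) = add K" "smult (base_module K) = monoid.mult K"
  by (auto simp: base_module_def)

lemma base_module: "cring K \<Longrightarrow> module K (base_module K)"
proof -
  assume "cring K"
  then interpret cring K .
  show ?thesis
  proof (intro moduleI abelian_groupI)
    show "cring K" ..
    fix x assume "x \<in> carrier (base_module K)"
    then show "\<exists>y\<in>carrier (base_module K). y \<oplus>\<^bsub>base_module K\<^esub> x = \<zero>\<^bsub>base_module K\<^esub>"
      by (intro bexI[of _ "\<ominus>\<^bsub>K\<^esub> x"]) (auto simp: l_neg)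
  qed (auto simp: a_ac l_distr r_distr m_assoc)
qed

lemma linear_map_scale_const:
  assumes "module K W" "linear_map K V (base_module K) f" "w \<in> carrier W"
  shows "linear_map K V W (\<lambda>x. f x \<odot>\<^bsub>W\<^esub> w)"
proof -
  interpret W: module K W by fact
  note lin = linear_map_closed[OF assms(2)] linear_map_add[OF assms(2)] linear_map_smult[OF assms(2)]
  show ?thesis using assms(3) lin
    by (intro linear_mapI) (simp_all add: W.smult_l_distr W.smult_assoc1)
qed

text \<open>Supports differ from summand to summand; padding with zeros moves all sums to one finite
  index set.\<close>

lemma finsum_superset:
  assumes "module K V" "finite F" "A \<subseteq> F" "\<And>a. a \<in> A \<Longrightarrow> g a \<in> carrier V"
    and "\<And>a. a \<in> F - A \<Longrightarrow> g a = \<zero>\<^bsub>V\<^esub>"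
  shows "(\<Oplus>\<^bsub>V\<^esub>a\<in>A. g a) = (\<Oplus>\<^bsub>V\<^esub>a\<in>F. g a)"
proof -
  interpret V: module K V by fact
  show ?thesis proof (intro V.M.add.finprod_mono_neutral_cong_left)
    show "g \<in> F \<rightarrow> carrier V" using assms(4,5) by (metis DiffI Pi_I V.M.zero_closed)
  qed (use assms in auto)
qed

section \<open>Quotients\<close>

locale quotient = module K V for K :: "'k ring" and V :: "('k, 'v, 'm) module_scheme" (structure) +
  fixes N assumes sub: "submodule N K V"
begin

abbreviation "Q \<equiv> quotient_module K V N"

lemma abelian_subgroup: "abelian_subgroup N V"
  using sub a_comm_group by (intro abelian_subgroupI2) (auto dest: submodule.axioms)

lemma additive_subgroup: "additive_subgroup N V"
  using sub by (intro additive_subgroupI) (auto dest: submodule.axioms)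

lemma null_sub: "x \<in> N \<Longrightarrow> x \<in> carrier V"
  using submoduleE(1)[OF sub] by auto

lemma coset_eq_iff:
  assumes "x \<in> carrier V" "y \<in> carrier V"
  shows "N +> x = N +> y \<longleftrightarrow> x \<ominus> y \<in> N"
proof
  assume "N +> x = N +> y"
  then have "N +> (x \<ominus> y) = N" using assms a_coset_add_inv2 null_sub by (metis a_minus_def subsetI)
  then show "x \<ominus> y \<in> N"
    using a_coset_join1 assms additive_subgroup.a_subgroup[OF additive_subgroup] by blast
next
  assume "x \<ominus> y \<in> N"
  then have "N +> (x \<ominus> y) = N"
    using a_coset_join2 assms additive_subgroup.a_subgroup[OF additive_subgroup] by auto
  then show "N +> x = N +> y" using a_coset_add_inv1 assms null_sub by (metis a_minus_def subsetI)
qed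

lemma coset_zero_iff: "x \<in> carrier V \<Longrightarrow> N +> x = N \<longleftrightarrow> x \<in> N"
  using a_coset_join1 a_coset_join2 additive_subgroup.a_subgroup[OF additive_subgroup] by blast

lemma coset_zero: "N +> \<zero> = N"
  using coset_zero_iff submoduleE(2)[OF sub] additive_subgroup.zero_closed[OF additive_subgroup] by auto

lemma mem_coset: "x \<in> carrier V \<Longrightarrow> x \<in> N +> x"
  using abelian_subgroup.a_rcos_self[OF abelian_subgroup] by auto

lemma mem_cosetD:
  assumes "y \<in> N +> x" "x \<in> carrier V" shows "y \<in> carrier V" "N +> x = N +> y"
  using assms a_r_coset_subset_G[of N x] null_sub
    a_repr_independence[OF assms additive_subgroup.a_subgroup[OF additive_subgroup]] by auto

lemma carrier_quot: "carrier Q = (\<lambda>x. N +> x) ` carrier V"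
  by (auto simp: quotient_module_def A_RCOSETS_def')

lemma coset_closed: "x \<in> carrier V \<Longrightarrow> N +> x \<in> carrier Q"
  by (auto simp: carrier_quot)

lemma zero_quot: "\<zero>\<^bsub>Q\<^esub> = N"
  by (simp add: quotient_module_def)

lemma add_quot: "x \<in> carrier V \<Longrightarrow> y \<in> carrier V \<Longrightarrow> (N +> x) \<oplus>\<^bsub>Q\<^esub> (N +> y) = N +> (x \<oplus> y)"
  using abelian_subgroup.a_rcos_sum[OF abelian_subgroup] by (simp add: quotient_module_def)

lemma smult_quot:
  assumes "a \<in> carrier K" "x \<in> carrier V" shows "a \<odot>\<^bsub>Q\<^esub> (N +> x) = N +> (a \<odot> x)"
proof -
  \<comment> \<open>Scaling a coset is defined as the union over all its representatives
    \<open>y\<close>. Each of them yields the same coset, so the union collapses.\<close>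
  have "N +> (a \<odot> y) = N +> (a \<odot> x)" if "y \<in> N +> x" for y
  proof -
    have y: "y \<in> carrier V" "N +> x = N +> y" using mem_cosetD[OF that assms(2)] by auto
    then have "y \<ominus> x \<in> N" using coset_eq_iff[of y x] assms by metis
    then have "a \<odot> (y \<ominus> x) \<in> N" using submoduleE(4)[OF sub] assms by auto
    moreover have "a \<odot> (y \<ominus> x) = a \<odot> y \<ominus> a \<odot> x"
      using y assms by (simp add: a_minus_def smult_r_distr smult_r_minus)
    ultimately show ?thesis using coset_eq_iff y assms by auto
  qed
  then have "(\<Union>y\<in>N +> x. N +> (a \<odot> y)) = (\<Union>y\<in>N +> x. N +> (a \<odot> x))"
    by (intro SUP_cong) simp_all
  also have "\<dots> = N +> (a \<odot> x)" using mem_coset[OF assms(2)] by (intro SUP_const) blast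
  finally show ?thesis by (simp add: quotient_module_def)
qed

lemma module_quot: "module K Q"
proof (intro moduleI abelian_groupI)
  show "cring K" ..
  show "\<zero>\<^bsub>Q\<^esub> \<in> carrier Q" using coset_closed[of \<zero>] by (simp add: coset_zero zero_quot)
  fix x assume "x \<in> carrier Q"
  then obtain x' where x: "x = N +> x'" "x' \<in> carrier V" by (auto simp: carrier_quot)
  show "\<zero>\<^bsub>Q\<^esub> \<oplus>\<^bsub>Q\<^esub> x = x" using add_quot[of \<zero> x'] x by (simp add: coset_zero zero_quot)
  have "(N +> (\<ominus> x')) \<oplus>\<^bsub>Q\<^esub> x = \<zero>\<^bsub>Q\<^esub>"
    using x by (simp add: add_quot l_neg zero_quot coset_zero)
  then show "\<exists>y\<in>carrier Q. y \<oplus>\<^bsub>Q\<^esub> x = \<zero>\<^bsub>Q\<^esub>" using x coset_closed[of "\<ominus> x'"] by auto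
  show "\<one>\<^bsub>K\<^esub> \<odot>\<^bsub>Q\<^esub> x = x" using x by (simp add: smult_quot)
qed (auto simp: carrier_quot add_quot smult_quot smult_l_distr smult_r_distr smult_assoc1 a_ac)

lemma coset_linear: "linear_map K V Q (\<lambda>x. N +> x)"
  by (intro linear_mapI) (auto simp: coset_closed add_quot smult_quot)

end

section \<open>Free modules\<close>

lemma free_module_simps:
  "f \<in> carrier (free_module K S) \<longleftrightarrow>
     (\<forall>s\<in>S. f s \<in> carrier K) \<and> (\<forall>s. s \<notin> S \<longrightarrow> f s = \<zero>\<^bsub>K\<^esub>) \<and> finite {s. f s \<noteq> \<zero>\<^bsub>K\<^esub>}"
  "zero (free_module K S) = (\<lambda>_. \<zero>\<^bsub>K\<^esub>)"
  "add (free_module K S) = (\<lambda>f g s. f s \<oplus>\<^bsub>K\<^esub> g s)"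
  "smult (free_module K S) = (\<lambda>a f s. a \<otimes>\<^bsub>K\<^esub> f s)"
  by (auto simp: free_module_def)

lemma free_module_finite: "f \<in> carrier (free_module K S) \<Longrightarrow> finite {s. f s \<noteq> \<zero>\<^bsub>K\<^esub>}"
  by (simp add: free_module_simps)

lemma free_module_value:
  assumes "cring K" "f \<in> carrier (free_module K S)" shows "f s \<in> carrier K"
proof -
  interpret cring K by fact
  show ?thesis using assms(2) by (cases "s \<in> S") (auto simp: free_module_simps)
qed

lemma free_module:
  assumes "cring K" shows "module K (free_module K S)"
proof -
  interpret cring K by fact
  let ?F = "free_module K S"
  note v = free_module_value[OF assms, of _ S]
  note s = free_module_simps
  show ?thesis
  proof (intro moduleI abelian_groupI)
    show "cring K" ..
    fix f g assume f: "f \<in> carrier ?F" and g: "g \<in> carrier ?F"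
    have "{s. f s \<oplus>\<^bsub>K\<^esub> g s \<noteq> \<zero>\<^bsub>K\<^esub>} \<subseteq> {s. f s \<noteq> \<zero>\<^bsub>K\<^esub>} \<union> {s. g s \<noteq> \<zero>\<^bsub>K\<^esub>}" by auto
    then have "finite {s. f s \<oplus>\<^bsub>K\<^esub> g s \<noteq> \<zero>\<^bsub>K\<^esub>}"
      using free_module_finite[OF f] free_module_finite[OF g] finite_subset by blast
    then show "f \<oplus>\<^bsub>?F\<^esub> g \<in> carrier ?F" using f g by (auto simp: s)
    show "f \<oplus>\<^bsub>?F\<^esub> g = g \<oplus>\<^bsub>?F\<^esub> f" using v f g by (auto simp: s a_comm)
  next
    fix a f assume a: "a \<in> carrier K" and f: "f \<in> carrier ?F"
    have "{s. a \<otimes>\<^bsub>K\<^esub> f s \<noteq> \<zero>\<^bsub>K\<^esub>} \<subseteq> {s. f s \<noteq> \<zero>\<^bsub>K\<^esub>}" using a by auto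
    then have "finite {s. a \<otimes>\<^bsub>K\<^esub> f s \<noteq> \<zero>\<^bsub>K\<^esub>}"
      using free_module_finite[OF f] finite_subset by blast
    then show "a \<odot>\<^bsub>?F\<^esub> f \<in> carrier ?F" using a f by (auto simp: s)
  next
    fix f assume f: "f \<in> carrier ?F"
    have "{s. \<ominus>\<^bsub>K\<^esub> f s \<noteq> \<zero>\<^bsub>K\<^esub>} \<subseteq> {s. f s \<noteq> \<zero>\<^bsub>K\<^esub>}" by auto
    then have "finite {s. \<ominus>\<^bsub>K\<^esub> f s \<noteq> \<zero>\<^bsub>K\<^esub>}"
      using free_module_finite[OF f] finite_subset by blast
    then have "(\<lambda>s. \<ominus>\<^bsub>K\<^esub> f s) \<in> carrier ?F" using f by (auto simp: s)
    moreover have "(\<lambda>s. \<ominus>\<^bsub>K\<^esub> f s) \<oplus>\<^bsub>?F\<^esub> f = \<zero>\<^bsub>?F\<^esub>" using v[OF f] by (auto simp: s l_neg)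
    ultimately show "\<exists>g\<in>carrier ?F. g \<oplus>\<^bsub>?F\<^esub> f = \<zero>\<^bsub>?F\<^esub>" by auto
    show "\<one>\<^bsub>K\<^esub> \<odot>\<^bsub>?F\<^esub> f = f" "\<zero>\<^bsub>?F\<^esub> \<oplus>\<^bsub>?F\<^esub> f = f" using v[OF f] by (auto simp: s)
  qed (auto simp: s v a_ac l_distr r_distr m_assoc)
qed

lemma basis_vec_closed:
  assumes "cring K" "s \<in> S" shows "basis_vec K s \<in> carrier (free_module K S)"
proof -
  interpret cring K by fact
  have "{t. basis_vec K s t \<noteq> \<zero>\<^bsub>K\<^esub>} \<subseteq> {s}" by (auto simp: basis_vec_def)
  then have "finite {t. basis_vec K s t \<noteq> \<zero>\<^bsub>K\<^esub>}" using finite_subset by blast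
  then show ?thesis using assms(2) by (auto simp: free_module_simps basis_vec_def)
qed

lemma free_module_induct [consumes 2, case_names zero add]:
  assumes "cring K" "f \<in> carrier (free_module K S)" and "P \<zero>\<^bsub>free_module K S\<^esub>"
    and "\<And>a s f. \<lbrakk>a \<in> carrier K; s \<in> S; f \<in> carrier (free_module K S); P f\<rbrakk>
      \<Longrightarrow> P ((a \<odot>\<^bsub>free_module K S\<^esub> basis_vec K s) \<oplus>\<^bsub>free_module K S\<^esub> f)"
  shows "P f"
proof -
  interpret cring K by fact
  \<comment> \<open>The induction runs over a finite set that merely contains the support, so that
    deleting the value at one point stays within the hypothesis even when that value was already
    zero.\<close>
  have "P f" if "finite F" "f \<in> carrier (free_module K S)" "{s. f s \<noteq> \<zero>\<^bsub>K\<^esub>} \<subseteq> F" for F f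
    using that
  proof (induction F arbitrary: f)
    case empty
    then have "f = \<zero>\<^bsub>free_module K S\<^esub>" by (auto simp: free_module_simps)
    then show ?case using assms(3) by simp
  next
    case (insert s F)
    let ?g = "f(s := \<zero>\<^bsub>K\<^esub>)"
    have "{t. ?g t \<noteq> \<zero>\<^bsub>K\<^esub>} \<subseteq> {t. f t \<noteq> \<zero>\<^bsub>K\<^esub>}" by auto
    then have "finite {t. ?g t \<noteq> \<zero>\<^bsub>K\<^esub>}"
      using free_module_finite[OF insert.prems(1)] finite_subset by blast
    then have g: "?g \<in> carrier (free_module K S)" using insert.prems by (auto simp: free_module_simps)
    have "{t. ?g t \<noteq> \<zero>\<^bsub>K\<^esub>} \<subseteq> F" using insert.prems by auto
    then have P: "P ?g" using insert.IH[OF g] by blast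
    show ?case
    proof (cases "s \<in> S")
      case True
      have "f = (f s \<odot>\<^bsub>free_module K S\<^esub> basis_vec K s) \<oplus>\<^bsub>free_module K S\<^esub> ?g"
        using free_module_value[OF assms(1) insert.prems(1)]
        by (auto simp: free_module_simps basis_vec_def)
      then show ?thesis using assms(4)[OF _ True g P, of "f s"]
          free_module_value[OF assms(1) insert.prems(1)] by metis
    next
      case False
      then have "?g = f" using insert.prems by (auto simp: free_module_simps)
      then show ?thesis using P by simp
    qed
  qed
  then show ?thesis using assms(2) by (auto simp: free_module_simps)
qed

context
  fixes K :: "'k ring" and U :: "('k, 'x, 'l) module_scheme" and S :: "'s set" and b :: "'s \<Rightarrow> 'x"
  assumes U: "module K U" and b: "\<And>s. s \<in> S \<Longrightarrow> b s \<in> carrier U"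
begin

interpretation U: module K U by (rule U)

text \<open>For pairs as index set this is the sum inside \<open>tensor_lift\<close>. The formula
  does not mention \<open>S\<close>, so one function serves the free modules on all subsets, as in
  an argument where \<open>S\<close> varies.\<close>

definition free_lift where "free_lift f = (\<Oplus>\<^bsub>U\<^esub>p\<in>{p. f p \<noteq> \<zero>\<^bsub>K\<^esub>}. f p \<odot>\<^bsub>U\<^esub> b p)"

lemma free_lift_superset:
  assumes f: "f \<in> carrier (free_module K S)" "finite F" "{p. f p \<noteq> \<zero>\<^bsub>K\<^esub>} \<subseteq> F" "F \<subseteq> S"
  shows "free_lift f = (\<Oplus>\<^bsub>U\<^esub>p\<in>F. f p \<odot>\<^bsub>U\<^esub> b p)"
  unfolding free_lift_def
proof (rule finsum_superset[OF U])
  fix a assume "a \<in> {p. f p \<noteq> \<zero>\<^bsub>K\<^esub>}"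
  then show "f a \<odot>\<^bsub>U\<^esub> b a \<in> carrier U" using b f by (auto simp: free_module_simps)
next
  fix a assume "a \<in> F - {p. f p \<noteq> \<zero>\<^bsub>K\<^esub>}"
  then show "f a \<odot>\<^bsub>U\<^esub> b a = \<zero>\<^bsub>U\<^esub>" using b f by auto
qed (use assms in auto)

lemma free_lift_linear: "linear_map K (free_module K S) U free_lift"
proof -
  let ?F = "free_module K S"
  interpret F: module K ?F by (rule free_module) (rule U.R.is_cring)
  have supp: "finite {p. f p \<noteq> \<zero>\<^bsub>K\<^esub>}" "{p. f p \<noteq> \<zero>\<^bsub>K\<^esub>} \<subseteq> S" if "f \<in> carrier ?F" for f
    using that by (auto simp: free_module_simps)
  have cl: "f p \<odot>\<^bsub>U\<^esub> b p \<in> carrier U" if "f \<in> carrier ?F" "p \<in> S" for f p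
    using that b by (auto simp: free_module_simps)
  show ?thesis
  proof (rule linear_mapI)
    fix f assume f: "f \<in> carrier ?F"
    have "(\<lambda>p. f p \<odot>\<^bsub>U\<^esub> b p) \<in> {p. f p \<noteq> \<zero>\<^bsub>K\<^esub>} \<rightarrow> carrier U" using cl[OF f] supp[OF f] by auto
    then show "free_lift f \<in> carrier U" unfolding free_lift_def by (rule U.M.finsum_closed)
  next
    fix f g assume f: "f \<in> carrier ?F" and g: "g \<in> carrier ?F"
    let ?A = "{p. f p \<noteq> \<zero>\<^bsub>K\<^esub>} \<union> {p. g p \<noteq> \<zero>\<^bsub>K\<^esub>}"
    have A: "finite ?A" "?A \<subseteq> S" using supp f g by auto
    have fg: "f \<oplus>\<^bsub>?F\<^esub> g \<in> carrier ?F" using f g by auto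
    have "free_lift (f \<oplus>\<^bsub>?F\<^esub> g) = (\<Oplus>\<^bsub>U\<^esub>p\<in>?A. (f \<oplus>\<^bsub>?F\<^esub> g) p \<odot>\<^bsub>U\<^esub> b p)"
      using A by (intro free_lift_superset[OF fg]) (auto simp: free_module_simps)
    also have "\<dots> = (\<Oplus>\<^bsub>U\<^esub>p\<in>?A. f p \<odot>\<^bsub>U\<^esub> b p \<oplus>\<^bsub>U\<^esub> g p \<odot>\<^bsub>U\<^esub> b p)"
      using A(2) f g cl b
      by (intro U.M.finsum_cong') (auto simp: free_module_simps U.smult_l_distr)
    also have "\<dots> = (\<Oplus>\<^bsub>U\<^esub>p\<in>?A. f p \<odot>\<^bsub>U\<^esub> b p) \<oplus>\<^bsub>U\<^esub> (\<Oplus>\<^bsub>U\<^esub>p\<in>?A. g p \<odot>\<^bsub>U\<^esub> b p)"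
      using A(2) cl[OF f] cl[OF g] by (intro U.M.finsum_addf) blast+
    also have "\<dots> = free_lift f \<oplus>\<^bsub>U\<^esub> free_lift g"
      using A free_lift_superset[OF f A(1) _ A(2)] free_lift_superset[OF g A(1) _ A(2)] by auto
    finally show "free_lift (f \<oplus>\<^bsub>?F\<^esub> g) = free_lift f \<oplus>\<^bsub>U\<^esub> free_lift g" .
  next
    fix a f assume a: "a \<in> carrier K" and f: "f \<in> carrier ?F"
    let ?A = "{p. f p \<noteq> \<zero>\<^bsub>K\<^esub>}"
    have af: "a \<odot>\<^bsub>?F\<^esub> f \<in> carrier ?F" using a f by auto
    have "free_lift (a \<odot>\<^bsub>?F\<^esub> f) = (\<Oplus>\<^bsub>U\<^esub>p\<in>?A. (a \<odot>\<^bsub>?F\<^esub> f) p \<odot>\<^bsub>U\<^esub> b p)"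
      using supp[OF f] a by (intro free_lift_superset[OF af]) (auto simp: free_module_simps)
    also have "\<dots> = (\<Oplus>\<^bsub>U\<^esub>p\<in>?A. a \<odot>\<^bsub>U\<^esub> (f p \<odot>\<^bsub>U\<^esub> b p))"
      using supp(2)[OF f] f a cl[OF f] b
      by (intro U.M.finsum_cong') (auto simp: free_module_simps U.smult_assoc1)
    also have "\<dots> = a \<odot>\<^bsub>U\<^esub> free_lift f"
      unfolding free_lift_def using supp[OF f] cl[OF f] a
      by (intro U.finsum_smult_ldistr[symmetric]) auto
    finally show "free_lift (a \<odot>\<^bsub>?F\<^esub> f) = a \<odot>\<^bsub>U\<^esub> free_lift f" .
  qed
qed

lemma free_lift_basis: assumes "s \<in> S" shows "free_lift (basis_vec K s) = b s"
proof -
  have "free_lift (basis_vec K s) = (\<Oplus>\<^bsub>U\<^esub>p\<in>{s}. basis_vec K s p \<odot>\<^bsub>U\<^esub> b p)"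
    using assms by (intro free_lift_superset basis_vec_closed U.R.is_cring) (auto simp: basis_vec_def)
  also have "\<dots> = b s" using b[OF assms] by (simp add: basis_vec_def)
  finally show ?thesis .
qed

end

section \<open>Tensor products\<close>

definition bilinear where
  "bilinear K V W U b \<longleftrightarrow> (\<forall>v\<in>carrier V. linear_map K W U (\<lambda>w. b v w)) \<and>
     (\<forall>w\<in>carrier W. linear_map K V U (\<lambda>v. b v w))"

lemma bilinearI:
  assumes "\<And>v. v \<in> carrier V \<Longrightarrow> linear_map K W U (\<lambda>w. b v w)"
    and "\<And>w. w \<in> carrier W \<Longrightarrow> linear_map K V U (\<lambda>v. b v w)"
  shows "bilinear K V W U b"
  using assms by (auto simp: bilinear_def)

lemma bilinear_closed: "bilinear K V W U b \<Longrightarrow> v \<in> carrier V \<Longrightarrow> w \<in> carrier W \<Longrightarrow> b v w \<in> carrier U"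
  by (auto simp: bilinear_def dest: linear_map_closed)

locale two_modules = V: module K V + W: module K W
  for K :: "'k ring" and V :: "('k, 'v, 'm) module_scheme" and W :: "('k, 'w, 'n) module_scheme"
begin

abbreviation "FVW \<equiv> free_module K (carrier V \<times> carrier W)"

sublocale F: module K FVW
  using V.R.is_cring by (rule free_module)

lemma e_closed: "v \<in> carrier V \<Longrightarrow> w \<in> carrier W \<Longrightarrow> basis_vec K (v, w) \<in> carrier FVW"
  by (rule basis_vec_closed[OF V.R.is_cring]) simp

lemma relators_sub: "bilinear_relators K V W \<subseteq> carrier FVW"
  unfolding bilinear_relators_def Let_def by (auto intro!: e_closed F.M.minus_closed F.smult_closed)

lemma null_submodule: "submodule (tensor_null K V W) K FVW"
proof -
  let ?A = "{N. submodule N K FVW \<and> bilinear_relators K V W \<subseteq> N}"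
  \<comment> \<open>The family is not empty, so its intersection stays inside the free
    module.\<close>
  have ne: "carrier FVW \<in> ?A" using relators_sub F.carrier_is_submodule by auto
  have E: "\<And>N. N \<in> ?A \<Longrightarrow> submodule N K FVW" by auto
  have z: "\<zero>\<^bsub>FVW\<^esub> \<in> N" if "N \<in> ?A" for N
    using subgroup.one_closed[OF submodule.axioms(1)[OF E[OF that]]] by simp
  show ?thesis unfolding tensor_null_def
  proof (rule F.submoduleI)
    show "\<Inter>?A \<subseteq> carrier FVW" using ne by blast
    show "\<zero>\<^bsub>FVW\<^esub> \<in> \<Inter>?A" using z by blast
    show "\<ominus>\<^bsub>FVW\<^esub> a \<in> \<Inter>?A" if "a \<in> \<Inter>?A" for a
      using F.submoduleE(3)[OF E] that by blast
    show "a \<oplus>\<^bsub>FVW\<^esub> b \<in> \<Inter>?A" if "a \<in> \<Inter>?A" "b \<in> \<Inter>?A" for a b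
      using F.submoduleE(5)[OF E] that by blast
    show "a \<odot>\<^bsub>FVW\<^esub> b \<in> \<Inter>?A" if "a \<in> carrier K" "b \<in> \<Inter>?A" for a b
      using F.submoduleE(4)[OF E] that by blast
  qed
qed

lemma relators_null: "bilinear_relators K V W \<subseteq> tensor_null K V W"
  unfolding tensor_null_def by auto

sublocale T: quotient K FVW "tensor_null K V W"
  by (intro quotient.intro quotient_axioms.intro F.module_axioms null_submodule)

lemma tensor_module: "module K (tensor K V W)"
  unfolding tensor_def by (rule T.module_quot)

lemma pure_closed: "v \<in> carrier V \<Longrightarrow> w \<in> carrier W \<Longrightarrow> pure K V W v w \<in> carrier (tensor K V W)"
  unfolding tensor_def pure_def by (intro T.coset_closed e_closed)

lemma pure_bilinear: "bilinear K V W (tensor K V W) (pure K V W)"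
proof -
  \<comment> \<open>Every identity asked for is one of the relators, hence holds modulo
    \<open>tensor_null\<close>.\<close>
  have rel: "tensor_null K V W +>\<^bsub>FVW\<^esub> x = tensor_null K V W +>\<^bsub>FVW\<^esub> y"
    if "x \<ominus>\<^bsub>FVW\<^esub> y \<in> bilinear_relators K V W" "x \<in> carrier FVW" "y \<in> carrier FVW" for x y
    using T.coset_eq_iff[OF that(2,3)] relators_null that(1) by blast
  show ?thesis
  proof (intro bilinearI linear_mapI pure_closed)
    fix v w w' assume a: "v \<in> carrier V" "w \<in> carrier W" "w' \<in> carrier W"
    have "basis_vec K (v, w \<oplus>\<^bsub>W\<^esub> w') \<ominus>\<^bsub>FVW\<^esub> (basis_vec K (v, w) \<oplus>\<^bsub>FVW\<^esub> basis_vec K (v, w'))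
        \<in> bilinear_relators K V W"
      using a unfolding bilinear_relators_def Let_def by blast
    from rel[OF this] show "pure K V W v (w \<oplus>\<^bsub>W\<^esub> w') = pure K V W v w \<oplus>\<^bsub>tensor K V W\<^esub> pure K V W v w'"
      unfolding pure_def tensor_def using a by (simp add: T.add_quot e_closed)
  next
    fix v v' w assume a: "v \<in> carrier V" "v' \<in> carrier V" "w \<in> carrier W"
    have "basis_vec K (v \<oplus>\<^bsub>V\<^esub> v', w) \<ominus>\<^bsub>FVW\<^esub> (basis_vec K (v, w) \<oplus>\<^bsub>FVW\<^esub> basis_vec K (v', w))
        \<in> bilinear_relators K V W"
      using a unfolding bilinear_relators_def Let_def by blast
    from rel[OF this] show "pure K V W (v \<oplus>\<^bsub>V\<^esub> v') w = pure K V W v w \<oplus>\<^bsub>tensor K V W\<^esub> pure K V W v' w"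
      unfolding pure_def tensor_def using a by (simp add: T.add_quot e_closed)
  next
    fix a v w assume a: "a \<in> carrier K" "v \<in> carrier V" "w \<in> carrier W"
    have "basis_vec K (v, a \<odot>\<^bsub>W\<^esub> w) \<ominus>\<^bsub>FVW\<^esub> a \<odot>\<^bsub>FVW\<^esub> basis_vec K (v, w) \<in> bilinear_relators K V W"
      using a unfolding bilinear_relators_def Let_def by blast
    from rel[OF this] show "pure K V W v (a \<odot>\<^bsub>W\<^esub> w) = a \<odot>\<^bsub>tensor K V W\<^esub> pure K V W v w"
      unfolding pure_def tensor_def using a by (simp add: T.smult_quot e_closed)
    have "basis_vec K (a \<odot>\<^bsub>V\<^esub> v, w) \<ominus>\<^bsub>FVW\<^esub> a \<odot>\<^bsub>FVW\<^esub> basis_vec K (v, w) \<in> bilinear_relators K V W"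
      using a unfolding bilinear_relators_def Let_def by blast
    from rel[OF this] show "pure K V W (a \<odot>\<^bsub>V\<^esub> v) w = a \<odot>\<^bsub>tensor K V W\<^esub> pure K V W v w"
      unfolding pure_def tensor_def using a by (simp add: T.smult_quot e_closed)
  qed auto
qed

text \<open>Sums of pure tensors suffice: a scalar coefficient is absorbed into the left
  factor.\<close>

lemma tensor_induct [consumes 1, case_names zero add]:
  assumes "t \<in> carrier (tensor K V W)" and "P \<zero>\<^bsub>tensor K V W\<^esub>"
    and "\<And>v w t. \<lbrakk>v \<in> carrier V; w \<in> carrier W; t \<in> carrier (tensor K V W); P t\<rbrakk>
      \<Longrightarrow> P (pure K V W v w \<oplus>\<^bsub>tensor K V W\<^esub> t)"
  shows "P t"
proof -
  obtain f where f: "f \<in> carrier FVW" "t = tensor_null K V W +>\<^bsub>FVW\<^esub> f"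
    using assms(1) by (auto simp: tensor_def T.carrier_quot)
  have "P (tensor_null K V W +>\<^bsub>FVW\<^esub> f)" using V.R.is_cring f(1)
  proof (induction rule: free_module_induct)
    case zero
    then show ?case using assms(2) by (simp only: T.coset_zero) (simp add: tensor_def T.zero_quot)
  next
    case (add a s f)
    obtain v w where s: "s = (v, w)" "v \<in> carrier V" "w \<in> carrier W" using add by auto
    have "tensor_null K V W +>\<^bsub>FVW\<^esub> (a \<odot>\<^bsub>FVW\<^esub> basis_vec K s \<oplus>\<^bsub>FVW\<^esub> f)
      = pure K V W (a \<odot>\<^bsub>V\<^esub> v) w \<oplus>\<^bsub>tensor K V W\<^esub> (tensor_null K V W +>\<^bsub>FVW\<^esub> f)"
      using pure_bilinear s add(1,3) e_closed
      unfolding bilinear_def linear_map_def pure_def tensor_def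
      by (simp add: T.add_quot T.smult_quot)
    moreover have "tensor_null K V W +>\<^bsub>FVW\<^esub> f \<in> carrier (tensor K V W)"
      using add by (auto simp: tensor_def T.coset_closed)
    ultimately show ?case using assms(3) s add by auto
  qed
  then show ?thesis using f by simp
qed

lemma tensor_map_eqI:
  assumes "module K U" "linear_map K (tensor K V W) U f" "linear_map K (tensor K V W) U g"
    and "\<And>v w. v \<in> carrier V \<Longrightarrow> w \<in> carrier W \<Longrightarrow> f (pure K V W v w) = g (pure K V W v w)"
    and "t \<in> carrier (tensor K V W)"
  shows "f t = g t"
  using assms(5)
proof (induction rule: tensor_induct)
  case zero
  then show ?case using linear_map_zero[OF tensor_module assms(1)] assms(2,3) by metis
next
  case (add v w t)
  then show ?case
    using assms(2-4) pure_closed by (simp add: linear_map_add[OF assms(2)] linear_map_add[OF assms(3)])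
qed

context
  fixes U :: "('k, 'x, 'l) module_scheme" and b
  assumes U: "module K U" and b: "bilinear K V W U b"
begin

private abbreviation "L \<equiv> free_lift K U (\<lambda>p. b (fst p) (snd p))"

interpretation U: module K U by (rule U)

private lemma bc: "p \<in> carrier V \<times> carrier W \<Longrightarrow> b (fst p) (snd p) \<in> carrier U"
  using b by (auto intro: bilinear_closed)

private lemmas Llin = free_lift_linear[where b = "\<lambda>p. b (fst p) (snd p)" and S = "carrier V \<times> carrier W", OF U bc]
private lemmas Lbasis = free_lift_basis[where b = "\<lambda>p. b (fst p) (snd p)" and S = "carrier V \<times> carrier W", OF U bc]

private lemmas Ldef = free_lift_def[where b = "\<lambda>p. b (fst p) (snd p)" and S = "carrier V \<times> carrier W", OF U bc]

text \<open>The kernel of \<open>L\<close> is a submodule and contains the bilinear relators, hence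
  also the smallest such submodule, \<open>tensor_null\<close>.\<close>

private lemma L_null: assumes "n \<in> tensor_null K V W" shows "L n = \<zero>\<^bsub>U\<^esub>"
proof -
  let ?N = "{f \<in> carrier FVW. L f = \<zero>\<^bsub>U\<^esub>}"
  note z = linear_map_zero[OF F.module_axioms U Llin] linear_map_uminus[OF F.module_axioms U Llin]
    linear_map_minus[OF F.module_axioms U Llin]
    linear_map_add[OF Llin] linear_map_smult[OF Llin] linear_map_closed[OF Llin]
  have "submodule ?N K FVW" by (rule F.submoduleI) (auto simp: z)
  moreover have "bilinear_relators K V W \<subseteq> ?N"
  proof -
    have bl: "b (v \<oplus>\<^bsub>V\<^esub> v') w = b v w \<oplus>\<^bsub>U\<^esub> b v' w" "b v w \<in> carrier U"
      "a \<in> carrier K \<Longrightarrow> b (a \<odot>\<^bsub>V\<^esub> v) w = a \<odot>\<^bsub>U\<^esub> b v w"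
      if "v \<in> carrier V" "v' \<in> carrier V" "w \<in> carrier W" for v v' w a
      using b that by (auto simp: bilinear_def linear_map_def)
    have br: "b v (w \<oplus>\<^bsub>W\<^esub> w') = b v w \<oplus>\<^bsub>U\<^esub> b v w'"
      "a \<in> carrier K \<Longrightarrow> b v (a \<odot>\<^bsub>W\<^esub> w) = a \<odot>\<^bsub>U\<^esub> b v w"
      if "v \<in> carrier V" "w' \<in> carrier W" "w \<in> carrier W" for v w w' a
      using b that by (auto simp: bilinear_def linear_map_def)
    have x: "x \<ominus>\<^bsub>U\<^esub> x = \<zero>\<^bsub>U\<^esub>" if "x \<in> carrier U" for x
      using that by (simp add: a_minus_def U.M.r_neg)
    have "L r = \<zero>\<^bsub>U\<^esub>" if "r \<in> bilinear_relators K V W" for r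
      using that unfolding bilinear_relators_def Let_def
      by (auto simp: z e_closed Lbasis bl br x)
    then show ?thesis using relators_sub by auto
  qed
  ultimately show ?thesis using assms unfolding tensor_null_def by auto
qed

text \<open>Two representatives of a coset differ by an element of \<open>tensor_null\<close>, on
  which \<open>L\<close> vanishes; this removes the choice in \<open>tensor_lift\<close>.\<close>

lemma tensor_lift_coset:
  assumes "f \<in> carrier FVW"
  shows "tensor_lift K V W U b (tensor_null K V W +>\<^bsub>FVW\<^esub> f) = L f"
proof -
  let ?t = "tensor_null K V W +>\<^bsub>FVW\<^esub> f"
  define g where "g = (SOME g. g \<in> ?t)"
  have g: "g \<in> ?t" unfolding g_def using T.mem_coset[OF assms] by (rule someI[where P = "\<lambda>g. g \<in> ?t"])
  then have gc: "g \<in> carrier FVW" "f \<ominus>\<^bsub>FVW\<^esub> g \<in> tensor_null K V W"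
    using T.mem_cosetD[OF g assms] T.coset_eq_iff assms by auto
  then have "L f \<ominus>\<^bsub>U\<^esub> L g = \<zero>\<^bsub>U\<^esub>"
    using L_null[OF gc(2)] linear_map_minus[OF F.module_axioms U Llin] assms by simp
  then have "L f = L g"
    by (rule minus_zeroD[OF U _ linear_map_closed[OF Llin assms] linear_map_closed[OF Llin gc(1)]])
  moreover have "tensor_lift K V W U b ?t = L g"
    unfolding tensor_lift_def Let_def g_def[symmetric] by (rule Ldef[symmetric])
  ultimately show ?thesis by simp
qed

lemma tensor_lift_linear: "linear_map K (tensor K V W) U (tensor_lift K V W U b)"
proof (rule linear_mapI)
  fix x assume "x \<in> carrier (tensor K V W)"
  then show "tensor_lift K V W U b x \<in> carrier U"
    using linear_map_closed[OF Llin] by (auto simp: tensor_def T.carrier_quot tensor_lift_coset)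
next
  fix x y assume "x \<in> carrier (tensor K V W)" "y \<in> carrier (tensor K V W)"
  then show "tensor_lift K V W U b (x \<oplus>\<^bsub>tensor K V W\<^esub> y)
      = tensor_lift K V W U b x \<oplus>\<^bsub>U\<^esub> tensor_lift K V W U b y"
    using linear_map_add[OF Llin] by (auto simp: tensor_def T.carrier_quot tensor_lift_coset T.add_quot)
next
  fix a x assume "a \<in> carrier K" "x \<in> carrier (tensor K V W)"
  then show "tensor_lift K V W U b (a \<odot>\<^bsub>tensor K V W\<^esub> x) = a \<odot>\<^bsub>U\<^esub> tensor_lift K V W U b x"
    using linear_map_smult[OF Llin] by (auto simp: tensor_def T.carrier_quot tensor_lift_coset T.smult_quot)
qed

lemma tensor_lift_pure:
  "v \<in> carrier V \<Longrightarrow> w \<in> carrier W \<Longrightarrow> tensor_lift K V W U b (pure K V W v w) = b v w"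
  unfolding pure_def by (simp add: tensor_lift_coset e_closed Lbasis)

end

end

section \<open>Functoriality of the tensor product\<close>

lemma bilinear_cong:
  assumes "module K V" "module K W"
    and "\<And>v w. v \<in> carrier V \<Longrightarrow> w \<in> carrier W \<Longrightarrow> b v w = b' v w"
  shows "bilinear K V W U b \<longleftrightarrow> bilinear K V W U b'"
proof -
  have "linear_map K W U (\<lambda>w. b v w) = linear_map K W U (\<lambda>w. b' v w)" if "v \<in> carrier V" for v
    by (rule linear_map_cong[OF assms(2)]) (use assms(3) that in auto)
  moreover have "linear_map K V U (\<lambda>v. b v w) = linear_map K V U (\<lambda>v. b' v w)" if "w \<in> carrier W" for w
    by (rule linear_map_cong[OF assms(1)]) (use assms(3) that in auto)
  ultimately show ?thesis unfolding bilinear_def by auto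
qed

lemma bilinear_comp:
  "bilinear K V W U b \<Longrightarrow> linear_map K U U' h \<Longrightarrow> bilinear K V W U' (\<lambda>v w. h (b v w))"
  unfolding bilinear_def by (auto intro: linear_map_comp)

lemma bilinear_precomp:
  assumes "bilinear K V' W' U b" "linear_map K V V' f" "linear_map K W W' g"
  shows "bilinear K V W U (\<lambda>v w. b (f v) (g w))"
  using assms unfolding bilinear_def
  by (auto intro: linear_map_comp[OF assms(2)] linear_map_comp[OF assms(3)]
      simp: linear_map_closed[OF assms(2)] linear_map_closed[OF assms(3)])

lemma tensor_module: "module K V \<Longrightarrow> module K W \<Longrightarrow> module K (tensor K V W)"
  by (intro two_modules.tensor_module two_modules.intro)

lemma pure_closed: "module K V \<Longrightarrow> module K W \<Longrightarrow> v \<in> carrier V \<Longrightarrow> w \<in> carrier W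
    \<Longrightarrow> pure K V W v w \<in> carrier (tensor K V W)"
  by (intro two_modules.pure_closed two_modules.intro)

lemma pure_bilinear: "module K V \<Longrightarrow> module K W \<Longrightarrow> bilinear K V W (tensor K V W) (pure K V W)"
  by (intro two_modules.pure_bilinear two_modules.intro)

lemma pure_linear:
  assumes "module K V" "module K W"
  shows "w \<in> carrier W \<Longrightarrow> linear_map K V (tensor K V W) (\<lambda>v. pure K V W v w)"
    and "v \<in> carrier V \<Longrightarrow> linear_map K W (tensor K V W) (\<lambda>w. pure K V W v w)"
  using pure_bilinear[OF assms] by (auto simp: bilinear_def)

lemmas tensor_eqI = two_modules.tensor_map_eqI[OF two_modules.intro]
lemmas tensor_lift_linear = two_modules.tensor_lift_linear[OF two_modules.intro]
lemmas tensor_lift_pure = two_modules.tensor_lift_pure[OF two_modules.intro]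
lemmas tensor_induct = two_modules.tensor_induct[OF two_modules.intro, consumes 3, case_names zero add]

lemma tensor_lift_cong:
  assumes "module K V" "module K W" "module K U" "bilinear K V W U b"
    and "\<And>v w. v \<in> carrier V \<Longrightarrow> w \<in> carrier W \<Longrightarrow> b v w = b' v w"
    and "t \<in> carrier (tensor K V W)"
  shows "tensor_lift K V W U b t = tensor_lift K V W U b' t"
proof -
  have b': "bilinear K V W U b'" using bilinear_cong[OF assms(1,2)] assms(4,5) by metis
  show ?thesis
    by (rule tensor_eqI[OF assms(1,2,3) tensor_lift_linear tensor_lift_linear])
      (use assms b' in \<open>auto simp: tensor_lift_pure\<close>)
qed

lemma tensor_lift_comp:
  assumes "module K V" "module K W" "module K U" "module K U'" "bilinear K V W U b"
    and "linear_map K U U' h" "t \<in> carrier (tensor K V W)"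
  shows "h (tensor_lift K V W U b t) = tensor_lift K V W U' (\<lambda>v w. h (b v w)) t"
  by (rule tensor_eqI[OF assms(1,2,4) linear_map_comp[OF tensor_lift_linear] tensor_lift_linear])
    (use assms bilinear_comp[OF assms(5,6)] in \<open>auto simp: tensor_lift_pure\<close>)

context
  fixes K :: "'k ring" and V :: "('k, 'v, 'm) module_scheme" and W :: "('k, 'w, 'n) module_scheme"
    and V' :: "('k, 'v2, 'm2) module_scheme" and W' :: "('k, 'w2, 'n2) module_scheme" and f g
  assumes mods: "module K V" "module K W" "module K V'" "module K W'"
    and f: "linear_map K V V' f" and g: "linear_map K W W' g"
begin

lemma tensor_map_bilinear: "bilinear K V W (tensor K V' W') (\<lambda>v w. pure K V' W' (f v) (g w))"
  by (rule bilinear_precomp[OF pure_bilinear[OF mods(3,4)] f g])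

lemma tensor_map_linear:
  "linear_map K (tensor K V W) (tensor K V' W') (tensor_map K V W V' W' f g)"
  unfolding tensor_map_def
  by (intro tensor_lift_linear mods tensor_module tensor_map_bilinear)

lemma tensor_map_pure:
  "v \<in> carrier V \<Longrightarrow> w \<in> carrier W
    \<Longrightarrow> tensor_map K V W V' W' f g (pure K V W v w) = pure K V' W' (f v) (g w)"
  unfolding tensor_map_def
  by (intro tensor_lift_pure mods tensor_module tensor_map_bilinear)

lemma tensor_lift_map:
  assumes "module K U" "bilinear K V' W' U b" "t \<in> carrier (tensor K V W)"
  shows "tensor_lift K V' W' U b (tensor_map K V W V' W' f g t)
    = tensor_lift K V W U (\<lambda>v w. b (f v) (g w)) t"
  by (rule tensor_eqI[OF mods(1,2) assms(1)
        linear_map_comp[OF tensor_map_linear tensor_lift_linear[OF mods(3,4)]] tensor_lift_linear])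
    (use assms mods bilinear_precomp[OF assms(2) f g] in
      \<open>auto simp: tensor_lift_pure tensor_map_pure linear_map_closed[OF f] linear_map_closed[OF g]\<close>)

end

lemma tensor_map_comp:
  assumes "module K V" "module K W" "module K V'" "module K W'" "module K V''" "module K W''"
    and "linear_map K V V' f" "linear_map K W W' g" "linear_map K V' V'' f'" "linear_map K W' W'' g'"
    and "t \<in> carrier (tensor K V W)"
  shows "tensor_map K V' W' V'' W'' f' g' (tensor_map K V W V' W' f g t)
    = tensor_map K V W V'' W'' (\<lambda>x. f' (f x)) (\<lambda>x. g' (g x)) t"
  unfolding tensor_map_def[of K V' W'] tensor_map_def[of K V W V'']
  by (rule tensor_lift_map[OF assms(1-4,7,8)])
    (use assms in \<open>auto intro: tensor_module tensor_map_bilinear\<close>)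

lemma tensor_map_cong:
  assumes "module K V" "module K W" "module K V'" "module K W'"
    and "linear_map K V V' f" "linear_map K W W' g"
    and "\<And>v. v \<in> carrier V \<Longrightarrow> f v = f' v" "\<And>w. w \<in> carrier W \<Longrightarrow> g w = g' w"
    and "t \<in> carrier (tensor K V W)"
  shows "tensor_map K V W V' W' f g t = tensor_map K V W V' W' f' g' t"
  unfolding tensor_map_def
  by (rule tensor_lift_cong[OF assms(1,2) _ tensor_map_bilinear])
    (use assms in \<open>auto intro: tensor_module\<close>)

text \<open>By induction on \<open>t\<close>, the lift is a sum of terms linear in \<open>m\<close>.
  It supplies linearity in the outer variable whenever lifts are nested, as in the associator and in
  \<open>entw_side\<close>.\<close>

lemma tensor_lift_param_linear:
  assumes mods: "module K V" "module K W" "module K U" "module K M"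
    and b: "\<And>m. m \<in> carrier M \<Longrightarrow> bilinear K V W U (b m)"
    and lin: "\<And>v w. v \<in> carrier V \<Longrightarrow> w \<in> carrier W \<Longrightarrow> linear_map K M U (\<lambda>m. b m v w)"
    and t: "t \<in> carrier (tensor K V W)"
  shows "linear_map K M U (\<lambda>m. tensor_lift K V W U (b m) t)"
  using mods(1,2) t
proof (induction rule: tensor_induct)
  case zero
  have "tensor_lift K V W U (b m) \<zero>\<^bsub>tensor K V W\<^esub> = \<zero>\<^bsub>U\<^esub>" if "m \<in> carrier M" for m
    using linear_map_zero[OF tensor_module[OF mods(1,2)] mods(3) tensor_lift_linear[OF mods(1-3) b[OF that]]] .
  then show ?case by (rule linear_map_congI[OF mods(4) linear_map_null[OF mods(3)]])
next
  case (add v w t)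
  have "tensor_lift K V W U (b m) (pure K V W v w \<oplus>\<^bsub>tensor K V W\<^esub> t)
      = b m v w \<oplus>\<^bsub>U\<^esub> tensor_lift K V W U (b m) t" if "m \<in> carrier M" for m
    using add mods linear_map_add[OF tensor_lift_linear[OF mods(1-3) b[OF that]] pure_closed add(3)]
    by (simp add: tensor_lift_pure b[OF that])
  then show ?case
    by (rule linear_map_congI[OF mods(4) linear_map_plus[OF mods(3) lin[OF add(1,2)] add(4)]])
qed

section \<open>Bases and coordinates\<close>

text \<open>The basis is indexed by its own elements, and independence is expressed by the dual
  functionals \<open>e i\<close>, because these are what extract coordinates from tensors.\<close>

definition is_basis :: "'k ring \<Rightarrow> ('k, 'w, 'n) module_scheme \<Rightarrow> 'w set \<Rightarrow> ('w \<Rightarrow> 'w \<Rightarrow> 'k) \<Rightarrow> bool" where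
  "is_basis K W B e \<longleftrightarrow> B \<subseteq> carrier W \<and> (\<forall>i\<in>B. linear_map K W (base_module K) (e i)) \<and>
     (\<forall>i\<in>B. \<forall>j\<in>B. e i j = (if i = j then \<one>\<^bsub>K\<^esub> else \<zero>\<^bsub>K\<^esub>)) \<and>
     (\<forall>w\<in>carrier W. finite {i \<in> B. e i w \<noteq> \<zero>\<^bsub>K\<^esub>} \<and>
        w = (\<Oplus>\<^bsub>W\<^esub>i\<in>{i \<in> B. e i w \<noteq> \<zero>\<^bsub>K\<^esub>}. e i w \<odot>\<^bsub>W\<^esub> i))"

lemma basis_exists:
  fixes K :: "'k ring" (structure) and W :: "('k, 'w, 'n) module_scheme"
  assumes "field K" "module K W"
  shows "\<exists>B e. is_basis K W B e"
proof -
  interpret field K by fact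
  interpret W: module K W by fact
  let ?L = "free_lift K W (\<lambda>w. w)"
  let ?F = "\<lambda>A. free_module K A"
  \<comment> \<open>\<open>?L\<close> evaluates a formal combination in \<open>W\<close>;
    independence of \<open>A\<close> is triviality of its kernel on the combinations supported in
    \<open>A\<close>.\<close>
  define indep where "indep A \<longleftrightarrow> A \<subseteq> carrier W \<and> (\<forall>f\<in>carrier (?F A). ?L f = \<zero>\<^bsub>W\<^esub> \<longrightarrow> f = \<zero>\<^bsub>?F A\<^esub>)" for A
  have "\<exists>M\<in>Collect indep. \<forall>X\<in>Collect indep. M \<subseteq> X \<longrightarrow> X = M"
  proof (rule subset_Zorn')
    fix Ch assume ch: "subset.chain (Collect indep) Ch"
    show "\<Union>Ch \<in> Collect indep"
    proof (cases "Ch = {}")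
      case True
      then show ?thesis by (auto simp: indep_def free_module_simps)
    next
      case False
      have "f = \<zero>\<^bsub>?F (\<Union>Ch)\<^esub>" if f: "f \<in> carrier (?F (\<Union>Ch))" "?L f = \<zero>\<^bsub>W\<^esub>" for f
      proof -
        \<comment> \<open>A combination has finite support, hence is already supported in one member
          of the chain.\<close>
        have "{s. f s \<noteq> \<zero>} \<subseteq> \<Union>Ch" using f(1) by (auto simp: free_module_simps)
        then obtain A where A: "A \<in> Ch" "{s. f s \<noteq> \<zero>} \<subseteq> A"
          using finite_subset_Union_chain[OF free_module_finite[OF f(1)] _ False ch] by blast
        then have "f \<in> carrier (?F A)" using f(1) by (auto simp: free_module_simps)
        moreover have "indep A" using A ch by (auto simp: subset.chain_def)
        ultimately show ?thesis using f(2) by (auto simp: indep_def free_module_simps)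
      qed
      moreover have "\<Union>Ch \<subseteq> carrier W" using ch unfolding subset.chain_def indep_def by blast
      ultimately show ?thesis by (auto simp: indep_def)
    qed
  qed
  then obtain B where B: "indep B" and max: "\<And>X. indep X \<Longrightarrow> B \<subseteq> X \<Longrightarrow> X = B" by auto
  have BW: "B \<subseteq> carrier W" using B by (simp add: indep_def)
  then have L: "linear_map K (?F B) W ?L" by (intro free_lift_linear[OF W.module_axioms]) auto
  interpret F: module K "?F B" by (rule free_module) (rule is_cring)
  \<comment> \<open>If \<open>w\<close> were not in the span of \<open>B\<close>, then
    \<open>insert w B\<close> would be independent, against maximality: a relation with coefficient
    zero at \<open>w\<close> is a relation in \<open>B\<close>, and one with a nonzero coefficient
    can be solved for \<open>w\<close> over the field.\<close>
  have surj: "\<exists>f\<in>carrier (?F B). ?L f = w" if w: "w \<in> carrier W" for w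
  proof (rule ccontr)
    assume no: "\<not> ?thesis"
    let ?B = "insert w B"
    have BW': "?B \<subseteq> carrier W" using BW w by auto
    have wB: "w \<notin> B"
    proof
      assume "w \<in> B"
      then have "basis_vec K w \<in> carrier (?F B)" "?L (basis_vec K w) = w"
        using BW by (auto intro!: basis_vec_closed is_cring free_lift_basis[OF W.module_axioms])
      then show False using no by blast
    qed
    interpret F': module K "?F ?B" by (rule free_module) (rule is_cring)
    have L': "linear_map K (?F ?B) W ?L" using BW' by (intro free_lift_linear[OF W.module_axioms]) auto
    have "f = \<zero>\<^bsub>?F ?B\<^esub>" if f: "f \<in> carrier (?F ?B)" "?L f = \<zero>\<^bsub>W\<^esub>" for f
    proof -
      let ?g = "f(w := \<zero>)"
      have "finite {s. ?g s \<noteq> \<zero>}"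
        by (rule finite_subset[OF _ free_module_finite[OF f(1)]]) auto
      then have g: "?g \<in> carrier (?F B)" "?g \<in> carrier (?F ?B)"
        using f(1) by (auto simp: free_module_simps)
      have fw: "f w \<in> carrier K" using f(1) by (auto simp: free_module_simps)
      have bv: "basis_vec K w \<in> carrier (?F ?B)" by (rule basis_vec_closed[OF is_cring]) simp
      have Lb: "?L (basis_vec K w) = w"
        using BW' by (intro free_lift_basis[OF W.module_axioms, where S = ?B]) auto
      have "f = (f w \<odot>\<^bsub>?F ?B\<^esub> basis_vec K w) \<oplus>\<^bsub>?F ?B\<^esub> ?g"
        using free_module_value[OF is_cring f(1)] by (auto simp: free_module_simps basis_vec_def)
      then have "?L f = ?L ((f w \<odot>\<^bsub>?F ?B\<^esub> basis_vec K w) \<oplus>\<^bsub>?F ?B\<^esub> ?g)" by simp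
      also have "\<dots> = f w \<odot>\<^bsub>W\<^esub> w \<oplus>\<^bsub>W\<^esub> ?L ?g"
        using fw bv g Lb by (simp add: linear_map_add[OF L'] linear_map_smult[OF L'])
      finally have eq: "f w \<odot>\<^bsub>W\<^esub> w \<oplus>\<^bsub>W\<^esub> ?L ?g = \<zero>\<^bsub>W\<^esub>" using f(2) by simp
      have Lg: "?L ?g \<in> carrier W" using linear_map_closed[OF L g(1)] .
      show ?thesis
      proof (cases "f w = \<zero>")
        case True
        then have "f = ?g" by auto
        then have "f = \<zero>\<^bsub>?F B\<^esub>" using B g(1) f(2) by (auto simp: indep_def)
        then show ?thesis by (simp add: free_module_simps)
      next
        case False
        then have u: "f w \<in> Units K" using fw field_Units by auto
        then have i: "inv f w \<in> carrier K" by simp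
        have "f w \<odot>\<^bsub>W\<^esub> w = \<ominus>\<^bsub>W\<^esub> ?L ?g" using eq Lg fw w W.M.minus_equality by simp
        also have "\<dots> = ?L (\<ominus>\<^bsub>?F B\<^esub> ?g)"
          using linear_map_uminus[OF F.module_axioms W.module_axioms L g(1)] by simp
        finally have e: "f w \<odot>\<^bsub>W\<^esub> w = ?L (\<ominus>\<^bsub>?F B\<^esub> ?g)" .
        have "w = (inv f w \<otimes> f w) \<odot>\<^bsub>W\<^esub> w" using u w by simp
        also have "\<dots> = ?L (inv f w \<odot>\<^bsub>?F B\<^esub> (\<ominus>\<^bsub>?F B\<^esub> ?g))"
          using i fw w g(1) e by (simp add: W.smult_assoc1 linear_map_smult[OF L])
        finally show ?thesis using no i g(1) by (metis F.M.a_inv_closed F.smult_closed)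
      qed
    qed
    then have "indep ?B" using BW' by (auto simp: indep_def)
    then show False using max[of ?B] wB by auto
  qed
  have inj: "f = g" if "f \<in> carrier (?F B)" "g \<in> carrier (?F B)" "?L f = ?L g" for f g
  proof -
    have "?L (f \<ominus>\<^bsub>?F B\<^esub> g) = \<zero>\<^bsub>W\<^esub>"
      using that linear_map_closed[OF L] linear_map_minus[OF F.module_axioms W.module_axioms L]
      by (simp add: a_minus_def W.M.r_neg)
    then have "f \<ominus>\<^bsub>?F B\<^esub> g = \<zero>\<^bsub>?F B\<^esub>" using B that by (auto simp: indep_def)
    then show ?thesis by (rule minus_zeroD[OF F.module_axioms _ that(1,2)])
  qed
  \<comment> \<open>The coordinates of \<open>w\<close> form its unique preimage under
    \<open>?L\<close>; uniqueness makes \<open>c\<close> linear.\<close>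
  define c where "c w = (SOME f. f \<in> carrier (?F B) \<and> ?L f = w)" for w
  have c: "c w \<in> carrier (?F B)" "?L (c w) = w" if "w \<in> carrier W" for w
    using someI_ex[of "\<lambda>f. f \<in> carrier (?F B) \<and> ?L f = w"] surj[OF that] unfolding c_def by auto
  have c_add: "c (v \<oplus>\<^bsub>W\<^esub> w) = c v \<oplus>\<^bsub>?F B\<^esub> c w" if "v \<in> carrier W" "w \<in> carrier W" for v w
    using that c by (intro inj) (auto simp: linear_map_add[OF L])
  have c_smult: "c (a \<odot>\<^bsub>W\<^esub> w) = a \<odot>\<^bsub>?F B\<^esub> c w" if "a \<in> carrier K" "w \<in> carrier W" for a w
    using that c by (intro inj) (auto simp: linear_map_smult[OF L])
  have c_basis: "c b = basis_vec K b" if "b \<in> B" for b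
  proof -
    have "?L (basis_vec K b) = b"
      using BW that by (intro free_lift_basis[OF W.module_axioms, where S = B]) auto
    then show ?thesis
      using c[of b] BW that by (intro inj[OF _ basis_vec_closed[OF is_cring]]) auto
  qed
  have supp: "{i \<in> B. c w i \<noteq> \<zero>} = {i. c w i \<noteq> \<zero>}" if "w \<in> carrier W" for w
    using c(1)[OF that] by (auto simp: free_module_simps)
  have "is_basis K W B (\<lambda>i w. c w i)"
    unfolding is_basis_def
  proof (intro conjI ballI BW)
    fix i assume "i \<in> B"
    show "linear_map K W (base_module K) (\<lambda>w. c w i)"
      using free_module_value[OF is_cring c(1)]
      by (intro linear_mapI) (auto simp: c_add c_smult free_module_simps)
    fix j assume "j \<in> B"
    then show "c j i = (if i = j then \<one> else \<zero>)" by (simp add: c_basis basis_vec_def)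
  next
    fix w assume w: "w \<in> carrier W"
    show "finite {i \<in> B. c w i \<noteq> \<zero>}" using free_module_finite[OF c(1)[OF w]] supp[OF w] by simp
    have "w = ?L (c w)" using c w by simp
    also have "\<dots> = (\<Oplus>\<^bsub>W\<^esub>i\<in>{i. c w i \<noteq> \<zero>}. c w i \<odot>\<^bsub>W\<^esub> i)"
      using BW by (intro free_lift_def[OF W.module_axioms, where S = B]) auto
    finally show "w = (\<Oplus>\<^bsub>W\<^esub>i\<in>{i \<in> B. c w i \<noteq> \<zero>}. c w i \<odot>\<^bsub>W\<^esub> i)" using supp[OF w] by simp
  qed
  then show ?thesis by blast
qed

text \<open>This is \<open>id \<otimes> \<phi>\<close> followed by the identification of
  \<open>V \<otimes> K\<close> with \<open>V\<close>.\<close>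

definition coord :: "'k ring \<Rightarrow> ('k, 'v, 'm) module_scheme \<Rightarrow> ('k, 'w, 'n) module_scheme \<Rightarrow> ('w \<Rightarrow> 'k)
    \<Rightarrow> ('v, 'w, 'k) tens \<Rightarrow> 'v" where
  "coord K V W \<phi> = tensor_lift K V W V (\<lambda>v w. \<phi> w \<odot>\<^bsub>V\<^esub> v)"

context
  fixes K :: "'k ring" and V :: "('k, 'v, 'm) module_scheme" and W :: "('k, 'w, 'n) module_scheme"
  assumes mods: "module K V" "module K W"
begin

lemma coord_bilinear:
  assumes "linear_map K W (base_module K) \<phi>"
  shows "bilinear K V W V (\<lambda>v w. \<phi> w \<odot>\<^bsub>V\<^esub> v)"
proof -
  interpret V: module K V by (rule mods)
  show ?thesis using linear_map_closed[OF assms]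
    by (intro bilinearI linear_map_scale_const linear_map_scale linear_map_ident mods assms) auto
qed

lemma coord_linear:
  "linear_map K W (base_module K) \<phi> \<Longrightarrow> linear_map K (tensor K V W) V (coord K V W \<phi>)"
  unfolding coord_def by (intro tensor_lift_linear coord_bilinear mods)

lemma coord_pure:
  "linear_map K W (base_module K) \<phi> \<Longrightarrow> v \<in> carrier V \<Longrightarrow> w \<in> carrier W
    \<Longrightarrow> coord K V W \<phi> (pure K V W v w) = \<phi> w \<odot>\<^bsub>V\<^esub> v"
  unfolding coord_def by (intro tensor_lift_pure coord_bilinear mods)

end

text \<open>Applying \<open>\<phi>\<close> to the second factor commutes with a map on the first
  factor and absorbs a map on the second. It is the tool for passing from tensor identities to
  coordinates.\<close>

lemma coord_map:
  assumes "module K V" "module K W" "module K V'" "module K W'"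
    and f: "linear_map K V V' f" and g: "linear_map K W W' g"
    and phi: "linear_map K W' (base_module K) \<phi>" and t: "t \<in> carrier (tensor K V W)"
  shows "coord K V' W' \<phi> (tensor_map K V W V' W' f g t) = f (coord K V W (\<lambda>w. \<phi> (g w)) t)"
proof -
  have lin: "linear_map K W (base_module K) (\<lambda>w. \<phi> (g w))" by (rule linear_map_comp[OF g phi])
  have "coord K V' W' \<phi> (tensor_map K V W V' W' f g t)
      = tensor_lift K V W V' (\<lambda>v w. \<phi> (g w) \<odot>\<^bsub>V'\<^esub> f v) t"
    unfolding coord_def by (rule tensor_lift_map[OF assms(1-4) f g assms(3) coord_bilinear[OF assms(3,4) phi] t])
  also have "\<dots> = tensor_lift K V W V' (\<lambda>v w. f (\<phi> (g w) \<odot>\<^bsub>V\<^esub> v)) t"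
    using linear_map_closed[OF lin] linear_map_smult[OF f]
    by (intro tensor_lift_cong[OF assms(1,2,3) _ _ t]
        bilinear_precomp[OF coord_bilinear[OF assms(3,4) phi] f g]) auto
  also have "\<dots> = f (coord K V W (\<lambda>w. \<phi> (g w)) t)"
    unfolding coord_def
    by (rule tensor_lift_comp[OF assms(1,2,1,3) coord_bilinear[OF assms(1,2) lin] f t, symmetric])
  finally show ?thesis .
qed

lemma is_basis_linear: "is_basis K W B e \<Longrightarrow> i \<in> B \<Longrightarrow> linear_map K W (base_module K) (e i)"
  by (simp add: is_basis_def)

lemma is_basis_mem: "is_basis K W B e \<Longrightarrow> i \<in> B \<Longrightarrow> i \<in> carrier W"
  by (auto simp: is_basis_def)

lemma is_basis_delta: "is_basis K W B e \<Longrightarrow> i \<in> B \<Longrightarrow> j \<in> B \<Longrightarrow>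
    e i j = (if i = j then \<one>\<^bsub>K\<^esub> else \<zero>\<^bsub>K\<^esub>)"
  by (auto simp: is_basis_def)

lemma is_basis_finite: "is_basis K W B e \<Longrightarrow> w \<in> carrier W \<Longrightarrow> finite {i \<in> B. e i w \<noteq> \<zero>\<^bsub>K\<^esub>}"
  by (auto simp: is_basis_def)

lemma is_basis_expand:
  assumes "module K W" "is_basis K W B e" "w \<in> carrier W" "finite F" "F \<subseteq> B"
    and "{i \<in> B. e i w \<noteq> \<zero>\<^bsub>K\<^esub>} \<subseteq> F"
  shows "w = (\<Oplus>\<^bsub>W\<^esub>i\<in>F. e i w \<odot>\<^bsub>W\<^esub> i)"
proof -
  interpret W: module K W by fact
  have ei: "e i w \<in> carrier K" "i \<in> carrier W" if "i \<in> B" for i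
    using linear_map_closed[OF is_basis_linear[OF assms(2) that] assms(3)] is_basis_mem[OF assms(2) that]
    by auto
  have "w = (\<Oplus>\<^bsub>W\<^esub>i\<in>{i \<in> B. e i w \<noteq> \<zero>\<^bsub>K\<^esub>}. e i w \<odot>\<^bsub>W\<^esub> i)"
    using assms(2,3) by (simp add: is_basis_def)
  also have "\<dots> = (\<Oplus>\<^bsub>W\<^esub>i\<in>F. e i w \<odot>\<^bsub>W\<^esub> i)"
    using assms(4-6) ei by (intro finsum_superset[OF assms(1)]) auto
  finally show ?thesis .
qed

context
  fixes K :: "'k ring" and V :: "('k, 'v, 'm) module_scheme" and W :: "('k, 'w, 'n) module_scheme"
    and B e
  assumes mods: "module K V" "module K W" and basis: "is_basis K W B e"
begin

interpretation V: module K V by (rule mods)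
interpretation W: module K W by (rule mods)
interpretation T: module K "tensor K V W" by (intro tensor_module mods)

private lemmas elin = is_basis_linear[OF basis]
private abbreviation "c i \<equiv> coord K V W (e i)"
private lemmas clin = coord_linear[OF mods elin]

private lemma cc: "i \<in> B \<Longrightarrow> t \<in> carrier (tensor K V W) \<Longrightarrow> c i t \<in> carrier V"
  using linear_map_closed[OF clin] by auto

private lemma pc: "i \<in> B \<Longrightarrow> t \<in> carrier (tensor K V W) \<Longrightarrow> pure K V W (c i t) i \<in> carrier (tensor K V W)"
  using cc is_basis_mem[OF basis] by (auto intro: pure_closed mods)

private lemma p0: "i \<in> B \<Longrightarrow> pure K V W \<zero>\<^bsub>V\<^esub> i = \<zero>\<^bsub>tensor K V W\<^esub>"
  using linear_map_zero[OF mods(1) T.module_axioms pure_linear(1)[OF mods is_basis_mem[OF basis]]] by simp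

text \<open>Finiteness and expansion are proved together, and the expansion over every finite set of
  basis elements containing the support: the summands have different supports, and cancellation may
  shrink the support of the sum.\<close>

lemma coord_finite_expand:
  assumes "t \<in> carrier (tensor K V W)"
  shows "finite {i \<in> B. coord K V W (e i) t \<noteq> \<zero>\<^bsub>V\<^esub>} \<and>
    (\<forall>F. finite F \<and> F \<subseteq> B \<and> {i \<in> B. coord K V W (e i) t \<noteq> \<zero>\<^bsub>V\<^esub>} \<subseteq> F \<longrightarrow>
      t = (\<Oplus>\<^bsub>tensor K V W\<^esub>i\<in>F. pure K V W (coord K V W (e i) t) i))"
  using mods assms
proof (induction rule: tensor_induct)
  case zero
  have c0: "c i \<zero>\<^bsub>tensor K V W\<^esub> = \<zero>\<^bsub>V\<^esub>" if "i \<in> B" for i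
    using linear_map_zero[OF T.module_axioms mods(1) clin[OF that]] .
  have "(\<Oplus>\<^bsub>tensor K V W\<^esub>i\<in>F. pure K V W (c i \<zero>\<^bsub>tensor K V W\<^esub>) i) = \<zero>\<^bsub>tensor K V W\<^esub>" if "F \<subseteq> B" for F
    using that c0 p0 by (intro T.M.add.finprod_one_eqI) auto
  moreover have "{i \<in> B. c i \<zero>\<^bsub>tensor K V W\<^esub> \<noteq> \<zero>\<^bsub>V\<^esub>} = {}" using c0 by blast
  then have "finite {i \<in> B. c i \<zero>\<^bsub>tensor K V W\<^esub> \<noteq> \<zero>\<^bsub>V\<^esub>}" by (simp only: finite.emptyI)
  ultimately show ?case by auto
next
  case (add v w t)
  let ?p = "pure K V W v w" and ?T = "tensor K V W"
  have p: "?p \<in> carrier ?T" using add by (intro pure_closed mods)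
  have ei: "e i w \<in> carrier K" "i \<in> carrier W" if "i \<in> B" for i
    using linear_map_closed[OF elin[OF that] add(2)] is_basis_mem[OF basis that] by auto
  have cp: "c i ?p = e i w \<odot>\<^bsub>V\<^esub> v" if "i \<in> B" for i
    using coord_pure[OF mods elin[OF that] add(1,2)] .
  have cs: "c i (?p \<oplus>\<^bsub>?T\<^esub> t) = c i ?p \<oplus>\<^bsub>V\<^esub> c i t" if "i \<in> B" for i
    using linear_map_add[OF clin[OF that] p add(3)] .
  let ?S = "\<lambda>t. {i \<in> B. c i t \<noteq> \<zero>\<^bsub>V\<^esub>}" and ?Sw = "{i \<in> B. e i w \<noteq> \<zero>\<^bsub>K\<^esub>}"
  have Sw: "finite ?Sw" using is_basis_finite[OF basis add(2)] .
  have St: "finite (?S t)" using add by auto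
  have sub: "?S (?p \<oplus>\<^bsub>?T\<^esub> t) \<subseteq> ?Sw \<union> ?S t" using cs cp cc add(1,3) by auto
  show ?case
  proof (intro conjI allI impI)
    show "finite (?S (?p \<oplus>\<^bsub>?T\<^esub> t))" using sub Sw St finite_subset by blast
    fix F assume F: "finite F \<and> F \<subseteq> B \<and> ?S (?p \<oplus>\<^bsub>?T\<^esub> t) \<subseteq> F"
    \<comment> \<open>Both summands are expanded over a common index set; the indices outside
      \<open>F\<close> contribute zero to the total and are dropped at the end.\<close>
    let ?F = "F \<union> ?Sw \<union> ?S t"
    have fF: "finite ?F" "?F \<subseteq> B" using F Sw St by auto
    have "?p = pure K V W v (\<Oplus>\<^bsub>W\<^esub>i\<in>?F. e i w \<odot>\<^bsub>W\<^esub> i)"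
      by (rule arg_cong[OF is_basis_expand[OF mods(2) basis add(2) fF]]) blast
    also have "\<dots> = (\<Oplus>\<^bsub>?T\<^esub>i\<in>?F. pure K V W v (e i w \<odot>\<^bsub>W\<^esub> i))"
      using fF ei by (intro linear_map_finsum[OF mods(2) T.module_axioms pure_linear(2)[OF mods add(1)]]) auto
    also have "\<dots> = (\<Oplus>\<^bsub>?T\<^esub>i\<in>?F. pure K V W (c i ?p) i)"
    proof (intro T.M.finsum_cong')
      show "(\<lambda>i. pure K V W (c i ?p) i) \<in> ?F \<rightarrow> carrier ?T" using fF pc p by blast
      fix i assume "i \<in> ?F"
      then have i: "i \<in> B" using fF by auto
      show "pure K V W v (e i w \<odot>\<^bsub>W\<^esub> i) = pure K V W (c i ?p) i"
        using i ei[OF i] add(1) linear_map_smult[OF pure_linear(1)[OF mods]] linear_map_smult[OF pure_linear(2)[OF mods]]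
        by (simp add: cp)
    qed simp
    finally have 1: "?p = (\<Oplus>\<^bsub>?T\<^esub>i\<in>?F. pure K V W (c i ?p) i)" .
    have 2: "t = (\<Oplus>\<^bsub>?T\<^esub>i\<in>?F. pure K V W (c i t) i)" 
    proof (rule add(4)[THEN conjunct2, rule_format])
      show "finite ?F \<and> ?F \<subseteq> B \<and> ?S t \<subseteq> ?F" using fF by simp
    qed
    have f1: "(\<lambda>i. pure K V W (c i ?p) i) \<in> ?F \<rightarrow> carrier ?T" "(\<lambda>i. pure K V W (c i t) i) \<in> ?F \<rightarrow> carrier ?T"
      using fF pc p add(3) by blast+
    have "?p \<oplus>\<^bsub>?T\<^esub> t = (\<Oplus>\<^bsub>?T\<^esub>i\<in>?F. pure K V W (c i ?p) i) \<oplus>\<^bsub>?T\<^esub> (\<Oplus>\<^bsub>?T\<^esub>i\<in>?F. pure K V W (c i t) i)"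
      using 1 2 by simp
    also have "\<dots> = (\<Oplus>\<^bsub>?T\<^esub>i\<in>?F. pure K V W (c i ?p) i \<oplus>\<^bsub>?T\<^esub> pure K V W (c i t) i)"
      by (rule T.M.finsum_addf[OF f1, symmetric])
    also have "\<dots> = (\<Oplus>\<^bsub>?T\<^esub>i\<in>?F. pure K V W (c i (?p \<oplus>\<^bsub>?T\<^esub> t)) i)"
    proof (intro T.M.finsum_cong')
      show "(\<lambda>i. pure K V W (c i (?p \<oplus>\<^bsub>?T\<^esub> t)) i) \<in> ?F \<rightarrow> carrier ?T" using fF pc p add(3) by blast
      fix i assume "i \<in> ?F"
      then have i: "i \<in> B" using fF by auto
      show "pure K V W (c i ?p) i \<oplus>\<^bsub>?T\<^esub> pure K V W (c i t) i = pure K V W (c i (?p \<oplus>\<^bsub>?T\<^esub> t)) i"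
        using linear_map_add[OF pure_linear(1)[OF mods is_basis_mem[OF basis i]] cc[OF i p] cc[OF i add(3)]]
        by (simp add: cs[OF i])
    qed simp
    also have "\<dots> = (\<Oplus>\<^bsub>?T\<^esub>i\<in>F. pure K V W (c i (?p \<oplus>\<^bsub>?T\<^esub> t)) i)"
    proof (rule finsum_superset[symmetric, OF T.module_axioms fF(1)])
      show "pure K V W (c a (?p \<oplus>\<^bsub>?T\<^esub> t)) a \<in> carrier ?T" if "a \<in> F" for a
        using that F pc p add(3) by blast
      show "pure K V W (c a (?p \<oplus>\<^bsub>?T\<^esub> t)) a = \<zero>\<^bsub>?T\<^esub>" if "a \<in> ?F - F" for a
      proof -
        have "a \<in> B" "c a (?p \<oplus>\<^bsub>?T\<^esub> t) = \<zero>\<^bsub>V\<^esub>" using that fF F by blast+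
        then show ?thesis using p0 by simp
      qed
    qed blast
    finally show "?p \<oplus>\<^bsub>?T\<^esub> t = (\<Oplus>\<^bsub>?T\<^esub>i\<in>F. pure K V W (c i (?p \<oplus>\<^bsub>?T\<^esub> t)) i)" .
  qed
qed

lemma coord_finite: "t \<in> carrier (tensor K V W) \<Longrightarrow> finite {i \<in> B. coord K V W (e i) t \<noteq> \<zero>\<^bsub>V\<^esub>}"
  using coord_finite_expand by blast

lemma coord_expand:
  "\<lbrakk>t \<in> carrier (tensor K V W); finite F; F \<subseteq> B; {i \<in> B. coord K V W (e i) t \<noteq> \<zero>\<^bsub>V\<^esub>} \<subseteq> F\<rbrakk>
    \<Longrightarrow> t = (\<Oplus>\<^bsub>tensor K V W\<^esub>i\<in>F. pure K V W (coord K V W (e i) t) i)"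
  using coord_finite_expand by blast

text \<open>Equal coordinates give equal supports and hence the same expansion.\<close>

lemma coord_eqI:
  assumes "t \<in> carrier (tensor K V W)" "t' \<in> carrier (tensor K V W)"
    and eq: "\<And>i. i \<in> B \<Longrightarrow> coord K V W (e i) t = coord K V W (e i) t'"
  shows "t = t'"
proof -
  let ?S = "{i \<in> B. coord K V W (e i) t \<noteq> \<zero>\<^bsub>V\<^esub>}"
  have S: "finite ?S" "?S = {i \<in> B. coord K V W (e i) t' \<noteq> \<zero>\<^bsub>V\<^esub>}"
    using coord_finite[OF assms(1)] eq by auto
  have "t = (\<Oplus>\<^bsub>tensor K V W\<^esub>i\<in>?S. pure K V W (coord K V W (e i) t) i)"
    by (intro coord_expand assms S) auto
  also have "\<dots> = (\<Oplus>\<^bsub>tensor K V W\<^esub>i\<in>?S. pure K V W (coord K V W (e i) t') i)"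
    using eq pc assms(2) by (intro T.M.finsum_cong') auto
  also have "\<dots> = t'"
    using S(2) by (intro coord_expand[symmetric] assms S) auto
  finally show ?thesis .
qed

end

section \<open>Associativity of the tensor product\<close>

context
  fixes K :: "'k ring" and V :: "('k, 'v, 'm) module_scheme" and W :: "('k, 'w, 'n) module_scheme"
    and U :: "('k, 'x, 'l) module_scheme"
  assumes mods: "module K V" "module K W" "module K U"
begin

private abbreviation "L3 \<equiv> tensor K (tensor K V W) U"
private abbreviation "R3 \<equiv> tensor K V (tensor K W U)"

private lemmas tmods = tensor_module[OF mods(1,2)] tensor_module[OF mods(2,3)]
  tensor_module[OF tensor_module[OF mods(1,2)] mods(3)] tensor_module[OF mods(1) tensor_module[OF mods(2,3)]]

lemma tensor_eqI_left:
  assumes "module K Z" "linear_map K (tensor K (tensor K V W) U) Z f" "linear_map K (tensor K (tensor K V W) U) Z g"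
    and eq: "\<And>v w u. \<lbrakk>v \<in> carrier V; w \<in> carrier W; u \<in> carrier U\<rbrakk>
      \<Longrightarrow> f (pure K (tensor K V W) U (pure K V W v w) u) = g (pure K (tensor K V W) U (pure K V W v w) u)"
    and "t \<in> carrier (tensor K (tensor K V W) U)"
  shows "f t = g t"
proof (rule tensor_eqI[OF tmods(1) mods(3) assms(1-3) _ assms(5)])
  fix s u assume s: "s \<in> carrier (tensor K V W)" and u: "u \<in> carrier U"
  note p = pure_linear(1)[OF tmods(1) mods(3) u]
  show "f (pure K (tensor K V W) U s u) = g (pure K (tensor K V W) U s u)"
    by (rule tensor_eqI[OF mods(1,2) assms(1) linear_map_comp[OF p assms(2)] linear_map_comp[OF p assms(3)] eq s])
      (use u in auto)
qed

lemma tensor_eqI_right: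
  assumes "module K Z" "linear_map K (tensor K V (tensor K W U)) Z f" "linear_map K (tensor K V (tensor K W U)) Z g"
    and eq: "\<And>v w u. \<lbrakk>v \<in> carrier V; w \<in> carrier W; u \<in> carrier U\<rbrakk>
      \<Longrightarrow> f (pure K V (tensor K W U) v (pure K W U w u)) = g (pure K V (tensor K W U) v (pure K W U w u))"
    and "t \<in> carrier (tensor K V (tensor K W U))"
  shows "f t = g t"
proof (rule tensor_eqI[OF mods(1) tmods(2) assms(1-3) _ assms(5)])
  fix s v assume s: "s \<in> carrier (tensor K W U)" and v: "v \<in> carrier V"
  note p = pure_linear(2)[OF mods(1) tmods(2) v]
  show "f (pure K V (tensor K W U) v s) = g (pure K V (tensor K W U) v s)"
    by (rule tensor_eqI[OF mods(2,3) assms(1) linear_map_comp[OF p assms(2)] linear_map_comp[OF p assms(3)] eq s])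
      (use v in auto)
qed

private lemma assoc_inner: "u \<in> carrier U \<Longrightarrow> bilinear K V W R3 (\<lambda>v w. pure K V (tensor K W U) v (pure K W U w u))"
  by (rule bilinear_precomp[OF pure_bilinear[OF mods(1) tmods(2)] linear_map_ident(1) pure_linear(1)[OF mods(2,3)]])

private lemma assoc_outer: "bilinear K (tensor K V W) U R3 (\<lambda>t u. tensor_lift K V W R3
    (\<lambda>v w. pure K V (tensor K W U) v (pure K W U w u)) t)"
proof (rule bilinearI)
  show "linear_map K (tensor K V W) R3 (tensor_lift K V W R3 (\<lambda>v w. pure K V (tensor K W U) v (pure K W U w u)))"
    if "u \<in> carrier U" for u
    by (intro tensor_lift_linear mods tmods assoc_inner that)
  show "linear_map K U R3 (\<lambda>u. tensor_lift K V W R3 (\<lambda>v w. pure K V (tensor K W U) v (pure K W U w u)) t)"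
    if "t \<in> carrier (tensor K V W)" for t
    by (rule tensor_lift_param_linear[OF mods(1,2) tmods(4) mods(3) assoc_inner _ that])
      (assumption, rule linear_map_comp[OF pure_linear(2)[OF mods(2,3)] pure_linear(2)[OF mods(1) tmods(2)]])
qed

lemma tensor_assoc_linear: "linear_map K (tensor K (tensor K V W) U) (tensor K V (tensor K W U)) (tensor_assoc K V W U)"
  unfolding tensor_assoc_def by (intro tensor_lift_linear mods tmods assoc_outer)

lemma tensor_assoc_pure:
  assumes "v \<in> carrier V" "w \<in> carrier W" "u \<in> carrier U"
  shows "tensor_assoc K V W U (pure K (tensor K V W) U (pure K V W v w) u) = pure K V (tensor K W U) v (pure K W U w u)"
  unfolding tensor_assoc_def
  using assms by (simp add: tensor_lift_pure[OF tmods(1) mods(3) tmods(4) assoc_outer]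
      tensor_lift_pure[OF mods(1,2) tmods(4) assoc_inner] pure_closed[OF mods(1,2)])

private lemma inv_inner: "v \<in> carrier V \<Longrightarrow> bilinear K W U L3 (\<lambda>w u. pure K (tensor K V W) U (pure K V W v w) u)"
  by (rule bilinear_precomp[OF pure_bilinear[OF tmods(1) mods(3)] pure_linear(2)[OF mods(1,2)] linear_map_ident(1)])

private lemma inv_outer: "bilinear K V (tensor K W U) L3 (\<lambda>v t. tensor_lift K W U L3
    (\<lambda>w u. pure K (tensor K V W) U (pure K V W v w) u) t)"
proof (rule bilinearI)
  show "linear_map K (tensor K W U) L3 (tensor_lift K W U L3 (\<lambda>w u. pure K (tensor K V W) U (pure K V W v w) u))"
    if "v \<in> carrier V" for v
    by (intro tensor_lift_linear mods tmods inv_inner that)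
  show "linear_map K V L3 (\<lambda>v. tensor_lift K W U L3 (\<lambda>w u. pure K (tensor K V W) U (pure K V W v w) u) t)"
    if "t \<in> carrier (tensor K W U)" for t
    by (rule tensor_lift_param_linear[OF mods(2,3) tmods(3) mods(1) inv_inner _ that])
      (assumption, rule linear_map_comp[OF pure_linear(1)[OF mods(1,2)] pure_linear(1)[OF tmods(1) mods(3)]])
qed

text \<open>The map back is the mirror-image double lift. Surjectivity lets an element of
  \<open>V \<otimes> (W \<otimes> U)\<close> be rebracketed, after which coordinates can be taken
  one factor at a time.\<close>

lemma tensor_assoc_surj:
  assumes "t \<in> carrier (tensor K V (tensor K W U))"
  shows "\<exists>s\<in>carrier (tensor K (tensor K V W) U). tensor_assoc K V W U s = t"
proof -
  let ?i = "tensor_lift K V (tensor K W U) L3 (\<lambda>v t. tensor_lift K W U L3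
    (\<lambda>w u. pure K (tensor K V W) U (pure K V W v w) u) t)"
  have i: "linear_map K R3 L3 ?i" by (intro tensor_lift_linear mods tmods inv_outer)
  have "tensor_assoc K V W U (?i t) = t"
  proof (rule tensor_eqI_right[OF tmods(4) linear_map_comp[OF i tensor_assoc_linear] linear_map_ident(1) _ assms])
    fix v w u assume "v \<in> carrier V" "w \<in> carrier W" "u \<in> carrier U"
    then show "tensor_assoc K V W U (?i (pure K V (tensor K W U) v (pure K W U w u))) = pure K V (tensor K W U) v (pure K W U w u)"
      by (simp add: tensor_lift_pure[OF mods(1) tmods(2,3) inv_outer]
          tensor_lift_pure[OF mods(2,3) tmods(3) inv_inner] pure_closed[OF mods(2,3)] tensor_assoc_pure)
  qed
  then show ?thesis using linear_map_closed[OF i assms] by blast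
qed

end

lemma tensor_assoc_natural:
  assumes mods: "module K V" "module K W" "module K U" "module K V'"
    and f: "linear_map K V V' f" and t: "t \<in> carrier (tensor K (tensor K V W) U)"
  shows "tensor_assoc K V' W U (tensor_map K (tensor K V W) U (tensor K V' W) U (tensor_map K V W V' W f id) id t)
    = tensor_map K V (tensor K W U) V' (tensor K W U) f id (tensor_assoc K V W U t)"
proof -
  note tm = tensor_module[OF mods(1,2)] tensor_module[OF mods(2,3)] tensor_module[OF mods(4,2)]
  note l = tensor_map_linear[OF mods(1,2,4,2) f linear_map_ident(2)]
  note ll = tensor_map_linear[OF tm(1) mods(3) tm(3) mods(3) l linear_map_ident(2)]
  note r = tensor_map_linear[OF mods(1) tm(2) mods(4) tm(2) f linear_map_ident(2)]
  show ?thesis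
  proof (rule tensor_eqI_left[OF mods(1-3) tensor_module[OF mods(4) tm(2)]
        linear_map_comp[OF ll tensor_assoc_linear[OF mods(4,2,3)]]
        linear_map_comp[OF tensor_assoc_linear[OF mods(1-3)] r] _ t])
    fix v w u assume a: "v \<in> carrier V" "w \<in> carrier W" "u \<in> carrier U"
    then show "tensor_assoc K V' W U (tensor_map K (tensor K V W) U (tensor K V' W) U
          (tensor_map K V W V' W f id) id (pure K (tensor K V W) U (pure K V W v w) u))
      = tensor_map K V (tensor K W U) V' (tensor K W U) f id
          (tensor_assoc K V W U (pure K (tensor K V W) U (pure K V W v w) u))"
      by (simp add: tensor_map_pure[OF tm(1) mods(3) tm(3) mods(3) l linear_map_ident(2)]
          tensor_map_pure[OF mods(1,2,4,2) f linear_map_ident(2)]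
          tensor_map_pure[OF mods(1) tm(2) mods(4) tm(2) f linear_map_ident(2)]
          tensor_assoc_pure mods pure_closed linear_map_closed[OF f])
  qed
qed

text \<open>The functional \<open>\<phi> \<otimes> \<chi>\<close> on \<open>W \<otimes> U\<close>,
  with the product of \<open>K\<close> as last step.\<close>

definition tensor_functional where
  "tensor_functional K W U \<phi> \<chi> = tensor_lift K W U (base_module K) (\<lambda>w u. \<phi> w \<otimes>\<^bsub>K\<^esub> \<chi> u)"

context
  fixes K :: "'k ring" and W :: "('k, 'w, 'n) module_scheme" and U :: "('k, 'x, 'l) module_scheme" and \<phi> \<chi>
  assumes mods: "module K W" "module K U"
    and lin: "linear_map K W (base_module K) \<phi>" "linear_map K U (base_module K) \<chi>"
begin

interpretation W: module K W by (rule mods)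

private lemma base: "module K (base_module K)" by (rule base_module[OF W.R.is_cring])

private lemma bil: "bilinear K W U (base_module K) (\<lambda>w u. \<phi> w \<otimes>\<^bsub>K\<^esub> \<chi> u)"
proof (rule bilinearI)
  show "linear_map K U (base_module K) (\<lambda>u. \<phi> w \<otimes>\<^bsub>K\<^esub> \<chi> u)" if "w \<in> carrier W" for w
    using linear_map_scale[OF base lin(2), of "\<phi> w"] linear_map_closed[OF lin(1) that] by simp
  show "linear_map K W (base_module K) (\<lambda>w. \<phi> w \<otimes>\<^bsub>K\<^esub> \<chi> u)" if "u \<in> carrier U" for u
    using linear_map_scale_const[OF base lin(1), of "\<chi> u"] linear_map_closed[OF lin(2) that] by simp
qed

lemma tensor_functional_linear: "linear_map K (tensor K W U) (base_module K) (tensor_functional K W U \<phi> \<chi>)"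
  unfolding tensor_functional_def by (intro tensor_lift_linear mods base bil)

lemma tensor_functional_pure: "w \<in> carrier W \<Longrightarrow> u \<in> carrier U \<Longrightarrow>
    tensor_functional K W U \<phi> \<chi> (pure K W U w u) = \<phi> w \<otimes>\<^bsub>K\<^esub> \<chi> u"
  unfolding tensor_functional_def by (intro tensor_lift_pure mods base bil)

text \<open>For fixed \<open>t\<close> and \<open>\<chi>\<close> this reduces the values of all
  \<open>\<phi> \<otimes> \<chi>\<close> at \<open>t\<close> to the values of \<open>\<phi>\<close>
  at a single element of \<open>W\<close>, so only finitely many functionals \<open>\<phi>\<close>
  of a dual basis give a nonzero value.\<close>

lemma tensor_functional_coord:
  assumes "t \<in> carrier (tensor K W U)"
  shows "tensor_functional K W U \<phi> \<chi> t = \<phi> (coord K W U \<chi> t)"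
proof (rule tensor_eqI[OF mods base tensor_functional_linear linear_map_comp[OF coord_linear[OF mods lin(2)] lin(1)] _ assms])
  fix w u assume a: "w \<in> carrier W" "u \<in> carrier U"
  have "\<phi> w \<in> carrier K" "\<chi> u \<in> carrier K" using a lin linear_map_closed by fastforce+
  then show "tensor_functional K W U \<phi> \<chi> (pure K W U w u) = \<phi> (coord K W U \<chi> (pure K W U w u))"
    using a by (simp add: tensor_functional_pure coord_pure[OF mods lin(2)] linear_map_smult[OF lin(1)] W.R.m_comm)
qed

text \<open>The associator turns a coordinate in the direction
  \<open>\<phi> \<otimes> \<chi>\<close> into two successive ones: \<open>\<chi>\<close> on the last
  factor, then \<open>\<phi>\<close> on the middle factor.\<close>

lemma coord_tensor_assoc:
  assumes V: "module K V" and t: "t \<in> carrier (tensor K (tensor K V W) U)"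
  shows "coord K V (tensor K W U) (tensor_functional K W U \<phi> \<chi>) (tensor_assoc K V W U t)
    = coord K V W \<phi> (coord K (tensor K V W) U \<chi> t)"
proof (rule tensor_eqI_left[OF V mods V linear_map_comp[OF tensor_assoc_linear[OF V mods]
        coord_linear[OF V tensor_module[OF mods] tensor_functional_linear]]
      linear_map_comp[OF coord_linear[OF tensor_module[OF V mods(1)] mods(2) lin(2)] coord_linear[OF V mods(1) lin(1)]] _ t])
  fix v w u assume a: "v \<in> carrier V" "w \<in> carrier W" "u \<in> carrier U"
  interpret V: module K V by (rule V)
  have k: "\<phi> w \<in> carrier K" "\<chi> u \<in> carrier K" using a lin linear_map_closed by fastforce+
  show "coord K V (tensor K W U) (tensor_functional K W U \<phi> \<chi>)
        (tensor_assoc K V W U (pure K (tensor K V W) U (pure K V W v w) u))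
      = coord K V W \<phi> (coord K (tensor K V W) U \<chi> (pure K (tensor K V W) U (pure K V W v w) u))"
    using a k V mods by (simp add: tensor_assoc_pure coord_pure lin tensor_functional_linear tensor_module
        pure_closed tensor_functional_pure linear_map_smult[OF coord_linear[OF V mods(1) lin(1)]]
        V.smult_assoc1[symmetric] W.R.m_comm)
qed

end

text \<open>Both elements are rebracketed through the surjective associator; there two successive
  coordinates separate them.\<close>

lemma coord_triple_eqI:
  assumes V: "module K V" and W: "module K W" and b: "is_basis K W B e"
    and t: "t \<in> carrier (tensor K V (tensor K W W))" and t': "t' \<in> carrier (tensor K V (tensor K W W))"
    and eq: "\<And>i j. \<lbrakk>i \<in> B; j \<in> B\<rbrakk> \<Longrightarrow>
      coord K V (tensor K W W) (tensor_functional K W W (e i) (e j)) t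
        = coord K V (tensor K W W) (tensor_functional K W W (e i) (e j)) t'"
  shows "t = t'"
proof -
  obtain s where s: "s \<in> carrier (tensor K (tensor K V W) W)" "tensor_assoc K V W W s = t"
    using tensor_assoc_surj[OF V W W t] by blast
  obtain s' where s': "s' \<in> carrier (tensor K (tensor K V W) W)" "tensor_assoc K V W W s' = t'"
    using tensor_assoc_surj[OF V W W t'] by blast
  note VW = tensor_module[OF V W]
  note bl = is_basis_linear[OF b]
  have "s = s'"
  proof (rule coord_eqI[OF VW W b s(1) s'(1)], rule coord_eqI[OF V W b])
    fix i j assume i: "i \<in> B" and j: "j \<in> B"
    show "coord K (tensor K V W) W (e i) s \<in> carrier (tensor K V W)"
      "coord K (tensor K V W) W (e i) s' \<in> carrier (tensor K V W)"
      using linear_map_closed[OF coord_linear[OF VW W bl[OF i]]] s s' by auto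
    show "coord K V W (e j) (coord K (tensor K V W) W (e i) s) = coord K V W (e j) (coord K (tensor K V W) W (e i) s')"
      using eq[OF j i] coord_tensor_assoc[OF W W bl[OF j] bl[OF i] V s(1)]
        coord_tensor_assoc[OF W W bl[OF j] bl[OF i] V s'(1)] s s' by simp
  qed
  then show ?thesis using s s' by simp
qed

section \<open>Small sets\<close>

context
  fixes U :: "'u itself"
  assumes univ: "universe U"
begin

lemma universe_infinite: "infinite (UNIV :: 'u set)"
proof -
  have "natLeq \<le>o |UNIV :: 'u set|"
    using univ by (auto simp: universe_def intro: ordLess_imp_ordLeq)
  then show ?thesis using infinite_iff_natLeq_ordLeq by blast
qed

lemma small_subset: "small U A \<Longrightarrow> B \<subseteq> A \<Longrightarrow> small U B"
  unfolding small_def using card_of_mono1 ordLeq_ordLess_trans by blast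

lemma small_image: "small U A \<Longrightarrow> small U (f ` A)"
  unfolding small_def using card_of_image ordLeq_ordLess_trans by blast

lemma small_finite: "finite A \<Longrightarrow> small U A"
  unfolding small_def using universe_infinite
  by (intro finite_ordLess_infinite card_of_Well_order) (auto simp: Field_card_of)

lemma small_nat: "small U (UNIV :: nat set)"
proof -
  have "|UNIV :: nat set| =o natLeq" by (rule card_of_nat)
  then show ?thesis using univ ordIso_ordLess_trans unfolding small_def universe_def by blast
qed

text \<open>The bound for a union of sets below an infinite cardinal is where regularity is
  used.\<close>

lemma small_UNION: "small U I \<Longrightarrow> (\<And>i. i \<in> I \<Longrightarrow> small U (A i)) \<Longrightarrow> small U (\<Union>i\<in>I. A i)"
  using univ universe_infinite unfolding small_def universe_def
  by (intro card_of_UNION_ordLess_infinite_Field_regularCard)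
    (auto simp: cinfinite_def card_of_card_order_on Field_card_of)

lemma small_Un: "small U A \<Longrightarrow> small U B \<Longrightarrow> small U (A \<union> B)"
  using small_UNION[of UNIV "\<lambda>b. if b then A else B"] by (simp add: small_finite UNIV_bool Un_commute)

lemma small_Sigma: "small U I \<Longrightarrow> (\<And>i. i \<in> I \<Longrightarrow> small U (A i)) \<Longrightarrow> small U (Sigma I A)"
  unfolding Sigma_def by (intro small_UNION) (auto simp: small_finite)

text \<open>Each length is handled by induction. The union over all lengths is small because the set
  of natural numbers is, which rests on the uncountability of the universe.\<close>

lemma small_lists:
  assumes "small U A" shows "small U (lists A)"
proof -
  define L where "L n = {xs \<in> lists A. length xs = n}" for n :: nat
  have "small U (L n)" for n
  proof (induction n)
    case 0
    have "L 0 \<subseteq> {[]}" by (auto simp: L_def)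
    then show ?case by (rule small_subset[OF small_finite, rotated]) simp
  next
    case (Suc n)
    have "L (Suc n) \<subseteq> (\<lambda>(x, xs). x # xs) ` (A \<times> L n)"
    proof
      fix xs assume "xs \<in> L (Suc n)"
      then show "xs \<in> (\<lambda>(x, xs). x # xs) ` (A \<times> L n)"
        by (cases xs) (auto simp: L_def)
    qed
    moreover have "small U (A \<times> L n)" using assms Suc by (intro small_Sigma)
    ultimately show ?case by (rule small_subset[OF small_image, rotated])
  qed
  then have "small U (\<Union>n. L n)" by (intro small_UNION small_nat)
  moreover have "lists A = (\<Union>n. L n)" by (auto simp: L_def)
  ultimately show ?thesis by simp
qed

lemma small_finite_subsets: "small U A \<Longrightarrow> small U {D. finite D \<and> D \<subseteq> A}"
proof -
  assume "small U A"
  then have "small U (set ` lists A)" by (intro small_image small_lists)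
  moreover have "{D. finite D \<and> D \<subseteq> A} \<subseteq> set ` lists A"
  proof
    fix D assume D: "D \<in> {D. finite D \<and> D \<subseteq> A}"
    then obtain xs where "set xs = D" using finite_list by blast
    then show "D \<in> set ` lists A" using D by (intro image_eqI[of _ _ xs]) auto
  qed
  ultimately show ?thesis by (rule small_subset)
qed

end

text \<open>Used to move carriers that consist of cosets or functions into the type
  \<open>'u\<close>.\<close>

lemma small_inj: "small (U :: 'u itself) A \<Longrightarrow> \<exists>f :: 'a \<Rightarrow> 'u. inj_on f A"
  unfolding small_def by (drule ordLess_imp_ordLeq) (simp flip: card_of_ordLeq)

section \<open>Operator representations\<close>

text \<open>
  A representation of a signature is a family of modules indexed by sorts, with a linear map for
  each operator.  The operators \<open>co s b\<close> stand for the coordinates of a coaction; an object must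
  have only finitely many nonzero coordinates at each element.
\<close>

locale signature =
  fixes K :: "'k ring" and S :: "'s set" and Op :: "'p set" and src tgt :: "'p \<Rightarrow> 's"
  assumes cring_K: "cring K"
    and src_sort: "p \<in> Op \<Longrightarrow> src p \<in> S" and tgt_sort: "p \<in> Op \<Longrightarrow> tgt p \<in> S"
begin

definition rep :: "('s \<Rightarrow> ('k, 'z) module) \<Rightarrow> ('p \<Rightarrow> 'z \<Rightarrow> 'z) \<Rightarrow> bool" where
  "rep W w \<longleftrightarrow> (\<forall>s\<in>S. module K (W s)) \<and> (\<forall>p\<in>Op. linear_map K (W (src p)) (W (tgt p)) (w p))"

definition rep_hom :: "('s \<Rightarrow> ('k, 'z) module) \<Rightarrow> ('p \<Rightarrow> 'z \<Rightarrow> 'z) \<Rightarrow> ('s \<Rightarrow> ('k, 'y) module)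
    \<Rightarrow> ('p \<Rightarrow> 'y \<Rightarrow> 'y) \<Rightarrow> ('s \<Rightarrow> 'z \<Rightarrow> 'y) \<Rightarrow> bool" where
  "rep_hom W w W' w' g \<longleftrightarrow> (\<forall>s\<in>S. linear_map K (W s) (W' s) (g s)) \<and>
     (\<forall>p\<in>Op. \<forall>m\<in>carrier (W (src p)). g (tgt p) (w p m) = w' p (g (src p) m))"

lemma rep_module: "rep W w \<Longrightarrow> s \<in> S \<Longrightarrow> module K (W s)"
  by (simp add: rep_def)

lemma rep_linear: "rep W w \<Longrightarrow> p \<in> Op \<Longrightarrow> linear_map K (W (src p)) (W (tgt p)) (w p)"
  by (simp add: rep_def)

lemma rep_hom_linear: "rep_hom W w W' w' g \<Longrightarrow> s \<in> S \<Longrightarrow> linear_map K (W s) (W' s) (g s)"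
  by (simp add: rep_hom_def)

lemma rep_hom_op: "rep_hom W w W' w' g \<Longrightarrow> p \<in> Op \<Longrightarrow> m \<in> carrier (W (src p))
    \<Longrightarrow> g (tgt p) (w p m) = w' p (g (src p) m)"
  by (simp add: rep_hom_def)

lemma rep_hom_comp:
  assumes g: "rep_hom W w W' w' g" and h: "rep_hom W' w' W'' w'' h"
  shows "rep_hom W w W'' w'' (\<lambda>s x. h s (g s x))"
  unfolding rep_hom_def
proof (intro conjI ballI)
  show "linear_map K (W s) (W'' s) (\<lambda>x. h s (g s x))" if "s \<in> S" for s
    using linear_map_comp[OF rep_hom_linear[OF g that] rep_hom_linear[OF h that]] .
  fix p m assume p: "p \<in> Op" "m \<in> carrier (W (src p))"
  then show "h (tgt p) (g (tgt p) (w p m)) = w'' p (h (src p) (g (src p) m))"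
    using rep_hom_op[OF g p] rep_hom_op[OF h p(1)] linear_map_closed[OF rep_hom_linear[OF g src_sort]] by simp
qed

lemma rep_hom_inverse:
  assumes W: "rep W w" and W': "rep W' w'" and g: "rep_hom W w W' w' g"
    and bij: "\<And>s. s \<in> S \<Longrightarrow> bij_betw (g s) (carrier (W s)) (carrier (W' s))"
  shows "rep_hom W' w' W w (\<lambda>s. inv_into (carrier (W s)) (g s))"
proof -
  let ?h = "\<lambda>s. inv_into (carrier (W s)) (g s)"
  have h: "?h s y \<in> carrier (W s)" "g s (?h s y) = y" if "s \<in> S" "y \<in> carrier (W' s)" for s y
    using bij[OF that(1)] that(2) by (auto simp: bij_betw_def f_inv_into_f inv_into_into)
  have eq: "?h s y = x" if "s \<in> S" "x \<in> carrier (W s)" "g s x = y" for s x y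
    using bij[OF that(1)] that(2,3) by (auto simp: bij_betw_def)
  show ?thesis
    unfolding rep_hom_def
  proof (intro conjI ballI linear_mapI)
    fix s x y assume a: "s \<in> S" "x \<in> carrier (W' s)" "y \<in> carrier (W' s)"
    interpret module K "W s" using rep_module[OF W a(1)] .
    show "?h s (x \<oplus>\<^bsub>W' s\<^esub> y) = ?h s x \<oplus>\<^bsub>W s\<^esub> ?h s y"
      using h a linear_map_add[OF rep_hom_linear[OF g a(1)]] by (intro eq) auto
  next
    fix s k x assume a: "s \<in> S" "x \<in> carrier (W' s)" "k \<in> carrier K"
    interpret module K "W s" using rep_module[OF W a(1)] .
    show "?h s (k \<odot>\<^bsub>W' s\<^esub> x) = k \<odot>\<^bsub>W s\<^esub> ?h s x"
      using h a linear_map_smult[OF rep_hom_linear[OF g a(1)]] by (intro eq) auto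
  next
    fix p x assume a: "p \<in> Op" "x \<in> carrier (W' (src p))"
    show "?h (tgt p) (w' p x) = w p (?h (src p) x)"
      using h a linear_map_closed[OF rep_linear[OF W a(1)]] rep_hom_op[OF g a(1)] src_sort tgt_sort
      by (intro eq) auto
  qed (use h in auto)
qed

text \<open>Objects must have carriers in a prescribed type. A module on cosets or functions is
  carried there by an injection, and \<open>inv_into\<close> pulls the operations back.\<close>

definition transport :: "('k, 'z) module \<Rightarrow> ('z \<Rightarrow> 'y) \<Rightarrow> ('k, 'y) module" where
  "transport V f =
     \<lparr>carrier = f ` carrier V, monoid.mult = undefined, one = undefined, zero = f \<zero>\<^bsub>V\<^esub>,
      add = (\<lambda>x y. f (inv_into (carrier V) f x \<oplus>\<^bsub>V\<^esub> inv_into (carrier V) f y)),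
      smult = (\<lambda>a x. f (a \<odot>\<^bsub>V\<^esub> inv_into (carrier V) f x))\<rparr>"

lemma transport:
  assumes V: "module K V" and inj: "inj_on f (carrier V)"
  shows "module K (transport V f)" "linear_map K V (transport V f) f"
proof -
  interpret V: module K V by fact
  note inv = inv_into_f_f[OF inj]
  have s: "carrier (transport V f) = f ` carrier V" "zero (transport V f) = f \<zero>\<^bsub>V\<^esub>"
    by (auto simp: transport_def)
  have a: "f x \<oplus>\<^bsub>transport V f\<^esub> f y = f (x \<oplus>\<^bsub>V\<^esub> y)" if "x \<in> carrier V" "y \<in> carrier V" for x y
    using that by (simp add: transport_def inv)
  have m: "k \<odot>\<^bsub>transport V f\<^esub> f x = f (k \<odot>\<^bsub>V\<^esub> x)" if "x \<in> carrier V" for x k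
    using that by (simp add: transport_def inv)
  show "module K (transport V f)"
  proof (intro moduleI abelian_groupI)
    fix x assume "x \<in> carrier (transport V f)"
    then obtain y where y: "x = f y" "y \<in> carrier V" by (auto simp: s)
    then show "\<exists>z\<in>carrier (transport V f). z \<oplus>\<^bsub>transport V f\<^esub> x = \<zero>\<^bsub>transport V f\<^esub>"
      by (intro bexI[of _ "f (\<ominus>\<^bsub>V\<^esub> y)"]) (auto simp: s a V.M.l_neg)
  qed (auto simp: s a m cring_K V.M.a_ac V.smult_l_distr V.smult_r_distr V.smult_assoc1)
  show "linear_map K V (transport V f) f" by (intro linear_mapI) (auto simp: s a m)
qed

text \<open>The operators are conjugated by the injections, one for each sort.\<close>

lemma transport_rep:
  fixes W :: "'s \<Rightarrow> ('k, 'z) module" and f :: "'s \<Rightarrow> 'z \<Rightarrow> 'y"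
  assumes W: "rep W w" and inj: "\<And>s. s \<in> S \<Longrightarrow> inj_on (f s) (carrier (W s))"
  shows "\<exists>w'. rep (\<lambda>s. transport (W s) (f s)) w' \<and> rep_hom W w (\<lambda>s. transport (W s) (f s)) w' f"
proof -
  let ?W = "\<lambda>s. transport (W s) (f s)"
  define w' where "w' p x = f (tgt p) (w p (inv_into (carrier (W (src p))) (f (src p)) x))" for p x
  have c: "carrier (?W s) = f s ` carrier (W s)" for s by (simp add: transport_def)
  have op: "w' p (f (src p) x) = f (tgt p) (w p x)" if "p \<in> Op" "x \<in> carrier (W (src p))" for p x
    using that inj src_sort by (simp add: w'_def inv_into_f_f)
  note lin = transport(2)[OF rep_module[OF W] inj]
  have "rep ?W w'"
    unfolding rep_def
  proof (intro conjI ballI transport(1) rep_module[OF W] inj)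
    fix p assume p: "p \<in> Op"
    note s = src_sort[OF p] tgt_sort[OF p]
    interpret s: module K "W (src p)" using rep_module[OF W s(1)] .
    note wl = linear_map_closed[OF rep_linear[OF W p]] linear_map_add[OF rep_linear[OF W p]]
      linear_map_smult[OF rep_linear[OF W p]]
    show "linear_map K (?W (src p)) (?W (tgt p)) (w' p)"
    proof (rule linear_mapI)
      fix x y assume "x \<in> carrier (?W (src p))" "y \<in> carrier (?W (src p))"
      then obtain x' y' where x: "x = f (src p) x'" "y = f (src p) y'"
        "x' \<in> carrier (W (src p))" "y' \<in> carrier (W (src p))" by (auto simp: c)
      show "w' p (x \<oplus>\<^bsub>?W (src p)\<^esub> y) = w' p x \<oplus>\<^bsub>?W (tgt p)\<^esub> w' p y"
        using x p by (simp add: op wl flip: linear_map_add[OF lin[OF s(1) s(1)]] linear_map_add[OF lin[OF s(2) s(2)]])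
    next
      fix a x assume a: "a \<in> carrier K" and "x \<in> carrier (?W (src p))"
      then obtain x' where x: "x = f (src p) x'" "x' \<in> carrier (W (src p))" by (auto simp: c)
      show "w' p (a \<odot>\<^bsub>?W (src p)\<^esub> x) = a \<odot>\<^bsub>?W (tgt p)\<^esub> w' p x"
        using x p a by (simp add: op wl flip: linear_map_smult[OF lin[OF s(1) s(1)]] linear_map_smult[OF lin[OF s(2) s(2)]])
    qed (use p op wl in \<open>auto simp: c\<close>)
  qed
  moreover have "rep_hom W w ?W w' f"
    unfolding rep_hom_def using op lin by auto
  ultimately show ?thesis by blast
qed

end

text \<open>The concrete category enters the general part only through this interface.
  \<open>arr_hom\<close>, \<open>arr_ext\<close> and \<open>arr_ex\<close> say that arrows are the
  homomorphisms of representations; \<open>create_inj\<close> and \<open>create_surj\<close> say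
  that a representation underlies an object if it is separated by maps to objects or covered by an
  object. The separating family \<open>\<Gamma>\<close> is not bounded in size. For a covered
  representation smallness and finiteness are inherited, for a separated one they must be supplied.
  The equations \<open>V M s = W s\<close> are literal, so a constructed carrier is kept as it
  is.\<close>

locale operator_category = signature K S Op src tgt
  for K :: "'k ring" and S :: "'s set" and Op :: "'p set" and src tgt :: "'p \<Rightarrow> 's" +
  fixes U :: "'u itself" and B :: "'b set" and co :: "'s \<Rightarrow> 'b \<Rightarrow> 'p"
    and Cat :: "('m, 'h) cat" and V :: "'m \<Rightarrow> 's \<Rightarrow> ('k, 'u) module"
    and op :: "'m \<Rightarrow> 'p \<Rightarrow> 'u \<Rightarrow> 'u" and ap :: "'h \<Rightarrow> 's \<Rightarrow> 'u \<Rightarrow> 'u"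
  assumes univ: "universe U" and small_K: "small U (carrier K)" and small_S: "small U S"
    and small_Op: "small U Op" and small_B: "small U B"
    and co: "\<lbrakk>s \<in> S; b \<in> B\<rbrakk> \<Longrightarrow> co s b \<in> Op \<and> src (co s b) = s \<and> tgt (co s b) = s"
    and obj_rep: "M \<in> obj Cat \<Longrightarrow> rep (V M) (op M)"
    and obj_small: "\<lbrakk>M \<in> obj Cat; s \<in> S\<rbrakk> \<Longrightarrow> small U (carrier (V M s))"
    and obj_finite: "\<lbrakk>M \<in> obj Cat; s \<in> S; m \<in> carrier (V M s)\<rbrakk>
      \<Longrightarrow> finite {b \<in> B. op M (co s b) m \<noteq> \<zero>\<^bsub>V M s\<^esub>}"
    and finite_step: "\<lbrakk>p \<in> Op; finite D; D \<subseteq> B\<rbrakk> \<Longrightarrow> \<exists>D'. finite D' \<and> D' \<subseteq> B \<and>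
      (\<forall>M\<in>obj Cat. \<forall>m\<in>carrier (V M (src p)).
        {b \<in> B. op M (co (src p) b) m \<noteq> \<zero>\<^bsub>V M (src p)\<^esub>} \<subseteq> D \<longrightarrow>
        {b \<in> B. op M (co (tgt p) b) (op M p m) \<noteq> \<zero>\<^bsub>V M (tgt p)\<^esub>} \<subseteq> D')"
    and arr_hom: "\<lbrakk>M \<in> obj Cat; N \<in> obj Cat; h \<in> arr Cat M N\<rbrakk>
      \<Longrightarrow> rep_hom (V M) (op M) (V N) (op N) (ap h)"
    and arr_ext: "\<lbrakk>M \<in> obj Cat; N \<in> obj Cat; h \<in> arr Cat M N; h' \<in> arr Cat M N;
        \<And>s m. \<lbrakk>s \<in> S; m \<in> carrier (V M s)\<rbrakk> \<Longrightarrow> ap h s m = ap h' s m\<rbrakk> \<Longrightarrow> h = h'"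
    and arr_ex: "\<lbrakk>M \<in> obj Cat; N \<in> obj Cat; rep_hom (V M) (op M) (V N) (op N) g\<rbrakk>
      \<Longrightarrow> \<exists>h\<in>arr Cat M N. \<forall>s\<in>S. \<forall>m\<in>carrier (V M s). ap h s m = g s m"
    and ident: "M \<in> obj Cat \<Longrightarrow> ident Cat M \<in> arr Cat M M"
      "\<lbrakk>M \<in> obj Cat; s \<in> S; m \<in> carrier (V M s)\<rbrakk> \<Longrightarrow> ap (ident Cat M) s m = m"
    and cmp: "\<lbrakk>L \<in> obj Cat; M \<in> obj Cat; N \<in> obj Cat; u \<in> arr Cat L M; v \<in> arr Cat M N\<rbrakk>
        \<Longrightarrow> cmp Cat L M N v u \<in> arr Cat L N"
      "\<lbrakk>L \<in> obj Cat; M \<in> obj Cat; N \<in> obj Cat; u \<in> arr Cat L M; v \<in> arr Cat M N;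
        s \<in> S; m \<in> carrier (V L s)\<rbrakk> \<Longrightarrow> ap (cmp Cat L M N v u) s m = ap v s (ap u s m)"
    and create_inj: "\<lbrakk>rep W w; \<And>s. s \<in> S \<Longrightarrow> small U (carrier (W s));
        \<And>T g. (T, g) \<in> \<Gamma> \<Longrightarrow> T \<in> obj Cat \<and> rep_hom W w (V T) (op T) g;
        \<And>s x. \<lbrakk>s \<in> S; x \<in> carrier (W s); \<And>T g. (T, g) \<in> \<Gamma> \<Longrightarrow> g s x = \<zero>\<^bsub>V T s\<^esub>\<rbrakk> \<Longrightarrow> x = \<zero>\<^bsub>W s\<^esub>;
        \<And>s x. \<lbrakk>s \<in> S; x \<in> carrier (W s)\<rbrakk> \<Longrightarrow> finite {b \<in> B. w (co s b) x \<noteq> \<zero>\<^bsub>W s\<^esub>}\<rbrakk>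
      \<Longrightarrow> \<exists>M\<in>obj Cat. (\<forall>s\<in>S. V M s = W s) \<and> (\<forall>p\<in>Op. \<forall>x\<in>carrier (W (src p)). op M p x = w p x)"
    and create_surj: "\<lbrakk>rep W w; T \<in> obj Cat; rep_hom (V T) (op T) W w q;
        \<And>s. s \<in> S \<Longrightarrow> q s ` carrier (V T s) = carrier (W s)\<rbrakk>
      \<Longrightarrow> \<exists>M\<in>obj Cat. (\<forall>s\<in>S. V M s = W s) \<and> (\<forall>p\<in>Op. \<forall>x\<in>carrier (W (src p)). op M p x = w p x)"
begin

lemma objM: "M \<in> obj Cat \<Longrightarrow> s \<in> S \<Longrightarrow> module K (V M s)"
  using rep_module[OF obj_rep] .

lemma op_linear: "M \<in> obj Cat \<Longrightarrow> p \<in> Op \<Longrightarrow> linear_map K (V M (src p)) (V M (tgt p)) (op M p)"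
  using rep_linear[OF obj_rep] .

lemma op_closed: "M \<in> obj Cat \<Longrightarrow> p \<in> Op \<Longrightarrow> m \<in> carrier (V M (src p)) \<Longrightarrow> op M p m \<in> carrier (V M (tgt p))"
  using linear_map_closed[OF op_linear] .

lemma ap_linear: "\<lbrakk>M \<in> obj Cat; N \<in> obj Cat; h \<in> arr Cat M N; s \<in> S\<rbrakk> \<Longrightarrow> linear_map K (V M s) (V N s) (ap h s)"
  using rep_hom_linear[OF arr_hom] .

lemma ap_closed: "\<lbrakk>M \<in> obj Cat; N \<in> obj Cat; h \<in> arr Cat M N; s \<in> S; m \<in> carrier (V M s)\<rbrakk>
    \<Longrightarrow> ap h s m \<in> carrier (V N s)"
  using linear_map_closed[OF ap_linear] .

lemma ap_zero: "\<lbrakk>M \<in> obj Cat; N \<in> obj Cat; h \<in> arr Cat M N; s \<in> S\<rbrakk> \<Longrightarrow> ap h s \<zero>\<^bsub>V M s\<^esub> = \<zero>\<^bsub>V N s\<^esub>"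
  using linear_map_zero[OF objM objM ap_linear] .

lemma ap_op: "\<lbrakk>M \<in> obj Cat; N \<in> obj Cat; h \<in> arr Cat M N; p \<in> Op; m \<in> carrier (V M (src p))\<rbrakk>
    \<Longrightarrow> ap h (tgt p) (op M p m) = op N p (ap h (src p) m)"
  using rep_hom_op[OF arr_hom] .

lemma zero_in: "M \<in> obj Cat \<Longrightarrow> s \<in> S \<Longrightarrow> \<zero>\<^bsub>V M s\<^esub> \<in> carrier (V M s)"
  by (metis objM module.axioms(2) abelian_groupE(2))

section \<open>Subobjects and quotients\<close>

definition subrep :: "'m \<Rightarrow> ('s \<Rightarrow> 'u set) \<Rightarrow> bool" where
  "subrep M N \<longleftrightarrow> (\<forall>s\<in>S. submodule (N s) K (V M s)) \<and>
     (\<forall>p\<in>Op. \<forall>m\<in>N (src p). op M p m \<in> N (tgt p))"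

text \<open>Closure under negation is obtained from the scalar -1.\<close>

lemma subrepI:
  assumes "M \<in> obj Cat" "\<And>s. s \<in> S \<Longrightarrow> N s \<subseteq> carrier (V M s)" "\<And>s. s \<in> S \<Longrightarrow> \<zero>\<^bsub>V M s\<^esub> \<in> N s"
    and "\<And>s x y. \<lbrakk>s \<in> S; x \<in> N s; y \<in> N s\<rbrakk> \<Longrightarrow> x \<oplus>\<^bsub>V M s\<^esub> y \<in> N s"
    and sm: "\<And>s a x. \<lbrakk>s \<in> S; a \<in> carrier K; x \<in> N s\<rbrakk> \<Longrightarrow> a \<odot>\<^bsub>V M s\<^esub> x \<in> N s"
    and "\<And>p x. \<lbrakk>p \<in> Op; x \<in> N (src p)\<rbrakk> \<Longrightarrow> op M p x \<in> N (tgt p)"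
  shows "subrep M N"
  unfolding subrep_def
proof (intro conjI ballI)
  fix s assume s: "s \<in> S"
  interpret module K "V M s" using objM assms(1) s .
  show "submodule (N s) K (V M s)"
  proof (rule submoduleI)
    fix x assume x: "x \<in> N s"
    then have "\<ominus>\<^bsub>V M s\<^esub> x = (\<ominus>\<^bsub>K\<^esub> \<one>\<^bsub>K\<^esub>) \<odot>\<^bsub>V M s\<^esub> x"
      using assms(2)[OF s] by (auto simp: smult_l_minus)
    then show "\<ominus>\<^bsub>V M s\<^esub> x \<in> N s" using sm[OF s _ x] by simp
  qed (use assms s in auto)
qed (use assms in auto)

text \<open>The inclusion into \<open>M\<close> alone is a jointly injective family, so
  \<open>create_inj\<close> applies; the coordinates are those of \<open>M\<close> and remain finite
  in number.\<close>

lemma subobject: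
  assumes M: "M \<in> obj Cat" and N: "subrep M N"
  shows "\<exists>A\<in>obj Cat. \<exists>i\<in>arr Cat A M. \<forall>s\<in>S. carrier (V A s) = N s \<and> (\<forall>m\<in>N s. ap i s m = m)"
proof -
  let ?W = "\<lambda>s. (V M s)\<lparr>carrier := N s\<rparr>"
  have sub: "submodule (N s) K (V M s)" if "s \<in> S" for s using N that by (simp add: subrep_def)
  have NV: "N s \<subseteq> carrier (V M s)" if "s \<in> S" for s
    using module.submoduleE(1)[OF objM[OF M that] sub[OF that]] .
  have closed: "op M p m \<in> N (tgt p)" if "p \<in> Op" "m \<in> N (src p)" for p m
    using N that by (simp add: subrep_def)
  have "rep ?W (op M)"
    unfolding rep_def
  proof (intro conjI ballI)
    show "module K (?W s)" if "s \<in> S" for s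
      using submodule.submodule_is_module[OF sub[OF that] objM[OF M that]] .
    fix p assume p: "p \<in> Op"
    show "linear_map K (?W (src p)) (?W (tgt p)) (op M p)"
      using NV[OF src_sort[OF p]] closed[OF p] linear_map_add[OF op_linear[OF M p]]
        linear_map_smult[OF op_linear[OF M p]]
      by (intro linear_mapI) (auto simp: subset_iff)
  qed
  moreover have hom: "rep_hom ?W (op M) (V M) (op M) (\<lambda>s m. m)"
    unfolding rep_hom_def by (auto intro!: linear_mapI dest: subsetD[OF NV])
  moreover have "small U (carrier (?W s))" if "s \<in> S" for s
    using small_subset[OF univ obj_small[OF M that] NV[OF that]] by simp
  moreover have "finite {b \<in> B. op M (co s b) x \<noteq> \<zero>\<^bsub>?W s\<^esub>}" if "s \<in> S" "x \<in> carrier (?W s)" for s x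
    using obj_finite[OF M that(1)] NV[OF that(1)] that by auto
  ultimately obtain A where A: "A \<in> obj Cat" "\<And>s. s \<in> S \<Longrightarrow> V A s = ?W s"
    "\<And>p x. \<lbrakk>p \<in> Op; x \<in> carrier (?W (src p))\<rbrakk> \<Longrightarrow> op A p x = op M p x"
    using create_inj[of ?W "op M" "{(M, \<lambda>s m. m)}"] M by force
  have "rep_hom (V A) (op A) (V M) (op M) (\<lambda>s m. m)"
    using hom A(2,3) src_sort unfolding rep_hom_def by simp
  then obtain i where "i \<in> arr Cat A M" "\<And>s m. \<lbrakk>s \<in> S; m \<in> carrier (V A s)\<rbrakk> \<Longrightarrow> ap i s m = m"
    using arr_ex[OF A(1) M] by blast
  then show ?thesis using A(1,2) by (intro bexI[of _ A] bexI[of _ i]) auto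
qed

text \<open>Cosets carry the operators, but they form a set of sets. As an image of a small set
  their carrier is small and is transported into \<open>'u\<close> before \<open>create_surj\<close>
  is applied.\<close>

lemma quotient_object:
  assumes M: "M \<in> obj Cat" and N: "subrep M N"
  shows "\<exists>Q\<in>obj Cat. \<exists>q\<in>arr Cat M Q. \<forall>s\<in>S. ap q s ` carrier (V M s) = carrier (V Q s) \<and>
    (\<forall>m\<in>carrier (V M s). ap q s m = \<zero>\<^bsub>V Q s\<^esub> \<longleftrightarrow> m \<in> N s)"
proof -
  have sub: "submodule (N s) K (V M s)" if "s \<in> S" for s using N that by (simp add: subrep_def)
  have quot: "quotient K (V M s) (N s)" if "s \<in> S" for s
    using objM[OF M that] sub[OF that] by (simp add: quotient_def quotient_axioms_def)
  let ?q = "\<lambda>s x. N s +>\<^bsub>V M s\<^esub> x"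
  let ?W = "\<lambda>s. quotient_module K (V M s) (N s)"
  \<comment> \<open>The operator on cosets, by choice of a representative; stability of
    \<open>N\<close> under the operators makes the choice immaterial.\<close>
  define w where "w p X = (SOME y. \<exists>x\<in>carrier (V M (src p)). X = ?q (src p) x \<and> y = ?q (tgt p) (op M p x))" for p X
  have w: "w p (?q (src p) x) = ?q (tgt p) (op M p x)" if p: "p \<in> Op" and x: "x \<in> carrier (V M (src p))" for p x
  proof -
    let ?P = "\<lambda>y. \<exists>x'\<in>carrier (V M (src p)). ?q (src p) x = ?q (src p) x' \<and> y = ?q (tgt p) (op M p x')"
    have "?P (w p (?q (src p) x))" unfolding w_def by (rule someI_ex) (use x in blast)
    then obtain x' where x': "x' \<in> carrier (V M (src p))" "?q (src p) x = ?q (src p) x'"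
      "w p (?q (src p) x) = ?q (tgt p) (op M p x')" by blast
    have "x \<ominus>\<^bsub>V M (src p)\<^esub> x' \<in> N (src p)"
      using quotient.coset_eq_iff[OF quot[OF src_sort[OF p]] x x'(1)] x'(2) by simp
    then have "op M p (x \<ominus>\<^bsub>V M (src p)\<^esub> x') \<in> N (tgt p)" using N p by (simp add: subrep_def)
    then have "op M p x \<ominus>\<^bsub>V M (tgt p)\<^esub> op M p x' \<in> N (tgt p)"
      using linear_map_minus[OF objM[OF M src_sort[OF p]] objM[OF M tgt_sort[OF p]] op_linear[OF M p] x x'(1)] by simp
    then show ?thesis
      using quotient.coset_eq_iff[OF quot[OF tgt_sort[OF p]] op_closed[OF M p x] op_closed[OF M p x'(1)]] x'(3) by simp
  qed
  have cW: "carrier (?W s) = ?q s ` carrier (V M s)" if "s \<in> S" for s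
    using quotient.carrier_quot[OF quot[OF that]] .
  have rep: "rep ?W w"
    unfolding rep_def
  proof (intro conjI ballI)
    show "module K (?W s)" if "s \<in> S" for s using quotient.module_quot[OF quot[OF that]] .
    fix p assume p: "p \<in> Op"
    note s = src_sort[OF p] and t = tgt_sort[OF p]
    note cl = op_closed[OF M p]
    interpret s: module K "V M (src p)" using objM[OF M s] .
    note [simp] = quotient.add_quot[OF quot[OF s]] quotient.add_quot[OF quot[OF t]]
      quotient.smult_quot[OF quot[OF s]] quotient.smult_quot[OF quot[OF t]]
    show "linear_map K (?W (src p)) (?W (tgt p)) (w p)"
      using cl by (intro linear_mapI)
        (auto simp: cW s t w[OF p] linear_map_add[OF op_linear[OF M p]] linear_map_smult[OF op_linear[OF M p]])
  qed
  have hom: "rep_hom (V M) (op M) ?W w ?q"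
    unfolding rep_hom_def using quotient.coset_linear[OF quot] w by auto
  have smallW: "small U (carrier (?W s))" if "s \<in> S" for s
    using cW[OF that] small_image[OF univ obj_small[OF M that]] by simp
  have "\<exists>f :: 'u set \<Rightarrow> 'u. inj_on f (carrier (?W s))" if "s \<in> S" for s
    using small_inj[OF smallW[OF that]] .
  then obtain f :: "'s \<Rightarrow> 'u set \<Rightarrow> 'u" where f: "\<And>s. s \<in> S \<Longrightarrow> inj_on (f s) (carrier (?W s))" by metis
  obtain w' where w': "rep (\<lambda>s. transport (?W s) (f s)) w'"
    "rep_hom ?W w (\<lambda>s. transport (?W s) (f s)) w' f" using transport_rep[OF rep f] by blast
  let ?r = "\<lambda>s x. f s (?q s x)"
  let ?T = "\<lambda>s. transport (?W s) (f s)"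
  have hom': "rep_hom (V M) (op M) ?T w' ?r" by (rule rep_hom_comp[OF hom w'(2)])
  have surj: "?r s ` carrier (V M s) = carrier (?T s)" if "s \<in> S" for s
    using cW[OF that] by (auto simp: transport_def)
  obtain Q where Q: "Q \<in> obj Cat" "\<And>s. s \<in> S \<Longrightarrow> V Q s = ?T s"
    "\<And>p x. \<lbrakk>p \<in> Op; x \<in> carrier (?T (src p))\<rbrakk> \<Longrightarrow> op Q p x = w' p x"
    using create_surj[OF w'(1) M hom' surj] by blast
  have "rep_hom (V M) (op M) (V Q) (op Q) ?r"
    unfolding rep_hom_def
  proof (intro conjI ballI)
    show "linear_map K (V M s) (V Q s) (?r s)" if "s \<in> S" for s
      using rep_hom_linear[OF hom' that] Q(2)[OF that] by simp
    fix p m assume p: "p \<in> Op" "m \<in> carrier (V M (src p))"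
    have "?r (src p) m \<in> carrier (?T (src p))" using surj[OF src_sort[OF p(1)]] p(2) by blast
    then show "?r (tgt p) (op M p m) = op Q p (?r (src p) m)"
      using rep_hom_op[OF hom' p] Q(3)[OF p(1)] by simp
  qed
  then obtain q where q: "q \<in> arr Cat M Q" "\<And>s m. \<lbrakk>s \<in> S; m \<in> carrier (V M s)\<rbrakk> \<Longrightarrow> ap q s m = ?r s m"
    using arr_ex[OF M Q(1)] by blast
  have "ap q s m = \<zero>\<^bsub>V Q s\<^esub> \<longleftrightarrow> m \<in> N s" if s: "s \<in> S" and m: "m \<in> carrier (V M s)" for s m
  proof -
    have "\<zero>\<^bsub>?W s\<^esub> = N s" "N s \<in> carrier (?W s)"
      using quotient.zero_quot[OF quot[OF s]] quotient.module_quot[OF quot[OF s]]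
      by (auto dest!: module.axioms(2) abelian_groupE(2))
    then have "ap q s m = \<zero>\<^bsub>V Q s\<^esub> \<longleftrightarrow> ?q s m = N s"
      using q(2)[OF s m] Q(2)[OF s] inj_on_eq_iff[OF f[OF s]] m cW[OF s] by (auto simp: transport_def)
    also have "\<dots> \<longleftrightarrow> m \<in> N s" using quotient.coset_zero_iff[OF quot[OF s] m] .
    finally show ?thesis .
  qed
  moreover have "ap q s ` carrier (V M s) = carrier (V Q s)" if s: "s \<in> S" for s
    using surj[OF s] q(2)[OF s] Q(2)[OF s] by simp
  ultimately show ?thesis using Q(1) q(1) by blast
qed

end

section \<open>Factorization through surjective and injective arrows\<close>

context operator_category begin

lemma small_inj_family:
  assumes "\<And>s. s \<in> S \<Longrightarrow> small U (A s :: 'z set)"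
  shows "\<exists>f :: 's \<Rightarrow> 'z \<Rightarrow> 'u. \<forall>s\<in>S. inj_on (f s) (A s)"
  by (intro bchoice ballI small_inj[of U] assms)

lemma arr_cmp_eqI:
  assumes "L \<in> obj Cat" "M \<in> obj Cat" "N \<in> obj Cat" "f \<in> arr Cat L M" "g \<in> arr Cat M N" "h \<in> arr Cat L N"
    and "\<And>s m. \<lbrakk>s \<in> S; m \<in> carrier (V L s)\<rbrakk> \<Longrightarrow> ap g s (ap f s m) = ap h s m"
  shows "cmp Cat L M N g f = h"
  using assms by (intro arr_ext[of L N]) (auto simp: cmp)

lemma category: "category Cat"
proof
  fix A B D E f g h
  assume o: "A \<in> obj Cat" "B \<in> obj Cat" "D \<in> obj Cat" "E \<in> obj Cat"
    and a: "f \<in> arr Cat A B" "g \<in> arr Cat B D" "h \<in> arr Cat D E"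
  show "cmp Cat A D E h (cmp Cat A B D g f) = cmp Cat A B E (cmp Cat B D E h g) f"
    using o a by (intro arr_cmp_eqI) (auto simp: cmp ap_closed)
next
  fix A B f assume o: "A \<in> obj Cat" "B \<in> obj Cat" and f: "f \<in> arr Cat A B"
  show "cmp Cat A A B f (ident Cat A) = f" "cmp Cat A B B (ident Cat B) f = f"
    using o f by (auto intro!: arr_cmp_eqI simp: ident ap_closed)
qed (auto simp: ident cmp)

text \<open>The factor is computed at any preimage under \<open>q\<close>. Two preimages differ by
  an element of the kernel of \<open>q\<close>, which \<open>t\<close> kills; surjectivity also
  forces uniqueness.\<close>

lemma factor_surj:
  assumes o: "A \<in> obj Cat" "Q \<in> obj Cat" "T \<in> obj Cat"
    and q: "q \<in> arr Cat A Q" and t: "t \<in> arr Cat A T"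
    and surj: "\<And>s. s \<in> S \<Longrightarrow> ap q s ` carrier (V A s) = carrier (V Q s)"
    and ker: "\<And>s m. \<lbrakk>s \<in> S; m \<in> carrier (V A s); ap q s m = \<zero>\<^bsub>V Q s\<^esub>\<rbrakk> \<Longrightarrow> ap t s m = \<zero>\<^bsub>V T s\<^esub>"
  shows "\<exists>!u. u \<in> arr Cat Q T \<and> cmp Cat A Q T u q = t"
proof -
  define g where "g s y = ap t s (SOME m. m \<in> carrier (V A s) \<and> ap q s m = y)" for s y
  have g: "g s (ap q s m) = ap t s m" if s: "s \<in> S" and m: "m \<in> carrier (V A s)" for s m
  proof -
    define m' where "m' = (SOME m'. m' \<in> carrier (V A s) \<and> ap q s m' = ap q s m)"
    have m': "m' \<in> carrier (V A s) \<and> ap q s m' = ap q s m"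
      unfolding m'_def by (rule someI[of _ m]) (use m in simp)
    interpret As: module K "V A s" using objM o s by blast
    interpret Qs: module K "V Q s" using objM o s by blast
    have "ap q s (m \<ominus>\<^bsub>V A s\<^esub> m') = ap q s m \<ominus>\<^bsub>V Q s\<^esub> ap q s m'"
      using linear_map_minus[OF As.module_axioms Qs.module_axioms ap_linear[OF o(1,2) q s]] m m' by simp
    also have "\<dots> = \<zero>\<^bsub>V Q s\<^esub>"
      using m' ap_closed[OF o(1,2) q s m] by (simp add: a_minus_def Qs.M.r_neg)
    finally have "ap t s (m \<ominus>\<^bsub>V A s\<^esub> m') = \<zero>\<^bsub>V T s\<^esub>" using ker s m m' by simp
    then have "ap t s m \<ominus>\<^bsub>V T s\<^esub> ap t s m' = \<zero>\<^bsub>V T s\<^esub>"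
      using linear_map_minus[OF As.module_axioms objM[OF o(3) s] ap_linear[OF o(1,3) t s]] m m' by simp
    then have "ap t s m = ap t s m'"
      using minus_zeroD[OF objM[OF o(3) s]] ap_closed[OF o(1,3) t s] m m' by blast
    then show ?thesis by (simp add: g_def m'_def)
  qed
  have ex: "\<exists>m\<in>carrier (V A s). y = ap q s m" if "s \<in> S" "y \<in> carrier (V Q s)" for s y
    using surj[OF that(1)] that(2) by blast
  have "rep_hom (V Q) (op Q) (V T) (op T) g"
    unfolding rep_hom_def
  proof (intro conjI ballI linear_mapI)
    fix s x assume s: "s \<in> S" and x: "x \<in> carrier (V Q s)"
    obtain m where m: "m \<in> carrier (V A s)" "x = ap q s m" using ex s x by blast
    then show "g s x \<in> carrier (V T s)" using g[OF s] ap_closed[OF o(1,3) t s] by simp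
    show "g s (a \<odot>\<^bsub>V Q s\<^esub> x) = a \<odot>\<^bsub>V T s\<^esub> g s x" if "a \<in> carrier K" for a
    proof -
      interpret As: module K "V A s" using objM o s by blast
      show ?thesis using m g[OF s] that linear_map_smult[OF ap_linear[OF o(1,3) t s]]
        by (simp flip: linear_map_smult[OF ap_linear[OF o(1,2) q s]])
    qed
    fix y assume "y \<in> carrier (V Q s)"
    then obtain n where n: "n \<in> carrier (V A s)" "y = ap q s n" using ex s by blast
    interpret As: module K "V A s" using objM o s by blast
    show "g s (x \<oplus>\<^bsub>V Q s\<^esub> y) = g s x \<oplus>\<^bsub>V T s\<^esub> g s y"
      using m n g[OF s] linear_map_add[OF ap_linear[OF o(1,3) t s]]
      by (simp flip: linear_map_add[OF ap_linear[OF o(1,2) q s]])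
  next
    fix p x assume p: "p \<in> Op" and x: "x \<in> carrier (V Q (src p))"
    obtain m where m: "m \<in> carrier (V A (src p))" "x = ap q (src p) m" using ex src_sort p x by blast
    then show "g (tgt p) (op Q p x) = op T p (g (src p) x)"
      using g src_sort tgt_sort p op_closed[OF o(1) p] ap_op[OF o(1,3) t p]
      by (simp flip: ap_op[OF o(1,2) q p])
  qed
  then obtain u where u: "u \<in> arr Cat Q T" "\<And>s m. \<lbrakk>s \<in> S; m \<in> carrier (V Q s)\<rbrakk> \<Longrightarrow> ap u s m = g s m"
    using arr_ex[OF o(2,3)] by blast
  show ?thesis
  proof (rule ex1I[of _ u])
    show "u \<in> arr Cat Q T \<and> cmp Cat A Q T u q = t"
      using u g ap_closed[OF o(1,2) q] by (intro conjI arr_cmp_eqI o q t) auto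
    fix v assume v: "v \<in> arr Cat Q T \<and> cmp Cat A Q T v q = t"
    show "v = u"
    proof (rule arr_ext[OF o(2,3)])
      fix s x assume s: "s \<in> S" and x: "x \<in> carrier (V Q s)"
      obtain m where m: "m \<in> carrier (V A s)" "x = ap q s m" using ex s x by blast
      have "ap v s x = ap t s m" using cmp(2)[OF o q, of v s m] v s m by auto
      then show "ap v s x = ap u s x" using u(2)[OF s x] g[OF s m(1)] m by simp
    qed (use u v in auto)
  qed
qed

text \<open>Each value of \<open>t\<close> has exactly one preimage under \<open>i\<close>, and
  injectivity makes the passage to preimages compatible with all operations.\<close>

lemma factor_inj:
  assumes o: "A \<in> obj Cat" "M \<in> obj Cat" "T \<in> obj Cat"
    and i: "i \<in> arr Cat A M" and t: "t \<in> arr Cat T M"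
    and inj: "\<And>s m. \<lbrakk>s \<in> S; m \<in> carrier (V A s); ap i s m = \<zero>\<^bsub>V M s\<^esub>\<rbrakk> \<Longrightarrow> m = \<zero>\<^bsub>V A s\<^esub>"
    and im: "\<And>s m. \<lbrakk>s \<in> S; m \<in> carrier (V T s)\<rbrakk> \<Longrightarrow> ap t s m \<in> ap i s ` carrier (V A s)"
  shows "\<exists>!u. u \<in> arr Cat T A \<and> cmp Cat T A M i u = t"
proof -
  have eq: "x = y" if "s \<in> S" "x \<in> carrier (V A s)" "y \<in> carrier (V A s)" "ap i s x = ap i s y" for s x y
  proof -
    interpret As: module K "V A s" using objM o that by blast
    interpret Ms: module K "V M s" using objM o that by blast
    have "ap i s (x \<ominus>\<^bsub>V A s\<^esub> y) = \<zero>\<^bsub>V M s\<^esub>"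
      using linear_map_minus[OF As.module_axioms Ms.module_axioms ap_linear[OF o(1,2) i that(1)]] that
        ap_closed[OF o(1,2) i that(1)] by (simp add: a_minus_def Ms.M.r_neg)
    then have "x \<ominus>\<^bsub>V A s\<^esub> y = \<zero>\<^bsub>V A s\<^esub>" using inj that by simp
    then show ?thesis by (rule minus_zeroD[OF As.module_axioms _ that(2,3)])
  qed
  define g where "g s x = (SOME y. y \<in> carrier (V A s) \<and> ap i s y = ap t s x)" for s x
  have g: "g s x \<in> carrier (V A s)" "ap i s (g s x) = ap t s x" if "s \<in> S" "x \<in> carrier (V T s)" for s x
  proof -
    have "\<exists>y. y \<in> carrier (V A s) \<and> ap i s y = ap t s x" using im[OF that] by auto
    from someI_ex[OF this] show "g s x \<in> carrier (V A s)" "ap i s (g s x) = ap t s x"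
      by (auto simp: g_def)
  qed
  have "rep_hom (V T) (op T) (V A) (op A) g"
    unfolding rep_hom_def
  proof (intro conjI ballI linear_mapI)
    fix s x assume s: "s \<in> S" and x: "x \<in> carrier (V T s)"
    interpret As: module K "V A s" using objM o s by blast
    interpret Ts: module K "V T s" using objM o s by blast
    show "g s x \<in> carrier (V A s)" using g s x by blast
    show "g s (a \<odot>\<^bsub>V T s\<^esub> x) = a \<odot>\<^bsub>V A s\<^esub> g s x" if "a \<in> carrier K" for a
      using s x g that linear_map_smult[OF ap_linear[OF o(3,2) t s]] linear_map_smult[OF ap_linear[OF o(1,2) i s]]
      by - (rule eq[OF s], auto)
    show "g s (x \<oplus>\<^bsub>V T s\<^esub> y) = g s x \<oplus>\<^bsub>V A s\<^esub> g s y" if "y \<in> carrier (V T s)" for y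
      using s x g that linear_map_add[OF ap_linear[OF o(3,2) t s]] linear_map_add[OF ap_linear[OF o(1,2) i s]]
      by - (rule eq[OF s], auto)
  next
    fix p x assume p: "p \<in> Op" and x: "x \<in> carrier (V T (src p))"
    note gx = g[OF src_sort[OF p] x] g[OF tgt_sort[OF p] op_closed[OF o(3) p x]]
    show "g (tgt p) (op T p x) = op A p (g (src p) x)"
      using gx op_closed[OF o(1) p gx(1)] ap_op[OF o(3,2) t p x] ap_op[OF o(1,2) i p gx(1)]
      by - (rule eq[OF tgt_sort[OF p]], simp_all)
  qed
  then obtain u where u: "u \<in> arr Cat T A" "\<And>s m. \<lbrakk>s \<in> S; m \<in> carrier (V T s)\<rbrakk> \<Longrightarrow> ap u s m = g s m"
    using arr_ex[OF o(3,1)] by blast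
  show ?thesis
  proof (rule ex1I[of _ u])
    show "u \<in> arr Cat T A \<and> cmp Cat T A M i u = t"
      using u g by (intro conjI arr_cmp_eqI o i t) auto
    fix v assume v: "v \<in> arr Cat T A \<and> cmp Cat T A M i v = t"
    show "v = u"
    proof (rule arr_ext[OF o(3,1)])
      fix s x assume s: "s \<in> S" and x: "x \<in> carrier (V T s)"
      have "ap i s (ap v s x) = ap t s x" using cmp(2)[OF o(3,1,2) _ i s x, of v] v by auto
      then show "ap v s x = ap u s x"
        using u(2)[OF s x] g[OF s x] ap_closed[OF o(3,1) _ s x, of v] v by - (rule eq[OF s], auto)
    qed (use u v in auto)
  qed
qed

section \<open>Presentations\<close>

text \<open>
  The object presented by symbols subject to all relations that hold under every evaluation in a
  class \<open>Ev\<close>; it is realised by the linear combinations of symbols as functions on \<open>Ev\<close>.  It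
  inherits every identity from the objects in which the symbols are evaluated.
\<close>

lemma presentation:
  fixes Sym :: "'s \<Rightarrow> 'z set" and act :: "'p \<Rightarrow> 'z \<Rightarrow> 'z" and Ev :: "('m \<times> ('s \<Rightarrow> 'z \<Rightarrow> 'u)) set"
  assumes small_Sym: "\<And>s. s \<in> S \<Longrightarrow> small U (Sym s)"
    and act: "\<And>p z. p \<in> Op \<Longrightarrow> z \<in> Sym (src p) \<Longrightarrow> act p z \<in> Sym (tgt p)"
    and Ev_obj: "\<And>T ev. (T, ev) \<in> Ev \<Longrightarrow> T \<in> obj Cat"
    and Ev_closed: "\<And>T ev s z. \<lbrakk>(T, ev) \<in> Ev; s \<in> S; z \<in> Sym s\<rbrakk> \<Longrightarrow> ev s z \<in> carrier (V T s)"
    and Ev_act: "\<And>T ev p z. \<lbrakk>(T, ev) \<in> Ev; p \<in> Op; z \<in> Sym (src p)\<rbrakk>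
      \<Longrightarrow> ev (tgt p) (act p z) = op T p (ev (src p) z)"
    and fin: "\<And>s z. \<lbrakk>s \<in> S; z \<in> Sym s\<rbrakk> \<Longrightarrow> \<exists>D. finite D \<and>
      (\<forall>(T, ev)\<in>Ev. {b \<in> B. op T (co s b) (ev s z) \<noteq> \<zero>\<^bsub>V T s\<^esub>} \<subseteq> D)"
  obtains P \<iota> where "P \<in> obj Cat" "\<And>s z. \<lbrakk>s \<in> S; z \<in> Sym s\<rbrakk> \<Longrightarrow> \<iota> s z \<in> carrier (V P s)"
    "\<And>T ev. (T, ev) \<in> Ev \<Longrightarrow> \<exists>h\<in>arr Cat P T. \<forall>s\<in>S. \<forall>z\<in>Sym s. ap h s (\<iota> s z) = ev s z"
    "\<And>T f g. \<lbrakk>T \<in> obj Cat; f \<in> arr Cat P T; g \<in> arr Cat P T;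
      \<And>s z. \<lbrakk>s \<in> S; z \<in> Sym s\<rbrakk> \<Longrightarrow> ap f s (\<iota> s z) = ap g s (\<iota> s z)\<rbrakk> \<Longrightarrow> f = g"
    "\<And>s x. \<lbrakk>s \<in> S; x \<in> carrier (V P s);
      \<And>T ev h. \<lbrakk>(T, ev) \<in> Ev; h \<in> arr Cat P T; \<forall>s\<in>S. \<forall>z\<in>Sym s. ap h s (\<iota> s z) = ev s z\<rbrakk>
        \<Longrightarrow> ap h s x = \<zero>\<^bsub>V T s\<^esub>\<rbrakk> \<Longrightarrow> x = \<zero>\<^bsub>V P s\<^esub>"
proof -
  interpret K: cring K by (rule cring_K)
  \<comment> \<open>A formal linear combination is a list of coefficients and symbols, and
    \<open>lc e s\<close> evaluates it at \<open>e\<close>, with a given element as last summand.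
    With lists, addition is concatenation, and the carrier is bounded by the number of lists,
    however large \<open>Ev\<close> may be.\<close>
  define lc where "lc e s = foldr (\<lambda>kz x. (fst kz \<odot>\<^bsub>V (fst e) s\<^esub> snd e s (snd kz)) \<oplus>\<^bsub>V (fst e) s\<^esub> x)"
    for e :: "'m \<times> ('s \<Rightarrow> 'z \<Rightarrow> 'u)" and s
  \<comment> \<open>Two combinations are identified when they have the same value at every
    evaluation; the value off \<open>Ev\<close> is fixed so that this is equality of
    functions.\<close>
  define F where "F s xs = (\<lambda>e. if e \<in> Ev then lc e s xs \<zero>\<^bsub>V (fst e) s\<^esub> else undefined)" for s xs
  define X where "X s = lists (carrier K \<times> Sym s)" for s
  define W :: "'s \<Rightarrow> ('k, 'm \<times> ('s \<Rightarrow> 'z \<Rightarrow> 'u) \<Rightarrow> 'u) module" where "W s = \<lparr>carrier = F s ` X s, monoid.mult = undefined, one = undefined, zero = F s [],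
    add = (\<lambda>x y e. if e \<in> Ev then x e \<oplus>\<^bsub>V (fst e) s\<^esub> y e else undefined),
    smult = (\<lambda>a x e. if e \<in> Ev then a \<odot>\<^bsub>V (fst e) s\<^esub> x e else undefined)\<rparr>" for s
  define w where "w p x = (\<lambda>e. if e \<in> Ev then op (fst e) p (x e) else undefined)"
    for p and x :: "'m \<times> ('s \<Rightarrow> 'z \<Rightarrow> 'u) \<Rightarrow> 'u"
  have mod: "module K (V (fst e) s)" if "e \<in> Ev" "s \<in> S" for e s
    using objM Ev_obj that by (cases e) auto
  have evc: "snd e s z \<in> carrier (V (fst e) s)" if "e \<in> Ev" "s \<in> S" "z \<in> Sym s" for e s z
    using Ev_closed that by (cases e) auto
  have F_Nil: "F s [] e = \<zero>\<^bsub>V (fst e) s\<^esub>" if "e \<in> Ev" for s e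
    using that by (simp add: F_def lc_def)
  have F_Cons: "F s (kz # xs) e = (fst kz \<odot>\<^bsub>V (fst e) s\<^esub> snd e s (snd kz)) \<oplus>\<^bsub>V (fst e) s\<^esub> F s xs e"
    if "e \<in> Ev" for s kz xs e
    using that by (simp add: F_def lc_def)
  have F_closed: "F s xs e \<in> carrier (V (fst e) s)" if "e \<in> Ev" "s \<in> S" "xs \<in> X s" for s xs e
  proof -
    interpret module K "V (fst e) s" using mod that by blast
    show ?thesis using that(3) unfolding X_def
      by (induction xs) (auto simp: F_Nil F_Cons that evc)
  qed
  have F_append: "F s (xs @ ys) e = F s xs e \<oplus>\<^bsub>V (fst e) s\<^esub> F s ys e"
    if "e \<in> Ev" "s \<in> S" "xs \<in> X s" "ys \<in> X s" for s xs ys e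
  proof -
    interpret module K "V (fst e) s" using mod that by blast
    show ?thesis using that(3)
    proof (induction xs)
      case (Cons kz xs)
      then have c: "fst kz \<in> carrier K" "snd kz \<in> Sym s" "xs \<in> X s" by (auto simp: X_def)
      show ?case using c Cons.IH F_closed[OF that(1,2)] that(4) evc[OF that(1,2)]
        by (simp add: F_Cons that(1) M.a_assoc)
    qed (use that F_closed in \<open>simp add: F_Nil\<close>)
  qed
  have F_map: "F s (map (\<lambda>(k, z). (a \<otimes>\<^bsub>K\<^esub> k, z)) xs) e = a \<odot>\<^bsub>V (fst e) s\<^esub> F s xs e"
    if "e \<in> Ev" "s \<in> S" "xs \<in> X s" "a \<in> carrier K" for s xs a e
  proof -
    interpret module K "V (fst e) s" using mod that by blast
    show ?thesis using that(3)
    proof (induction xs)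
      case (Cons kz xs)
      then have c: "fst kz \<in> carrier K" "snd kz \<in> Sym s" "xs \<in> X s" by (auto simp: X_def)
      show ?case using c Cons.IH F_closed[OF that(1,2)] that(4) evc[OF that(1,2)]
        by (simp add: F_Cons that(1) smult_r_distr smult_assoc1 case_prod_beta)
    qed (use that in \<open>simp add: F_Nil\<close>)
  qed
  have F_op: "F (tgt p) (map (\<lambda>(k, z). (k, act p z)) xs) e = op (fst e) p (F (src p) xs e)"
    if "e \<in> Ev" "p \<in> Op" "xs \<in> X (src p)" for p xs e
  proof -
    have o: "fst e \<in> obj Cat" using Ev_obj that(1) by (cases e) auto
    note s = src_sort[OF that(2)] and t = tgt_sort[OF that(2)]
    interpret module K "V (fst e) (src p)" using mod that s by blast
    note lin = linear_map_add[OF op_linear[OF o that(2)]] linear_map_smult[OF op_linear[OF o that(2)]]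
      linear_map_zero[OF objM[OF o s] objM[OF o t] op_linear[OF o that(2)]]
    have E: "snd e (tgt p) (act p z) = op (fst e) p (snd e (src p) z)" if "z \<in> Sym (src p)" for z
      using Ev_act[of "fst e" "snd e"] that \<open>e \<in> Ev\<close> \<open>p \<in> Op\<close> by simp
    show ?thesis using that(3)
    proof (induction xs)
      case (Cons kz xs)
      then have c: "fst kz \<in> carrier K" "snd kz \<in> Sym (src p)" "xs \<in> X (src p)" by (auto simp: X_def)
      show ?case using c Cons.IH F_closed[OF that(1) s] evc[OF that(1) s]
        by (simp add: F_Cons that(1) lin E case_prod_beta)
    qed (use that in \<open>simp add: F_Nil lin\<close>)
  qed
  have X_closed: "[] \<in> X s" "xs \<in> X s \<Longrightarrow> ys \<in> X s \<Longrightarrow> xs @ ys \<in> X s"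
    "a \<in> carrier K \<Longrightarrow> xs \<in> X s \<Longrightarrow> map (\<lambda>(k, z). (a \<otimes>\<^bsub>K\<^esub> k, z)) xs \<in> X s" for s xs ys a
    by (auto simp: X_def) (drule (1) bspec, simp)+
  have X_act: "map (\<lambda>(k, z). (k, act p z)) xs \<in> X (tgt p)" if "p \<in> Op" "xs \<in> X (src p)" for p xs
    using that act by (auto simp: X_def) (drule (1) bspec, simp)+
  have F_ext: "F s xs = f" if "\<And>e. e \<in> Ev \<Longrightarrow> F s xs e = f e" "\<And>e. e \<notin> Ev \<Longrightarrow> f e = undefined" for s xs f
    using that by (auto simp: F_def)
  have F_out: "F s xs e = undefined" if "e \<notin> Ev" for s xs e using that by (simp add: F_def)
  have W_simps: "carrier (W s) = F s ` X s" "\<zero>\<^bsub>W s\<^esub> = F s []"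
    "x \<oplus>\<^bsub>W s\<^esub> y = (\<lambda>e. if e \<in> Ev then x e \<oplus>\<^bsub>V (fst e) s\<^esub> y e else undefined)"
    "a \<odot>\<^bsub>W s\<^esub> x = (\<lambda>e. if e \<in> Ev then a \<odot>\<^bsub>V (fst e) s\<^esub> x e else undefined)" for s x y a
    by (auto simp: W_def)
  have W_add: "F s xs \<oplus>\<^bsub>W s\<^esub> F s ys = F s (xs @ ys)" if "s \<in> S" "xs \<in> X s" "ys \<in> X s" for s xs ys
    unfolding W_simps by (rule F_ext[symmetric]) (use that F_append in auto)
  have W_smult: "a \<odot>\<^bsub>W s\<^esub> F s xs = F s (map (\<lambda>(k, z). (a \<otimes>\<^bsub>K\<^esub> k, z)) xs)"
    if "s \<in> S" "xs \<in> X s" "a \<in> carrier K" for s xs a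
    unfolding W_simps by (rule F_ext[symmetric]) (use that F_map in auto)
  have w_F: "w p (F (src p) xs) = F (tgt p) (map (\<lambda>(k, z). (k, act p z)) xs)"
    if "p \<in> Op" "xs \<in> X (src p)" for p xs
    unfolding w_def by (rule F_ext[symmetric]) (use that F_op in auto)
  have Wc: "x e \<in> carrier (V (fst e) s)" if "x \<in> carrier (W s)" "e \<in> Ev" "s \<in> S" for x e s
    using that(1) F_closed[OF that(2,3)] by (auto simp: W_simps)
  have Wout: "x e = undefined" if "x \<in> carrier (W s)" "e \<notin> Ev" for x e s
    using that(1) F_out[OF that(2)] by (auto simp: W_simps)
  have W_ext: "x = y" if "x \<in> carrier (W s)" "y \<in> carrier (W s)" "\<And>e. e \<in> Ev \<Longrightarrow> x e = y e" for x y s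
  proof
    fix e show "x e = y e" using that(3) Wout[OF that(1)] Wout[OF that(2)] by (cases "e \<in> Ev") simp_all
  qed
  have W_cl: "x \<oplus>\<^bsub>W s\<^esub> y \<in> carrier (W s)" "a \<in> carrier K \<Longrightarrow> a \<odot>\<^bsub>W s\<^esub> x \<in> carrier (W s)"
    if s: "s \<in> S" and x: "x \<in> carrier (W s)" and y: "y \<in> carrier (W s)" for x y a s
  proof -
    obtain xs ys where "x = F s xs" "y = F s ys" "xs \<in> X s" "ys \<in> X s" using x y by (auto simp: W_simps(1))
    then show "x \<oplus>\<^bsub>W s\<^esub> y \<in> carrier (W s)" "a \<in> carrier K \<Longrightarrow> a \<odot>\<^bsub>W s\<^esub> x \<in> carrier (W s)"
      using s X_closed by (auto simp: W_add W_smult W_simps(1))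
  qed
  have W0: "\<zero>\<^bsub>W s\<^esub> \<in> carrier (W s)" for s using X_closed by (auto simp: W_simps)
  \<comment> \<open>The module laws hold at each evaluation \<open>e\<close>, since they hold in
    \<open>V (fst e) s\<close>; the negative is the multiple by -1.\<close>
  have W_mod: "module K (W s)" if s: "s \<in> S" for s
  proof -
    have ops: "(x \<oplus>\<^bsub>W s\<^esub> y) e = x e \<oplus>\<^bsub>V (fst e) s\<^esub> y e" "(a \<odot>\<^bsub>W s\<^esub> x) e = a \<odot>\<^bsub>V (fst e) s\<^esub> x e"
      "\<zero>\<^bsub>W s\<^esub> e = \<zero>\<^bsub>V (fst e) s\<^esub>" if "e \<in> Ev" for x y a e
      using that by (auto simp: W_simps F_Nil)
    have ax: "x e \<oplus>\<^bsub>V (fst e) s\<^esub> y e \<oplus>\<^bsub>V (fst e) s\<^esub> z e = x e \<oplus>\<^bsub>V (fst e) s\<^esub> (y e \<oplus>\<^bsub>V (fst e) s\<^esub> z e)"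
      "x e \<oplus>\<^bsub>V (fst e) s\<^esub> y e = y e \<oplus>\<^bsub>V (fst e) s\<^esub> x e"
      "\<zero>\<^bsub>V (fst e) s\<^esub> \<oplus>\<^bsub>V (fst e) s\<^esub> x e = x e"
      "(\<ominus>\<^bsub>K\<^esub> \<one>\<^bsub>K\<^esub>) \<odot>\<^bsub>V (fst e) s\<^esub> x e \<oplus>\<^bsub>V (fst e) s\<^esub> x e = \<zero>\<^bsub>V (fst e) s\<^esub>"
      "\<one>\<^bsub>K\<^esub> \<odot>\<^bsub>V (fst e) s\<^esub> x e = x e"
      "\<lbrakk>a \<in> carrier K; b \<in> carrier K\<rbrakk> \<Longrightarrow>
        (a \<oplus>\<^bsub>K\<^esub> b) \<odot>\<^bsub>V (fst e) s\<^esub> x e = a \<odot>\<^bsub>V (fst e) s\<^esub> x e \<oplus>\<^bsub>V (fst e) s\<^esub> b \<odot>\<^bsub>V (fst e) s\<^esub> x e"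
      "a \<in> carrier K \<Longrightarrow>
        a \<odot>\<^bsub>V (fst e) s\<^esub> (x e \<oplus>\<^bsub>V (fst e) s\<^esub> y e) = a \<odot>\<^bsub>V (fst e) s\<^esub> x e \<oplus>\<^bsub>V (fst e) s\<^esub> a \<odot>\<^bsub>V (fst e) s\<^esub> y e"
      "\<lbrakk>a \<in> carrier K; b \<in> carrier K\<rbrakk> \<Longrightarrow>
        (a \<otimes>\<^bsub>K\<^esub> b) \<odot>\<^bsub>V (fst e) s\<^esub> x e = a \<odot>\<^bsub>V (fst e) s\<^esub> (b \<odot>\<^bsub>V (fst e) s\<^esub> x e)"
      if x: "x \<in> carrier (W s)" and y: "y \<in> carrier (W s)" and z: "z \<in> carrier (W s)" and e: "e \<in> Ev" for x y z e a b
    proof -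
      interpret module K "V (fst e) s" using mod e s by blast
      have c: "x e \<in> carrier (V (fst e) s)" "y e \<in> carrier (V (fst e) s)" "z e \<in> carrier (V (fst e) s)"
        using Wc x y z e s by auto
      show "x e \<oplus>\<^bsub>V (fst e) s\<^esub> y e \<oplus>\<^bsub>V (fst e) s\<^esub> z e = x e \<oplus>\<^bsub>V (fst e) s\<^esub> (y e \<oplus>\<^bsub>V (fst e) s\<^esub> z e)"
        "x e \<oplus>\<^bsub>V (fst e) s\<^esub> y e = y e \<oplus>\<^bsub>V (fst e) s\<^esub> x e"
        "\<zero>\<^bsub>V (fst e) s\<^esub> \<oplus>\<^bsub>V (fst e) s\<^esub> x e = x e"
        "(\<ominus>\<^bsub>K\<^esub> \<one>\<^bsub>K\<^esub>) \<odot>\<^bsub>V (fst e) s\<^esub> x e \<oplus>\<^bsub>V (fst e) s\<^esub> x e = \<zero>\<^bsub>V (fst e) s\<^esub>"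
        "\<one>\<^bsub>K\<^esub> \<odot>\<^bsub>V (fst e) s\<^esub> x e = x e"
        using c by (auto simp: M.a_assoc smult_l_minus M.l_neg intro: M.a_comm)
      show "\<lbrakk>a \<in> carrier K; b \<in> carrier K\<rbrakk> \<Longrightarrow>
        (a \<oplus>\<^bsub>K\<^esub> b) \<odot>\<^bsub>V (fst e) s\<^esub> x e = a \<odot>\<^bsub>V (fst e) s\<^esub> x e \<oplus>\<^bsub>V (fst e) s\<^esub> b \<odot>\<^bsub>V (fst e) s\<^esub> x e"
        "a \<in> carrier K \<Longrightarrow>
        a \<odot>\<^bsub>V (fst e) s\<^esub> (x e \<oplus>\<^bsub>V (fst e) s\<^esub> y e) = a \<odot>\<^bsub>V (fst e) s\<^esub> x e \<oplus>\<^bsub>V (fst e) s\<^esub> a \<odot>\<^bsub>V (fst e) s\<^esub> y e"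
        "\<lbrakk>a \<in> carrier K; b \<in> carrier K\<rbrakk> \<Longrightarrow>
        (a \<otimes>\<^bsub>K\<^esub> b) \<odot>\<^bsub>V (fst e) s\<^esub> x e = a \<odot>\<^bsub>V (fst e) s\<^esub> (b \<odot>\<^bsub>V (fst e) s\<^esub> x e)"
        using c by (simp_all add: smult_l_distr smult_r_distr smult_assoc1)
    qed
    show ?thesis
    proof (intro moduleI abelian_groupI cring_K W0)
      fix x assume x: "x \<in> carrier (W s)"
      show "\<exists>y\<in>carrier (W s). y \<oplus>\<^bsub>W s\<^esub> x = \<zero>\<^bsub>W s\<^esub>"
      proof
        show nx: "(\<ominus>\<^bsub>K\<^esub> \<one>\<^bsub>K\<^esub>) \<odot>\<^bsub>W s\<^esub> x \<in> carrier (W s)" using W_cl(2)[OF s x x] by simp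
        show "(\<ominus>\<^bsub>K\<^esub> \<one>\<^bsub>K\<^esub>) \<odot>\<^bsub>W s\<^esub> x \<oplus>\<^bsub>W s\<^esub> x = \<zero>\<^bsub>W s\<^esub>"
          by (rule W_ext[OF W_cl(1)[OF s nx x] W0]) (simp add: ops ax(4)[OF x x x])
      qed
      show "\<zero>\<^bsub>W s\<^esub> \<oplus>\<^bsub>W s\<^esub> x = x"
        by (rule W_ext[OF W_cl(1)[OF s W0 x] x]) (simp add: ops ax(3)[OF x x x])
      show "\<one>\<^bsub>K\<^esub> \<odot>\<^bsub>W s\<^esub> x = x"
        by (rule W_ext[OF W_cl(2)[OF s x x] x]) (simp_all add: ops ax(5)[OF x x x])
      fix y assume y: "y \<in> carrier (W s)"
      show "x \<oplus>\<^bsub>W s\<^esub> y \<in> carrier (W s)" using W_cl(1)[OF s x y] .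
      show "x \<oplus>\<^bsub>W s\<^esub> y = y \<oplus>\<^bsub>W s\<^esub> x"
        by (rule W_ext[OF W_cl(1)[OF s x y] W_cl(1)[OF s y x]]) (simp add: ops ax(2)[OF x y x])
      show "x \<oplus>\<^bsub>W s\<^esub> y \<oplus>\<^bsub>W s\<^esub> z = x \<oplus>\<^bsub>W s\<^esub> (y \<oplus>\<^bsub>W s\<^esub> z)" if z: "z \<in> carrier (W s)" for z
        by (rule W_ext[OF W_cl(1)[OF s W_cl(1)[OF s x y] z] W_cl(1)[OF s x W_cl(1)[OF s y z]]])
          (simp add: ops ax(1)[OF x y z])
    next
      fix a x assume a: "a \<in> carrier K" and x: "x \<in> carrier (W s)"
      show ax': "a \<odot>\<^bsub>W s\<^esub> x \<in> carrier (W s)" using W_cl(2)[OF s x x a] .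
      show "a \<odot>\<^bsub>W s\<^esub> (x \<oplus>\<^bsub>W s\<^esub> y) = a \<odot>\<^bsub>W s\<^esub> x \<oplus>\<^bsub>W s\<^esub> a \<odot>\<^bsub>W s\<^esub> y" if y: "y \<in> carrier (W s)" for y
        by (rule W_ext[OF W_cl(2)[OF s W_cl(1)[OF s x y] x a] W_cl(1)[OF s ax' W_cl(2)[OF s y y a]]])
          (simp add: ops ax(7)[OF x y x _ a])
      fix b assume b: "b \<in> carrier K"
      show "(a \<oplus>\<^bsub>K\<^esub> b) \<odot>\<^bsub>W s\<^esub> x = a \<odot>\<^bsub>W s\<^esub> x \<oplus>\<^bsub>W s\<^esub> b \<odot>\<^bsub>W s\<^esub> x"
        by (rule W_ext[OF W_cl(2)[OF s x x] W_cl(1)[OF s ax' W_cl(2)[OF s x x b]]])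
          (use a b in \<open>simp_all add: ops ax(6)[OF x x x _ a b]\<close>)
      show "(a \<otimes>\<^bsub>K\<^esub> b) \<odot>\<^bsub>W s\<^esub> x = a \<odot>\<^bsub>W s\<^esub> (b \<odot>\<^bsub>W s\<^esub> x)"
        by (rule W_ext[OF W_cl(2)[OF s x x] W_cl(2)[OF s W_cl(2)[OF s x x b] x a]])
          (use a b in \<open>simp_all add: ops ax(8)[OF x x x _ a b]\<close>)
    qed
  qed
  have rep: "rep W w"
    unfolding rep_def
  proof (intro conjI ballI W_mod)
    fix p assume p: "p \<in> Op"
    note s = src_sort[OF p] and t = tgt_sort[OF p]
    have wc: "w p x \<in> carrier (W (tgt p))" if "x \<in> carrier (W (src p))" for x
      using that w_F[OF p] X_act[OF p] by (auto simp: W_simps(1))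
    have lin: "op (fst e) p (x e \<oplus>\<^bsub>V (fst e) (src p)\<^esub> y e) = op (fst e) p (x e) \<oplus>\<^bsub>V (fst e) (tgt p)\<^esub> op (fst e) p (y e)"
      "a \<in> carrier K \<Longrightarrow> op (fst e) p (a \<odot>\<^bsub>V (fst e) (src p)\<^esub> x e) = a \<odot>\<^bsub>V (fst e) (tgt p)\<^esub> op (fst e) p (x e)"
      if e: "e \<in> Ev" and x: "x \<in> carrier (W (src p))" and y: "y \<in> carrier (W (src p))" for e x y a
    proof -
      have o: "fst e \<in> obj Cat" using Ev_obj e by (cases e) auto
      show "op (fst e) p (x e \<oplus>\<^bsub>V (fst e) (src p)\<^esub> y e) = op (fst e) p (x e) \<oplus>\<^bsub>V (fst e) (tgt p)\<^esub> op (fst e) p (y e)"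
        using linear_map_add[OF op_linear[OF o p]] Wc[OF x e s] Wc[OF y e s] by simp
      show "a \<in> carrier K \<Longrightarrow> op (fst e) p (a \<odot>\<^bsub>V (fst e) (src p)\<^esub> x e) = a \<odot>\<^bsub>V (fst e) (tgt p)\<^esub> op (fst e) p (x e)"
        using linear_map_smult[OF op_linear[OF o p]] Wc[OF x e s] by simp
    qed
    show "linear_map K (W (src p)) (W (tgt p)) (w p)"
    proof (rule linear_mapI[OF wc])
      fix x y assume x: "x \<in> carrier (W (src p))" and y: "y \<in> carrier (W (src p))"
      show "w p (x \<oplus>\<^bsub>W (src p)\<^esub> y) = w p x \<oplus>\<^bsub>W (tgt p)\<^esub> w p y"
        using lin(1)[OF _ x y] by (auto simp: w_def W_simps)
    next
      fix a x assume a: "a \<in> carrier K" and x: "x \<in> carrier (W (src p))"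
      show "w p (a \<odot>\<^bsub>W (src p)\<^esub> x) = a \<odot>\<^bsub>W (tgt p)\<^esub> w p x"
        using lin(2)[OF _ x x a] by (auto simp: w_def W_simps)
    qed
  qed
  have hom: "rep_hom W w (V (fst e)) (op (fst e)) (\<lambda>s x. x e)" if e: "e \<in> Ev" for e
    unfolding rep_hom_def
    using e by (intro conjI ballI linear_mapI Wc) (simp_all add: W_simps(3,4) w_def)
  have smallW: "small U (carrier (W s))" if "s \<in> S" for s
    unfolding W_simps X_def
    by (intro small_image[OF univ] small_lists[OF univ] small_Sigma[OF univ] small_K small_Sym that)
  \<comment> \<open>The coordinates of a combination lie in the union of the uniform bounds for its
    finitely many symbols.\<close>
  have finW: "finite {b \<in> B. w (co s b) x \<noteq> \<zero>\<^bsub>W s\<^esub>}" if s: "s \<in> S" and x: "x \<in> carrier (W s)" for s x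
  proof -
    obtain xs where xs: "xs \<in> X s" "x = F s xs" using x by (auto simp: W_simps)
    obtain D where D: "\<And>z. z \<in> Sym s \<Longrightarrow> finite (D z)"
      "\<And>z T ev. \<lbrakk>z \<in> Sym s; (T, ev) \<in> Ev\<rbrakk> \<Longrightarrow> {b \<in> B. op T (co s b) (ev s z) \<noteq> \<zero>\<^bsub>V T s\<^esub>} \<subseteq> D z"
    proof -
      have "\<forall>z. \<exists>D. z \<in> Sym s \<longrightarrow> finite D \<and>
        (\<forall>(T, ev)\<in>Ev. {b \<in> B. op T (co s b) (ev s z) \<noteq> \<zero>\<^bsub>V T s\<^esub>} \<subseteq> D)" using fin[OF s] by blast
      then obtain D where "\<forall>z. z \<in> Sym s \<longrightarrow> finite (D z) \<and>
        (\<forall>(T, ev)\<in>Ev. {b \<in> B. op T (co s b) (ev s z) \<noteq> \<zero>\<^bsub>V T s\<^esub>} \<subseteq> D z)" by (rule choice[THEN exE]) blast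
      then show ?thesis by (intro that[of D]) blast+
    qed
    have z: "op (fst e) (co s b) (F s ys e) = \<zero>\<^bsub>V (fst e) s\<^esub>"
      if e: "e \<in> Ev" and b: "b \<in> B" "b \<notin> (\<Union>kz\<in>set ys. D (snd kz))" and ys: "ys \<in> X s" for e b ys
    proof -
      have o: "fst e \<in> obj Cat" using Ev_obj e by (cases e) auto
      note c = co[OF s b(1)]
      have l: "linear_map K (V (fst e) s) (V (fst e) s) (op (fst e) (co s b))"
        using op_linear[OF o, of "co s b"] c by simp
      interpret module K "V (fst e) s" using mod e s by blast
      have zero: "op (fst e) (co s b) (snd e s z) = \<zero>\<^bsub>V (fst e) s\<^esub>" if "z \<in> Sym s" "b \<notin> D z" for z
        using D(2)[OF that(1), of "fst e" "snd e"] e b(1) that(2) by auto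
      show ?thesis using ys b(2)
      proof (induction ys)
        case Nil
        then show ?case using linear_map_zero[OF module_axioms module_axioms l] e by (simp add: F_Nil)
      next
        case (Cons kz ys)
        then have "fst kz \<in> carrier K" "snd kz \<in> Sym s" "ys \<in> X s" by (auto simp: X_def)
        then show ?case using Cons F_closed[OF e s] evc[OF e s]
          by (simp add: F_Cons e linear_map_add[OF l] linear_map_smult[OF l] zero)
      qed
    qed
    have "{b \<in> B. w (co s b) x \<noteq> \<zero>\<^bsub>W s\<^esub>} \<subseteq> (\<Union>kz\<in>set xs. D (snd kz))"
    proof (rule subsetI, rule ccontr)
      fix b assume b: "b \<in> {b \<in> B. w (co s b) x \<noteq> \<zero>\<^bsub>W s\<^esub>}" "b \<notin> (\<Union>kz\<in>set xs. D (snd kz))"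
      then have "w (co s b) x = \<zero>\<^bsub>W s\<^esub>"
        unfolding xs(2) W_simps(2) w_def using z[OF _ _ b(2) xs(1)] F_Nil F_out by fastforce
      then show False using b by simp
    qed
    moreover have "finite (\<Union>kz\<in>set xs. D (snd kz))" using xs(1) D(1) by (auto simp: X_def lists_eq_set)
    ultimately show ?thesis by (rule finite_subset)
  qed
  \<comment> \<open>The carriers consist of functions on \<open>Ev\<close>; they are small and are
    moved into \<open>'u\<close>.\<close>
  obtain f :: "'s \<Rightarrow> ('m \<times> ('s \<Rightarrow> 'z \<Rightarrow> 'u) \<Rightarrow> 'u) \<Rightarrow> 'u" where f: "\<forall>s\<in>S. inj_on (f s) (carrier (W s))"
    using small_inj_family[of "\<lambda>s. carrier (W s)"] smallW by blast
  let ?T = "\<lambda>s. transport (W s) (f s)"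
  obtain w' where w': "rep ?T w'" "rep_hom W w ?T w' f" using transport_rep[OF rep, of f] f by blast
  have cT: "carrier (?T s) = f s ` carrier (W s)" for s by (simp add: transport_def)
  have bij: "bij_betw (f s) (carrier (W s)) (carrier (?T s))" if "s \<in> S" for s
    using f that by (auto simp: bij_betw_def cT)
  let ?i = "\<lambda>s. inv_into (carrier (W s)) (f s)"
  have inv: "rep_hom ?T w' W w ?i" by (rule rep_hom_inverse[OF rep w' bij])
  have iT: "?i s y \<in> carrier (W s)" "f s (?i s y) = y" if "s \<in> S" "y \<in> carrier (?T s)" for s y
    using that cT f by (auto simp: inv_into_into f_inv_into_f)
  have if': "?i s (f s x) = x" if "s \<in> S" "x \<in> carrier (W s)" for s x using that f by simp
  have T0: "f s \<zero>\<^bsub>W s\<^esub> = \<zero>\<^bsub>?T s\<^esub>" for s by (simp add: transport_def)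
  \<comment> \<open>The separating family consists of the evaluations themselves, read back through
    the inverse of the transport.\<close>
  have "\<exists>M\<in>obj Cat. (\<forall>s\<in>S. V M s = ?T s) \<and> (\<forall>p\<in>Op. \<forall>x\<in>carrier (?T (src p)). op M p x = w' p x)"
  proof (rule create_inj[OF w'(1), where \<Gamma> = "{(fst e, \<lambda>s y. ?i s y e) | e. e \<in> Ev}"])
    show "small U (carrier (?T s))" if "s \<in> S" for s
      unfolding cT by (intro small_image[OF univ] smallW that)
  next
    fix T g assume "(T, g) \<in> {(fst e, \<lambda>s y. ?i s y e) | e. e \<in> Ev}"
    then obtain e where e: "e \<in> Ev" "T = fst e" "g = (\<lambda>s y. ?i s y e)" by auto
    moreover have "T \<in> obj Cat" using Ev_obj e by (cases e) auto
    ultimately show "T \<in> obj Cat \<and> rep_hom ?T w' (V T) (op T) g"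
      using rep_hom_comp[OF inv hom[OF e(1)]] by simp
  next
    fix s y assume s: "s \<in> S" and y: "y \<in> carrier (?T s)"
      and z: "\<And>T g. (T, g) \<in> {(fst e, \<lambda>s y. ?i s y e) | e. e \<in> Ev} \<Longrightarrow> g s y = \<zero>\<^bsub>V T s\<^esub>"
    have "?i s y = \<zero>\<^bsub>W s\<^esub>"
    proof (rule W_ext[OF iT(1)[OF s y] W0])
      fix e assume e: "e \<in> Ev"
      then have "(fst e, \<lambda>s y. ?i s y e) \<in> {(fst e, \<lambda>s y. ?i s y e) | e. e \<in> Ev}" by blast
      from z[OF this] show "?i s y e = \<zero>\<^bsub>W s\<^esub> e" using F_Nil[OF e] by (simp add: W_simps(2))
    qed
    then show "y = \<zero>\<^bsub>?T s\<^esub>" using iT(2)[OF s y] T0 by metis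
  next
    fix s y assume s: "s \<in> S" and y: "y \<in> carrier (?T s)"
    have "w (co s b) (?i s y) = \<zero>\<^bsub>W s\<^esub> \<Longrightarrow> w' (co s b) y = \<zero>\<^bsub>?T s\<^esub>" if b: "b \<in> B" for b
      using rep_hom_op[OF w'(2), of "co s b" "?i s y"] co[OF s b] iT[OF s y] T0[of s] by auto
    then have "{b \<in> B. w' (co s b) y \<noteq> \<zero>\<^bsub>?T s\<^esub>} \<subseteq> {b \<in> B. w (co s b) (?i s y) \<noteq> \<zero>\<^bsub>W s\<^esub>}" by blast
    then show "finite {b \<in> B. w' (co s b) y \<noteq> \<zero>\<^bsub>?T s\<^esub>}"
      using finW[OF s iT(1)[OF s y]] finite_subset by blast
  qed
  then obtain P where P: "P \<in> obj Cat" "\<And>s. s \<in> S \<Longrightarrow> V P s = ?T s"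
    "\<And>p x. \<lbrakk>p \<in> Op; x \<in> carrier (?T (src p))\<rbrakk> \<Longrightarrow> op P p x = w' p x" by blast
  define \<iota> where "\<iota> s z = f s (F s [(\<one>\<^bsub>K\<^esub>, z)])" for s z
  have X1: "[(\<one>\<^bsub>K\<^esub>, z)] \<in> X s" if "z \<in> Sym s" for s z using that by (auto simp: X_def)
  have F1: "F s [(\<one>\<^bsub>K\<^esub>, z)] e = snd e s z" if "e \<in> Ev" "s \<in> S" "z \<in> Sym s" for s z e
  proof -
    interpret module K "V (fst e) s" using mod that by blast
    show ?thesis using that evc by (simp add: F_Cons F_Nil)
  qed
  have \<iota>: "\<iota> s z \<in> carrier (V P s)" if "s \<in> S" "z \<in> Sym s" for s z
    using P(2)[OF that(1)] X1[OF that(2)] by (auto simp: \<iota>_def cT W_simps(1))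
  have h_ex: "\<exists>h\<in>arr Cat P (fst e). \<forall>s\<in>S. \<forall>x\<in>carrier (V P s). ap h s x = ?i s x e" if e: "e \<in> Ev" for e
  proof (rule arr_ex[OF P(1)])
    show "fst e \<in> obj Cat" using Ev_obj e by (cases e) auto
    show "rep_hom (V P) (op P) (V (fst e)) (op (fst e)) (\<lambda>s x. ?i s x e)"
      using rep_hom_comp[OF inv hom[OF e]] P src_sort unfolding rep_hom_def by simp
  qed
  have i\<iota>: "?i s (\<iota> s z) e = snd e s z" if "e \<in> Ev" "s \<in> S" "z \<in> Sym s" for e s z
    using that X1 F1 if' by (simp add: \<iota>_def W_simps(1))
  \<comment> \<open>Every element is a finite combination of symbols, so an arrow out of
    \<open>P\<close> is determined by its values at them.\<close>
  have span: "f' = g'" if T: "T \<in> obj Cat" and f': "f' \<in> arr Cat P T" and g': "g' \<in> arr Cat P T"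
    and eq: "\<And>s z. \<lbrakk>s \<in> S; z \<in> Sym s\<rbrakk> \<Longrightarrow> ap f' s (\<iota> s z) = ap g' s (\<iota> s z)" for T f' g'
  proof (rule arr_ext[OF P(1) T f' g'])
    fix s m assume s: "s \<in> S" and m: "m \<in> carrier (V P s)"
    obtain xs where xs: "xs \<in> X s" "m = f s (F s xs)" using m P(2)[OF s] by (auto simp: cT W_simps(1))
    note lf = ap_linear[OF P(1) T f' s] and lg = ap_linear[OF P(1) T g' s]
    have lin: "linear_map K (W s) (V P s) (f s)" using rep_hom_linear[OF w'(2) s] P(2)[OF s] by simp
    have "ap f' s (f s (F s xs)) = ap g' s (f s (F s xs))" using xs(1)
    proof (induction xs)
      case Nil
      have "f s (F s []) = \<zero>\<^bsub>V P s\<^esub>" using T0[of s] P(2)[OF s] by (simp add: W_simps(2))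
      then show ?case using ap_zero[OF P(1) T _ s] f' g' by simp
    next
      case (Cons kz xs)
      obtain k z where kz: "kz = (k, z)" by (cases kz)
      have c: "k \<in> carrier K" "z \<in> Sym s" "xs \<in> X s" using Cons.prems kz by (auto simp: X_def)
      have F1c: "F s [(\<one>\<^bsub>K\<^esub>, z)] \<in> carrier (W s)" "F s xs \<in> carrier (W s)" using X1 c by (auto simp: W_simps(1))
      have "F s (kz # xs) = (k \<odot>\<^bsub>W s\<^esub> F s [(\<one>\<^bsub>K\<^esub>, z)]) \<oplus>\<^bsub>W s\<^esub> F s xs"
        unfolding W_simps by (rule F_ext) (use c s F1 kz in \<open>auto simp: F_Cons\<close>)
      then have "f s (F s (kz # xs)) = (k \<odot>\<^bsub>V P s\<^esub> \<iota> s z) \<oplus>\<^bsub>V P s\<^esub> f s (F s xs)"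
        using c F1c W_cl(2)[OF s F1c(1) F1c(1)] by (simp add: linear_map_add[OF lin] linear_map_smult[OF lin] \<iota>_def)
      moreover have "f s (F s xs) \<in> carrier (V P s)" using linear_map_closed[OF lin F1c(2)] .
      moreover have "k \<odot>\<^bsub>V P s\<^esub> \<iota> s z \<in> carrier (V P s)"
        using module.smult_closed[OF objM[OF P(1) s] c(1) \<iota>[OF s c(2)]] .
      ultimately show ?case using c s \<iota>[OF s c(2)] eq Cons.IH[OF c(3)]
        by (simp add: linear_map_add[OF lf] linear_map_add[OF lg] linear_map_smult[OF lf] linear_map_smult[OF lg])
    qed
    then show "ap f' s m = ap g' s m" using xs by simp
  qed
  \<comment> \<open>Elements are functions on \<open>Ev\<close> up to transport; one that vanishes
    under all evaluation arrows is the zero function.\<close>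
  have joint: "x = \<zero>\<^bsub>V P s\<^esub>" if s: "s \<in> S" and x: "x \<in> carrier (V P s)"
    and z: "\<And>T ev h. \<lbrakk>(T, ev) \<in> Ev; h \<in> arr Cat P T; \<forall>s\<in>S. \<forall>z\<in>Sym s. ap h s (\<iota> s z) = ev s z\<rbrakk>
        \<Longrightarrow> ap h s x = \<zero>\<^bsub>V T s\<^esub>" for s x
  proof -
    have x': "x \<in> carrier (?T s)" using x P(2)[OF s] by simp
    have "?i s x = \<zero>\<^bsub>W s\<^esub>"
    proof (rule W_ext[OF iT(1)[OF s x'] W0])
      fix e assume e: "e \<in> Ev"
      obtain h where h: "h \<in> arr Cat P (fst e)" "\<forall>s\<in>S. \<forall>x\<in>carrier (V P s). ap h s x = ?i s x e" using h_ex[OF e] by blast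
      have "\<forall>s\<in>S. \<forall>z\<in>Sym s. ap h s (\<iota> s z) = snd e s z" using h(2) i\<iota>[OF e] \<iota> by simp
      then have "ap h s x = \<zero>\<^bsub>V (fst e) s\<^esub>" using z[of "fst e" "snd e"] e h(1) by simp
      then show "?i s x e = \<zero>\<^bsub>W s\<^esub> e" using h(2) s x F_Nil[OF e] by (simp add: W_simps(2))
    qed
    then show ?thesis using iT(2)[OF s x'] T0[of s] P(2)[OF s] by simp
  qed
  have ev_ex: "\<exists>h\<in>arr Cat P T. \<forall>s\<in>S. \<forall>z\<in>Sym s. ap h s (\<iota> s z) = ev s z" if "(T, ev) \<in> Ev" for T ev
    using h_ex[OF that] i\<iota>[OF that] \<iota> by fastforce
  show thesis by (rule that[OF P(1) \<iota> ev_ex span joint])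
qed

end

context operator_category begin

section \<open>Coproducts and the preadditive structure\<close>

text \<open>The symbols are the elements of the summands, tagged by their index, and the evaluations
  are all families of arrows out of the summands. The universal property is then existence and
  uniqueness of evaluation arrows, and relations such as additivity hold in the presented object
  because every such family respects them.\<close>

lemma coproduct_exists:
  fixes I :: "'i set"
  assumes I: "small U I" and F: "\<And>i. i \<in> I \<Longrightarrow> F i \<in> obj Cat"
  shows "\<exists>P inc. is_coproduct Cat I F P inc"
proof -
  let ?Sym = "\<lambda>s. SIGMA i:I. carrier (V (F i) s)"
  let ?act = "\<lambda>p (i, m). (i, op (F i) p m)"
  let ?ev = "\<lambda>t s (i, m). ap (t i) s m"
  let ?Ev = "{(T, ?ev t) | T t. T \<in> obj Cat \<and> (\<forall>i\<in>I. t i \<in> arr Cat (F i) T)}"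
  have fin: "\<exists>D. finite D \<and> (\<forall>(T, ev)\<in>?Ev. {b \<in> B. op T (co s b) (ev s z) \<noteq> \<zero>\<^bsub>V T s\<^esub>} \<subseteq> D)"
    if s: "s \<in> S" and z: "z \<in> ?Sym s" for s z
  proof -
    obtain i m where im: "z = (i, m)" "i \<in> I" "m \<in> carrier (V (F i) s)" using z by auto
    \<comment> \<open>An arrow commutes with coordinates, so the image of \<open>m\<close> has no
      nonzero coordinates beyond those of \<open>m\<close>, whatever the family
      \<open>t\<close>.\<close>
    let ?D = "{b \<in> B. op (F i) (co s b) m \<noteq> \<zero>\<^bsub>V (F i) s\<^esub>}"
    have "op T (co s b) (ap (t i) s m) = \<zero>\<^bsub>V T s\<^esub>"
      if T: "T \<in> obj Cat" "\<forall>i\<in>I. t i \<in> arr Cat (F i) T" and b: "b \<in> B" "b \<notin> ?D" for T t b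
    proof -
      have ti: "t i \<in> arr Cat (F i) T" using T im by blast
      have "ap (t i) s (op (F i) (co s b) m) = op T (co s b) (ap (t i) s m)"
        using ap_op[OF F[OF im(2)] T(1) ti, of "co s b" m] co[OF s b(1)] im(3) by simp
      then show ?thesis using b ap_zero[OF F[OF im(2)] T(1) ti s] by simp
    qed
    then show ?thesis using obj_finite[OF F[OF im(2)] s im(3)] im(1) by (intro exI[of _ ?D]) auto
  qed
  obtain P \<iota> where P: "P \<in> obj Cat" and \<iota>: "\<And>s z. \<lbrakk>s \<in> S; z \<in> ?Sym s\<rbrakk> \<Longrightarrow> \<iota> s z \<in> carrier (V P s)"
    and ex: "\<And>T ev. (T, ev) \<in> ?Ev \<Longrightarrow> \<exists>h\<in>arr Cat P T. \<forall>s\<in>S. \<forall>z\<in>?Sym s. ap h s (\<iota> s z) = ev s z"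
    and uniq: "\<And>T f g. \<lbrakk>T \<in> obj Cat; f \<in> arr Cat P T; g \<in> arr Cat P T;
      \<And>s z. \<lbrakk>s \<in> S; z \<in> ?Sym s\<rbrakk> \<Longrightarrow> ap f s (\<iota> s z) = ap g s (\<iota> s z)\<rbrakk> \<Longrightarrow> f = g"
    and joint: "\<And>s x. \<lbrakk>s \<in> S; x \<in> carrier (V P s);
      \<And>T ev h. \<lbrakk>(T, ev) \<in> ?Ev; h \<in> arr Cat P T; \<forall>s\<in>S. \<forall>z\<in>?Sym s. ap h s (\<iota> s z) = ev s z\<rbrakk>
        \<Longrightarrow> ap h s x = \<zero>\<^bsub>V T s\<^esub>\<rbrakk> \<Longrightarrow> x = \<zero>\<^bsub>V P s\<^esub>"
  proof (rule presentation[of ?Sym ?act ?Ev])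
    show "small U (?Sym s)" if "s \<in> S" for s
      by (intro small_Sigma[OF univ] I obj_small F that)
    show "?act p z \<in> ?Sym (tgt p)" if "p \<in> Op" "z \<in> ?Sym (src p)" for p z
      using that op_closed[OF F] by auto
    show "ev s z \<in> carrier (V T s)" if "(T, ev) \<in> ?Ev" "s \<in> S" "z \<in> ?Sym s" for T ev s z
      using that ap_closed[OF F] by auto
    show "ev (tgt p) (?act p z) = op T p (ev (src p) z)" if "(T, ev) \<in> ?Ev" "p \<in> Op" "z \<in> ?Sym (src p)" for T ev p z
      using that ap_op[OF F] by auto
  qed (use fin in auto)
  have hom: "rep_hom (V (F i)) (op (F i)) (V P) (op P) (\<lambda>s m. \<iota> s (i, m))" if i: "i \<in> I" for i
  proof -
    \<comment> \<open>Elements of \<open>P\<close> are equal if all arrows induced by such families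
      agree on them.\<close>
    have zero: "x = y"
      if s: "s \<in> S" and x: "x \<in> carrier (V P s)" and y: "y \<in> carrier (V P s)"
        and eq: "\<And>T t h. \<lbrakk>T \<in> obj Cat; \<forall>i\<in>I. t i \<in> arr Cat (F i) T; h \<in> arr Cat P T;
          \<And>s i m. \<lbrakk>s \<in> S; i \<in> I; m \<in> carrier (V (F i) s)\<rbrakk> \<Longrightarrow> ap h s (\<iota> s (i, m)) = ap (t i) s m\<rbrakk>
          \<Longrightarrow> ap h s x = ap h s y" for s x y
    proof -
      interpret P: module K "V P s" using objM[OF P s] .
      have "x \<ominus>\<^bsub>V P s\<^esub> y = \<zero>\<^bsub>V P s\<^esub>"
      proof (rule joint[OF s])
        show "x \<ominus>\<^bsub>V P s\<^esub> y \<in> carrier (V P s)" using x y by simp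
        fix T ev h assume h: "(T, ev) \<in> ?Ev" "h \<in> arr Cat P T" "\<forall>s\<in>S. \<forall>z\<in>?Sym s. ap h s (\<iota> s z) = ev s z"
        then obtain t where t: "T \<in> obj Cat" "\<forall>i\<in>I. t i \<in> arr Cat (F i) T" "ev = ?ev t" by auto
        have "ap h s' (\<iota> s' (i, m)) = ap (t i) s' m" if "s' \<in> S" "i \<in> I" "m \<in> carrier (V (F i) s')" for s' i m
          using h(3) t(3) that by auto
        then have "ap h s x = ap h s y" using eq[OF t(1,2) h(2)] by blast
        interpret T: module K "V T s" using objM[OF t(1) s] .
        from \<open>ap h s x = ap h s y\<close> show "ap h s (x \<ominus>\<^bsub>V P s\<^esub> y) = \<zero>\<^bsub>V T s\<^esub>"
          using linear_map_minus[OF P.module_axioms T.module_axioms ap_linear[OF P t(1) h(2) s] x y]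
            ap_closed[OF P t(1) h(2) s y] by (simp add: a_minus_def T.M.r_neg)
      qed
      then show ?thesis by (rule minus_zeroD[OF P.module_axioms _ x y])
    qed
    have cl: "\<iota> s (i, m) \<in> carrier (V P s)" if "s \<in> S" "m \<in> carrier (V (F i) s)" for s m
      using \<iota> that i by blast
    show ?thesis
      unfolding rep_hom_def
    proof (intro conjI ballI linear_mapI cl)
      fix s x y assume s: "s \<in> S" and x: "x \<in> carrier (V (F i) s)" and y: "y \<in> carrier (V (F i) s)"
      interpret Fi: module K "V (F i) s" using objM[OF F[OF i] s] .
      interpret P: module K "V P s" using objM[OF P s] .
      show "\<iota> s (i, x \<oplus>\<^bsub>V (F i) s\<^esub> y) = \<iota> s (i, x) \<oplus>\<^bsub>V P s\<^esub> \<iota> s (i, y)"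
      proof (rule zero[OF s])
        fix T t h assume h: "T \<in> obj Cat" "\<forall>i\<in>I. t i \<in> arr Cat (F i) T" "h \<in> arr Cat P T"
          and e: "\<And>s i m. \<lbrakk>s \<in> S; i \<in> I; m \<in> carrier (V (F i) s)\<rbrakk> \<Longrightarrow> ap h s (\<iota> s (i, m)) = ap (t i) s m"
        have ti: "t i \<in> arr Cat (F i) T" using h i by blast
        show "ap h s (\<iota> s (i, x \<oplus>\<^bsub>V (F i) s\<^esub> y)) = ap h s (\<iota> s (i, x) \<oplus>\<^bsub>V P s\<^esub> \<iota> s (i, y))"
          using e[OF s i] x y cl[OF s] linear_map_add[OF ap_linear[OF P h(1,3) s]]
            linear_map_add[OF ap_linear[OF F[OF i] h(1) ti s]] by simp
      qed (use cl[OF s] x y in auto)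
    next
      fix s a x assume s: "s \<in> S" and x: "x \<in> carrier (V (F i) s)" and a: "a \<in> carrier K"
      interpret Fi: module K "V (F i) s" using objM[OF F[OF i] s] .
      interpret P: module K "V P s" using objM[OF P s] .
      show "\<iota> s (i, a \<odot>\<^bsub>V (F i) s\<^esub> x) = a \<odot>\<^bsub>V P s\<^esub> \<iota> s (i, x)"
      proof (rule zero[OF s])
        fix T t h assume h: "T \<in> obj Cat" "\<forall>i\<in>I. t i \<in> arr Cat (F i) T" "h \<in> arr Cat P T"
          and e: "\<And>s i m. \<lbrakk>s \<in> S; i \<in> I; m \<in> carrier (V (F i) s)\<rbrakk> \<Longrightarrow> ap h s (\<iota> s (i, m)) = ap (t i) s m"
        have ti: "t i \<in> arr Cat (F i) T" using h i by blast
        show "ap h s (\<iota> s (i, a \<odot>\<^bsub>V (F i) s\<^esub> x)) = ap h s (a \<odot>\<^bsub>V P s\<^esub> \<iota> s (i, x))"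
          using e[OF s i] x a cl[OF s] linear_map_smult[OF ap_linear[OF P h(1,3) s]]
            linear_map_smult[OF ap_linear[OF F[OF i] h(1) ti s]] by simp
      qed (use cl[OF s] x a in auto)
    next
      fix p x assume p: "p \<in> Op" and x: "x \<in> carrier (V (F i) (src p))"
      note s = src_sort[OF p] and t = tgt_sort[OF p]
      note px = op_closed[OF F[OF i] p x]
      show "\<iota> (tgt p) (i, op (F i) p x) = op P p (\<iota> (src p) (i, x))"
      proof (rule zero[OF t cl[OF t px] op_closed[OF P p cl[OF s x]]])
        fix T t h assume h: "T \<in> obj Cat" "\<forall>i\<in>I. t i \<in> arr Cat (F i) T" "h \<in> arr Cat P T"
          and e: "\<And>s i m. \<lbrakk>s \<in> S; i \<in> I; m \<in> carrier (V (F i) s)\<rbrakk> \<Longrightarrow> ap h s (\<iota> s (i, m)) = ap (t i) s m"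
        have ti: "t i \<in> arr Cat (F i) T" using h i by blast
        show "ap h (tgt p) (\<iota> (tgt p) (i, op (F i) p x)) = ap h (tgt p) (op P p (\<iota> (src p) (i, x)))"
          using e[OF tgt_sort[OF p] i px] e[OF s i x] ap_op[OF P h(1,3) p cl[OF s x]] ap_op[OF F[OF i] h(1) ti p x] by simp
      qed
    qed
  qed
  have "\<exists>h\<in>arr Cat (F i) P. \<forall>s\<in>S. \<forall>m\<in>carrier (V (F i) s). ap h s m = \<iota> s (i, m)" if "i \<in> I" for i
    using arr_ex[OF F[OF that] P hom[OF that]] .
  then obtain inc where inc: "\<And>i. i \<in> I \<Longrightarrow> inc i \<in> arr Cat (F i) P"
    "\<And>i s m. \<lbrakk>i \<in> I; s \<in> S; m \<in> carrier (V (F i) s)\<rbrakk> \<Longrightarrow> ap (inc i) s m = \<iota> s (i, m)" by metis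
  have "is_coproduct Cat I F P inc"
    unfolding is_coproduct_def
  proof (intro conjI ballI allI impI P inc)
    fix T t assume T: "T \<in> obj Cat" and t: "\<forall>i\<in>I. t i \<in> arr Cat (F i) T"
    then have "(T, ?ev t) \<in> ?Ev" by blast
    from ex[OF this] obtain u where u: "u \<in> arr Cat P T" "\<forall>s\<in>S. \<forall>z\<in>?Sym s. ap u s (\<iota> s z) = ?ev t s z" by blast
    show "\<exists>!u. u \<in> arr Cat P T \<and> (\<forall>i\<in>I. cmp Cat (F i) P T u (inc i) = t i)"
    proof (rule ex1I[of _ u])
      show "u \<in> arr Cat P T \<and> (\<forall>i\<in>I. cmp Cat (F i) P T u (inc i) = t i)"
      proof (intro conjI ballI u(1))
        fix i assume i: "i \<in> I"
        show "cmp Cat (F i) P T u (inc i) = t i"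
          using u(2) inc t i T P F by (intro arr_cmp_eqI u(1)) auto
      qed
      fix v assume v: "v \<in> arr Cat P T \<and> (\<forall>i\<in>I. cmp Cat (F i) P T v (inc i) = t i)"
      show "v = u"
      proof (rule uniq[OF T])
        fix s z assume s: "s \<in> S" and z: "z \<in> ?Sym s"
        then obtain i m where im: "z = (i, m)" "i \<in> I" "m \<in> carrier (V (F i) s)" by blast
        have "ap v s (ap (inc i) s m) = ap (t i) s m"
          using cmp(2)[OF F[OF im(2)] P T inc(1)[OF im(2)] _ s im(3), of v] v im by auto
        moreover have "ap u s (\<iota> s z) = ap (t i) s m" using u(2) s z im by auto
        ultimately show "ap v s (\<iota> s z) = ap u s (\<iota> s z)" using inc(2)[OF im(2) s im(3)] im(1) by simp
      qed (use u v in auto)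
    qed
  qed
  then show ?thesis by blast
qed

text \<open>Arrows are visible only through \<open>ap\<close>, so the sum is chosen among the arrows
  with the pointwise values; \<open>arr_ext\<close> makes it unique.\<close>

definition add_arr :: "'m \<Rightarrow> 'm \<Rightarrow> 'h \<Rightarrow> 'h \<Rightarrow> 'h" where
  "add_arr M N f g = (SOME h. h \<in> arr Cat M N \<and>
     (\<forall>s\<in>S. \<forall>m\<in>carrier (V M s). ap h s m = ap f s m \<oplus>\<^bsub>V N s\<^esub> ap g s m))"

definition zero_arr :: "'m \<Rightarrow> 'm \<Rightarrow> 'h" where
  "zero_arr M N = (SOME h. h \<in> arr Cat M N \<and> (\<forall>s\<in>S. \<forall>m\<in>carrier (V M s). ap h s m = \<zero>\<^bsub>V N s\<^esub>))"

lemma add_arr: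
  assumes o: "M \<in> obj Cat" "N \<in> obj Cat" and f: "f \<in> arr Cat M N" and g: "g \<in> arr Cat M N"
  shows "add_arr M N f g \<in> arr Cat M N"
    "\<lbrakk>s \<in> S; m \<in> carrier (V M s)\<rbrakk> \<Longrightarrow> ap (add_arr M N f g) s m = ap f s m \<oplus>\<^bsub>V N s\<^esub> ap g s m"
proof -
  have "rep_hom (V M) (op M) (V N) (op N) (\<lambda>s m. ap f s m \<oplus>\<^bsub>V N s\<^esub> ap g s m)"
    unfolding rep_hom_def
  proof (intro conjI ballI)
    show "linear_map K (V M s) (V N s) (\<lambda>m. ap f s m \<oplus>\<^bsub>V N s\<^esub> ap g s m)" if "s \<in> S" for s
      using o f g that by (intro linear_map_plus objM ap_linear)
    fix p m assume p: "p \<in> Op" and m: "m \<in> carrier (V M (src p))"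
    show "ap f (tgt p) (op M p m) \<oplus>\<^bsub>V N (tgt p)\<^esub> ap g (tgt p) (op M p m)
        = op N p (ap f (src p) m \<oplus>\<^bsub>V N (src p)\<^esub> ap g (src p) m)"
      using ap_op[OF o f p m] ap_op[OF o g p m] linear_map_add[OF op_linear[OF o(2) p]]
        ap_closed[OF o f src_sort[OF p] m] ap_closed[OF o g src_sort[OF p] m] by simp
  qed
  from arr_ex[OF o this] have "\<exists>h. h \<in> arr Cat M N \<and>
     (\<forall>s\<in>S. \<forall>m\<in>carrier (V M s). ap h s m = ap f s m \<oplus>\<^bsub>V N s\<^esub> ap g s m)" by blast
  from someI_ex[OF this] show "add_arr M N f g \<in> arr Cat M N"
    "\<lbrakk>s \<in> S; m \<in> carrier (V M s)\<rbrakk> \<Longrightarrow> ap (add_arr M N f g) s m = ap f s m \<oplus>\<^bsub>V N s\<^esub> ap g s m"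
    unfolding add_arr_def by blast+
qed

lemma zero_arr:
  assumes o: "M \<in> obj Cat" "N \<in> obj Cat"
  shows "zero_arr M N \<in> arr Cat M N"
    "\<lbrakk>s \<in> S; m \<in> carrier (V M s)\<rbrakk> \<Longrightarrow> ap (zero_arr M N) s m = \<zero>\<^bsub>V N s\<^esub>"
proof -
  have "rep_hom (V M) (op M) (V N) (op N) (\<lambda>s m. \<zero>\<^bsub>V N s\<^esub>)"
    unfolding rep_hom_def
    using o linear_map_zero[OF objM[OF o(2) src_sort] objM[OF o(2) tgt_sort] op_linear[OF o(2)]]
    by (auto intro!: linear_map_null objM)
  from arr_ex[OF o this] have "\<exists>h. h \<in> arr Cat M N \<and> (\<forall>s\<in>S. \<forall>m\<in>carrier (V M s). ap h s m = \<zero>\<^bsub>V N s\<^esub>)" by blast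
  from someI_ex[OF this] show "zero_arr M N \<in> arr Cat M N"
    "\<lbrakk>s \<in> S; m \<in> carrier (V M s)\<rbrakk> \<Longrightarrow> ap (zero_arr M N) s m = \<zero>\<^bsub>V N s\<^esub>"
    unfolding zero_arr_def by blast+
qed

lemma neg_arr:
  assumes o: "M \<in> obj Cat" "N \<in> obj Cat" and f: "f \<in> arr Cat M N"
  shows "\<exists>g\<in>arr Cat M N. \<forall>s\<in>S. \<forall>m\<in>carrier (V M s). ap g s m = (\<ominus>\<^bsub>K\<^esub> \<one>\<^bsub>K\<^esub>) \<odot>\<^bsub>V N s\<^esub> ap f s m"
proof (rule arr_ex[OF o])
  interpret K: cring K by (rule cring_K)
  show "rep_hom (V M) (op M) (V N) (op N) (\<lambda>s m. (\<ominus>\<^bsub>K\<^esub> \<one>\<^bsub>K\<^esub>) \<odot>\<^bsub>V N s\<^esub> ap f s m)"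
    unfolding rep_hom_def
  proof (intro conjI ballI)
    show "linear_map K (V M s) (V N s) (\<lambda>m. (\<ominus>\<^bsub>K\<^esub> \<one>\<^bsub>K\<^esub>) \<odot>\<^bsub>V N s\<^esub> ap f s m)" if "s \<in> S" for s
      using o f that by (intro linear_map_scale objM ap_linear) auto
    fix p m assume p: "p \<in> Op" and m: "m \<in> carrier (V M (src p))"
    show "(\<ominus>\<^bsub>K\<^esub> \<one>\<^bsub>K\<^esub>) \<odot>\<^bsub>V N (tgt p)\<^esub> ap f (tgt p) (op M p m) = op N p ((\<ominus>\<^bsub>K\<^esub> \<one>\<^bsub>K\<^esub>) \<odot>\<^bsub>V N (src p)\<^esub> ap f (src p) m)"
      using ap_op[OF o f p m] linear_map_smult[OF op_linear[OF o(2) p]]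
        ap_closed[OF o f src_sort[OF p] m] by simp
  qed
qed

lemma preadditive: "preadditive Cat add_arr zero_arr"
  unfolding preadditive_def
proof (intro conjI ballI)
  fix M N assume o: "M \<in> obj Cat" "N \<in> obj Cat"
  interpret K: cring K by (rule cring_K)
  let ?G = "\<lparr>carrier = arr Cat M N, monoid.mult = add_arr M N, one = zero_arr M N\<rparr>"
  have ax: "a \<oplus>\<^bsub>V N s\<^esub> b = b \<oplus>\<^bsub>V N s\<^esub> a" "a \<oplus>\<^bsub>V N s\<^esub> b \<oplus>\<^bsub>V N s\<^esub> c = a \<oplus>\<^bsub>V N s\<^esub> (b \<oplus>\<^bsub>V N s\<^esub> c)"
    "\<zero>\<^bsub>V N s\<^esub> \<oplus>\<^bsub>V N s\<^esub> a = a" "(\<ominus>\<^bsub>K\<^esub> \<one>\<^bsub>K\<^esub>) \<odot>\<^bsub>V N s\<^esub> a \<oplus>\<^bsub>V N s\<^esub> a = \<zero>\<^bsub>V N s\<^esub>"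
    if "s \<in> S" "a \<in> carrier (V N s)" "b \<in> carrier (V N s)" "c \<in> carrier (V N s)" for s a b c
  proof -
    interpret module K "V N s" using objM[OF o(2) that(1)] .
    show "a \<oplus>\<^bsub>V N s\<^esub> b = b \<oplus>\<^bsub>V N s\<^esub> a" "a \<oplus>\<^bsub>V N s\<^esub> b \<oplus>\<^bsub>V N s\<^esub> c = a \<oplus>\<^bsub>V N s\<^esub> (b \<oplus>\<^bsub>V N s\<^esub> c)"
      "\<zero>\<^bsub>V N s\<^esub> \<oplus>\<^bsub>V N s\<^esub> a = a" "(\<ominus>\<^bsub>K\<^esub> \<one>\<^bsub>K\<^esub>) \<odot>\<^bsub>V N s\<^esub> a \<oplus>\<^bsub>V N s\<^esub> a = \<zero>\<^bsub>V N s\<^esub>"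
      using that by (auto simp: M.a_assoc smult_l_minus M.l_neg intro: M.a_comm)
  qed
  note cl = ap_closed[OF o]
  show "comm_group ?G"
  proof (rule comm_groupI)
    fix f assume "f \<in> carrier ?G"
    then have f: "f \<in> arr Cat M N" by simp
    obtain g where g: "g \<in> arr Cat M N" "\<forall>s\<in>S. \<forall>m\<in>carrier (V M s). ap g s m = (\<ominus>\<^bsub>K\<^esub> \<one>\<^bsub>K\<^esub>) \<odot>\<^bsub>V N s\<^esub> ap f s m"
      using neg_arr[OF o f] by blast
    have "add_arr M N g f = zero_arr M N"
    proof (rule arr_ext[OF o add_arr(1)[OF o g(1) f] zero_arr(1)[OF o]])
      fix s m assume s: "s \<in> S" and m: "m \<in> carrier (V M s)"
      note c = cl[OF f s m]
      show "ap (add_arr M N g f) s m = ap (zero_arr M N) s m"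
        using add_arr(2)[OF o g(1) f s m] zero_arr(2)[OF o s m] g(2) s m ax(4)[OF s c c c] by simp
    qed
    then show "\<exists>y\<in>carrier ?G. y \<otimes>\<^bsub>?G\<^esub> f = \<one>\<^bsub>?G\<^esub>" using g(1) by (intro bexI[of _ g]) auto
    have "add_arr M N (zero_arr M N) f = f"
    proof (rule arr_ext[OF o add_arr(1)[OF o zero_arr(1)[OF o] f] f])
      fix s m assume s: "s \<in> S" and m: "m \<in> carrier (V M s)"
      note c = cl[OF f s m]
      show "ap (add_arr M N (zero_arr M N) f) s m = ap f s m"
        using add_arr(2)[OF o zero_arr(1)[OF o] f s m] zero_arr(2)[OF o s m] ax(3)[OF s c c c] by simp
    qed
    then show "\<one>\<^bsub>?G\<^esub> \<otimes>\<^bsub>?G\<^esub> f = f" by simp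
    fix g assume "g \<in> carrier ?G"
    then have g: "g \<in> arr Cat M N" by simp
    show "f \<otimes>\<^bsub>?G\<^esub> g \<in> carrier ?G" using add_arr(1)[OF o f g] by simp
    have "add_arr M N f g = add_arr M N g f"
    proof (rule arr_ext[OF o add_arr(1)[OF o f g] add_arr(1)[OF o g f]])
      fix s m assume s: "s \<in> S" and m: "m \<in> carrier (V M s)"
      show "ap (add_arr M N f g) s m = ap (add_arr M N g f) s m"
        using add_arr(2)[OF o f g s m] add_arr(2)[OF o g f s m]
          ax(1)[OF s cl[OF f s m] cl[OF g s m] cl[OF g s m]] by simp
    qed
    then show "f \<otimes>\<^bsub>?G\<^esub> g = g \<otimes>\<^bsub>?G\<^esub> f" by simp
    fix h assume "h \<in> carrier ?G"
    then have h: "h \<in> arr Cat M N" by simp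
    have "add_arr M N (add_arr M N f g) h = add_arr M N f (add_arr M N g h)"
    proof (rule arr_ext[OF o add_arr(1)[OF o add_arr(1)[OF o f g] h] add_arr(1)[OF o f add_arr(1)[OF o g h]]])
      fix s m assume s: "s \<in> S" and m: "m \<in> carrier (V M s)"
      show "ap (add_arr M N (add_arr M N f g) h) s m = ap (add_arr M N f (add_arr M N g h)) s m"
        using add_arr(2)[OF o add_arr(1)[OF o f g] h s m] add_arr(2)[OF o f g s m]
          add_arr(2)[OF o f add_arr(1)[OF o g h] s m] add_arr(2)[OF o g h s m]
          ax(2)[OF s cl[OF f s m] cl[OF g s m] cl[OF h s m]] by simp
    qed
    then show "f \<otimes>\<^bsub>?G\<^esub> g \<otimes>\<^bsub>?G\<^esub> h = f \<otimes>\<^bsub>?G\<^esub> (g \<otimes>\<^bsub>?G\<^esub> h)" by simp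
  qed (use zero_arr(1)[OF o] in auto)
next
  fix A M D f f' g g'
  assume o: "A \<in> obj Cat" "M \<in> obj Cat" "D \<in> obj Cat"
    and f: "f \<in> arr Cat A M" "f' \<in> arr Cat A M" and g: "g \<in> arr Cat M D" "g' \<in> arr Cat M D"
  show "cmp Cat A M D g (add_arr A M f f') = add_arr A D (cmp Cat A M D g f) (cmp Cat A M D g f')"
  proof (rule arr_cmp_eqI[OF o])
    fix s m assume s: "s \<in> S" and m: "m \<in> carrier (V A s)"
    show "ap g s (ap (add_arr A M f f') s m) = ap (add_arr A D (cmp Cat A M D g f) (cmp Cat A M D g f')) s m"
      using s m o f g by (simp add: add_arr cmp ap_closed linear_map_add[OF ap_linear[OF o(2,3) g(1) s]])
  qed (use o f g in \<open>auto intro!: add_arr cmp\<close>)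
  show "cmp Cat A M D (add_arr M D g g') f = add_arr A D (cmp Cat A M D g f) (cmp Cat A M D g' f)"
  proof (rule arr_cmp_eqI[OF o])
    fix s m assume s: "s \<in> S" and m: "m \<in> carrier (V A s)"
    show "ap (add_arr M D g g') s (ap f s m) = ap (add_arr A D (cmp Cat A M D g f) (cmp Cat A M D g' f)) s m"
      using s m o f g by (simp add: add_arr cmp ap_closed)
  qed (use o f g in \<open>auto intro!: add_arr cmp\<close>)
qed

text \<open>The coproduct over \<open>bool\<close> gives the inclusions, and its universal property
  the projections. The sum of the two composites is the identity because both have the same
  restrictions along the inclusions.\<close>

lemma biproduct_exists:
  assumes o: "A \<in> obj Cat" "B' \<in> obj Cat"
  shows "\<exists>P i1 i2 p1 p2. is_biproduct Cat add_arr A B' P i1 i2 p1 p2"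
proof -
  let ?F = "\<lambda>b :: bool. if b then A else B'"
  have F: "?F b \<in> obj Cat" for b using o by simp
  obtain P inc where P: "is_coproduct Cat (UNIV :: bool set) ?F P inc"
    using coproduct_exists[OF small_finite[OF univ], of UNIV ?F] F by auto
  have Po: "P \<in> obj Cat" and inc: "\<And>i. inc i \<in> arr Cat (?F i) P"
    and up: "\<And>T t. \<lbrakk>T \<in> obj Cat; \<forall>i. t i \<in> arr Cat (?F i) T\<rbrakk>
      \<Longrightarrow> \<exists>!u. u \<in> arr Cat P T \<and> (\<forall>i. cmp Cat (?F i) P T u (inc i) = t i)"
    using P by (auto simp: is_coproduct_def)
  let ?t1 = "\<lambda>b. if b then ident Cat A else zero_arr B' A"
  let ?t2 = "\<lambda>b. if b then zero_arr A B' else ident Cat B'"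
  have "\<forall>i. ?t1 i \<in> arr Cat (?F i) A" "\<forall>i. ?t2 i \<in> arr Cat (?F i) B'"
    using ident(1) zero_arr(1) o by auto
  note u1 = up[OF o(1) this(1)] and u2 = up[OF o(2) this(2)]
  obtain p1 where p1: "p1 \<in> arr Cat P A" "\<forall>i. cmp Cat (?F i) P A p1 (inc i) = ?t1 i"
    using ex1_implies_ex[OF u1] by blast
  obtain p2 where p2: "p2 \<in> arr Cat P B'" "\<forall>i. cmp Cat (?F i) P B' p2 (inc i) = ?t2 i"
    using ex1_implies_ex[OF u2] by blast
  let ?i1 = "inc True" and ?i2 = "inc False"
  have i1: "?i1 \<in> arr Cat A P" and i2: "?i2 \<in> arr Cat B' P" using inc[of True] inc[of False] by auto
  have e: "cmp Cat A P A p1 ?i1 = ident Cat A" "cmp Cat B' P A p1 ?i2 = zero_arr B' A"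
    "cmp Cat A P B' p2 ?i1 = zero_arr A B'" "cmp Cat B' P B' p2 ?i2 = ident Cat B'"
    using p1(2)[rule_format, of True] p1(2)[rule_format, of False]
      p2(2)[rule_format, of True] p2(2)[rule_format, of False] by auto
  have ape: "ap p1 s (ap ?i1 s m) = m" "ap p2 s (ap ?i1 s m) = \<zero>\<^bsub>V B' s\<^esub>" if "s \<in> S" "m \<in> carrier (V A s)" for s m
    using cmp(2)[OF o(1) Po o(1) i1 p1(1) that] cmp(2)[OF o(1) Po o(2) i1 p2(1) that] e
      ident(2)[OF o(1) that] zero_arr(2)[OF o that] by auto
  have ape': "ap p2 s (ap ?i2 s m) = m" "ap p1 s (ap ?i2 s m) = \<zero>\<^bsub>V A s\<^esub>" if "s \<in> S" "m \<in> carrier (V B' s)" for s m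
    using cmp(2)[OF o(2) Po o(1) i2 p1(1) that] cmp(2)[OF o(2) Po o(2) i2 p2(1) that] e
      ident(2)[OF o(2) that] zero_arr(2)[OF o(2,1) that] by auto
  let ?h = "add_arr P P (cmp Cat P A P ?i1 p1) (cmp Cat P B' P ?i2 p2)"
  have c1: "cmp Cat P A P ?i1 p1 \<in> arr Cat P P" and c2: "cmp Cat P B' P ?i2 p2 \<in> arr Cat P P"
    using cmp(1) Po o p1 p2 i1 i2 by auto
  have hin: "?h \<in> arr Cat P P" by (rule add_arr(1)[OF Po Po c1 c2])
  have aph: "ap ?h s x = ap ?i1 s (ap p1 s x) \<oplus>\<^bsub>V P s\<^esub> ap ?i2 s (ap p2 s x)" if "s \<in> S" "x \<in> carrier (V P s)" for s x
    using add_arr(2)[OF Po Po c1 c2 that] cmp(2)[OF Po o(1) Po p1(1) i1 that] cmp(2)[OF Po o(2) Po p2(1) i2 that] by simp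
  have "cmp Cat (?F i) P P ?h (inc i) = inc i" for i
  proof (rule arr_cmp_eqI[OF F Po Po inc hin inc])
    fix s m assume s: "s \<in> S" and m: "m \<in> carrier (V (?F i) s)"
    interpret P: module K "V P s" using objM[OF Po s] .
    note c = ap_closed[OF F Po inc s m]
    show "ap ?h s (ap (inc i) s m) = ap (inc i) s m"
      using m c aph[OF s c] ape[OF s] ape'[OF s] ap_zero[OF o(1) Po i1 s] ap_zero[OF o(2) Po i2 s]
      by (cases i) auto
  qed
  moreover have "cmp Cat (?F i) P P (ident Cat P) (inc i) = inc i" for i
    using ap_closed[OF F Po inc] by (intro arr_cmp_eqI[OF F Po Po inc _ inc]) (auto simp: ident Po)
  ultimately have "?h = ident Cat P"
    using up[OF Po, of inc] inc hin ident(1)[OF Po] by blast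
  then have "is_biproduct Cat add_arr A B' P ?i1 ?i2 p1 p2"
    unfolding is_biproduct_def using Po i1 i2 p1(1) p2(1) e by simp
  then show ?thesis by blast
qed

section \<open>Kernels and cokernels\<close>

text \<open>For a zero object the identity coincides with the zero arrow, so every element is
  zero.\<close>

lemma zero_object_iff: "zero_object Cat Z \<longleftrightarrow> Z \<in> obj Cat \<and> (\<forall>s\<in>S. carrier (V Z s) = {\<zero>\<^bsub>V Z s\<^esub>})"
proof
  assume Z: "zero_object Cat Z"
  then have o: "Z \<in> obj Cat" by (simp add: zero_object_def)
  then have "ident Cat Z = zero_arr Z Z" using Z ident(1) zero_arr(1) unfolding zero_object_def by blast
  then show "Z \<in> obj Cat \<and> (\<forall>s\<in>S. carrier (V Z s) = {\<zero>\<^bsub>V Z s\<^esub>})"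
    using o ident(2)[OF o] zero_arr(2)[OF o o] zero_in[OF o] by fastforce
next
  assume Z: "Z \<in> obj Cat \<and> (\<forall>s\<in>S. carrier (V Z s) = {\<zero>\<^bsub>V Z s\<^esub>})"
  then have o: "Z \<in> obj Cat" by simp
  have eq: "f = zero_arr Z A" if "A \<in> obj Cat" "f \<in> arr Cat Z A" for A f
    using that o Z zero_arr(2)[OF o that(1)] ap_zero[OF o that]
    by (intro arr_ext[OF o that zero_arr(1)[OF o that(1)]]) auto
  have eq': "f = zero_arr A Z" if "A \<in> obj Cat" "f \<in> arr Cat A Z" for A f
    using that o Z zero_arr(2)[OF that(1) o] ap_closed[OF that(1) o that(2)]
    by (intro arr_ext[OF that(1) o that(2) zero_arr(1)[OF that(1) o]]) auto
  show "zero_object Cat Z"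
    unfolding zero_object_def using o eq eq' zero_arr(1) by blast
qed

text \<open>The coproduct of the empty family has only one endomorphism.\<close>

lemma zero_object_exists: "\<exists>Z. zero_object Cat Z"
proof -
  obtain Z inc where Z: "is_coproduct Cat ({} :: bool set) (\<lambda>_. undefined) Z inc"
    using coproduct_exists[of "{} :: bool set" "\<lambda>_. undefined"] small_finite[OF univ] by auto
  then have o: "Z \<in> obj Cat" by (simp add: is_coproduct_def)
  have "\<exists>!u. u \<in> arr Cat Z Z" using Z o by (auto simp: is_coproduct_def)
  then have "ident Cat Z = zero_arr Z Z" using ident(1)[OF o] zero_arr(1)[OF o o] by blast
  then have "\<forall>s\<in>S. carrier (V Z s) = {\<zero>\<^bsub>V Z s\<^esub>}"
    using ident(2)[OF o] zero_arr(2)[OF o o] zero_in[OF o] by fastforce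
  then show ?thesis using zero_object_iff o by blast
qed

lemma zero_arrow_iff:
  assumes o: "A \<in> obj Cat" "D \<in> obj Cat" and f: "f \<in> arr Cat A D"
  shows "zero_arrow Cat A D f \<longleftrightarrow> (\<forall>s\<in>S. \<forall>m\<in>carrier (V A s). ap f s m = \<zero>\<^bsub>V D s\<^esub>)"
proof
  assume "zero_arrow Cat A D f"
  then obtain Z u v where Z: "zero_object Cat Z" "u \<in> arr Cat A Z" "v \<in> arr Cat Z D" "f = cmp Cat A Z D v u"
    unfolding zero_arrow_def by blast
  then have Zo: "Z \<in> obj Cat" "\<And>s. s \<in> S \<Longrightarrow> carrier (V Z s) = {\<zero>\<^bsub>V Z s\<^esub>}" using zero_object_iff by auto
  show "\<forall>s\<in>S. \<forall>m\<in>carrier (V A s). ap f s m = \<zero>\<^bsub>V D s\<^esub>"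
  proof (intro ballI)
    fix s m assume s: "s \<in> S" and m: "m \<in> carrier (V A s)"
    have "ap u s m = \<zero>\<^bsub>V Z s\<^esub>" using ap_closed[OF o(1) Zo(1) Z(2) s m] Zo(2)[OF s] by simp
    then show "ap f s m = \<zero>\<^bsub>V D s\<^esub>"
      using cmp(2)[OF o(1) Zo(1) o(2) Z(2,3) s m] Z(4) ap_zero[OF Zo(1) o(2) Z(3) s] by simp
  qed
next
  assume z: "\<forall>s\<in>S. \<forall>m\<in>carrier (V A s). ap f s m = \<zero>\<^bsub>V D s\<^esub>"
  obtain Z where Z: "zero_object Cat Z" using zero_object_exists by blast
  then have Zo: "Z \<in> obj Cat" by (simp add: zero_object_def)
  have "cmp Cat A Z D (zero_arr Z D) (zero_arr A Z) = f"
    using z zero_arr[OF o(1) Zo] zero_arr[OF Zo o(2)] zero_in[OF Zo]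
    by (intro arr_cmp_eqI o Zo f) auto
  then show "zero_arrow Cat A D f"
    unfolding zero_arrow_def using Z zero_arr(1)[OF o(1) Zo] zero_arr(1)[OF Zo o(2)] by metis
qed

section \<open>Kernels and images as families of subspaces\<close>

definition ker :: "'m \<Rightarrow> 'm \<Rightarrow> 'h \<Rightarrow> 's \<Rightarrow> 'u set" where
  "ker A D f s = {m \<in> carrier (V A s). ap f s m = \<zero>\<^bsub>V D s\<^esub>}"

definition im :: "'m \<Rightarrow> 'h \<Rightarrow> 's \<Rightarrow> 'u set" where
  "im A f s = ap f s ` carrier (V A s)"

lemma subrep_ker:
  assumes o: "A \<in> obj Cat" "D \<in> obj Cat" and f: "f \<in> arr Cat A D"
  shows "subrep A (ker A D f)"
proof (rule subrepI[OF o(1)])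
  fix s assume s: "s \<in> S"
  interpret A: module K "V A s" using objM o s by blast
  interpret D: module K "V D s" using objM o s by blast
  note l = ap_linear[OF o f s]
  show "ker A D f s \<subseteq> carrier (V A s)" by (auto simp: ker_def)
  show "\<zero>\<^bsub>V A s\<^esub> \<in> ker A D f s" using ap_zero[OF o f s] by (simp add: ker_def)
  show "x \<oplus>\<^bsub>V A s\<^esub> y \<in> ker A D f s" if "x \<in> ker A D f s" "y \<in> ker A D f s" for x y
    using that linear_map_add[OF l] by (simp add: ker_def)
  show "a \<odot>\<^bsub>V A s\<^esub> x \<in> ker A D f s" if "a \<in> carrier K" "x \<in> ker A D f s" for a x
    using that linear_map_smult[OF l] by (simp add: ker_def)
next
  fix p x assume p: "p \<in> Op" and x: "x \<in> ker A D f (src p)"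
  then show "op A p x \<in> ker A D f (tgt p)"
    using op_closed[OF o(1) p] ap_op[OF o f p]
      linear_map_zero[OF objM[OF o(2) src_sort[OF p]] objM[OF o(2) tgt_sort[OF p]] op_linear[OF o(2) p]]
    by (simp add: ker_def)
qed

lemma subrep_im:
  assumes o: "A \<in> obj Cat" "D \<in> obj Cat" and f: "f \<in> arr Cat A D"
  shows "subrep D (im A f)"
proof (rule subrepI[OF o(2)])
  fix s assume s: "s \<in> S"
  interpret A: module K "V A s" using objM o s by blast
  note l = ap_linear[OF o f s]
  show "im A f s \<subseteq> carrier (V D s)" using ap_closed[OF o f s] by (auto simp: im_def)
  show "\<zero>\<^bsub>V D s\<^esub> \<in> im A f s" using ap_zero[OF o f s] unfolding im_def by (metis A.M.zero_closed image_eqI)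
  show "x \<oplus>\<^bsub>V D s\<^esub> y \<in> im A f s" if "x \<in> im A f s" "y \<in> im A f s" for x y
    using that by (auto simp: im_def simp flip: linear_map_add[OF l])
  show "a \<odot>\<^bsub>V D s\<^esub> x \<in> im A f s" if "a \<in> carrier K" "x \<in> im A f s" for a x
    using that by (auto simp: im_def simp flip: linear_map_smult[OF l])
next
  fix p x assume p: "p \<in> Op" and x: "x \<in> im A f (src p)"
  then show "op D p x \<in> im A f (tgt p)"
    using op_closed[OF o(1) p] ap_op[OF o f p] by (auto simp: im_def simp flip: ap_op[OF o f p])
qed

lemma mem_ker_cmp:
  assumes "A \<in> obj Cat" "D \<in> obj Cat" "T \<in> obj Cat" "f \<in> arr Cat A D" "t \<in> arr Cat T A"
  shows "zero_arrow Cat T D (cmp Cat T A D f t) \<longleftrightarrow> (\<forall>s\<in>S. im T t s \<subseteq> ker A D f s)"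
  using assms by (auto simp: zero_arrow_iff cmp ap_closed im_def ker_def image_subset_iff)

definition injective :: "'m \<Rightarrow> 'm \<Rightarrow> 'h \<Rightarrow> bool" where
  "injective A D f \<longleftrightarrow> (\<forall>s\<in>S. ker A D f s = {\<zero>\<^bsub>V A s\<^esub>})"

definition surjective :: "'m \<Rightarrow> 'm \<Rightarrow> 'h \<Rightarrow> bool" where
  "surjective A D f \<longleftrightarrow> (\<forall>s\<in>S. im A f s = carrier (V D s))"

lemma subobject_ker:
  assumes o: "A \<in> obj Cat" "D \<in> obj Cat" and f: "f \<in> arr Cat A D"
  obtains N k where "N \<in> obj Cat" "k \<in> arr Cat N A" "injective N A k" "\<And>s. s \<in> S \<Longrightarrow> im N k s = ker A D f s"
    "\<And>s. s \<in> S \<Longrightarrow> carrier (V N s) = ker A D f s"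
    "\<And>s m. \<lbrakk>s \<in> S; m \<in> carrier (V N s)\<rbrakk> \<Longrightarrow> ap k s m = m"
proof -
  obtain N k where N: "N \<in> obj Cat" "k \<in> arr Cat N A" "\<And>s. s \<in> S \<Longrightarrow> carrier (V N s) = ker A D f s"
    "\<And>s m. \<lbrakk>s \<in> S; m \<in> carrier (V N s)\<rbrakk> \<Longrightarrow> ap k s m = m"
  proof -
    obtain N k where N: "N \<in> obj Cat" "k \<in> arr Cat N A"
      "\<forall>s\<in>S. carrier (V N s) = ker A D f s \<and> (\<forall>m\<in>ker A D f s. ap k s m = m)"
      using subobject[OF o(1) subrep_ker[OF o f]] by blast
    show thesis by (rule that[OF N(1,2)]) (use N(3) in auto)
  qed
  have "\<zero>\<^bsub>V N s\<^esub> = \<zero>\<^bsub>V A s\<^esub>" if "s \<in> S" for s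
    using N(4)[OF that zero_in[OF N(1) that]] ap_zero[OF N(1) o(1) N(2) that] by simp
  then have "injective N A k" using N zero_in[OF N(1)] by (auto simp: injective_def ker_def)
  moreover have "im N k s = ker A D f s" if "s \<in> S" for s using N(3,4)[OF that] by (force simp: im_def)
  ultimately show ?thesis using that N by metis
qed

lemma kernelI:
  assumes o: "A \<in> obj Cat" "D \<in> obj Cat" "N \<in> obj Cat" and f: "f \<in> arr Cat A D" and k: "k \<in> arr Cat N A"
    and inj: "injective N A k" and im: "\<And>s. s \<in> S \<Longrightarrow> im N k s = ker A D f s"
  shows "is_kernel Cat A D f N k"
  unfolding is_kernel_def
proof (intro conjI ballI impI o k)
  show "zero_arrow Cat N D (cmp Cat N A D f k)" using mem_ker_cmp[OF o f k] im by simp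
  fix T t assume T: "T \<in> obj Cat" and t: "t \<in> arr Cat T A" and z: "zero_arrow Cat T D (cmp Cat T A D f t)"
  show "\<exists>!u. u \<in> arr Cat T N \<and> cmp Cat T N A k u = t"
  proof (rule factor_inj[OF o(3,1) T k t])
    show "ap t s m \<in> ap k s ` carrier (V N s)" if "s \<in> S" "m \<in> carrier (V T s)" for s m
      using mem_ker_cmp[OF o(1,2) T f t] z im[OF that(1)] that unfolding im_def by blast
  qed (use inj in \<open>auto simp: injective_def ker_def\<close>)
qed

lemma cokernelI:
  assumes o: "A \<in> obj Cat" "D \<in> obj Cat" "Q \<in> obj Cat" and f: "f \<in> arr Cat A D" and q: "q \<in> arr Cat D Q"
    and surj: "surjective D Q q" and ker: "\<And>s. s \<in> S \<Longrightarrow> ker D Q q s = im A f s"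
  shows "is_cokernel Cat A D f Q q"
  unfolding is_cokernel_def
proof (intro conjI ballI impI o q)
  show "zero_arrow Cat A Q (cmp Cat A D Q q f)" using mem_ker_cmp[OF o(2,3,1) q f] ker by simp
  fix T t assume T: "T \<in> obj Cat" and t: "t \<in> arr Cat D T" and z: "zero_arrow Cat A T (cmp Cat A D T t f)"
  have "\<And>s. s \<in> S \<Longrightarrow> ker D Q q s \<subseteq> ker D T t s" using mem_ker_cmp[OF o(2) T o(1) t f] z ker by simp
  then show "\<exists>!u. u \<in> arr Cat Q T \<and> cmp Cat D Q T u q = t"
    using surj by (intro factor_surj[OF o(2,3) T q t]) (auto simp: surjective_def ker_def im_def subset_iff)
qed

lemma quotient_by:
  assumes "M \<in> obj Cat" "subrep M N"
  obtains Q q where "Q \<in> obj Cat" "q \<in> arr Cat M Q" "surjective M Q q" "\<And>s. s \<in> S \<Longrightarrow> ker M Q q s = N s"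
proof -
  obtain Q q where Q: "Q \<in> obj Cat" "q \<in> arr Cat M Q"
    "\<And>s. s \<in> S \<Longrightarrow> ap q s ` carrier (V M s) = carrier (V Q s)"
    "\<And>s m. \<lbrakk>s \<in> S; m \<in> carrier (V M s)\<rbrakk> \<Longrightarrow> ap q s m = \<zero>\<^bsub>V Q s\<^esub> \<longleftrightarrow> m \<in> N s"
  proof -
    obtain Q q where Q: "Q \<in> obj Cat" "q \<in> arr Cat M Q"
      "\<forall>s\<in>S. ap q s ` carrier (V M s) = carrier (V Q s) \<and>
        (\<forall>m\<in>carrier (V M s). ap q s m = \<zero>\<^bsub>V Q s\<^esub> \<longleftrightarrow> m \<in> N s)"
      using quotient_object[OF assms] by blast
    show thesis by (rule that[OF Q(1,2)]) (use Q(3) in auto)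
  qed
  have "N s \<subseteq> carrier (V M s)" if "s \<in> S" for s
    using assms(2) module.submoduleE(1)[OF objM[OF assms(1) that]] that by (auto simp: subrep_def)
  then have "ker M Q q s = N s" if "s \<in> S" for s using Q(4) that by (auto simp: ker_def)
  then show ?thesis using that Q by (auto simp: surjective_def im_def)
qed

text \<open>If the projection onto the quotient by \<open>N\<close> is zero, then \<open>N\<close>
  is everything. In this way surjectivity claims are derived from cancellation or uniqueness of
  arrows.\<close>

lemma subrep_eq_if_quotient_zero:
  assumes M: "M \<in> obj Cat" and N: "subrep M N"
    and eq: "\<And>Q q. \<lbrakk>Q \<in> obj Cat; q \<in> arr Cat M Q; \<And>s m. \<lbrakk>s \<in> S; m \<in> N s\<rbrakk> \<Longrightarrow> ap q s m = \<zero>\<^bsub>V Q s\<^esub>\<rbrakk>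
      \<Longrightarrow> q = zero_arr M Q" and s: "s \<in> S"
  shows "N s = carrier (V M s)"
proof -
  obtain Q q where Q: "Q \<in> obj Cat" "q \<in> arr Cat M Q" "surjective M Q q" "\<And>s. s \<in> S \<Longrightarrow> ker M Q q s = N s"
    using quotient_by[OF M N] by blast
  have "q = zero_arr M Q" by (rule eq[OF Q(1,2)]) (use Q(4) in \<open>auto simp: ker_def\<close>)
  then have "ker M Q q s = carrier (V M s)" using zero_arr(2)[OF M Q(1) s] by (auto simp: ker_def)
  then show ?thesis using Q(4)[OF s] by simp
qed

text \<open>A monic arrow cannot distinguish the inclusion of its kernel from the zero
  arrow.\<close>

lemma monic_injective:
  assumes o: "A \<in> obj Cat" "D \<in> obj Cat" and f: "monic Cat A D f"
  shows "injective A D f"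
proof -
  have fa: "f \<in> arr Cat A D" using f by (simp add: monic_def)
  obtain N k where N: "N \<in> obj Cat" "k \<in> arr Cat N A" "\<And>s. s \<in> S \<Longrightarrow> im N k s = ker A D f s"
    using subobject_ker[OF o fa] by metis
  have "cmp Cat N A D f k = cmp Cat N A D f (zero_arr N A)"
  proof (rule arr_cmp_eqI[OF N(1) o N(2) fa])
    show "cmp Cat N A D f (zero_arr N A) \<in> arr Cat N D" using N o fa zero_arr(1) cmp(1) by blast
    fix s m assume s: "s \<in> S" and m: "m \<in> carrier (V N s)"
    then have "ap k s m \<in> ker A D f s" using N(3)[OF s] by (auto simp: im_def)
    then show "ap f s (ap k s m) = ap (cmp Cat N A D f (zero_arr N A)) s m"
      using s m N o fa by (simp add: ker_def cmp zero_arr ap_zero)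
  qed
  then have "k = zero_arr N A" using f N zero_arr(1)[OF N(1) o(1)] unfolding monic_def by blast
  then have "ker A D f s \<subseteq> {\<zero>\<^bsub>V A s\<^esub>}" if "s \<in> S" for s
    using N(3)[OF that] zero_arr(2)[OF N(1) o(1) that] by (auto simp: im_def)
  moreover have "\<zero>\<^bsub>V A s\<^esub> \<in> ker A D f s" if "s \<in> S" for s
    using zero_in[OF o(1) that] ap_zero[OF o fa that] by (simp add: ker_def)
  ultimately show ?thesis by (auto simp: injective_def)
qed

text \<open>An arrow that vanishes on the image of \<open>f\<close> has the same composite with
  \<open>f\<close> as the zero arrow, hence is zero when \<open>f\<close> is epic. This makes the
  quotient by the image trivial.\<close>

lemma epic_surjective:
  assumes o: "A \<in> obj Cat" "D \<in> obj Cat" and f: "epic Cat A D f"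
  shows "surjective A D f"
  unfolding surjective_def
proof
  have fa: "f \<in> arr Cat A D" using f by (simp add: epic_def)
  fix s assume s: "s \<in> S"
  show "im A f s = carrier (V D s)"
  proof (rule subrep_eq_if_quotient_zero[OF o(2) subrep_im[OF o fa] _ s])
    fix Q q assume Q: "Q \<in> obj Cat" "q \<in> arr Cat D Q"
      and z: "\<And>s m. \<lbrakk>s \<in> S; m \<in> im A f s\<rbrakk> \<Longrightarrow> ap q s m = \<zero>\<^bsub>V Q s\<^esub>"
    note zd = zero_arr(1)[OF o(2) Q(1)]
    have "cmp Cat A D Q q f = cmp Cat A D Q (zero_arr D Q) f"
    proof (rule arr_cmp_eqI[OF o Q(1) fa Q(2)])
      show "cmp Cat A D Q (zero_arr D Q) f \<in> arr Cat A Q" using cmp(1)[OF o Q(1) fa zd] .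
      fix s m assume "s \<in> S" "m \<in> carrier (V A s)"
      then show "ap q s (ap f s m) = ap (cmp Cat A D Q (zero_arr D Q) f) s m"
        using z[of s "ap f s m"] cmp(2)[OF o Q(1) fa zd] zero_arr(2)[OF o(2) Q(1)] ap_closed[OF o fa]
        by (simp add: im_def)
    qed
    then show "q = zero_arr D Q" using f Q zd unfolding epic_def by blast
  qed
qed

lemma kernel_exists:
  assumes "A \<in> obj Cat" "D \<in> obj Cat" "f \<in> arr Cat A D"
  shows "\<exists>N k. is_kernel Cat A D f N k"
  using subobject_ker[OF assms] kernelI[OF assms(1,2) _ assms(3)] by metis

lemma cokernel_exists:
  assumes "A \<in> obj Cat" "D \<in> obj Cat" "f \<in> arr Cat A D"
  shows "\<exists>Q q. is_cokernel Cat A D f Q q"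
  using quotient_by[OF assms(2) subrep_im[OF assms]] cokernelI[OF assms(1,2) _ assms(3)] by metis

lemma abelian: "abelian_category Cat"
  unfolding abelian_category_def
proof (intro conjI ballI allI impI)
  show "category Cat" by (rule category)
  show "\<exists>hadd hzero. preadditive Cat hadd hzero \<and>
      (\<forall>A\<in>obj Cat. \<forall>D\<in>obj Cat. \<exists>P i1 i2 p1 p2. is_biproduct Cat hadd A D P i1 i2 p1 p2)"
    using preadditive biproduct_exists by blast
  show "\<exists>Z. zero_object Cat Z" by (rule zero_object_exists)
  fix A D assume o: "A \<in> obj Cat" "D \<in> obj Cat"
  show "\<exists>N k. is_kernel Cat A D f N k" "\<exists>Q q. is_cokernel Cat A D f Q q" if "f \<in> arr Cat A D" for f
    using kernel_exists cokernel_exists o that by blast+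
  show "\<exists>Q\<in>obj Cat. \<exists>g\<in>arr Cat D Q. is_kernel Cat D Q g A f" if "monic Cat A D f" for f
  proof -
    have f: "f \<in> arr Cat A D" using that by (simp add: monic_def)
    obtain Q q where Q: "Q \<in> obj Cat" "q \<in> arr Cat D Q" "\<And>s. s \<in> S \<Longrightarrow> ker D Q q s = im A f s"
      using quotient_by[OF o(2) subrep_im[OF o f]] by metis
    \<comment> \<open>A monic arrow is the kernel of the projection modulo its image.\<close>
    then have "is_kernel Cat D Q q A f"
      using monic_injective[OF o that] by (intro kernelI o f) auto
    then show ?thesis using Q by blast
  qed
  show "\<exists>N\<in>obj Cat. \<exists>g\<in>arr Cat N A. is_cokernel Cat N A g D f" if "epic Cat A D f" for f
  proof -
    have f: "f \<in> arr Cat A D" using that by (simp add: epic_def)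
    obtain N k where N: "N \<in> obj Cat" "k \<in> arr Cat N A" "\<And>s. s \<in> S \<Longrightarrow> im N k s = ker A D f s"
      using subobject_ker[OF o f] by metis
    \<comment> \<open>Dually, an epic arrow is the cokernel of the inclusion of its kernel.\<close>
    then have "is_cokernel Cat N A k D f"
      using epic_surjective[OF o that] by (intro cokernelI o f) auto
    then show ?thesis using N by blast
  qed
qed

lemma AB3: "AB3 U Cat"
  unfolding AB3_def
proof (intro conjI abelian allI impI)
  fix I :: "'u set" and F assume "small U I \<and> F \<in> I \<rightarrow> obj Cat"
  then show "\<exists>P inc. is_coproduct Cat I F P inc" by (intro coproduct_exists) auto
qed

end

section \<open>Filtered colimits\<close>

lemma is_functor_arr: "\<lbrakk>is_functor J C F; i \<in> obj J; j \<in> obj J; u \<in> arr J i j\<rbrakk>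
    \<Longrightarrow> farr F i j u \<in> arr C (fob F i) (fob F j)"
  by (auto simp: is_functor_def)

lemma is_coproduct_univ:
  assumes "is_coproduct C I F P inc" "T \<in> obj C" "\<And>i. i \<in> I \<Longrightarrow> t i \<in> arr C (F i) T"
  shows "\<exists>!u. u \<in> arr C P T \<and> (\<forall>i\<in>I. cmp C (F i) P T u (inc i) = t i)"
  using assms unfolding is_coproduct_def by metis

section \<open>Finite diagrams in a filtered category\<close>

lemma filtered_upper_bound:
  assumes J: "category J" "filtered J" and I: "finite I" "I \<subseteq> obj J"
  shows "\<exists>l\<in>obj J. \<forall>i\<in>I. arr J i l \<noteq> {}"
  using I
proof (induction I)
  case empty
  then show ?case using J(2) by (auto simp: filtered_def)
next
  case (insert i I)
  then obtain l where l: "l \<in> obj J" "\<forall>i\<in>I. arr J i l \<noteq> {}" by auto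
  have "i \<in> obj J" using insert.prems by simp
  with l J(2) obtain k where "k \<in> obj J" "arr J i k \<noteq> {}" "arr J l k \<noteq> {}"
    unfolding filtered_def by meson
  then obtain a b where k: "k \<in> obj J" "a \<in> arr J i k" "b \<in> arr J l k" by blast
  have "arr J i' k \<noteq> {}" if i': "i' \<in> I" for i'
  proof -
    obtain c where "c \<in> arr J i' l" using l i' by blast
    then have "cmp J i' l k b c \<in> arr J i' k"
      using category.cmp_arr[OF J(1)] i' insert.prems l k by blast
    then show ?thesis by blast
  qed
  then show ?case using k by blast
qed

text \<open>Induction on the arrows of the diagram: the relation for a new arrow is forced by
  passing to an object where the two sides are coequalized, and composing with the new arrow
  preserves the relations already obtained.\<close>

lemma filtered_finite_cocone:
  assumes J: "category J" "filtered J" and I: "finite I" "I \<subseteq> obj J"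
    and A: "finite A" "\<And>i k u. (i, k, u) \<in> A \<Longrightarrow> i \<in> I \<and> k \<in> I \<and> u \<in> arr J i k"
  shows "\<exists>l\<in>obj J. \<exists>w. (\<forall>i\<in>I. w i \<in> arr J i l) \<and> (\<forall>(i, k, u)\<in>A. cmp J i k l (w k) u = w i)"
  using A
proof (induction A)
  case empty
  obtain l where l: "l \<in> obj J" "\<forall>i\<in>I. arr J i l \<noteq> {}" using filtered_upper_bound[OF J I] by blast
  then have "\<forall>i\<in>I. \<exists>w. w \<in> arr J i l" by blast
  then obtain w where "\<forall>i\<in>I. w i \<in> arr J i l" by metis
  then show ?case using l by blast
next
  case (insert x A)
  obtain i k u where x: "x = (i, k, u)" by (cases x) auto
  have i: "i \<in> I" "k \<in> I" "u \<in> arr J i k" using insert.prems x by blast+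
  obtain l w where l: "l \<in> obj J" "\<forall>i\<in>I. w i \<in> arr J i l" "\<forall>(i, k, u)\<in>A. cmp J i k l (w k) u = w i"
    using insert.IH insert.prems by blast
  have a: "cmp J i k l (w k) u \<in> arr J i l" "w i \<in> arr J i l"
    using category.cmp_arr[OF J(1)] i l I by blast+
  then obtain l' v where v: "l' \<in> obj J" "v \<in> arr J l l'"
    "cmp J i l l' v (cmp J i k l (w k) u) = cmp J i l l' v (w i)"
    using J(2) l i I unfolding filtered_def by blast
  let ?w = "\<lambda>i. cmp J i l l' v (w i)"
  have "?w j \<in> arr J j l'" if "j \<in> I" for j
    using category.cmp_arr[OF J(1)] that l v I by blast
  moreover have "cmp J i' k' l' (?w k') u' = ?w i'" if "(i', k', u') \<in> insert x A" for i' k' u'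
  proof -
    have m: "i' \<in> I" "k' \<in> I" "u' \<in> arr J i' k'" using insert.prems that by blast+
    have "cmp J i' k' l' (?w k') u' = cmp J i' l l' v (cmp J i' k' l (w k') u')"
      using category.cmp_assoc[OF J(1), of i' k' l l' u' "w k'" v] m l v subsetD[OF I(2) m(1)] subsetD[OF I(2) m(2)]
      by simp
    also have "\<dots> = ?w i'" using that v(3) l(3) x by auto
    finally show ?thesis .
  qed
  ultimately show ?case using v(1) by (intro bexI[of _ l'] exI[of _ ?w]) auto
qed

context operator_category begin

text \<open>The definition of a kernel speaks of factorizations only. Uniqueness makes
  \<open>k\<close> monic, hence injective, and the kernel constructed as a subobject factors through
  \<open>k\<close>, so \<open>k\<close> has the full image.\<close>

lemma kernelD:
  assumes o: "A \<in> obj Cat" "D \<in> obj Cat" and f: "f \<in> arr Cat A D" and k: "is_kernel Cat A D f N k"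
  shows "N \<in> obj Cat" "k \<in> arr Cat N A" "injective N A k" "s \<in> S \<Longrightarrow> im N k s = ker A D f s"
proof -
  show N: "N \<in> obj Cat" and ka: "k \<in> arr Cat N A" using k by (auto simp: is_kernel_def)
  have z: "\<forall>s\<in>S. im N k s \<subseteq> ker A D f s" using k mem_ker_cmp[OF o N f ka] by (auto simp: is_kernel_def)
  have "monic Cat N A k"
    unfolding monic_def
  proof (intro conjI ka ballI impI)
    fix T g h assume T: "T \<in> obj Cat" "g \<in> arr Cat T N" "h \<in> arr Cat T N" and eq: "cmp Cat T N A k g = cmp Cat T N A k h"
    let ?t = "cmp Cat T N A k g"
    have t: "?t \<in> arr Cat T A" using cmp(1) T N o ka by blast
    have "im T ?t s \<subseteq> ker A D f s" if s: "s \<in> S" for s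
    proof -
      have "im T ?t s \<subseteq> im N k s"
        using cmp(2)[OF T(1) N o(1) T(2) ka s] ap_closed[OF T(1) N T(2) s] by (auto simp: im_def)
      then show ?thesis using z s by blast
    qed
    then have "\<exists>!u. u \<in> arr Cat T N \<and> cmp Cat T N A k u = ?t"
      using k T(1) t mem_ker_cmp[OF o T(1) f t] unfolding is_kernel_def by blast
    then show "g = h" using T eq by metis
  qed
  then show "injective N A k" using monic_injective[OF N o(1)] by blast
  fix s assume s: "s \<in> S"
  obtain N' k' where N': "N' \<in> obj Cat" "k' \<in> arr Cat N' A" "\<And>s. s \<in> S \<Longrightarrow> im N' k' s = ker A D f s"
    using subobject_ker[OF o f] by metis
  then have "zero_arrow Cat N' D (cmp Cat N' A D f k')" using mem_ker_cmp[OF o N'(1) f N'(2)] by simp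
  then obtain u where u: "u \<in> arr Cat N' N" "cmp Cat N' N A k u = k'"
    using k N' unfolding is_kernel_def by blast
  have "im N' k' s \<subseteq> im N k s"
    using cmp(2)[OF N'(1) N o(1) u(1) ka s] u ap_closed[OF N'(1) N u(1) s] by (auto simp: im_def)
  then show "im N k s = ker A D f s" using z N'(3) s by blast
qed

text \<open>Dually, \<open>q\<close> is epic, hence surjective, and the projection modulo the image
  of \<open>f\<close> factors through \<open>q\<close>, so \<open>q\<close> kills nothing beyond
  that image.\<close>

lemma cokernelD:
  assumes o: "A \<in> obj Cat" "D \<in> obj Cat" and f: "f \<in> arr Cat A D" and q: "is_cokernel Cat A D f Q q"
  shows "Q \<in> obj Cat" "q \<in> arr Cat D Q" "surjective D Q q" "s \<in> S \<Longrightarrow> ker D Q q s = im A f s"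
proof -
  show Q: "Q \<in> obj Cat" and qa: "q \<in> arr Cat D Q" using q by (auto simp: is_cokernel_def)
  have z: "\<forall>s\<in>S. im A f s \<subseteq> ker D Q q s" using q mem_ker_cmp[OF o(2) Q o(1) qa f] by (auto simp: is_cokernel_def)
  have "epic Cat D Q q"
    unfolding epic_def
  proof (intro conjI qa ballI impI)
    fix T g h assume T: "T \<in> obj Cat" "g \<in> arr Cat Q T" "h \<in> arr Cat Q T" and eq: "cmp Cat D Q T g q = cmp Cat D Q T h q"
    let ?t = "cmp Cat D Q T g q"
    have t: "?t \<in> arr Cat D T" using cmp(1) T Q o qa by blast
    have "im A f s \<subseteq> ker D T ?t s" if s: "s \<in> S" for s
    proof -
      have "ker D Q q s \<subseteq> ker D T ?t s"
        using cmp(2)[OF o(2) Q T(1) qa T(2) s] ap_zero[OF Q T(1,2) s] by (auto simp: ker_def)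
      then show ?thesis using z s by blast
    qed
    then have "\<exists>!u. u \<in> arr Cat Q T \<and> cmp Cat D Q T u q = ?t"
      using q T(1) t mem_ker_cmp[OF o(2) T(1) o(1) t f] unfolding is_cokernel_def by blast
    then show "g = h" using T eq by metis
  qed
  then show "surjective D Q q" using epic_surjective[OF o(2) Q] by blast
  fix s assume s: "s \<in> S"
  obtain Q' q' where Q': "Q' \<in> obj Cat" "q' \<in> arr Cat D Q'" "\<And>s. s \<in> S \<Longrightarrow> ker D Q' q' s = im A f s"
    using quotient_by[OF o(2) subrep_im[OF o f]] by metis
  then have "zero_arrow Cat A Q' (cmp Cat A D Q' q' f)" using mem_ker_cmp[OF o(2) Q'(1) o(1) Q'(2) f] by simp
  then obtain u where u: "u \<in> arr Cat Q Q'" "cmp Cat D Q Q' u q = q'"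
    using q Q' unfolding is_cokernel_def by blast
  have "ker D Q q s \<subseteq> ker D Q' q' s"
    using cmp(2)[OF o(2) Q Q'(1) qa u(1) s] u ap_zero[OF Q Q'(1) u(1) s] by (auto simp: ker_def)
  then show "ker D Q q s = im A f s" using z Q'(3) s by blast
qed

text \<open>Categorical exactness becomes exactness at elements, the form in which filtered colimits
  are compared.\<close>

lemma short_exact_iff:
  assumes o: "A \<in> obj Cat" "D \<in> obj Cat" "E \<in> obj Cat" and f: "f \<in> arr Cat A D" and g: "g \<in> arr Cat D E"
  shows "short_exact Cat A D E f g \<longleftrightarrow>
    injective A D f \<and> surjective D E g \<and> (\<forall>s\<in>S. im A f s = ker D E g s)"
  unfolding short_exact_def
  using kernelD[OF o(2,3) g, of A f] cokernelD[OF o(1,2) f, of E g]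
    kernelI[OF o(2,3,1) g f] cokernelI[OF o f g] by metis

section \<open>Elements of a filtered colimit\<close>

context
  fixes J :: "('i, 'e) cat" and G M m
  assumes J: "small_category U J" "filtered J" and G: "is_functor J Cat G" and col: "is_colimit J Cat G M m"
begin

private lemma J_cat: "category J" using J by (simp add: small_category_def)

private lemma M: "M \<in> obj Cat" using col by (simp add: is_colimit_def cocone_def)

private lemma G_obj: "j \<in> obj J \<Longrightarrow> fob G j \<in> obj Cat"
  using G by (auto simp: is_functor_def)

private lemma G_arr: "i \<in> obj J \<Longrightarrow> j \<in> obj J \<Longrightarrow> u \<in> arr J i j \<Longrightarrow> farr G i j u \<in> arr Cat (fob G i) (fob G j)"
  using G by (auto simp: is_functor_def)

private lemma G_cmp: "\<lbrakk>i \<in> obj J; j \<in> obj J; k \<in> obj J; u \<in> arr J i j; v \<in> arr J j k\<rbrakk> \<Longrightarrow>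
    farr G i k (cmp J i j k v u) = cmp Cat (fob G i) (fob G j) (fob G k) (farr G j k v) (farr G i j u)"
  using G unfolding is_functor_def by blast

lemma colimit_arr: "j \<in> obj J \<Longrightarrow> m j \<in> arr Cat (fob G j) M"
  using col by (auto simp: is_colimit_def cocone_def)

lemma colimit_step:
  assumes "i \<in> obj J" "j \<in> obj J" "u \<in> arr J i j" "s \<in> S" "x \<in> carrier (V (fob G i) s)"
  shows "ap (m j) s (ap (farr G i j u) s x) = ap (m i) s x"
proof -
  have "cmp Cat (fob G i) (fob G j) M (m j) (farr G i j u) = m i"
    using col assms unfolding is_colimit_def cocone_def by blast
  then show ?thesis
    using cmp(2)[OF G_obj[OF assms(1)] G_obj[OF assms(2)] M G_arr[OF assms(1-3)] colimit_arr[OF assms(2)] assms(4,5)] by simp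
qed

text \<open>The elements coming from some index are closed under sums because two indices have a
  common successor, so they form a subobject. An arrow that kills it restricts to the zero cocone
  and is zero by uniqueness.\<close>

lemma colimit_element:
  assumes s: "s \<in> S" and x: "x \<in> carrier (V M s)"
  shows "\<exists>j\<in>obj J. \<exists>a\<in>carrier (V (fob G j) s). x = ap (m j) s a"
proof -
  define N where "N s = {ap (m j) s a | j a. j \<in> obj J \<and> a \<in> carrier (V (fob G j) s)}" for s
  have NI: "ap (m j) s a \<in> N s" if "j \<in> obj J" "a \<in> carrier (V (fob G j) s)" for j a s
    using that by (auto simp: N_def)
  have NE: "\<exists>j a. j \<in> obj J \<and> a \<in> carrier (V (fob G j) s) \<and> x = ap (m j) s a" if "x \<in> N s" for x s
    using that by (auto simp: N_def)
  have sub: "subrep M N"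
  proof (rule subrepI[OF M])
    fix s assume s: "s \<in> S"
    show "N s \<subseteq> carrier (V M s)" using ap_closed[OF G_obj M colimit_arr s] by (auto simp: N_def)
    obtain j where j: "j \<in> obj J" using J(2) by (auto simp: filtered_def)
    show "\<zero>\<^bsub>V M s\<^esub> \<in> N s"
      using NI[OF j zero_in[OF G_obj[OF j] s]] ap_zero[OF G_obj[OF j] M colimit_arr[OF j] s] by simp
    show "x \<oplus>\<^bsub>V M s\<^esub> y \<in> N s" if xN: "x \<in> N s" and yN: "y \<in> N s" for x y
    proof -
      obtain i a where i: "i \<in> obj J" "a \<in> carrier (V (fob G i) s)" "x = ap (m i) s a" using NE[OF xN] by blast
      obtain j b where j: "j \<in> obj J" "b \<in> carrier (V (fob G j) s)" "y = ap (m j) s b" using NE[OF yN] by blast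
      obtain k where "k \<in> obj J" "arr J i k \<noteq> {}" "arr J j k \<noteq> {}"
        using J(2) i(1) j(1) unfolding filtered_def by meson
      then obtain u v where k: "k \<in> obj J" "u \<in> arr J i k" "v \<in> arr J j k" by blast
      have c: "ap (farr G i k u) s a \<in> carrier (V (fob G k) s)" "ap (farr G j k v) s b \<in> carrier (V (fob G k) s)"
        using ap_closed[OF G_obj G_obj G_arr s] i j k by auto
      interpret Gk: module K "V (fob G k) s" using objM[OF G_obj[OF k(1)] s] .
      have "x \<oplus>\<^bsub>V M s\<^esub> y = ap (m k) s (ap (farr G i k u) s a \<oplus>\<^bsub>V (fob G k) s\<^esub> ap (farr G j k v) s b)"
        using linear_map_add[OF ap_linear[OF G_obj[OF k(1)] M colimit_arr[OF k(1)] s] c]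
          colimit_step[OF i(1) k(1,2) s i(2)] colimit_step[OF j(1) k(1,3) s j(2)] i j by simp
      then show ?thesis using NI[OF k(1)] c by simp
    qed
    show "a \<odot>\<^bsub>V M s\<^esub> x \<in> N s" if aK: "a \<in> carrier K" and xN: "x \<in> N s" for a x
    proof -
      obtain i b where i: "i \<in> obj J" "b \<in> carrier (V (fob G i) s)" "x = ap (m i) s b" using NE[OF xN] by blast
      interpret Gi: module K "V (fob G i) s" using objM[OF G_obj[OF i(1)] s] .
      have "a \<odot>\<^bsub>V M s\<^esub> x = ap (m i) s (a \<odot>\<^bsub>V (fob G i) s\<^esub> b)"
        using linear_map_smult[OF ap_linear[OF G_obj[OF i(1)] M colimit_arr[OF i(1)] s] aK i(2)] i by simp
      then show ?thesis using NI[OF i(1)] i aK by simp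
    qed
  next
    fix p x assume p: "p \<in> Op" and x: "x \<in> N (src p)"
    obtain i b where i: "i \<in> obj J" "b \<in> carrier (V (fob G i) (src p))" "x = ap (m i) (src p) b" using NE[OF x] by blast
    show "op M p x \<in> N (tgt p)"
      using NI[OF i(1) op_closed[OF G_obj[OF i(1)] p i(2)]] ap_op[OF G_obj[OF i(1)] M colimit_arr[OF i(1)] p i(2)] i by simp
  qed
  have "N s = carrier (V M s)"
  proof (rule subrep_eq_if_quotient_zero[OF M sub _ s])
    fix Q q assume Q: "Q \<in> obj Cat" "q \<in> arr Cat M Q" and z: "\<And>s m. \<lbrakk>s \<in> S; m \<in> N s\<rbrakk> \<Longrightarrow> ap q s m = \<zero>\<^bsub>V Q s\<^esub>"
    have zq: "cmp Cat (fob G j) M Q q (m j) = zero_arr (fob G j) Q" if "j \<in> obj J" for j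
      using z NI[OF that] zero_arr[OF G_obj[OF that] Q(1)]
      by (intro arr_cmp_eqI[OF G_obj[OF that] M Q(1) colimit_arr[OF that] Q(2)]) auto
    have zz: "cmp Cat (fob G j) M Q (zero_arr M Q) (m j) = zero_arr (fob G j) Q" if "j \<in> obj J" for j
      using ap_closed[OF G_obj[OF that] M colimit_arr[OF that]] zero_arr[OF G_obj[OF that] Q(1)] zero_arr[OF M Q(1)]
      by (intro arr_cmp_eqI[OF G_obj[OF that] M Q(1) colimit_arr[OF that]]) auto
    have "cocone J Cat G Q (\<lambda>j. zero_arr (fob G j) Q)"
      unfolding cocone_def
    proof (intro conjI ballI Q(1))
      show "zero_arr (fob G j) Q \<in> arr Cat (fob G j) Q" if "j \<in> obj J" for j
        using zero_arr(1)[OF G_obj[OF that] Q(1)] .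
      fix i j u assume i: "i \<in> obj J" "j \<in> obj J" "u \<in> arr J i j"
      show "cmp Cat (fob G i) (fob G j) Q (zero_arr (fob G j) Q) (farr G i j u) = zero_arr (fob G i) Q"
        using ap_closed[OF G_obj[OF i(1)] G_obj[OF i(2)] G_arr[OF i]]
        by (intro arr_cmp_eqI G_obj i Q(1) G_arr zero_arr(1)) (simp_all add: zero_arr[OF G_obj Q(1)] i)
    qed
    \<comment> \<open>Both \<open>q\<close> and the zero arrow mediate the zero cocone.\<close>
    then have "\<exists>!u. u \<in> arr Cat M Q \<and> (\<forall>i\<in>obj J. cmp Cat (fob G i) M Q u (m i) = zero_arr (fob G i) Q)"
      using col unfolding is_colimit_def by blast
    then show "q = zero_arr M Q" using zq zz Q(2) zero_arr(1)[OF M Q(1)] by blast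
  qed
  then show ?thesis using NE[of x s] x by blast
qed

text \<open>
  The quotient of the coproduct of the diagram by the subobject \<open>D\<close> of elements killed by all
  sufficiently late cocones is a cocone in which no element dies that does not die in the diagram.
\<close>

lemma colimit_zero:
  assumes s: "s \<in> S" and j: "j \<in> obj J" and a: "a \<in> carrier (V (fob G j) s)"
    and z: "ap (m j) s a = \<zero>\<^bsub>V M s\<^esub>"
  shows "\<exists>k\<in>obj J. \<exists>u\<in>arr J j k. ap (farr G j k u) s a = \<zero>\<^bsub>V (fob G k) s\<^esub>"
proof -
  have "small U (obj J)" using J by (simp add: small_category_def)
  then obtain P inc where P: "is_coproduct Cat (obj J) (fob G) P inc"
    using coproduct_exists[of "obj J" "fob G"] G_obj by blast
  have Po: "P \<in> obj Cat" and inc: "\<And>i. i \<in> obj J \<Longrightarrow> inc i \<in> arr Cat (fob G i) P"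
    and up: "\<And>T t. \<lbrakk>T \<in> obj Cat; \<forall>i\<in>obj J. t i \<in> arr Cat (fob G i) T\<rbrakk>
      \<Longrightarrow> \<exists>!u. u \<in> arr Cat P T \<and> (\<forall>i\<in>obj J. cmp Cat (fob G i) P T u (inc i) = t i)"
    using P by (auto simp: is_coproduct_def)
  \<comment> \<open>A stage of the diagram with vertices \<open>I\<close> and arrows
    \<open>A\<close> is a cocone \<open>w\<close> on it with vertex \<open>l\<close>, together with
    an arrow \<open>\<phi>\<close> from the coproduct to the value at \<open>l\<close> that
    restricts to the images of \<open>w\<close> on the summands in \<open>I\<close>; on the other
    summands it is arbitrary.\<close>
  define stage where "stage I A l w \<phi> \<longleftrightarrow> l \<in> obj J \<and> (\<forall>i\<in>I. w i \<in> arr J i l) \<and>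
    (\<forall>(i, k, u)\<in>A. cmp J i k l (w k) u = w i) \<and> \<phi> \<in> arr Cat P (fob G l) \<and>
    (\<forall>i\<in>I. cmp Cat (fob G i) P (fob G l) \<phi> (inc i) = farr G i l (w i))" for I A l w \<phi>
  define fine where "fine I A \<longleftrightarrow> finite I \<and> I \<subseteq> obj J \<and> finite A \<and>
    (\<forall>(i, k, u)\<in>A. i \<in> I \<and> k \<in> I \<and> u \<in> arr J i k)" for I A
  \<comment> \<open>An element lies in \<open>D\<close> once a single finite diagram forces it to
    vanish at all stages of that diagram; larger diagrams then force this too, by
    \<open>stage_mono\<close>.\<close>
  define D where "D s = {d \<in> carrier (V P s). \<exists>I A. fine I A \<and>
    (\<forall>l w \<phi>. stage I A l w \<phi> \<longrightarrow> ap \<phi> s d = \<zero>\<^bsub>V (fob G l) s\<^esub>)}" for s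
  have stageD: "l \<in> obj J" "\<phi> \<in> arr Cat P (fob G l)" "fob G l \<in> obj Cat" if "stage I A l w \<phi>" for I A l w \<phi>
    using that G_obj by (auto simp: stage_def)
  have stage_mono: "stage I A l w \<phi>" if "stage I' A' l w \<phi>" "I \<subseteq> I'" "A \<subseteq> A'" for I A I' A' l w \<phi>
    using that unfolding stage_def by blast
  have DI: "d \<in> D s" if "d \<in> carrier (V P s)" "fine I A"
    "\<And>l w \<phi>. stage I A l w \<phi> \<Longrightarrow> ap \<phi> s d = \<zero>\<^bsub>V (fob G l) s\<^esub>" for d s I A
    using that unfolding D_def by blast
  have DE: "\<exists>I A. fine I A \<and> (\<forall>l w \<phi>. stage I A l w \<phi> \<longrightarrow> ap \<phi> s d = \<zero>\<^bsub>V (fob G l) s\<^esub>)" if "d \<in> D s" for d s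
    using that by (simp add: D_def)
  have DV: "d \<in> carrier (V P s)" if "d \<in> D s" for d s using that by (simp add: D_def)
  have subD: "subrep P D"
  proof (rule subrepI[OF Po])
    fix s assume s: "s \<in> S"
    interpret P: module K "V P s" using objM[OF Po s] .
    show "D s \<subseteq> carrier (V P s)" using DV by blast
    show "\<zero>\<^bsub>V P s\<^esub> \<in> D s"
      using ap_zero[OF Po stageD(3,2) s] by (intro DI[of _ _ "{}" "{}"]) (auto simp: fine_def)
    show "x \<oplus>\<^bsub>V P s\<^esub> y \<in> D s" if x: "x \<in> D s" and y: "y \<in> D s" for x y
    proof -
      obtain I A where I: "fine I A" "\<And>l w \<phi>. stage I A l w \<phi> \<Longrightarrow> ap \<phi> s x = \<zero>\<^bsub>V (fob G l) s\<^esub>"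
        using DE[OF x] by blast
      obtain I' A' where I': "fine I' A'" "\<And>l w \<phi>. stage I' A' l w \<phi> \<Longrightarrow> ap \<phi> s y = \<zero>\<^bsub>V (fob G l) s\<^esub>"
        using DE[OF y] by blast
      show ?thesis
      proof (rule DI)
        show "x \<oplus>\<^bsub>V P s\<^esub> y \<in> carrier (V P s)" using DV x y by simp
        \<comment> \<open>Enlarging a diagram leaves fewer stages, so the union of the two witnesses
          is a witness for the sum.\<close>
        show "fine (I \<union> I') (A \<union> A')" using I(1) I'(1) unfolding fine_def by blast
        fix l w \<phi> assume st: "stage (I \<union> I') (A \<union> A') l w \<phi>"
        interpret Gl: module K "V (fob G l) s" using objM[OF stageD(3)[OF st] s] .
        have "ap \<phi> s x = \<zero>\<^bsub>V (fob G l) s\<^esub>" "ap \<phi> s y = \<zero>\<^bsub>V (fob G l) s\<^esub>"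
          using I(2)[OF stage_mono[OF st]] I'(2)[OF stage_mono[OF st]] by auto
        then show "ap \<phi> s (x \<oplus>\<^bsub>V P s\<^esub> y) = \<zero>\<^bsub>V (fob G l) s\<^esub>"
          using linear_map_add[OF ap_linear[OF Po stageD(3)[OF st] stageD(2)[OF st] s] DV[OF x] DV[OF y]] by simp
      qed
    qed
    show "c \<odot>\<^bsub>V P s\<^esub> x \<in> D s" if c: "c \<in> carrier K" and x: "x \<in> D s" for c x
    proof -
      obtain I A where I: "fine I A" "\<And>l w \<phi>. stage I A l w \<phi> \<Longrightarrow> ap \<phi> s x = \<zero>\<^bsub>V (fob G l) s\<^esub>"
        using DE[OF x] by blast
      show ?thesis
      proof (rule DI[OF _ I(1)])
        show "c \<odot>\<^bsub>V P s\<^esub> x \<in> carrier (V P s)" using DV x c by simp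
        fix l w \<phi> assume st: "stage I A l w \<phi>"
        interpret Gl: module K "V (fob G l) s" using objM[OF stageD(3)[OF st] s] .
        show "ap \<phi> s (c \<odot>\<^bsub>V P s\<^esub> x) = \<zero>\<^bsub>V (fob G l) s\<^esub>"
          using linear_map_smult[OF ap_linear[OF Po stageD(3)[OF st] stageD(2)[OF st] s] c DV[OF x]] I(2)[OF st] c by simp
      qed
    qed
  next
    fix p x assume p: "p \<in> Op" and x: "x \<in> D (src p)"
    obtain I A where I: "fine I A" "\<And>l w \<phi>. stage I A l w \<phi> \<Longrightarrow> ap \<phi> (src p) x = \<zero>\<^bsub>V (fob G l) (src p)\<^esub>"
      using DE[OF x] by blast
    show "op P p x \<in> D (tgt p)"
    proof (rule DI[OF op_closed[OF Po p DV[OF x]] I(1)])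
      fix l w \<phi> assume st: "stage I A l w \<phi>"
      note lo = stageD(3)[OF st]
      show "ap \<phi> (tgt p) (op P p x) = \<zero>\<^bsub>V (fob G l) (tgt p)\<^esub>"
        using ap_op[OF Po lo stageD(2)[OF st] p DV[OF x]] I(2)[OF st]
          linear_map_zero[OF objM[OF lo src_sort[OF p]] objM[OF lo tgt_sort[OF p]] op_linear[OF lo p]] by simp
    qed
  qed
  obtain T q where T: "T \<in> obj Cat" "q \<in> arr Cat P T" "\<And>s. s \<in> S \<Longrightarrow> ker P T q s = D s"
    using quotient_by[OF Po subD] by metis
  let ?t = "\<lambda>i. cmp Cat (fob G i) P T q (inc i)"
  have t: "?t i \<in> arr Cat (fob G i) T" if "i \<in> obj J" for i
    using cmp(1)[OF G_obj[OF that] Po T(1) inc[OF that] T(2)] .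
  have apt: "ap (?t i) s x = ap q s (ap (inc i) s x)" if "i \<in> obj J" "s \<in> S" "x \<in> carrier (V (fob G i) s)" for i s x
    using cmp(2)[OF G_obj[OF that(1)] Po T(1) inc[OF that(1)] T(2) that(2,3)] .
  have stage_inc: "ap \<phi> s (ap (inc i) s x) = ap (farr G i l (w i)) s x"
    if "stage I A l w \<phi>" "i \<in> I" "I \<subseteq> obj J" "s \<in> S" "x \<in> carrier (V (fob G i) s)" for I A l w \<phi> i s x
  proof -
    have i: "i \<in> obj J" using that by blast
    have "cmp Cat (fob G i) P (fob G l) \<phi> (inc i) = farr G i l (w i)" using that(1,2) by (simp add: stage_def)
    then show ?thesis using cmp(2)[OF G_obj[OF i] Po stageD(3)[OF that(1)] inc[OF i] stageD(2)[OF that(1)] that(4,5)] by simp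
  qed
  have "cocone J Cat G T ?t"
    unfolding cocone_def
  proof (intro conjI ballI T(1) t)
    fix i k u assume i: "i \<in> obj J" and k: "k \<in> obj J" and u: "u \<in> arr J i k"
    note gu = G_arr[OF i k u]
    show "cmp Cat (fob G i) (fob G k) T (?t k) (farr G i k u) = ?t i"
    proof (rule arr_cmp_eqI[OF G_obj[OF i] G_obj[OF k] T(1) gu t[OF k] t[OF i]])
      fix s x assume s: "s \<in> S" and x: "x \<in> carrier (V (fob G i) s)"
      interpret P: module K "V P s" using objM[OF Po s] .
      interpret Ts: module K "V T s" using objM[OF T(1) s] .
      note gx = ap_closed[OF G_obj[OF i] G_obj[OF k] gu s x]
      let ?y = "ap (inc k) s (ap (farr G i k u) s x)" and ?x = "ap (inc i) s x"
      have y: "?y \<in> carrier (V P s)" "?x \<in> carrier (V P s)"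
        using ap_closed[OF G_obj[OF k] Po inc[OF k] s gx] ap_closed[OF G_obj[OF i] Po inc[OF i] s x] by auto
      have "?y \<ominus>\<^bsub>V P s\<^esub> ?x \<in> D s"
      proof (rule DI)
        show "?y \<ominus>\<^bsub>V P s\<^esub> ?x \<in> carrier (V P s)" using y by simp
        \<comment> \<open>The diagram consisting of \<open>u\<close> alone forces the difference to
          vanish, since \<open>w\<close> is compatible with \<open>u\<close> at each of its
          stages.\<close>
        show "fine {i, k} {(i, k, u)}" using i k u by (auto simp: fine_def)
        fix l w \<phi> assume st: "stage {i, k} {(i, k, u)} l w \<phi>"
        interpret Gl: module K "V (fob G l) s" using objM[OF stageD(3)[OF st] s] .
        have w: "w i \<in> arr J i l" "w k \<in> arr J k l" "cmp J i k l (w k) u = w i" using st by (auto simp: stage_def)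
        have "ap \<phi> s ?y = ap (farr G k l (w k)) s (ap (farr G i k u) s x)"
          using stage_inc[OF st _ _ s gx] i k by simp
        also have "\<dots> = ap (farr G i l (w i)) s x"
          using G_cmp[OF i k stageD(1)[OF st] u w(2)] w(3)
            cmp(2)[OF G_obj[OF i] G_obj[OF k] stageD(3)[OF st] gu G_arr[OF k stageD(1)[OF st] w(2)] s x] by simp
        also have "\<dots> = ap \<phi> s ?x" using stage_inc[OF st _ _ s x] i k by simp
        finally show "ap \<phi> s (?y \<ominus>\<^bsub>V P s\<^esub> ?x) = \<zero>\<^bsub>V (fob G l) s\<^esub>"
          using linear_map_minus[OF P.module_axioms Gl.module_axioms ap_linear[OF Po stageD(3)[OF st] stageD(2)[OF st] s] y]
            ap_closed[OF Po stageD(3)[OF st] stageD(2)[OF st] s y(2)] by (simp add: a_minus_def Gl.M.r_neg)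
      qed
      then have "ap q s (?y \<ominus>\<^bsub>V P s\<^esub> ?x) = \<zero>\<^bsub>V T s\<^esub>" using T(3)[OF s] by (auto simp: ker_def)
      then have "ap q s ?y \<ominus>\<^bsub>V T s\<^esub> ap q s ?x = \<zero>\<^bsub>V T s\<^esub>"
        using linear_map_minus[OF P.module_axioms Ts.module_axioms ap_linear[OF Po T(1,2) s] y] by simp
      then have "ap q s ?y = ap q s ?x"
        by (rule minus_zeroD[OF Ts.module_axioms _ ap_closed[OF Po T(1,2) s y(1)] ap_closed[OF Po T(1,2) s y(2)]])
      then show "ap (?t k) s (ap (farr G i k u) s x) = ap (?t i) s x" using apt[OF k s gx] apt[OF i s x] by simp
    qed
  qed
  then obtain v where v: "v \<in> arr Cat M T" "\<forall>i\<in>obj J. cmp Cat (fob G i) M T v (m i) = ?t i"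
    using col unfolding is_colimit_def by blast
  \<comment> \<open>The cocone into the quotient factors through \<open>M\<close>, so an element
    that dies in \<open>M\<close> dies in the quotient; its image in the coproduct therefore lies in
    \<open>D\<close>.\<close>
  have "ap (?t j) s a = ap v s (ap (m j) s a)"
    using cmp(2)[OF G_obj[OF j] M T(1) colimit_arr[OF j] v(1) s a] v(2) j by simp
  then have "ap q s (ap (inc j) s a) = \<zero>\<^bsub>V T s\<^esub>"
    using z ap_zero[OF M T(1) v(1) s] apt[OF j s a] by simp
  then have "ap (inc j) s a \<in> D s"
    using T(3)[OF s] ap_closed[OF G_obj[OF j] Po inc[OF j] s a] by (auto simp: ker_def)
  then obtain I A where I: "fine I A" "\<And>l w \<phi>. stage I A l w \<phi> \<Longrightarrow> ap \<phi> s (ap (inc j) s a) = \<zero>\<^bsub>V (fob G l) s\<^esub>"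
    using DE by blast
  \<comment> \<open>The witnessing diagram, enlarged by the vertex \<open>j\<close>, has a cocone
    because \<open>J\<close> is filtered. Extended by zero on the other summands, it gives a stage,
    and there \<open>a\<close> must vanish.\<close>
  have "\<exists>l\<in>obj J. \<exists>w. (\<forall>i\<in>insert j I. w i \<in> arr J i l) \<and> (\<forall>(i, k, u)\<in>A. cmp J i k l (w k) u = w i)"
    using I(1) j by (intro filtered_finite_cocone[OF J_cat J(2)]) (auto simp: fine_def)
  then obtain l w where l: "l \<in> obj J" "\<forall>i\<in>insert j I. w i \<in> arr J i l" "\<forall>(i, k, u)\<in>A. cmp J i k l (w k) u = w i"
    by blast
  let ?f = "\<lambda>i. if i \<in> insert j I then farr G i l (w i) else zero_arr (fob G i) (fob G l)"
  have "\<forall>i\<in>obj J. ?f i \<in> arr Cat (fob G i) (fob G l)"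
    using l G_arr zero_arr(1)[OF G_obj G_obj] by auto
  from ex1_implies_ex[OF up[OF G_obj[OF l(1)] this]] obtain \<phi> where \<phi>: "\<phi> \<in> arr Cat P (fob G l)"
    "\<forall>i\<in>obj J. cmp Cat (fob G i) P (fob G l) \<phi> (inc i) = ?f i" by blast
  have st: "stage (insert j I) A l w \<phi>"
    using \<phi> l j I(1) by (auto simp: stage_def fine_def)
  have "ap \<phi> s (ap (inc j) s a) = \<zero>\<^bsub>V (fob G l) s\<^esub>" by (rule I(2)[OF stage_mono[OF st]]) auto
  then have "ap (farr G j l (w j)) s a = \<zero>\<^bsub>V (fob G l) s\<^esub>"
    using stage_inc[OF st _ _ s a] I(1) j by (auto simp: fine_def)
  then show ?thesis using l by blast
qed

end

text \<open>An element of a colimit comes from some index, and one that vanishes in the colimit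
  vanishes at a later index. Each part of exactness is therefore checked at an index, after moving
  far enough along \<open>J\<close>.\<close>

lemma AB5: "AB5 U Cat"
  unfolding AB5_def
proof (intro conjI AB3 allI impI, elim conjE)
  fix J :: "('u, 'u) cat" and F G H s t L l M m N n f g
  assume J: "small_category U J" "filtered J"
    and F: "is_functor J Cat F" and G: "is_functor J Cat G" and H: "is_functor J Cat H"
    and s: "nat_trans J Cat F G s" and t: "nat_trans J Cat G H t"
    and ex: "\<forall>j\<in>obj J. short_exact Cat (fob F j) (fob G j) (fob H j) (s j) (t j)"
    and L: "is_colimit J Cat F L l" and M: "is_colimit J Cat G M m" and N: "is_colimit J Cat H N n"
    and f: "f \<in> arr Cat L M"
    and fs: "\<forall>j\<in>obj J. cmp Cat (fob F j) L M f (l j) = cmp Cat (fob F j) (fob G j) M (m j) (s j)"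
    and g: "g \<in> arr Cat M N"
    and gt: "\<forall>j\<in>obj J. cmp Cat (fob G j) M N g (m j) = cmp Cat (fob G j) (fob H j) N (n j) (t j)"
  have o: "L \<in> obj Cat" "M \<in> obj Cat" "N \<in> obj Cat"
    using L M N by (auto simp: is_colimit_def cocone_def)
  have ob: "fob F j \<in> obj Cat" "fob G j \<in> obj Cat" "fob H j \<in> obj Cat" if "j \<in> obj J" for j
    using F G H that by (auto simp: is_functor_def)
  have Fa: "farr F i j u \<in> arr Cat (fob F i) (fob F j)" and Ga: "farr G i j u \<in> arr Cat (fob G i) (fob G j)"
    and Ha: "farr H i j u \<in> arr Cat (fob H i) (fob H j)"
    if "i \<in> obj J" "j \<in> obj J" "u \<in> arr J i j" for i j u
    using that by (auto intro: is_functor_arr[OF F] is_functor_arr[OF G] is_functor_arr[OF H])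
  have sa: "s j \<in> arr Cat (fob F j) (fob G j)" and ta: "t j \<in> arr Cat (fob G j) (fob H j)" if "j \<in> obj J" for j
    using s t that by (auto simp: nat_trans_def)
  note la = colimit_arr[OF J F L] and ma = colimit_arr[OF J G M] and na = colimit_arr[OF J H N]
  have exj: "injective (fob F j) (fob G j) (s j)" "surjective (fob G j) (fob H j) (t j)"
    "\<And>x. x \<in> S \<Longrightarrow> im (fob F j) (s j) x = ker (fob G j) (fob H j) (t j) x" if "j \<in> obj J" for j
    using ex short_exact_iff[OF ob[OF that] sa[OF that] ta[OF that]] that by auto
  have s_nat: "ap (farr G i j u) x (ap (s i) x a) = ap (s j) x (ap (farr F i j u) x a)"
    if i: "i \<in> obj J" "j \<in> obj J" "u \<in> arr J i j" and x: "x \<in> S" and a: "a \<in> carrier (V (fob F i) x)" for i j u x a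
  proof -
    have "cmp Cat (fob F i) (fob G i) (fob G j) (farr G i j u) (s i) = cmp Cat (fob F i) (fob F j) (fob G j) (s j) (farr F i j u)"
      using s i unfolding nat_trans_def by blast
    then show ?thesis
      using cmp(2)[OF ob(1)[OF i(1)] ob(2)[OF i(1)] ob(2)[OF i(2)] sa[OF i(1)] Ga[OF i] x a]
        cmp(2)[OF ob(1)[OF i(1)] ob(1)[OF i(2)] ob(2)[OF i(2)] Fa[OF i] sa[OF i(2)] x a] by simp
  qed
  have t_nat: "ap (farr H i j u) x (ap (t i) x a) = ap (t j) x (ap (farr G i j u) x a)"
    if i: "i \<in> obj J" "j \<in> obj J" "u \<in> arr J i j" and x: "x \<in> S" and a: "a \<in> carrier (V (fob G i) x)" for i j u x a
  proof -
    have "cmp Cat (fob G i) (fob H i) (fob H j) (farr H i j u) (t i) = cmp Cat (fob G i) (fob G j) (fob H j) (t j) (farr G i j u)"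
      using t i unfolding nat_trans_def by blast
    then show ?thesis
      using cmp(2)[OF ob(2)[OF i(1)] ob(3)[OF i(1)] ob(3)[OF i(2)] ta[OF i(1)] Ha[OF i] x a]
        cmp(2)[OF ob(2)[OF i(1)] ob(2)[OF i(2)] ob(3)[OF i(2)] Ga[OF i] ta[OF i(2)] x a] by simp
  qed
  have f_l: "ap f x (ap (l j) x a) = ap (m j) x (ap (s j) x a)"
    if j: "j \<in> obj J" and x: "x \<in> S" and a: "a \<in> carrier (V (fob F j) x)" for j x a
    using cmp(2)[OF ob(1)[OF j] o(1,2) la[OF j] f x a] cmp(2)[OF ob(1,2)[OF j] o(2) sa[OF j] ma[OF j] x a]
      fs j by simp
  have g_m: "ap g x (ap (m j) x a) = ap (n j) x (ap (t j) x a)"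
    if j: "j \<in> obj J" and x: "x \<in> S" and a: "a \<in> carrier (V (fob G j) x)" for j x a
    using cmp(2)[OF ob(2)[OF j] o(2,3) ma[OF j] g x a] cmp(2)[OF ob(2,3)[OF j] o(3) ta[OF j] na[OF j] x a]
      gt j by simp
  have "injective L M f"
    unfolding injective_def
  proof
    fix x assume x: "x \<in> S"
    have "y = \<zero>\<^bsub>V L x\<^esub>" if y: "y \<in> ker L M f x" for y
    proof -
      obtain j a where j: "j \<in> obj J" "a \<in> carrier (V (fob F j) x)" "y = ap (l j) x a"
        using colimit_element[OF J F L x, of y] y unfolding ker_def by blast
      note sja = ap_closed[OF ob(1,2)[OF j(1)] sa[OF j(1)] x j(2)]
      have "ap (m j) x (ap (s j) x a) = \<zero>\<^bsub>V M x\<^esub>" using y f_l[OF j(1) x j(2)] j(3) by (simp add: ker_def)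
      \<comment> \<open>The image in \<open>G\<close> dies at a later index \<open>k\<close>, and
        injectivity of \<open>s k\<close> shows that the element already died in \<open>F\<close>
        there.\<close>
      then obtain k u where k: "k \<in> obj J" "u \<in> arr J j k"
        "ap (farr G j k u) x (ap (s j) x a) = \<zero>\<^bsub>V (fob G k) x\<^esub>"
        using colimit_zero[OF J G M x j(1) sja] by blast
      have "ap (farr F j k u) x a \<in> ker (fob F k) (fob G k) (s k) x"
        using s_nat[OF j(1) k(1,2) x j(2)] k ap_closed[OF ob(1)[OF j(1)] ob(1)[OF k(1)] Fa[OF j(1) k(1,2)] x j(2)]
        by (simp add: ker_def)
      then have "ap (farr F j k u) x a = \<zero>\<^bsub>V (fob F k) x\<^esub>" using exj(1)[OF k(1)] x by (auto simp: injective_def)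
      then show ?thesis
        using colimit_step[OF J F L j(1) k(1,2) x j(2)] ap_zero[OF ob(1)[OF k(1)] o(1) la[OF k(1)] x] j(3) by simp
    qed
    moreover have "\<zero>\<^bsub>V L x\<^esub> \<in> ker L M f x" using zero_in[OF o(1) x] ap_zero[OF o(1,2) f x] by (simp add: ker_def)
    ultimately show "ker L M f x = {\<zero>\<^bsub>V L x\<^esub>}" by blast
  qed
  moreover have "surjective M N g"
    unfolding surjective_def
  proof (rule ballI, rule subset_antisym)
    fix x assume x: "x \<in> S"
    show "im M g x \<subseteq> carrier (V N x)" using ap_closed[OF o(2,3) g x] by (auto simp: im_def)
    show "carrier (V N x) \<subseteq> im M g x"
    proof
      fix y assume "y \<in> carrier (V N x)"
      then obtain j c where j: "j \<in> obj J" "c \<in> carrier (V (fob H j) x)" "y = ap (n j) x c"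
        using colimit_element[OF J H N x] by blast
      then obtain b where b: "b \<in> carrier (V (fob G j) x)" "c = ap (t j) x b"
        using exj(2)[OF j(1)] x by (auto simp: surjective_def im_def)
      then have "y = ap g x (ap (m j) x b)" using g_m[OF j(1) x b(1)] j(3) by simp
      then show "y \<in> im M g x" using ap_closed[OF ob(2)[OF j(1)] o(2) ma[OF j(1)] x b(1)] by (auto simp: im_def)
    qed
  qed
  moreover have "im L f x = ker M N g x" if x: "x \<in> S" for x
  proof
    show "im L f x \<subseteq> ker M N g x"
    proof
      fix y assume "y \<in> im L f x"
      then obtain z where z: "z \<in> carrier (V L x)" "y = ap f x z" by (auto simp: im_def)
      obtain j a where j: "j \<in> obj J" "a \<in> carrier (V (fob F j) x)" "z = ap (l j) x a"
        using colimit_element[OF J F L x z(1)] by blast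
      note sja = ap_closed[OF ob(1,2)[OF j(1)] sa[OF j(1)] x j(2)]
      have "ap (s j) x a \<in> ker (fob G j) (fob H j) (t j) x" using exj(3)[OF j(1) x] j(2) by (auto simp: im_def)
      then have "ap g x y = \<zero>\<^bsub>V N x\<^esub>"
        using f_l[OF j(1) x j(2)] g_m[OF j(1) x sja] z j(3) ap_zero[OF ob(3)[OF j(1)] o(3) na[OF j(1)] x]
        by (simp add: ker_def)
      then show "y \<in> ker M N g x" using ap_closed[OF o(1,2) f x z(1)] z(2) by (simp add: ker_def)
    qed
    show "ker M N g x \<subseteq> im L f x"
    proof
      fix y assume y: "y \<in> ker M N g x"
      then obtain j b where j: "j \<in> obj J" "b \<in> carrier (V (fob G j) x)" "y = ap (m j) x b"
        using colimit_element[OF J G M x, of y] unfolding ker_def by blast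
      note tjb = ap_closed[OF ob(2,3)[OF j(1)] ta[OF j(1)] x j(2)]
      have "ap (n j) x (ap (t j) x b) = \<zero>\<^bsub>V N x\<^esub>" using y g_m[OF j(1) x j(2)] j(3) by (simp add: ker_def)
      \<comment> \<open>The image in \<open>H\<close> dies at a later index \<open>k\<close>, and
        exactness there lifts the element of \<open>G\<close> to \<open>F\<close>.\<close>
      then obtain k u where k: "k \<in> obj J" "u \<in> arr J j k"
        "ap (farr H j k u) x (ap (t j) x b) = \<zero>\<^bsub>V (fob H k) x\<^esub>"
        using colimit_zero[OF J H N x j(1) tjb] by blast
      have "ap (farr G j k u) x b \<in> ker (fob G k) (fob H k) (t k) x"
        using t_nat[OF j(1) k(1,2) x j(2)] k ap_closed[OF ob(2)[OF j(1)] ob(2)[OF k(1)] Ga[OF j(1) k(1,2)] x j(2)]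
        by (simp add: ker_def)
      then obtain a where a: "a \<in> carrier (V (fob F k) x)" "ap (farr G j k u) x b = ap (s k) x a"
        using exj(3)[OF k(1) x] by (auto simp: im_def)
      have "y = ap f x (ap (l k) x a)"
        using f_l[OF k(1) x a(1)] colimit_step[OF J G M j(1) k(1,2) x j(2)] a(2) j(3) by simp
      then show "y \<in> im L f x" using ap_closed[OF ob(1)[OF k(1)] o(1) la[OF k(1)] x a(1)] by (auto simp: im_def)
    qed
  qed
  ultimately show "short_exact Cat L M N f g" using short_exact_iff[OF o f g] by blast
qed

section \<open>A generator\<close>

text \<open>Composable words of operators from sort \<open>r\<close> to sort \<open>s\<close>. The
  head of the list is applied last, in accordance with \<open>foldr\<close>.\<close>

fun walk :: "'s \<Rightarrow> 'p list \<Rightarrow> 's \<Rightarrow> bool" where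
  "walk r [] s \<longleftrightarrow> s = r"
| "walk r (p # ps) s \<longleftrightarrow> p \<in> Op \<and> tgt p = s \<and> walk r ps (src p)"

lemma walk_lists: "walk r ps s \<Longrightarrow> ps \<in> lists Op"
  by (induction ps arbitrary: s) auto

lemma walk_closed:
  "\<lbrakk>T \<in> obj Cat; m \<in> carrier (V T r); walk r ps s\<rbrakk> \<Longrightarrow> foldr (op T) ps m \<in> carrier (V T s)"
  by (induction ps arbitrary: s) (auto intro: op_closed)

text \<open>Iterating \<open>finite_step\<close> along the word bounds the support of the result by
  a set that depends only on \<open>D\<close> and the word, not on the object or the
  element.\<close>

lemma walk_finite:
  assumes r: "r \<in> S" and D: "finite D" "D \<subseteq> B" and w: "walk r ps s"
  shows "\<exists>D'. finite D' \<and> D' \<subseteq> B \<and> (\<forall>T\<in>obj Cat. \<forall>m\<in>carrier (V T r).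
    {b \<in> B. op T (co r b) m \<noteq> \<zero>\<^bsub>V T r\<^esub>} \<subseteq> D \<longrightarrow>
    {b \<in> B. op T (co s b) (foldr (op T) ps m) \<noteq> \<zero>\<^bsub>V T s\<^esub>} \<subseteq> D')"
  using w
proof (induction ps arbitrary: s)
  case Nil
  then show ?case using D by auto
next
  case (Cons p ps)
  then have p: "p \<in> Op" "tgt p = s" "walk r ps (src p)" by auto
  obtain D1 where D1: "finite D1" "D1 \<subseteq> B" "\<forall>T\<in>obj Cat. \<forall>m\<in>carrier (V T r).
    {b \<in> B. op T (co r b) m \<noteq> \<zero>\<^bsub>V T r\<^esub>} \<subseteq> D \<longrightarrow>
    {b \<in> B. op T (co (src p) b) (foldr (op T) ps m) \<noteq> \<zero>\<^bsub>V T (src p)\<^esub>} \<subseteq> D1"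
    using Cons.IH[OF p(3)] by blast
  obtain D2 where D2: "finite D2" "D2 \<subseteq> B" "\<forall>T\<in>obj Cat. \<forall>m\<in>carrier (V T (src p)).
    {b \<in> B. op T (co (src p) b) m \<noteq> \<zero>\<^bsub>V T (src p)\<^esub>} \<subseteq> D1 \<longrightarrow>
    {b \<in> B. op T (co (tgt p) b) (op T p m) \<noteq> \<zero>\<^bsub>V T (tgt p)\<^esub>} \<subseteq> D2"
    using finite_step[OF p(1) D1(1,2)] by blast
  have "{b \<in> B. op T (co s b) (foldr (op T) (p # ps) m) \<noteq> \<zero>\<^bsub>V T s\<^esub>} \<subseteq> D2"
    if T: "T \<in> obj Cat" and m: "m \<in> carrier (V T r)" and D: "{b \<in> B. op T (co r b) m \<noteq> \<zero>\<^bsub>V T r\<^esub>} \<subseteq> D" for T m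
  proof -
    have "{b \<in> B. op T (co (src p) b) (foldr (op T) ps m) \<noteq> \<zero>\<^bsub>V T (src p)\<^esub>} \<subseteq> D1" using D1(3) T m D by blast
    from D2(3)[rule_format, OF T walk_closed[OF T m p(3)] this] show ?thesis using p(2) by simp
  qed
  then show ?case using D2(1,2) by blast
qed

text \<open>The symbols are the words starting at sort \<open>r\<close>, the evaluations are the
  elements of sort \<open>r\<close> with support in \<open>D\<close>, taken in all objects, and the
  universal element is the empty word. Bounding the support by \<open>D\<close> is what makes
  \<open>walk_finite\<close> applicable.\<close>

lemma local_generator:
  assumes r: "r \<in> S" and D: "finite D" "D \<subseteq> B"
  shows "\<exists>P\<in>obj Cat. \<exists>x\<in>carrier (V P r). \<forall>T\<in>obj Cat. \<forall>m\<in>carrier (V T r).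
    {b \<in> B. op T (co r b) m \<noteq> \<zero>\<^bsub>V T r\<^esub>} \<subseteq> D \<longrightarrow> (\<exists>h\<in>arr Cat P T. ap h r x = m)"
proof -
  let ?Sym = "\<lambda>s. {ps. walk r ps s}" and ?act = "\<lambda>p ps. p # ps"
  let ?ev = "\<lambda>T m (s :: 's) ps. foldr (op T) ps m"
  let ?Ev = "{(T, ?ev T m) | T m. T \<in> obj Cat \<and> m \<in> carrier (V T r) \<and>
    {b \<in> B. op T (co r b) m \<noteq> \<zero>\<^bsub>V T r\<^esub>} \<subseteq> D}"
  have fin: "\<exists>D. finite D \<and> (\<forall>(T, ev)\<in>?Ev. {b \<in> B. op T (co s b) (ev s z) \<noteq> \<zero>\<^bsub>V T s\<^esub>} \<subseteq> D)"
    if "s \<in> S" "z \<in> ?Sym s" for s z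
  proof -
    obtain D' where D': "finite D'" "\<forall>T\<in>obj Cat. \<forall>m\<in>carrier (V T r).
      {b \<in> B. op T (co r b) m \<noteq> \<zero>\<^bsub>V T r\<^esub>} \<subseteq> D \<longrightarrow>
      {b \<in> B. op T (co s b) (foldr (op T) z m) \<noteq> \<zero>\<^bsub>V T s\<^esub>} \<subseteq> D'"
      using walk_finite[OF r D, of z s] \<open>z \<in> ?Sym s\<close> by blast
    show ?thesis
    proof (intro exI[of _ D'] conjI D'(1) ballI)
      fix e assume "e \<in> ?Ev"
      then obtain T m where "e = (T, ?ev T m)" "T \<in> obj Cat" "m \<in> carrier (V T r)"
        "{b \<in> B. op T (co r b) m \<noteq> \<zero>\<^bsub>V T r\<^esub>} \<subseteq> D" by blast
      then show "case e of (T, ev) \<Rightarrow> {b \<in> B. op T (co s b) (ev s z) \<noteq> \<zero>\<^bsub>V T s\<^esub>} \<subseteq> D'"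
        using D'(2) by simp
    qed
  qed
  obtain P \<iota> where P: "P \<in> obj Cat" and \<iota>: "\<And>s z. \<lbrakk>s \<in> S; z \<in> ?Sym s\<rbrakk> \<Longrightarrow> \<iota> s z \<in> carrier (V P s)"
    and ex: "\<And>T ev. (T, ev) \<in> ?Ev \<Longrightarrow> \<exists>h\<in>arr Cat P T. \<forall>s\<in>S. \<forall>z\<in>?Sym s. ap h s (\<iota> s z) = ev s z"
  proof (rule presentation[of ?Sym ?act ?Ev])
    show "small U (?Sym s)" if "s \<in> S" for s
      by (rule small_subset[OF univ small_lists[OF univ small_Op]]) (use walk_lists in auto)
    show "ev s z \<in> carrier (V T s)" if "(T, ev) \<in> ?Ev" "s \<in> S" "z \<in> ?Sym s" for T ev s z
      using that walk_closed by auto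
  qed (use fin in auto)
  show ?thesis
  proof (intro bexI[OF _ P] bexI[of _ "\<iota> r []"] ballI impI)
    show "\<iota> r [] \<in> carrier (V P r)" using \<iota>[OF r] by simp
    fix T m assume "T \<in> obj Cat" "m \<in> carrier (V T r)" "{b \<in> B. op T (co r b) m \<noteq> \<zero>\<^bsub>V T r\<^esub>} \<subseteq> D"
    then have "(T, ?ev T m) \<in> ?Ev" by blast
    from ex[OF this] obtain h where h: "h \<in> arr Cat P T" "\<forall>s\<in>S. \<forall>z\<in>?Sym s. ap h s (\<iota> s z) = ?ev T m s z"
      by blast
    have "ap h r (\<iota> r []) = m" using h(2)[rule_format, OF r, of "[]"] by simp
    then show "\<exists>h\<in>arr Cat P T. ap h r (\<iota> r []) = m" using h(1) by blast
  qed
qed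

text \<open>Different arrows differ at some element \<open>m\<close>. The summand belonging to the
  sort and the support of \<open>m\<close> has an arrow hitting \<open>m\<close>, and this arrow
  separates the two.\<close>

lemma generator_exists: "\<exists>G. generator Cat G"
proof -
  \<comment> \<open>One summand for each sort and each finite set of coordinates; finite sets
    suffice because every element of an object has finite support, and they keep the index set
    small.\<close>
  let ?I = "SIGMA r:S. {D. finite D \<and> D \<subseteq> B}"
  define gen where "gen r D P x \<longleftrightarrow> P \<in> obj Cat \<and> x \<in> carrier (V P r) \<and>
    (\<forall>T\<in>obj Cat. \<forall>m\<in>carrier (V T r).
      {b \<in> B. op T (co r b) m \<noteq> \<zero>\<^bsub>V T r\<^esub>} \<subseteq> D \<longrightarrow> (\<exists>h\<in>arr Cat P T. ap h r x = m))" for r D P x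
  have genD: "P \<in> obj Cat" "x \<in> carrier (V P r)"
    "\<And>T m. \<lbrakk>T \<in> obj Cat; m \<in> carrier (V T r); {b \<in> B. op T (co r b) m \<noteq> \<zero>\<^bsub>V T r\<^esub>} \<subseteq> D\<rbrakk>
      \<Longrightarrow> \<exists>h\<in>arr Cat P T. ap h r x = m" if "gen r D P x" for r D P x
    using that unfolding gen_def by blast+
  have "\<exists>P x. gen r D P x" if "r \<in> S" "finite D" "D \<subseteq> B" for r D
    using local_generator[OF that] unfolding gen_def by blast
  then have "\<forall>i\<in>?I. \<exists>Px. gen (fst i) (snd i) (fst Px) (snd Px)" by simp
  then obtain Px where Px: "\<And>i. i \<in> ?I \<Longrightarrow> gen (fst i) (snd i) (fst (Px i)) (snd (Px i))" by metis
  have Px_obj: "fst (Px i) \<in> obj Cat" if "i \<in> ?I" for i using genD(1)[OF Px[OF that]] .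
  moreover have "small U ?I" by (intro small_Sigma[OF univ] small_S small_finite_subsets[OF univ] small_B)
  ultimately obtain G inc where G: "is_coproduct Cat ?I (\<lambda>i. fst (Px i)) G inc"
    using coproduct_exists[of ?I "\<lambda>i. fst (Px i)"] by blast
  have Go: "G \<in> obj Cat" using G by (simp add: is_coproduct_def)
  have "generator Cat G"
    unfolding generator_def
  proof (intro conjI Go ballI impI)
    fix A A' f g assume o: "A \<in> obj Cat" "A' \<in> obj Cat" and f: "f \<in> arr Cat A A'" and g: "g \<in> arr Cat A A'" and ne: "f \<noteq> g"
    then obtain r m where r: "r \<in> S" "m \<in> carrier (V A r)" "ap f r m \<noteq> ap g r m" using arr_ext[OF o f g] by blast
    let ?D = "{b \<in> B. op A (co r b) m \<noteq> \<zero>\<^bsub>V A r\<^esub>}"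
    have i: "(r, ?D) \<in> ?I" using r(1) obj_finite[OF o(1) r(1,2)] by blast
    obtain P x where P: "Px (r, ?D) = (P, x)" by (cases "Px (r, ?D)")
    have gPx: "gen r ?D P x" using Px[OF i] P by simp
    note Po = genD(1,2)[OF gPx]
    have "\<exists>h\<in>arr Cat P A. ap h r x = m" by (rule genD(3)[OF gPx o(1) r(2) subset_refl])
    then obtain h where h: "h \<in> arr Cat P A" "ap h r x = m" by blast
    \<comment> \<open>The arrow hitting \<open>m\<close> on its own summand is extended by zero to
      the whole coproduct.\<close>
    let ?t = "\<lambda>j. if j = (r, ?D) then h else zero_arr (fst (Px j)) A"
    have "\<forall>j\<in>?I. ?t j \<in> arr Cat (fst (Px j)) A"
      using h P zero_arr(1)[OF _ o(1)] Px_obj by auto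
    then have "\<exists>!u. u \<in> arr Cat G A \<and> (\<forall>j\<in>?I. cmp Cat (fst (Px j)) G A u (inc j) = ?t j)"
      by (intro is_coproduct_univ[OF G o(1)]) blast
    then obtain u where u: "u \<in> arr Cat G A" "\<forall>j\<in>?I. cmp Cat (fst (Px j)) G A u (inc j) = ?t j" by blast
    have inc: "inc (r, ?D) \<in> arr Cat P G" using G i P unfolding is_coproduct_def by force
    have "cmp Cat P G A u (inc (r, ?D)) = h" using u(2)[rule_format, OF i] P by simp
    then have um: "ap u r (ap (inc (r, ?D)) r x) = m" using cmp(2)[OF Po(1) Go o(1) inc u(1) r(1) Po(2)] h(2) by simp
    have y: "ap (inc (r, ?D)) r x \<in> carrier (V G r)" using ap_closed[OF Po(1) Go inc r(1) Po(2)] .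
    have "cmp Cat G A A' f u \<noteq> cmp Cat G A A' g u"
      using cmp(2)[OF Go o u(1) f r(1) y] cmp(2)[OF Go o u(1) g r(1) y] um r(3) by auto
    then show "\<exists>h\<in>arr Cat G A. cmp Cat G A A' f h \<noteq> cmp Cat G A A' g h" using u(1) by blast
  qed
  then show ?thesis by blast
qed

theorem grothendieck: "grothendieck_category U Cat"
  unfolding grothendieck_category_def using AB5 generator_exists by blast

end

section \<open>Comodules in coordinates\<close>

text \<open>The tensor product looks only at the carrier, the addition and the scalar multiplication
  of \<open>V\<close>. A \<open>comodule\<close> record may therefore be exchanged for its
  underlying \<open>module\<close> record.\<close>

lemma tensor_module_cong:
  assumes "carrier V = carrier V'" "add V = add V'" "smult V = smult V'"
  shows "tensor K V W = tensor K V' W" "pure K V W = pure K V' W"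
  using assms unfolding tensor_def tensor_null_def bilinear_relators_def pure_def by simp_all

lemma coord_module_cong:
  assumes "carrier V = carrier V'" "add V = add V'" "smult V = smult V'" "zero V = zero V'"
  shows "coord K V W = coord K V' W"
  unfolding coord_def tensor_lift_def finsum_def finprod_def by (simp add: assms fun_eq_iff Let_def)

lemma linear_map_module_cong:
  assumes "carrier V = carrier V'" "add V = add V'" "smult V = smult V'"
    and "carrier W = carrier W'" "add W = add W'" "smult W = smult W'"
  shows "linear_map K V W = linear_map K V' W'"
  using assms by (simp add: linear_map_def fun_eq_iff)

lemma module_cong:
  assumes "module K V" and eq: "carrier V = carrier V'" "add V = add V'" "smult V = smult V'" "zero V = zero V'"
  shows "module K V'"
proof -
  interpret V: module K V by fact
  note eq' = eq[symmetric]
  show ?thesis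
  proof (intro moduleI abelian_groupI)
    show "cring K" ..
    fix x assume "x \<in> carrier V'"
    then show "\<exists>y\<in>carrier V'. y \<oplus>\<^bsub>V'\<^esub> x = \<zero>\<^bsub>V'\<^esub>"
      by (intro bexI[of _ "\<ominus>\<^bsub>V\<^esub> x"]) (auto simp: eq' V.M.l_neg)
  qed (auto simp: eq' V.M.a_ac V.smult_l_distr V.smult_r_distr V.smult_assoc1)
qed

lemma jointly_injective_eq:
  assumes W: "module K W" and T: "\<And>T g. (T, g) \<in> \<Gamma> \<Longrightarrow> module K T \<and> linear_map K W T g"
    and inj: "\<And>x. \<lbrakk>x \<in> carrier W; \<And>T g. (T, g) \<in> \<Gamma> \<Longrightarrow> g x = \<zero>\<^bsub>T\<^esub>\<rbrakk> \<Longrightarrow> x = \<zero>\<^bsub>W\<^esub>"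
    and x: "x \<in> carrier W" and y: "y \<in> carrier W" and eq: "\<And>T g. (T, g) \<in> \<Gamma> \<Longrightarrow> g x = g y"
  shows "x = y"
proof -
  interpret W: module K W by fact
  have "x \<ominus>\<^bsub>W\<^esub> y = \<zero>\<^bsub>W\<^esub>"
  proof (rule inj)
    show "x \<ominus>\<^bsub>W\<^esub> y \<in> carrier W" using x y by simp
    fix T g assume Tg: "(T, g) \<in> \<Gamma>"
    then interpret T: module K T using T by blast
    have g: "linear_map K W T g" using T Tg by blast
    show "g (x \<ominus>\<^bsub>W\<^esub> y) = \<zero>\<^bsub>T\<^esub>"
      using linear_map_minus[OF W T.module_axioms g x y] eq[OF Tg] linear_map_closed[OF g y]
      by (simp add: a_minus_def T.M.r_neg)
  qed
  then show ?thesis by (rule minus_zeroD[OF W _ x y])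
qed

section \<open>Coactions as families of coordinate operators\<close>

locale coalgebra_basis = coalgebra K C for K :: "'k ring" and C :: "('k, 'c) coalgebra" +
  fixes B :: "'c set" and e :: "'c \<Rightarrow> 'c \<Rightarrow> 'k"
  assumes basis: "is_basis K C B e"
begin

text \<open>A linear coaction without the comodule axioms: enough to define coordinates. The axioms
  are transferred to it afterwards along homomorphisms.\<close>

definition precomodule :: "('k, 'u, 'c) comodule \<Rightarrow> bool" where
  "precomodule M \<longleftrightarrow> module K M \<and> linear_map K M (tensor K M C) (coact M)"

definition cf :: "('k, 'u, 'c) comodule \<Rightarrow> 'c \<Rightarrow> 'u \<Rightarrow> 'u" where
  "cf M b m = coord K M C (e b) (coact M m)"

lemma precomoduleD:
  assumes "precomodule M"
  shows "module K M" "linear_map K M (tensor K M C) (coact M)"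
    "m \<in> carrier M \<Longrightarrow> coact M m \<in> carrier (tensor K M C)"
  using assms unfolding precomodule_def by (auto dest: linear_map_closed)

lemma comodule_pre: "comodule K C M \<Longrightarrow> precomodule M"
  by (simp add: precomodule_def comodule_def)

lemmas e_linear = is_basis_linear[OF basis]

lemma cf_linear: "precomodule M \<Longrightarrow> b \<in> B \<Longrightarrow> linear_map K M M (cf M b)"
  unfolding cf_def
  by (rule linear_map_comp[OF precomoduleD(2) coord_linear[OF precomoduleD(1) module e_linear]])

lemma cf_finite: "precomodule M \<Longrightarrow> m \<in> carrier M \<Longrightarrow> finite {b \<in> B. cf M b m \<noteq> \<zero>\<^bsub>M\<^esub>}"
  unfolding cf_def by (rule coord_finite[OF precomoduleD(1) module basis precomoduleD(3)])

lemma coact_expand: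
  assumes "precomodule M" "m \<in> carrier M" "finite D" "D \<subseteq> B" "{b \<in> B. cf M b m \<noteq> \<zero>\<^bsub>M\<^esub>} \<subseteq> D"
  shows "coact M m = (\<Oplus>\<^bsub>tensor K M C\<^esub>d\<in>D. pure K M C (cf M d m) d)"
  using coord_expand[OF precomoduleD(1)[OF assms(1)] module basis precomoduleD(3)[OF assms(1,2)] assms(3,4)] assms(5)
  by (simp add: cf_def)

text \<open>The coaction of \<open>m\<close> is a sum of pure tensors
  \<open>m\<^sub>d \<otimes> d\<close> with \<open>d\<close> in \<open>D\<close>. The finiteness
  bounds are obtained by showing that a linear map kills all these terms.\<close>

lemma linear_coact_zero:
  assumes M: "precomodule M" and m: "m \<in> carrier M" and D: "finite D" "D \<subseteq> B" "{b \<in> B. cf M b m \<noteq> \<zero>\<^bsub>M\<^esub>} \<subseteq> D"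
    and Z: "module K Z" and f: "linear_map K (tensor K M C) Z f"
    and zero: "\<And>d. d \<in> D \<Longrightarrow> f (pure K M C (cf M d m) d) = \<zero>\<^bsub>Z\<^esub>"
  shows "f (coact M m) = \<zero>\<^bsub>Z\<^esub>"
proof -
  interpret Z: module K Z by fact
  note M' = precomoduleD[OF M]
  have p: "pure K M C (cf M d m) d \<in> carrier (tensor K M C)" if "d \<in> D" for d
    using that D(2) linear_map_closed[OF cf_linear[OF M] m] is_basis_mem[OF basis]
    by (intro pure_closed M' module) auto
  have "f (coact M m) = (\<Oplus>\<^bsub>Z\<^esub>d\<in>D. f (pure K M C (cf M d m) d))"
    unfolding coact_expand[OF M m D]
    by (rule linear_map_finsum[OF tensor_module[OF M'(1) module] Z f D(1) p])
  also have "\<dots> = \<zero>\<^bsub>Z\<^esub>" using zero by (intro Z.M.add.finprod_one_eqI) auto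
  finally show ?thesis .
qed

text \<open>The coaction is the sum of the tensors \<open>\<rho> b m \<otimes> b\<close> over the
  finitely many nonzero coordinates. Its linearity is checked in coordinates, where it becomes
  linearity of each \<open>\<rho> b\<close>.\<close>

lemma coact_exists:
  assumes V: "module K V" and lin: "\<And>b. b \<in> B \<Longrightarrow> linear_map K V V (\<rho> b)"
    and fin: "\<And>m. m \<in> carrier V \<Longrightarrow> finite {b \<in> B. \<rho> b m \<noteq> \<zero>\<^bsub>V\<^esub>}"
  shows "\<exists>\<delta>. linear_map K V (tensor K V C) \<delta> \<and> (\<forall>b\<in>B. \<forall>m\<in>carrier V. coord K V C (e b) (\<delta> m) = \<rho> b m)"
proof -
  interpret V: module K V by fact
  interpret T: module K "tensor K V C" by (rule tensor_module[OF V module])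
  define \<delta> where "\<delta> m = (\<Oplus>\<^bsub>tensor K V C\<^esub>b\<in>{b \<in> B. \<rho> b m \<noteq> \<zero>\<^bsub>V\<^esub>}. pure K V C (\<rho> b m) b)" for m
  have p: "pure K V C (\<rho> b m) b \<in> carrier (tensor K V C)" if "b \<in> B" "m \<in> carrier V" for b m
    using that linear_map_closed[OF lin] is_basis_mem[OF basis] by (intro pure_closed V module) auto
  have \<delta>: "\<delta> m \<in> carrier (tensor K V C)" if "m \<in> carrier V" for m
    unfolding \<delta>_def using p that by (intro T.M.finsum_closed) auto
  have c: "coord K V C (e b) (\<delta> m) = \<rho> b m" if b: "b \<in> B" and m: "m \<in> carrier V" for b m
  proof -
    let ?S = "{b \<in> B. \<rho> b m \<noteq> \<zero>\<^bsub>V\<^esub>}"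
    note l = coord_linear[OF V module e_linear[OF b]]
    have r: "\<rho> b' m \<in> carrier V" if "b' \<in> B" for b' using linear_map_closed[OF lin[OF that] m] .
    have "coord K V C (e b) (\<delta> m) = (\<Oplus>\<^bsub>V\<^esub>b'\<in>?S. coord K V C (e b) (pure K V C (\<rho> b' m) b'))"
      unfolding \<delta>_def using p m by (intro linear_map_finsum[OF T.module_axioms V l fin[OF m]]) auto
    \<comment> \<open>Since \<open>e\<close> is dual to \<open>B\<close>, only the summand at
      \<open>b\<close> survives.\<close>
    also have "\<dots> = (\<Oplus>\<^bsub>V\<^esub>b'\<in>?S. if b = b' then \<rho> b' m else \<zero>\<^bsub>V\<^esub>)"
      using r b is_basis_mem[OF basis] is_basis_delta[OF basis b]
      by (intro V.M.finsum_cong') (auto simp: coord_pure[OF V module e_linear[OF b]])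
    also have "\<dots> = \<rho> b m"
    proof (cases "b \<in> ?S")
      case True
      then show ?thesis using r by (intro V.M.finsum_singleton fin m) auto
    next
      case False
      have "(\<Oplus>\<^bsub>V\<^esub>b'\<in>?S. if b = b' then \<rho> b' m else \<zero>\<^bsub>V\<^esub>) = \<zero>\<^bsub>V\<^esub>"
        using False by (intro V.M.add.finprod_one_eqI) auto
      then show ?thesis using False b by simp
    qed
    finally show ?thesis .
  qed
  have "linear_map K V (tensor K V C) \<delta>"
  proof (rule linear_mapI[OF \<delta>])
    fix x y assume x: "x \<in> carrier V" and y: "y \<in> carrier V"
    show "\<delta> (x \<oplus>\<^bsub>V\<^esub> y) = \<delta> x \<oplus>\<^bsub>tensor K V C\<^esub> \<delta> y"
    proof (rule coord_eqI[OF V module basis])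
      fix b assume b: "b \<in> B"
      show "coord K V C (e b) (\<delta> (x \<oplus>\<^bsub>V\<^esub> y)) = coord K V C (e b) (\<delta> x \<oplus>\<^bsub>tensor K V C\<^esub> \<delta> y)"
        using linear_map_add[OF coord_linear[OF V module e_linear[OF b]] \<delta>[OF x] \<delta>[OF y]]
          c[OF b] x y linear_map_add[OF lin[OF b] x y] by simp
    qed (use \<delta> x y in auto)
  next
    fix a x assume a: "a \<in> carrier K" and x: "x \<in> carrier V"
    show "\<delta> (a \<odot>\<^bsub>V\<^esub> x) = a \<odot>\<^bsub>tensor K V C\<^esub> \<delta> x"
    proof (rule coord_eqI[OF V module basis])
      fix b assume b: "b \<in> B"
      show "coord K V C (e b) (\<delta> (a \<odot>\<^bsub>V\<^esub> x)) = coord K V C (e b) (a \<odot>\<^bsub>tensor K V C\<^esub> \<delta> x)"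
        using linear_map_smult[OF coord_linear[OF V module e_linear[OF b]] a \<delta>[OF x]]
          c[OF b] x a linear_map_smult[OF lin[OF b] a x] by simp
    qed (use \<delta> x a in auto)
  qed
  then show ?thesis using c by blast
qed

text \<open>A tensor in \<open>N \<otimes> C\<close> is determined by its coordinates, and
  \<open>h \<otimes> id\<close> acts on coordinates through \<open>h\<close>.\<close>

lemma colinear_iff_cf:
  assumes M: "precomodule M" and N: "precomodule N" and h: "linear_map K M N h"
  shows "(\<forall>m\<in>carrier M. coact N (h m) = tensor_map K M C N C h id (coact M m)) \<longleftrightarrow>
    (\<forall>b\<in>B. \<forall>m\<in>carrier M. cf N b (h m) = h (cf M b m))"
proof -
  note M' = precomoduleD[OF M] and N' = precomoduleD[OF N]
  have c: "coord K N C (e b) (tensor_map K M C N C h id (coact M m)) = h (cf M b m)"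
    if "b \<in> B" "m \<in> carrier M" for b m
    using coord_map[OF M'(1) module N'(1) module h linear_map_ident(2) e_linear[OF that(1)] M'(3)[OF that(2)]]
    by (simp add: cf_def)
  show ?thesis
  proof (intro iffI ballI)
    fix b m assume "\<forall>m\<in>carrier M. coact N (h m) = tensor_map K M C N C h id (coact M m)"
      and "b \<in> B" "m \<in> carrier M"
    then show "cf N b (h m) = h (cf M b m)" using c by (simp add: cf_def)
  next
    fix m assume eq: "\<forall>b\<in>B. \<forall>m\<in>carrier M. cf N b (h m) = h (cf M b m)" and m: "m \<in> carrier M"
    show "coact N (h m) = tensor_map K M C N C h id (coact M m)"
    proof (rule coord_eqI[OF N'(1) module basis])
      show "coact N (h m) \<in> carrier (tensor K N C)" using N'(3) linear_map_closed[OF h m] by blast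
      show "tensor_map K M C N C h id (coact M m) \<in> carrier (tensor K N C)"
        using linear_map_closed[OF tensor_map_linear[OF M'(1) module N'(1) module h linear_map_ident(2)] M'(3)[OF m]] .
      show "coord K N C (e b) (coact N (h m)) = coord K N C (e b) (tensor_map K M C N C h id (coact M m))" if "b \<in> B" for b
        using c[OF that m] eq that m by (simp add: cf_def)
    qed
  qed
qed

definition prehom :: "('k, 'u, 'c) comodule \<Rightarrow> ('k, 'v, 'c) comodule \<Rightarrow> ('u \<Rightarrow> 'v) \<Rightarrow> bool" where
  "prehom M N h \<longleftrightarrow> linear_map K M N h \<and> (\<forall>b\<in>B. \<forall>m\<in>carrier M. cf N b (h m) = h (cf M b m))"

lemma prehom_linear: "prehom M N h \<Longrightarrow> linear_map K M N h"
  by (simp add: prehom_def)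

lemma prehom_coact: "\<lbrakk>precomodule M; precomodule N; prehom M N h; m \<in> carrier M\<rbrakk>
    \<Longrightarrow> coact N (h m) = tensor_map K M C N C h id (coact M m)"
  using colinear_iff_cf unfolding prehom_def by blast

lemma colinear_map_iff_prehom:
  "\<lbrakk>precomodule M; precomodule N\<rbrakk> \<Longrightarrow> colinear_map K C M N h \<longleftrightarrow> prehom M N h"
  using colinear_iff_cf unfolding prehom_def colinear_map_def by blast

section \<open>The comodule axioms along homomorphisms\<close>

definition coassoc_left where
  "coassoc_left M m = tensor_assoc K M C C (tensor_map K M C (tensor K M C) C (coact M) id (coact M m))"

definition coassoc_right where
  "coassoc_right M m = tensor_map K M C M (tensor K C C) id (comult C) (coact M m)"

lemma coassoc_closed:
  assumes M: "precomodule M" and m: "m \<in> carrier M"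
  shows "coassoc_left M m \<in> carrier (tensor K M (tensor K C C))"
    "coassoc_right M m \<in> carrier (tensor K M (tensor K C C))"
proof -
  note M' = precomoduleD[OF M]
  note MC = tensor_module[OF M'(1) module] and CC = tensor_module[OF module module]
  show "coassoc_left M m \<in> carrier (tensor K M (tensor K C C))"
    unfolding coassoc_left_def
    using linear_map_closed[OF tensor_assoc_linear[OF M'(1) module module]
        linear_map_closed[OF tensor_map_linear[OF M'(1) module MC module M'(2) linear_map_ident(2)] M'(3)[OF m]]] .
  show "coassoc_right M m \<in> carrier (tensor K M (tensor K C C))"
    unfolding coassoc_right_def
    using linear_map_closed[OF tensor_map_linear[OF M'(1) module M'(1) CC linear_map_ident(2) comult_linear] M'(3)[OF m]] .
qed

text \<open>Both sides of coassociativity, as maps from \<open>M\<close> to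
  \<open>M \<otimes> (C \<otimes> C)\<close>, commute with colinear maps, so the axiom may be
  compared before or after a homomorphism.\<close>

lemma coassoc_natural:
  assumes M: "precomodule M" and N: "precomodule N" and h: "prehom M N h" and m: "m \<in> carrier M"
  shows "coassoc_left N (h m) = tensor_map K M (tensor K C C) N (tensor K C C) h id (coassoc_left M m)"
    "coassoc_right N (h m) = tensor_map K M (tensor K C C) N (tensor K C C) h id (coassoc_right M m)"
proof -
  note M' = precomoduleD[OF M] and N' = precomoduleD[OF N] and hl = prehom_linear[OF h]
  note hm = prehom_coact[OF M N h]
  note MC = tensor_module[OF M'(1) module] and CC = tensor_module[OF module module]
    and NC = tensor_module[OF N'(1) module]
  note cm = M'(3)[OF m]
  note hC = tensor_map_linear[OF M'(1) module N'(1) module hl linear_map_ident(2)]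
  note cM = tensor_map_linear[OF M'(1) module MC module M'(2) linear_map_ident(2)]
  have "tensor_map K N C (tensor K N C) C (coact N) id (coact N (h m))
      = tensor_map K M C (tensor K N C) C (\<lambda>x. coact N (h x)) (\<lambda>x. id (id x)) (coact M m)"
    unfolding hm[OF m]
    by (rule tensor_map_comp[OF M'(1) module N'(1) module NC module hl linear_map_ident(2) N'(2) linear_map_ident(2) cm])
  also have "\<dots> = tensor_map K M C (tensor K N C) C (\<lambda>x. tensor_map K M C N C h id (coact M x)) (\<lambda>x. id (id x)) (coact M m)"
    using linear_map_comp[OF hl N'(2)]
    by (intro tensor_map_cong[OF M'(1) module NC module _ _ _ _ cm]) (auto simp: hm linear_map_ident)
  also have "\<dots> = tensor_map K (tensor K M C) C (tensor K N C) C (tensor_map K M C N C h id) id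
      (tensor_map K M C (tensor K M C) C (coact M) id (coact M m))"
    by (rule tensor_map_comp[OF M'(1) module MC module NC module M'(2) linear_map_ident(2) hC linear_map_ident(2) cm, symmetric])
  finally show "coassoc_left N (h m) = tensor_map K M (tensor K C C) N (tensor K C C) h id (coassoc_left M m)"
    unfolding coassoc_left_def
    using tensor_assoc_natural[OF M'(1) module module N'(1) hl linear_map_closed[OF cM cm]] by simp
  have "coassoc_right N (h m)
      = tensor_map K M C N (tensor K C C) (\<lambda>x. id (h x)) (\<lambda>x. comult C (id x)) (coact M m)"
    unfolding coassoc_right_def hm[OF m]
    by (rule tensor_map_comp[OF M'(1) module N'(1) module N'(1) CC hl linear_map_ident(2) linear_map_ident(2) comult_linear cm])
  also have "\<dots> = tensor_map K M C N (tensor K C C) (\<lambda>x. h (id x)) (\<lambda>x. id (comult C x)) (coact M m)"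
    by simp
  also have "\<dots> = tensor_map K M (tensor K C C) N (tensor K C C) h id (coassoc_right M m)"
    unfolding coassoc_right_def
    by (rule tensor_map_comp[OF M'(1) module M'(1) CC N'(1) CC linear_map_ident(2) comult_linear hl linear_map_ident(2) cm, symmetric])
  finally show "coassoc_right N (h m) = tensor_map K M (tensor K C C) N (tensor K C C) h id (coassoc_right M m)" .
qed

lemma comodule_iff:
  "comodule K C M \<longleftrightarrow> precomodule M \<and> (\<forall>m\<in>carrier M. coassoc_left M m = coassoc_right M m) \<and>
    (\<forall>m\<in>carrier M. coord K M C (counit C) (coact M m) = m)"
  unfolding comodule_def precomodule_def coassoc_left_def coassoc_right_def coord_def by blast

lemma counit_natural:
  assumes M: "precomodule M" and N: "precomodule N" and h: "prehom M N h" and m: "m \<in> carrier M"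
  shows "coord K N C (counit C) (coact N (h m)) = h (coord K M C (counit C) (coact M m))"
  unfolding prehom_coact[OF M N h m]
  using coord_map[OF precomoduleD(1)[OF M] module precomoduleD(1)[OF N] module prehom_linear[OF h]
      linear_map_ident(2) counit_linear precomoduleD(3)[OF M m]] by simp

text \<open>Every element of \<open>W\<close> is of the form \<open>q m\<close>, and naturality
  computes the two sides of each axiom there from those at \<open>m\<close>.\<close>

lemma comodule_surj:
  assumes T: "comodule K C T" and W: "precomodule W" and q: "prehom T W q" and surj: "q ` carrier T = carrier W"
  shows "comodule K C W"
proof -
  note T' = T[unfolded comodule_iff]
  note nat = coassoc_natural[OF comodule_pre[OF T] W q] counit_natural[OF comodule_pre[OF T] W q]
  have "\<forall>m\<in>carrier T. coassoc_left W (q m) = coassoc_right W (q m)" using nat(1,2) T' by simp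
  moreover have "\<forall>m\<in>carrier T. coord K W C (counit C) (coact W (q m)) = q m" using nat(3) T' by simp
  ultimately show ?thesis unfolding comodule_iff surj[symmetric] using W by blast
qed

text \<open>The two sides of coassociativity lie in \<open>W \<otimes> (C \<otimes> C)\<close>,
  where the family cannot be applied directly. Coordinates along \<open>e i \<otimes> e j\<close>
  bring them into \<open>W\<close>, where the family separates elements.\<close>

lemma comodule_inj:
  assumes W: "precomodule W" and T: "\<And>T g. (T, g) \<in> \<Gamma> \<Longrightarrow> comodule K C T \<and> prehom W T g"
    and inj: "\<And>x. \<lbrakk>x \<in> carrier W; \<And>T g. (T, g) \<in> \<Gamma> \<Longrightarrow> g x = \<zero>\<^bsub>T\<^esub>\<rbrakk> \<Longrightarrow> x = \<zero>\<^bsub>W\<^esub>"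
  shows "comodule K C W"
  unfolding comodule_iff
proof (intro conjI W ballI)
  note W' = precomoduleD[OF W]
  have lin: "module K T \<and> linear_map K W T g" if "(T, g) \<in> \<Gamma>" for T g
    using T[OF that] precomoduleD(1)[OF comodule_pre] prehom_linear by blast
  have eqI: "x = y" if "x \<in> carrier W" "y \<in> carrier W" "\<And>T g. (T, g) \<in> \<Gamma> \<Longrightarrow> g x = g y" for x y
    by (rule jointly_injective_eq[of K W \<Gamma>, OF W'(1) lin inj that])
  fix m assume m: "m \<in> carrier W"
  note cl = coassoc_closed[OF W m]
  note CC = tensor_module[OF module module]
  show "coassoc_left W m = coassoc_right W m"
  proof (rule coord_triple_eqI[OF W'(1) module basis cl])
    fix i j assume i: "i \<in> B" and j: "j \<in> B"
    let ?f = "tensor_functional K C C (e i) (e j)"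
    note f = tensor_functional_linear[OF module module e_linear[OF i] e_linear[OF j]]
    note fl = coord_linear[OF W'(1) CC f]
    show "coord K W (tensor K C C) ?f (coassoc_left W m) = coord K W (tensor K C C) ?f (coassoc_right W m)"
    proof (rule eqI)
      show "coord K W (tensor K C C) ?f (coassoc_left W m) \<in> carrier W"
        "coord K W (tensor K C C) ?f (coassoc_right W m) \<in> carrier W"
        using linear_map_closed[OF fl] cl by auto
      fix T g assume Tg: "(T, g) \<in> \<Gamma>"
      then have g: "comodule K C T" "prehom W T g" using T by auto
      note T' = precomoduleD[OF comodule_pre[OF g(1)]]
      have gm: "g m \<in> carrier T" using linear_map_closed[OF prehom_linear[OF g(2)] m] .
      note cm = coord_map[OF W'(1) CC T'(1) CC prehom_linear[OF g(2)] linear_map_ident(2) f]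
      have "g (coord K W (tensor K C C) ?f (coassoc_left W m)) = coord K T (tensor K C C) ?f (coassoc_left T (g m))"
        using cm[OF cl(1)] coassoc_natural(1)[OF W comodule_pre[OF g(1)] g(2) m] by simp
      also have "\<dots> = coord K T (tensor K C C) ?f (coassoc_right T (g m))"
        using g(1) gm unfolding comodule_iff by simp
      also have "\<dots> = g (coord K W (tensor K C C) ?f (coassoc_right W m))"
        using cm[OF cl(2)] coassoc_natural(2)[OF W comodule_pre[OF g(1)] g(2) m] by simp
      finally show "g (coord K W (tensor K C C) ?f (coassoc_left W m)) = g (coord K W (tensor K C C) ?f (coassoc_right W m))" .
    qed
  qed
  show "coord K W C (counit C) (coact W m) = m"
  proof (rule eqI[OF _ m])
    show "coord K W C (counit C) (coact W m) \<in> carrier W"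
      using linear_map_closed[OF coord_linear[OF W'(1) module counit_linear] W'(3)[OF m]] .
    fix T g assume Tg: "(T, g) \<in> \<Gamma>"
    then have g: "comodule K C T" "prehom W T g" using T by auto
    have gm: "g m \<in> carrier T" using linear_map_closed[OF prehom_linear[OF g(2)] m] .
    show "g (coord K W C (counit C) (coact W m)) = g m"
      using counit_natural[OF W comodule_pre[OF g(1)] g(2) m] g(1) gm unfolding comodule_iff by simp
  qed
qed

text \<open>By coassociativity, two coordinates in succession amount to one coordinate along the
  convolution product of \<open>e i\<close> and \<open>e j\<close>, that is,
  \<open>e i \<otimes> e j\<close> composed with the comultiplication.\<close>

lemma cf_cf:
  assumes M: "comodule K C M" and m: "m \<in> carrier M" and i: "i \<in> B" and j: "j \<in> B"
  shows "cf M i (cf M j m) = coord K M C (\<lambda>c. tensor_functional K C C (e i) (e j) (comult C c)) (coact M m)"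
proof -
  note pre = comodule_pre[OF M]
  note M' = precomoduleD[OF pre] and MC = tensor_module[OF precomoduleD(1)[OF pre] module]
    and CC = tensor_module[OF module module]
  note cm = M'(3)[OF m]
  let ?f = "tensor_functional K C C (e i) (e j)"
  note f = tensor_functional_linear[OF module module e_linear[OF i] e_linear[OF j]]
  note cM = tensor_map_linear[OF M'(1) module MC module M'(2) linear_map_ident(2)]
  have "coord K M (tensor K C C) ?f (coassoc_left M m)
      = coord K M C (e i) (coord K (tensor K M C) C (e j) (tensor_map K M C (tensor K M C) C (coact M) id (coact M m)))"
    unfolding coassoc_left_def
    by (rule coord_tensor_assoc[OF module module e_linear[OF i] e_linear[OF j] M'(1) linear_map_closed[OF cM cm]])
  also have "\<dots> = cf M i (cf M j m)"
    using coord_map[OF M'(1) module MC module M'(2) linear_map_ident(2) e_linear[OF j] cm] by (simp add: cf_def)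
  finally have "cf M i (cf M j m) = coord K M (tensor K C C) ?f (coassoc_right M m)"
    using M m unfolding comodule_iff by simp
  also have "\<dots> = coord K M C (\<lambda>c. ?f (comult C c)) (coact M m)"
    unfolding coassoc_right_def
    using coord_map[OF M'(1) module M'(1) CC linear_map_ident(2) comult_linear f cm] by simp
  finally show ?thesis .
qed

text \<open>If the support of \<open>m\<close> lies in \<open>D\<close>, only the tensors
  \<open>comult C d\<close> with \<open>d\<close> in \<open>D\<close> contribute, and each of them,
  with \<open>e j\<close> applied to its second factor, becomes an element of \<open>C\<close> with
  finitely many nonzero coordinates.\<close>

lemma cf_finite_step:
  assumes D: "finite D" "D \<subseteq> B" and j: "j \<in> B"
  shows "\<exists>D'. finite D' \<and> D' \<subseteq> B \<and> (\<forall>(M :: ('k, 'u, 'c) comodule) m. comodule K C M \<and> m \<in> carrier M \<and>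
    {b \<in> B. cf M b m \<noteq> \<zero>\<^bsub>M\<^esub>} \<subseteq> D \<longrightarrow> {b \<in> B. cf M b (cf M j m) \<noteq> \<zero>\<^bsub>M\<^esub>} \<subseteq> D')"
proof -
  let ?D = "\<Union>d\<in>D. {i \<in> B. e i (coord K C C (e j) (comult C d)) \<noteq> \<zero>\<^bsub>K\<^esub>}"
  have dC: "d \<in> carrier C" if "d \<in> D" for d using that D(2) is_basis_mem[OF basis] by auto
  have Cd: "coord K C C (e j) (comult C d) \<in> carrier C" if "d \<in> D" for d
    using linear_map_closed[OF coord_linear[OF module module e_linear[OF j]] linear_map_closed[OF comult_linear dC[OF that]]] .
  have fin: "finite ?D" using D(1) is_basis_finite[OF basis Cd] by blast
  have step: "{b \<in> B. cf M b (cf M j m) \<noteq> \<zero>\<^bsub>M\<^esub>} \<subseteq> ?D"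
    if M: "comodule K C M" and m: "m \<in> carrier M" and sup: "{b \<in> B. cf M b m \<noteq> \<zero>\<^bsub>M\<^esub>} \<subseteq> D" for M :: "('k, 'u, 'c) comodule" and m
  proof (rule subsetI, rule ccontr)
    fix i assume "i \<in> {b \<in> B. cf M b (cf M j m) \<noteq> \<zero>\<^bsub>M\<^esub>}" and n: "i \<notin> ?D"
    then have i: "i \<in> B" "cf M i (cf M j m) \<noteq> \<zero>\<^bsub>M\<^esub>" by auto
    note pre = comodule_pre[OF M]
    note M' = precomoduleD[OF pre]
    interpret M: module K M by (rule M')
    let ?f = "\<lambda>c. tensor_functional K C C (e i) (e j) (comult C c)"
    have f: "linear_map K C (base_module K) ?f"
      by (rule linear_map_comp[OF comult_linear tensor_functional_linear[OF module module e_linear[OF i(1)] e_linear[OF j]]])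
    have "coord K M C ?f (coact M m) = \<zero>\<^bsub>M\<^esub>"
    proof (rule linear_coact_zero[OF pre m D sup M'(1) coord_linear[OF M'(1) module f]])
      fix d assume d: "d \<in> D"
      have "?f d = \<zero>\<^bsub>K\<^esub>"
        using n d i(1) tensor_functional_coord[OF module module e_linear[OF i(1)] e_linear[OF j] linear_map_closed[OF comult_linear dC[OF d]]]
        by auto
      moreover have "cf M d m \<in> carrier M" using linear_map_closed[OF cf_linear[OF pre] m] d D(2) by blast
      ultimately show "coord K M C ?f (pure K M C (cf M d m) d) = \<zero>\<^bsub>M\<^esub>"
        using coord_pure[OF M'(1) module f _ dC[OF d]] by simp
    qed
    then show False using cf_cf[OF M m i(1) j] i(2) by simp
  qed
  show ?thesis
  proof (intro exI[of _ ?D] conjI fin)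
    show "?D \<subseteq> B" by blast
  qed (intro allI impI, elim conjE, rule step)
qed

section \<open>The entwining condition\<close>

text \<open>
  \<open>H\<close> is a morphism space acting on \<open>M\<close> with values in \<open>M'\<close>, and \<open>p c\<close> is \<open>\<psi>(c \<otimes> f)\<close> for a
  fixed \<open>f\<close>; \<open>entw_side\<close> sends \<open>m\<^sub>0 \<otimes> m\<^sub>1\<close> to \<open>m\<^sub>0 f\<^sub>\<psi> \<otimes> m\<^sub>1\<^sup>\<psi>\<close>.
\<close>

definition entw_side where
  "entw_side H M M' a p = tensor_lift K M C (tensor K M' C) (\<lambda>m0 m1. tensor_map K H C M' C (\<lambda>f. a f m0) id (p m1))"

context
  fixes H :: "('k, 'f, 'n) module_scheme" and p
  assumes H: "module K H" and p: "linear_map K C (tensor K H C) p"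
begin

text \<open>Linearity in \<open>m0\<close> is linearity of a lift in a parameter, because
  \<open>m0\<close> occurs inside the map that is tensored with the identity.\<close>

lemma entw_side_bilinear:
  assumes M: "module K M" "module K M'" and a: "bilinear K H M M' a"
  shows "bilinear K M C (tensor K M' C) (\<lambda>m0 m1. tensor_map K H C M' C (\<lambda>f. a f m0) id (p m1))"
proof (rule bilinearI)
  have al: "linear_map K H M' (\<lambda>f. a f m)" if "m \<in> carrier M" for m using a that by (simp add: bilinear_def)
  show "linear_map K C (tensor K M' C) (\<lambda>c. tensor_map K H C M' C (\<lambda>f. a f m) id (p c))" if "m \<in> carrier M" for m
    by (rule linear_map_comp[OF p tensor_map_linear[OF H module M(2) module al[OF that] linear_map_ident(2)]])
  show "linear_map K M (tensor K M' C) (\<lambda>m. tensor_map K H C M' C (\<lambda>f. a f m) id (p c))" if c: "c \<in> carrier C" for c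
    unfolding tensor_map_def
  proof (rule tensor_lift_param_linear[OF H module tensor_module[OF M(2) module] M(1) _ _ linear_map_closed[OF p c]])
    show "bilinear K H C (tensor K M' C) (\<lambda>f c. pure K M' C (a f m) (id c))" if "m \<in> carrier M" for m
      by (rule tensor_map_bilinear[OF H module M(2) module al[OF that] linear_map_ident(2)])
    fix f c assume f: "f \<in> carrier H" and c: "c \<in> carrier C"
    have "linear_map K M M' (a f)" using a f by (simp add: bilinear_def)
    from linear_map_comp[OF this pure_linear(1)[OF M(2) module c]]
    show "linear_map K M (tensor K M' C) (\<lambda>m. pure K M' C (a f m) (id c))" by simp
  qed
qed

lemma entw_side_linear:
  assumes M: "module K M" "module K M'" and a: "bilinear K H M M' a"
  shows "linear_map K (tensor K M C) (tensor K M' C) (entw_side H M M' a p)"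
  unfolding entw_side_def
  by (rule tensor_lift_linear[OF M(1) module tensor_module[OF M(2) module] entw_side_bilinear[OF assms]])

text \<open>The right-hand side of the entwining condition commutes with pairs of linear maps that
  respect the action, so the condition transfers in the same way as the comodule axioms.\<close>

lemma entw_side_natural:
  assumes M: "module K M" "module K M'" and a: "bilinear K H M M' a"
    and N: "module K N" "module K N'" and a': "bilinear K H N N' a'"
    and h: "linear_map K M N h" and h': "linear_map K M' N' h'"
    and comm: "\<And>f m. \<lbrakk>f \<in> carrier H; m \<in> carrier M\<rbrakk> \<Longrightarrow> h' (a f m) = a' f (h m)"
    and t: "t \<in> carrier (tensor K M C)"
  shows "entw_side H N N' a' p (tensor_map K M C N C h id t) = tensor_map K M' C N' C h' id (entw_side H M M' a p t)"
proof -
  note b = entw_side_bilinear[OF M a] and b' = entw_side_bilinear[OF N a']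
  note N'C = tensor_module[OF N(2) module] and M'C = tensor_module[OF M(2) module]
  note h'C = tensor_map_linear[OF M(2) module N(2) module h' linear_map_ident(2)]
  have "entw_side H N N' a' p (tensor_map K M C N C h id t)
      = tensor_lift K M C (tensor K N' C) (\<lambda>m0 m1. tensor_map K H C N' C (\<lambda>f. a' f (h m0)) id (p (id m1))) t"
    unfolding entw_side_def
    by (rule tensor_lift_map[OF M(1) module N(1) module h linear_map_ident(2) N'C b' t])
  also have "\<dots> = tensor_lift K M C (tensor K N' C) (\<lambda>m0 m1. tensor_map K M' C N' C h' id (tensor_map K H C M' C (\<lambda>f. a f m0) id (p m1))) t"
  proof (rule tensor_lift_cong[OF M(1) module N'C bilinear_precomp[OF b' h linear_map_ident(2)] _ t])
    fix m c assume m: "m \<in> carrier M" and c: "c \<in> carrier C"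
    note pc = linear_map_closed[OF p c]
    have al: "linear_map K H M' (\<lambda>f. a f m)" using a m by (simp add: bilinear_def)
    have "tensor_map K M' C N' C h' id (tensor_map K H C M' C (\<lambda>f. a f m) id (p c))
        = tensor_map K H C N' C (\<lambda>f. h' (a f m)) (\<lambda>x. id (id x)) (p c)"
      by (rule tensor_map_comp[OF H module M(2) module N(2) module al linear_map_ident(2) h' linear_map_ident(2) pc])
    also have "\<dots> = tensor_map K H C N' C (\<lambda>f. a' f (h m)) id (p c)"
      using linear_map_comp[OF al h'] comm m
      by (intro tensor_map_cong[OF H module N(2) module _ _ _ _ pc]) (auto simp: linear_map_ident)
    finally show "tensor_map K H C N' C (\<lambda>f. a' f (h m)) id (p (id c))
        = tensor_map K M' C N' C h' id (tensor_map K H C M' C (\<lambda>f. a f m) id (p c))" by simp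
  qed
  also have "\<dots> = tensor_map K M' C N' C h' id (entw_side H M M' a p t)"
    unfolding entw_side_def
    by (rule tensor_lift_comp[OF M(1) module M'C N'C b h'C t, symmetric])
  finally show ?thesis .
qed

text \<open>The coordinate \<open>i\<close> of \<open>m f\<close> is the sum over \<open>d\<close>
  in \<open>D\<close> of \<open>m\<^sub>d\<close> acted on by the coordinate \<open>i\<close> of
  \<open>\<psi>(d \<otimes> f)\<close>. Each tensor \<open>p d\<close> has finitely many nonzero
  coordinates, so the bound depends only on \<open>D\<close> and \<open>p\<close>.\<close>

lemma entw_side_finite_step:
  assumes D: "finite D" "D \<subseteq> B"
  shows "\<exists>D'. finite D' \<and> D' \<subseteq> B \<and> (\<forall>(M :: ('k, 'u, 'c) comodule) (M' :: ('k, 'u, 'c) comodule) a m f0. precomodule M \<and> precomodule M' \<and> bilinear K H M M' a \<and>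
    m \<in> carrier M \<and> coact M' (a f0 m) = entw_side H M M' a p (coact M m) \<and>
    {b \<in> B. cf M b m \<noteq> \<zero>\<^bsub>M\<^esub>} \<subseteq> D \<longrightarrow> {b \<in> B. cf M' b (a f0 m) \<noteq> \<zero>\<^bsub>M'\<^esub>} \<subseteq> D')"
proof -
  let ?D = "\<Union>d\<in>D. {i \<in> B. coord K H C (e i) (p d) \<noteq> \<zero>\<^bsub>H\<^esub>}"
  have dC: "d \<in> carrier C" if "d \<in> D" for d using that D(2) is_basis_mem[OF basis] by auto
  have fin: "finite ?D" using D(1) coord_finite[OF H module basis linear_map_closed[OF p dC]] by blast
  have step: "{b \<in> B. cf M' b (a f0 m) \<noteq> \<zero>\<^bsub>M'\<^esub>} \<subseteq> ?D"
    if M: "precomodule M" "precomodule M'" and a: "bilinear K H M M' a" and m: "m \<in> carrier M"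
      and eq: "coact M' (a f0 m) = entw_side H M M' a p (coact M m)" and sup: "{b \<in> B. cf M b m \<noteq> \<zero>\<^bsub>M\<^esub>} \<subseteq> D"
    for M M' :: "('k, 'u, 'c) comodule" and a m f0
  proof (rule subsetI, rule ccontr)
    fix i assume "i \<in> {b \<in> B. cf M' b (a f0 m) \<noteq> \<zero>\<^bsub>M'\<^esub>}" and n: "i \<notin> ?D"
    then have i: "i \<in> B" "cf M' i (a f0 m) \<noteq> \<zero>\<^bsub>M'\<^esub>" by auto
    note Mm = precomoduleD[OF M(1)] and Mm' = precomoduleD[OF M(2)]
    note l = entw_side_linear[OF Mm(1) Mm'(1) a]
    have "coord K M' C (e i) (entw_side H M M' a p (coact M m)) = \<zero>\<^bsub>M'\<^esub>"
    proof (rule linear_coact_zero[OF M(1) m D sup Mm'(1)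
          linear_map_comp[OF l coord_linear[OF Mm'(1) module e_linear[OF i(1)]]]])
      fix d assume d: "d \<in> D"
      have cfm: "cf M d m \<in> carrier M" using linear_map_closed[OF cf_linear[OF M(1)] m] d D(2) by blast
      have al: "linear_map K H M' (\<lambda>f. a f (cf M d m))" using a cfm by (simp add: bilinear_def)
      have "entw_side H M M' a p (pure K M C (cf M d m) d) = tensor_map K H C M' C (\<lambda>f. a f (cf M d m)) id (p d)"
        unfolding entw_side_def
        by (rule tensor_lift_pure[OF Mm(1) module tensor_module[OF Mm'(1) module] entw_side_bilinear[OF Mm(1) Mm'(1) a] cfm dC[OF d]])
      then have "coord K M' C (e i) (entw_side H M M' a p (pure K M C (cf M d m) d)) = a (coord K H C (e i) (p d)) (cf M d m)"
        using coord_map[OF H module Mm'(1) module al linear_map_ident(2) e_linear[OF i(1)] linear_map_closed[OF p dC[OF d]]] by simp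
      also have "\<dots> = \<zero>\<^bsub>M'\<^esub>" using n d i(1) linear_map_zero[OF H Mm'(1) al] by auto
      finally show "coord K M' C (e i) (entw_side H M M' a p (pure K M C (cf M d m) d)) = \<zero>\<^bsub>M'\<^esub>" .
    qed
    then show False using i(2) eq by (simp add: cf_def)
  qed
  show ?thesis
  proof (intro exI[of _ ?D] conjI fin)
    show "?D \<subseteq> B" by blast
    qed (intro allI impI step; elim conjE; assumption)
qed

end

end

section \<open>Entwined modules as operator representations\<close>

datatype ('x, 'a, 'o, 'f, 'c) operator = Act 'x 'o 'o 'f | Map 'x 'x 'a 'o | Co 'x 'o 'c

locale entwined_representation = coalgebra_basis K C B e
  for K :: "'k ring" and C :: "('k, 'c) coalgebra" and B e +
  fixes U :: "'u itself" and X :: "('x, 'a) cat" and R :: "('x, 'a, 'o, 'f, 'k, 'c) representation"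
  assumes univ: "universe U" and small_K: "small U (carrier K)" and small_C: "small U (carrier C)"
    and small_X: "small_category U X" and R: "is_representation U K C X R"
begin

abbreviation "E x \<equiv> fob R x"
abbreviation "sp M x r \<equiv> espace (rspace M x) r"
abbreviation "act M x s r \<equiv> eact (rspace M x) s r"
abbreviation "H x s r \<equiv> lhom (E x) s r"
abbreviation "Fo x y \<alpha> \<equiv> fob (farr R x y \<alpha>)"
abbreviation "Fa x y \<alpha> \<equiv> farr (farr R x y \<alpha>)"
abbreviation "Mods \<equiv> Mod_cat U K C X R :: (('x, 'a, 'o, 'f, 'k, 'u, 'c) repmod, 'x \<Rightarrow> 'o \<Rightarrow> 'u \<Rightarrow> 'u) cat"

section \<open>The linear categories and functors of the representation\<close>

lemma X_category: "category X" using small_X by (simp add: small_category_def)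

lemmas X_ident = category.ident_arr[OF X_category]
lemmas X_cmp = category.cmp_arr[OF X_category]

lemma E_entwining: "x \<in> obj X \<Longrightarrow> entwining K C (E x)"
  and E_small: "x \<in> obj X \<Longrightarrow> small_category U (underlying (E x))"
  using R unfolding is_representation_def is_functor_def Ent_cat_def by auto

lemma E_linear: "x \<in> obj X \<Longrightarrow> linear_category K (E x)"
  using E_entwining entwining.axioms(1) by blast

lemma E_category: "x \<in> obj X \<Longrightarrow> category (underlying (E x))"
  using E_small by (simp add: small_category_def)

lemma lid_closed: "x \<in> obj X \<Longrightarrow> r \<in> lobj (E x) \<Longrightarrow> lid (E x) r \<in> carrier (H x r r)"
  using category.ident_arr[OF E_category, of x r] by (simp add: underlying_def)

lemma lcmp_closed: "\<lbrakk>x \<in> obj X; t \<in> lobj (E x); s \<in> lobj (E x); r \<in> lobj (E x);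
    g \<in> carrier (H x t s); f \<in> carrier (H x s r)\<rbrakk> \<Longrightarrow> lcmp (E x) t s r f g \<in> carrier (H x t r)"
  using category.cmp_arr[OF E_category, of x t s r g f] by (simp add: underlying_def)

lemma H_module: "\<lbrakk>x \<in> obj X; s \<in> lobj (E x); r \<in> lobj (E x)\<rbrakk> \<Longrightarrow> module K (H x s r)"
  using linear_category.hom_module[OF E_linear] .

lemma psi_linear: "\<lbrakk>x \<in> obj X; s \<in> lobj (E x); r \<in> lobj (E x); f \<in> carrier (H x s r)\<rbrakk>
    \<Longrightarrow> linear_map K C (tensor K (H x s r) C) (\<lambda>c. psi K C (E x) s r c f)"
  by (rule linear_map_comp[OF pure_linear(1)[OF module H_module] entwining.entw_linear[OF E_entwining]])

lemma R_arr: "\<lbrakk>x \<in> obj X; y \<in> obj X; \<alpha> \<in> arr X x y\<rbrakk> \<Longrightarrow> farr R x y \<alpha> \<in> arr (Ent_cat U K C) (E x) (E y)"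
  using R unfolding is_representation_def by (rule is_functor_arr)

lemma R_functor: "\<lbrakk>x \<in> obj X; y \<in> obj X; \<alpha> \<in> arr X x y\<rbrakk>
    \<Longrightarrow> is_functor (underlying (E x)) (underlying (E y)) (farr R x y \<alpha>)"
  using R_arr[of x y \<alpha>] by (simp add: Ent_cat_def entwining_morphism_def)

lemma Fo_closed: "\<lbrakk>x \<in> obj X; y \<in> obj X; \<alpha> \<in> arr X x y; r \<in> lobj (E x)\<rbrakk> \<Longrightarrow> Fo x y \<alpha> r \<in> lobj (E y)"
  using R_functor[of x y \<alpha>] by (auto simp: is_functor_def underlying_def)

lemma Fa_closed: "\<lbrakk>x \<in> obj X; y \<in> obj X; \<alpha> \<in> arr X x y; s \<in> lobj (E x); r \<in> lobj (E x); f \<in> carrier (H x s r)\<rbrakk>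
    \<Longrightarrow> Fa x y \<alpha> s r f \<in> carrier (H y (Fo x y \<alpha> s) (Fo x y \<alpha> r))"
  using is_functor_arr[OF R_functor[of x y \<alpha>], of s r f] by (simp add: underlying_def)

lemma Fo_ident: "\<lbrakk>x \<in> obj X; r \<in> lobj (E x)\<rbrakk> \<Longrightarrow> Fo x x (ident X x) r = r"
  using R by (simp add: is_representation_def is_functor_def Ent_cat_def)

lemma Fo_cmp: "\<lbrakk>x \<in> obj X; y \<in> obj X; z \<in> obj X; \<alpha> \<in> arr X x y; \<beta> \<in> arr X y z; r \<in> lobj (E x)\<rbrakk>
    \<Longrightarrow> Fo x z (cmp X x y z \<beta> \<alpha>) r = Fo y z \<beta> (Fo x y \<alpha> r)"
  using R by (simp add: is_representation_def is_functor_def Ent_cat_def compose_def)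

text \<open>The part of the structure that any representation of the signature with small spaces and
  finite coordinates provides: linear operators and linear coactions, subject to no identities. The
  extensionality clauses fix the maps \<open>rmap\<close> off the carriers.\<close>

definition pre :: "('x, 'a, 'o, 'f, 'k, 'u, 'c) repmod \<Rightarrow> bool" where
  "pre M \<longleftrightarrow>
     (\<forall>x\<in>obj X. \<forall>r\<in>lobj (E x). precomodule (sp M x r) \<and> small U (carrier (sp M x r))) \<and>
     (\<forall>x\<in>obj X. \<forall>s\<in>lobj (E x). \<forall>r\<in>lobj (E x). \<forall>f\<in>carrier (H x s r).
        linear_map K (sp M x r) (sp M x s) (act M x s r f)) \<and>
     (\<forall>x\<in>obj X. \<forall>y\<in>obj X. \<forall>\<alpha>\<in>arr X x y. rmap M x y \<alpha> \<in> extensional (lobj (E x)) \<and>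
        (\<forall>r\<in>lobj (E x). rmap M x y \<alpha> r \<in> extensional (carrier (sp M x r)) \<and>
          linear_map K (sp M x r) (sp M y (Fo x y \<alpha> r)) (rmap M x y \<alpha> r)))"

text \<open>The axioms, all of them testable at elements. Linearity of the action in the arrow
  \<open>f\<close> belongs here, because it relates different operators.\<close>

definition laws :: "('x, 'a, 'o, 'f, 'k, 'u, 'c) repmod \<Rightarrow> bool" where
  "laws M \<longleftrightarrow>
     (\<forall>x\<in>obj X. \<forall>r\<in>lobj (E x). comodule K C (sp M x r)) \<and>
     (\<forall>x\<in>obj X. \<forall>s\<in>lobj (E x). \<forall>r\<in>lobj (E x). \<forall>m\<in>carrier (sp M x r).
        (\<forall>f\<in>carrier (H x s r). \<forall>f'\<in>carrier (H x s r).
          act M x s r (f \<oplus>\<^bsub>H x s r\<^esub> f') m = act M x s r f m \<oplus>\<^bsub>sp M x s\<^esub> act M x s r f' m) \<and>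
        (\<forall>a\<in>carrier K. \<forall>f\<in>carrier (H x s r).
          act M x s r (a \<odot>\<^bsub>H x s r\<^esub> f) m = a \<odot>\<^bsub>sp M x s\<^esub> act M x s r f m)) \<and>
     (\<forall>x\<in>obj X. \<forall>r\<in>lobj (E x). \<forall>m\<in>carrier (sp M x r). act M x r r (lid (E x) r) m = m) \<and>
     (\<forall>x\<in>obj X. \<forall>t\<in>lobj (E x). \<forall>s\<in>lobj (E x). \<forall>r\<in>lobj (E x). \<forall>g\<in>carrier (H x t s). \<forall>f\<in>carrier (H x s r).
        \<forall>m\<in>carrier (sp M x r). act M x t r (lcmp (E x) t s r f g) m = act M x t s g (act M x s r f m)) \<and>
     (\<forall>x\<in>obj X. \<forall>s\<in>lobj (E x). \<forall>r\<in>lobj (E x). \<forall>f\<in>carrier (H x s r). \<forall>m\<in>carrier (sp M x r).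
        coact (sp M x s) (act M x s r f m) = entw_side (H x s r) (sp M x r) (sp M x s) (act M x s r)
          (\<lambda>c. psi K C (E x) s r c f) (coact (sp M x r) m)) \<and>
     (\<forall>x\<in>obj X. \<forall>y\<in>obj X. \<forall>\<alpha>\<in>arr X x y. \<forall>r\<in>lobj (E x). \<forall>m\<in>carrier (sp M x r). \<forall>b\<in>B.
        cf (sp M y (Fo x y \<alpha> r)) b (rmap M x y \<alpha> r m) = rmap M x y \<alpha> r (cf (sp M x r) b m)) \<and>
     (\<forall>x\<in>obj X. \<forall>y\<in>obj X. \<forall>\<alpha>\<in>arr X x y. \<forall>s\<in>lobj (E x). \<forall>r\<in>lobj (E x). \<forall>f\<in>carrier (H x s r).
        \<forall>m\<in>carrier (sp M x r). rmap M x y \<alpha> s (act M x s r f m)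
          = act M y (Fo x y \<alpha> s) (Fo x y \<alpha> r) (Fa x y \<alpha> s r f) (rmap M x y \<alpha> r m)) \<and>
     (\<forall>x\<in>obj X. \<forall>r\<in>lobj (E x). \<forall>m\<in>carrier (sp M x r). rmap M x x (ident X x) r m = m) \<and>
     (\<forall>x\<in>obj X. \<forall>y\<in>obj X. \<forall>z\<in>obj X. \<forall>\<alpha>\<in>arr X x y. \<forall>\<beta>\<in>arr X y z. \<forall>r\<in>lobj (E x). \<forall>m\<in>carrier (sp M x r).
        rmap M x z (cmp X x y z \<beta> \<alpha>) r m = rmap M y z \<beta> (Fo x y \<alpha> r) (rmap M x y \<alpha> r m))"

definition is_hom :: "('x, 'a, 'o, 'f, 'k, 'u, 'c) repmod \<Rightarrow> ('x, 'a, 'o, 'f, 'k, 'u, 'c) repmod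
    \<Rightarrow> ('x \<times> 'o \<Rightarrow> 'u \<Rightarrow> 'u) \<Rightarrow> bool" where
  "is_hom M N g \<longleftrightarrow>
     (\<forall>x\<in>obj X. \<forall>r\<in>lobj (E x). prehom (sp M x r) (sp N x r) (g (x, r))) \<and>
     (\<forall>x\<in>obj X. \<forall>s\<in>lobj (E x). \<forall>r\<in>lobj (E x). \<forall>f\<in>carrier (H x s r). \<forall>m\<in>carrier (sp M x r).
        g (x, s) (act M x s r f m) = act N x s r f (g (x, r) m)) \<and>
     (\<forall>x\<in>obj X. \<forall>y\<in>obj X. \<forall>\<alpha>\<in>arr X x y. \<forall>r\<in>lobj (E x). \<forall>m\<in>carrier (sp M x r).
        g (y, Fo x y \<alpha> r) (rmap M x y \<alpha> r m) = rmap N x y \<alpha> r (g (x, r) m))"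

lemma pre_sp: "\<lbrakk>pre M; x \<in> obj X; r \<in> lobj (E x)\<rbrakk> \<Longrightarrow> precomodule (sp M x r)"
  and pre_small: "\<lbrakk>pre M; x \<in> obj X; r \<in> lobj (E x)\<rbrakk> \<Longrightarrow> small U (carrier (sp M x r))"
  and pre_act: "\<lbrakk>pre M; x \<in> obj X; s \<in> lobj (E x); r \<in> lobj (E x); f \<in> carrier (H x s r)\<rbrakk>
    \<Longrightarrow> linear_map K (sp M x r) (sp M x s) (act M x s r f)"
  and pre_rmap: "\<lbrakk>pre M; x \<in> obj X; y \<in> obj X; \<alpha> \<in> arr X x y; r \<in> lobj (E x)\<rbrakk>
    \<Longrightarrow> linear_map K (sp M x r) (sp M y (Fo x y \<alpha> r)) (rmap M x y \<alpha> r)"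
  by (simp_all add: pre_def)

lemma pre_rmap_ext: "\<lbrakk>pre M; x \<in> obj X; y \<in> obj X; \<alpha> \<in> arr X x y\<rbrakk> \<Longrightarrow> rmap M x y \<alpha> \<in> extensional (lobj (E x))"
    "\<lbrakk>pre M; x \<in> obj X; y \<in> obj X; \<alpha> \<in> arr X x y; r \<in> lobj (E x)\<rbrakk> \<Longrightarrow> rmap M x y \<alpha> r \<in> extensional (carrier (sp M x r))"
  by (simp_all add: pre_def)

lemma pre_module: "\<lbrakk>pre M; x \<in> obj X; r \<in> lobj (E x)\<rbrakk> \<Longrightarrow> module K (sp M x r)"
  using precomoduleD(1)[OF pre_sp] .

lemma pre_act_closed: "\<lbrakk>pre M; x \<in> obj X; s \<in> lobj (E x); r \<in> lobj (E x); f \<in> carrier (H x s r); m \<in> carrier (sp M x r)\<rbrakk>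
    \<Longrightarrow> act M x s r f m \<in> carrier (sp M x s)"
  using linear_map_closed[OF pre_act] .

lemma pre_rmap_closed: "\<lbrakk>pre M; x \<in> obj X; y \<in> obj X; \<alpha> \<in> arr X x y; r \<in> lobj (E x); m \<in> carrier (sp M x r)\<rbrakk>
    \<Longrightarrow> rmap M x y \<alpha> r m \<in> carrier (sp M y (Fo x y \<alpha> r))"
  using linear_map_closed[OF pre_rmap] .

lemma is_hom_prehom: "\<lbrakk>is_hom M N g; x \<in> obj X; r \<in> lobj (E x)\<rbrakk> \<Longrightarrow> prehom (sp M x r) (sp N x r) (g (x, r))"
  and is_hom_act: "\<lbrakk>is_hom M N g; x \<in> obj X; s \<in> lobj (E x); r \<in> lobj (E x); f \<in> carrier (H x s r); m \<in> carrier (sp M x r)\<rbrakk>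
    \<Longrightarrow> g (x, s) (act M x s r f m) = act N x s r f (g (x, r) m)"
  and is_hom_rmap: "\<lbrakk>is_hom M N g; x \<in> obj X; y \<in> obj X; \<alpha> \<in> arr X x y; r \<in> lobj (E x); m \<in> carrier (sp M x r)\<rbrakk>
    \<Longrightarrow> g (y, Fo x y \<alpha> r) (rmap M x y \<alpha> r m) = rmap N x y \<alpha> r (g (x, r) m)"
  by (simp_all add: is_hom_def)

lemma is_hom_linear: "\<lbrakk>is_hom M N g; x \<in> obj X; r \<in> lobj (E x)\<rbrakk> \<Longrightarrow> linear_map K (sp M x r) (sp N x r) (g (x, r))"
  using prehom_linear[OF is_hom_prehom] .

lemma is_hom_cf: "\<lbrakk>is_hom M N g; x \<in> obj X; r \<in> lobj (E x); b \<in> B; m \<in> carrier (sp M x r)\<rbrakk>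
    \<Longrightarrow> cf (sp N x r) b (g (x, r) m) = g (x, r) (cf (sp M x r) b m)"
  using is_hom_prehom unfolding prehom_def by blast

lemma is_hom_closed: "\<lbrakk>is_hom M N g; x \<in> obj X; r \<in> lobj (E x); m \<in> carrier (sp M x r)\<rbrakk> \<Longrightarrow> g (x, r) m \<in> carrier (sp N x r)"
  using linear_map_closed[OF is_hom_linear] .

lemma lawsD:
  assumes "laws M"
  shows "\<lbrakk>x \<in> obj X; r \<in> lobj (E x)\<rbrakk> \<Longrightarrow> comodule K C (sp M x r)"
    "\<lbrakk>x \<in> obj X; s \<in> lobj (E x); r \<in> lobj (E x); m \<in> carrier (sp M x r); f \<in> carrier (H x s r); f' \<in> carrier (H x s r)\<rbrakk>
      \<Longrightarrow> act M x s r (f \<oplus>\<^bsub>H x s r\<^esub> f') m = act M x s r f m \<oplus>\<^bsub>sp M x s\<^esub> act M x s r f' m"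
    "\<lbrakk>x \<in> obj X; s \<in> lobj (E x); r \<in> lobj (E x); m \<in> carrier (sp M x r); a \<in> carrier K; f \<in> carrier (H x s r)\<rbrakk>
      \<Longrightarrow> act M x s r (a \<odot>\<^bsub>H x s r\<^esub> f) m = a \<odot>\<^bsub>sp M x s\<^esub> act M x s r f m"
    "\<lbrakk>x \<in> obj X; r \<in> lobj (E x); m \<in> carrier (sp M x r)\<rbrakk> \<Longrightarrow> act M x r r (lid (E x) r) m = m"
    "\<lbrakk>x \<in> obj X; t \<in> lobj (E x); s \<in> lobj (E x); r \<in> lobj (E x); g \<in> carrier (H x t s); f \<in> carrier (H x s r); m \<in> carrier (sp M x r)\<rbrakk>
      \<Longrightarrow> act M x t r (lcmp (E x) t s r f g) m = act M x t s g (act M x s r f m)"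
    "\<lbrakk>x \<in> obj X; s \<in> lobj (E x); r \<in> lobj (E x); f \<in> carrier (H x s r); m \<in> carrier (sp M x r)\<rbrakk>
      \<Longrightarrow> coact (sp M x s) (act M x s r f m) = entw_side (H x s r) (sp M x r) (sp M x s) (act M x s r)
          (\<lambda>c. psi K C (E x) s r c f) (coact (sp M x r) m)"
    "\<lbrakk>x \<in> obj X; y \<in> obj X; \<alpha> \<in> arr X x y; r \<in> lobj (E x); m \<in> carrier (sp M x r); b \<in> B\<rbrakk>
      \<Longrightarrow> cf (sp M y (Fo x y \<alpha> r)) b (rmap M x y \<alpha> r m) = rmap M x y \<alpha> r (cf (sp M x r) b m)"
    "\<lbrakk>x \<in> obj X; y \<in> obj X; \<alpha> \<in> arr X x y; s \<in> lobj (E x); r \<in> lobj (E x); f \<in> carrier (H x s r); m \<in> carrier (sp M x r)\<rbrakk>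
      \<Longrightarrow> rmap M x y \<alpha> s (act M x s r f m)
          = act M y (Fo x y \<alpha> s) (Fo x y \<alpha> r) (Fa x y \<alpha> s r f) (rmap M x y \<alpha> r m)"
    "\<lbrakk>x \<in> obj X; r \<in> lobj (E x); m \<in> carrier (sp M x r)\<rbrakk> \<Longrightarrow> rmap M x x (ident X x) r m = m"
    "\<lbrakk>x \<in> obj X; y \<in> obj X; z \<in> obj X; \<alpha> \<in> arr X x y; \<beta> \<in> arr X y z; r \<in> lobj (E x); m \<in> carrier (sp M x r)\<rbrakk>
      \<Longrightarrow> rmap M x z (cmp X x y z \<beta> \<alpha>) r m = rmap M y z \<beta> (Fo x y \<alpha> r) (rmap M x y \<alpha> r m)"
  using assms unfolding laws_def by simp_all

section \<open>Transfer of the laws along homomorphisms\<close>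

lemma act_bilinear:
  assumes M: "pre M" and x: "x \<in> obj X" "s \<in> lobj (E x)" "r \<in> lobj (E x)"
    and add: "\<And>f f' m. \<lbrakk>f \<in> carrier (H x s r); f' \<in> carrier (H x s r); m \<in> carrier (sp M x r)\<rbrakk>
      \<Longrightarrow> act M x s r (f \<oplus>\<^bsub>H x s r\<^esub> f') m = act M x s r f m \<oplus>\<^bsub>sp M x s\<^esub> act M x s r f' m"
    and smult: "\<And>a f m. \<lbrakk>a \<in> carrier K; f \<in> carrier (H x s r); m \<in> carrier (sp M x r)\<rbrakk>
      \<Longrightarrow> act M x s r (a \<odot>\<^bsub>H x s r\<^esub> f) m = a \<odot>\<^bsub>sp M x s\<^esub> act M x s r f m"
  shows "bilinear K (H x s r) (sp M x r) (sp M x s) (act M x s r)"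
  by (intro bilinearI pre_act[OF M x] linear_mapI pre_act_closed[OF M x] add smult)

lemma laws_act_bilinear: "\<lbrakk>pre M; laws M; x \<in> obj X; s \<in> lobj (E x); r \<in> lobj (E x)\<rbrakk>
    \<Longrightarrow> bilinear K (H x s r) (sp M x r) (sp M x s) (act M x s r)"
  by (rule act_bilinear) (auto simp: lawsD)

lemma entw_natural:
  assumes M: "pre M" and N: "pre N" and h: "is_hom M N h"
    and x: "x \<in> obj X" and s: "s \<in> lobj (E x)" and r: "r \<in> lobj (E x)" and f: "f \<in> carrier (H x s r)"
    and m: "m \<in> carrier (sp M x r)"
    and aM: "bilinear K (H x s r) (sp M x r) (sp M x s) (act M x s r)"
    and aN: "bilinear K (H x s r) (sp N x r) (sp N x s) (act N x s r)"
  shows "entw_side (H x s r) (sp N x r) (sp N x s) (act N x s r) (\<lambda>c. psi K C (E x) s r c f) (coact (sp N x r) (h (x, r) m))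
    = tensor_map K (sp M x s) C (sp N x s) C (h (x, s)) id
        (entw_side (H x s r) (sp M x r) (sp M x s) (act M x s r) (\<lambda>c. psi K C (E x) s r c f) (coact (sp M x r) m))"
  unfolding prehom_coact[OF pre_sp[OF M x r] pre_sp[OF N x r] is_hom_prehom[OF h x r] m]
  by (rule entw_side_natural[OF H_module[OF x s r] psi_linear[OF x s r f] pre_module[OF M x r] pre_module[OF M x s] aM
        pre_module[OF N x r] pre_module[OF N x s] aN is_hom_linear[OF h x r] is_hom_linear[OF h x s]
        is_hom_act[OF h x s r] precomoduleD(3)[OF pre_sp[OF M x r] m]])

text \<open>Each law is tested at a preimage under \<open>q\<close>, where it holds, and
  \<open>q\<close> commutes with all operators occurring in it.\<close>

lemma laws_surj:
  assumes T: "pre T" "laws T" and W: "pre W" and q: "is_hom T W q"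
    and surj: "\<And>x r. \<lbrakk>x \<in> obj X; r \<in> lobj (E x)\<rbrakk> \<Longrightarrow> q (x, r) ` carrier (sp T x r) = carrier (sp W x r)"
  shows "laws W"
proof -
  have ex: "\<exists>n\<in>carrier (sp T x r). m = q (x, r) n" if "x \<in> obj X" "r \<in> lobj (E x)" "m \<in> carrier (sp W x r)" for x r m
    using surj[OF that(1,2)] that(3) by blast
  \<comment> \<open>Oriented so that operators move inside \<open>q\<close>: both sides of a law
    become values of \<open>q\<close>, and the law in \<open>T\<close> applies.\<close>
  note [simp] = is_hom_act[OF q, symmetric] is_hom_rmap[OF q, symmetric] is_hom_cf[OF q]
    pre_act_closed[OF T(1)] pre_rmap_closed[OF T(1)] Fo_closed Fa_closed lid_closed lcmp_closed X_ident X_cmp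
    linear_map_add[OF is_hom_linear[OF q], symmetric] linear_map_smult[OF is_hom_linear[OF q], symmetric]
  note L = lawsD[OF T(2)]
  have add: "act W x s r (f \<oplus>\<^bsub>H x s r\<^esub> f') m = act W x s r f m \<oplus>\<^bsub>sp W x s\<^esub> act W x s r f' m"
    if x: "x \<in> obj X" "s \<in> lobj (E x)" "r \<in> lobj (E x)" and f: "f \<in> carrier (H x s r)" "f' \<in> carrier (H x s r)"
      and m: "m \<in> carrier (sp W x r)" for x s r f f' m
  proof -
    interpret module K "H x s r" by (rule H_module[OF x])
    obtain n where "n \<in> carrier (sp T x r)" "m = q (x, r) n" using ex x m by blast
    then show ?thesis using x f by (simp add: L(2))
  qed
  have smult: "act W x s r (a \<odot>\<^bsub>H x s r\<^esub> f) m = a \<odot>\<^bsub>sp W x s\<^esub> act W x s r f m"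
    if x: "x \<in> obj X" "s \<in> lobj (E x)" "r \<in> lobj (E x)" and f: "a \<in> carrier K" "f \<in> carrier (H x s r)"
      and m: "m \<in> carrier (sp W x r)" for x s r a f m
  proof -
    interpret module K "H x s r" by (rule H_module[OF x])
    obtain n where "n \<in> carrier (sp T x r)" "m = q (x, r) n" using ex x m by blast
    then show ?thesis using x f by (simp add: L(3))
  qed
  show ?thesis
    unfolding laws_def
  proof (intro conjI ballI)
    show "comodule K C (sp W x r)" if x: "x \<in> obj X" "r \<in> lobj (E x)" for x r
      by (rule comodule_surj[OF L(1)[OF x] pre_sp[OF W x] is_hom_prehom[OF q x] surj[OF x]])
  next
    fix x s r f m assume x: "x \<in> obj X" "s \<in> lobj (E x)" "r \<in> lobj (E x)" and f: "f \<in> carrier (H x s r)"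
      and m: "m \<in> carrier (sp W x r)"
    obtain n where n: "n \<in> carrier (sp T x r)" "m = q (x, r) n" using ex x m by blast
    have "coact (sp W x s) (act W x s r f m) = coact (sp W x s) (q (x, s) (act T x s r f n))"
      using n x f by simp
    also have "\<dots> = tensor_map K (sp T x s) C (sp W x s) C (q (x, s)) id (coact (sp T x s) (act T x s r f n))"
      by (rule prehom_coact[OF pre_sp[OF T(1) x(1,2)] pre_sp[OF W x(1,2)] is_hom_prehom[OF q x(1,2)]]) (use n x f in simp)
    also have "\<dots> = entw_side (H x s r) (sp W x r) (sp W x s) (act W x s r) (\<lambda>c. psi K C (E x) s r c f) (coact (sp W x r) m)"
      unfolding L(6)[OF x f n(1)] n(2)
      by (rule entw_natural[OF T(1) W q x f n(1) laws_act_bilinear[OF T x] act_bilinear[OF W x], symmetric])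
        (use add smult x in auto)
    finally show "coact (sp W x s) (act W x s r f m) =
        entw_side (H x s r) (sp W x r) (sp W x s) (act W x s r) (\<lambda>c. psi K C (E x) s r c f) (coact (sp W x r) m)" .
  next
    fix x r m assume x: "x \<in> obj X" "r \<in> lobj (E x)" and m: "m \<in> carrier (sp W x r)"
    obtain n where n: "n \<in> carrier (sp T x r)" "m = q (x, r) n" using ex x m by blast
    then show "act W x r r (lid (E x) r) m = m" using x by (simp add: L(4))
    \<comment> \<open>The map along the identity ends in the sort of
      \<open>Fo x x (ident X x) r\<close>, which agrees with \<open>r\<close> only by functoriality;
      the instance is therefore spelled out.\<close>
    have "rmap W x x (ident X x) r (q (x, r) n) = q (x, Fo x x (ident X x) r) (rmap T x x (ident X x) r n)"
      using is_hom_rmap[OF q x(1,1) X_ident x(2)] n x by simp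
    then show "rmap W x x (ident X x) r m = m" using n x by (simp add: L(9) Fo_ident del: is_hom_rmap)
  next
    fix x t s r g f m assume x: "x \<in> obj X" "t \<in> lobj (E x)" "s \<in> lobj (E x)" "r \<in> lobj (E x)"
      and f: "g \<in> carrier (H x t s)" "f \<in> carrier (H x s r)" and m: "m \<in> carrier (sp W x r)"
    obtain n where n: "n \<in> carrier (sp T x r)" "m = q (x, r) n" using ex x m by blast
    then show "act W x t r (lcmp (E x) t s r f g) m = act W x t s g (act W x s r f m)" using x f by (simp add: L(5))
  next
    fix x y \<alpha> r m b assume x: "x \<in> obj X" "y \<in> obj X" "\<alpha> \<in> arr X x y" "r \<in> lobj (E x)" and m: "m \<in> carrier (sp W x r)" and b: "b \<in> B"
    obtain n where n: "n \<in> carrier (sp T x r)" "m = q (x, r) n" using ex x m by blast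
    then show "cf (sp W y (Fo x y \<alpha> r)) b (rmap W x y \<alpha> r m) = rmap W x y \<alpha> r (cf (sp W x r) b m)"
      using x b linear_map_closed[OF cf_linear[OF pre_sp[OF T(1) x(1,4)] b]] by (simp add: L(7))
  next
    fix x y \<alpha> s r f m assume x: "x \<in> obj X" "y \<in> obj X" "\<alpha> \<in> arr X x y" "s \<in> lobj (E x)" "r \<in> lobj (E x)" "f \<in> carrier (H x s r)"
      and m: "m \<in> carrier (sp W x r)"
    obtain n where n: "n \<in> carrier (sp T x r)" "m = q (x, r) n" using ex x m by blast
    then show "rmap W x y \<alpha> s (act W x s r f m) = act W y (Fo x y \<alpha> s) (Fo x y \<alpha> r) (Fa x y \<alpha> s r f) (rmap W x y \<alpha> r m)"
      using x by (simp add: L(8))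
  next
    fix x y z \<alpha> \<beta> r m assume x: "x \<in> obj X" "y \<in> obj X" "z \<in> obj X" "\<alpha> \<in> arr X x y" "\<beta> \<in> arr X y z" "r \<in> lobj (E x)"
      and m: "m \<in> carrier (sp W x r)"
    obtain n where n: "n \<in> carrier (sp T x r)" "m = q (x, r) n" using ex x m by blast
    have "rmap W x z (cmp X x y z \<beta> \<alpha>) r m = q (z, Fo x z (cmp X x y z \<beta> \<alpha>) r) (rmap T x z (cmp X x y z \<beta> \<alpha>) r n)"
      using is_hom_rmap[OF q x(1,3) X_cmp[OF x(1-3) x(4,5)] x(6) n(1)] n(2) by simp
    then show "rmap W x z (cmp X x y z \<beta> \<alpha>) r m = rmap W y z \<beta> (Fo x y \<alpha> r) (rmap W x y \<alpha> r m)"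
      using n x by (simp add: L(10) Fo_cmp)
  qed (use add smult in auto)
qed

text \<open>The two sides of a law agree after every homomorphism of the family, and the family
  separates elements.\<close>

lemma laws_inj:
  assumes W: "pre W" and \<Gamma>: "\<And>T g. (T, g) \<in> \<Gamma> \<Longrightarrow> pre T \<and> laws T \<and> is_hom W T g"
    and inj: "\<And>x r m. \<lbrakk>x \<in> obj X; r \<in> lobj (E x); m \<in> carrier (sp W x r);
      \<And>T g. (T, g) \<in> \<Gamma> \<Longrightarrow> g (x, r) m = \<zero>\<^bsub>sp T x r\<^esub>\<rbrakk> \<Longrightarrow> m = \<zero>\<^bsub>sp W x r\<^esub>"
  shows "laws W"
proof -
  have eqI: "m = n" if x: "x \<in> obj X" "r \<in> lobj (E x)" and mn: "m \<in> carrier (sp W x r)" "n \<in> carrier (sp W x r)"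
    and eq: "\<And>T g. \<lbrakk>pre T; laws T; is_hom W T g; (T, g) \<in> \<Gamma>\<rbrakk> \<Longrightarrow> g (x, r) m = g (x, r) n" for x r m n
  proof (rule jointly_injective_eq[of K "sp W x r" "(\<lambda>(T, g). (sp T x r, g (x, r))) ` \<Gamma>", OF pre_module[OF W x] _ _ mn])
    show "module K T' \<and> linear_map K (sp W x r) T' g'" if "(T', g') \<in> (\<lambda>(T, g). (sp T x r, g (x, r))) ` \<Gamma>" for T' g'
      using that \<Gamma> pre_module x is_hom_linear by fastforce
    show "m = \<zero>\<^bsub>sp W x r\<^esub>" if "m \<in> carrier (sp W x r)"
      "\<And>T' g'. (T', g') \<in> (\<lambda>(T, g). (sp T x r, g (x, r))) ` \<Gamma> \<Longrightarrow> g' m = \<zero>\<^bsub>T'\<^esub>" for m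
      using that by (intro inj[OF x]) force+
    show "g' m = g' n" if "(T', g') \<in> (\<lambda>(T, g). (sp T x r, g (x, r))) ` \<Gamma>" for T' g'
      using that eq \<Gamma> by fastforce
  qed
  note [simp] = is_hom_act is_hom_rmap is_hom_closed pre_act_closed pre_rmap_closed Fo_closed Fa_closed lid_closed lcmp_closed
    X_ident X_cmp
  have add: "act W x s r (f \<oplus>\<^bsub>H x s r\<^esub> f') m = act W x s r f m \<oplus>\<^bsub>sp W x s\<^esub> act W x s r f' m"
    if x: "x \<in> obj X" "s \<in> lobj (E x)" "r \<in> lobj (E x)" and f: "f \<in> carrier (H x s r)" "f' \<in> carrier (H x s r)"
      and m: "m \<in> carrier (sp W x r)" for x s r f f' m
  proof (rule eqI[OF x(1,2)])
    interpret H: module K "H x s r" by (rule H_module[OF x])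
    interpret W: module K "sp W x s" by (rule pre_module[OF W x(1,2)])
    show "act W x s r (f \<oplus>\<^bsub>H x s r\<^esub> f') m \<in> carrier (sp W x s)"
      "act W x s r f m \<oplus>\<^bsub>sp W x s\<^esub> act W x s r f' m \<in> carrier (sp W x s)" using W x f m by simp_all
    fix T g assume T: "pre T" "laws T" "is_hom W T g"
    show "g (x, s) (act W x s r (f \<oplus>\<^bsub>H x s r\<^esub> f') m) = g (x, s) (act W x s r f m \<oplus>\<^bsub>sp W x s\<^esub> act W x s r f' m)"
      using T W x f m by (simp add: linear_map_add[OF is_hom_linear[OF T(3)]] is_hom_act[OF T(3)] is_hom_closed[OF T(3)] lawsD(2)[OF T(2)])
  qed
  have smult: "act W x s r (a \<odot>\<^bsub>H x s r\<^esub> f) m = a \<odot>\<^bsub>sp W x s\<^esub> act W x s r f m"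
    if x: "x \<in> obj X" "s \<in> lobj (E x)" "r \<in> lobj (E x)" and f: "a \<in> carrier K" "f \<in> carrier (H x s r)"
      and m: "m \<in> carrier (sp W x r)" for x s r a f m
  proof (rule eqI[OF x(1,2)])
    interpret H: module K "H x s r" by (rule H_module[OF x])
    interpret W: module K "sp W x s" by (rule pre_module[OF W x(1,2)])
    show "act W x s r (a \<odot>\<^bsub>H x s r\<^esub> f) m \<in> carrier (sp W x s)"
      "a \<odot>\<^bsub>sp W x s\<^esub> act W x s r f m \<in> carrier (sp W x s)" using W x f m by simp_all
    fix T g assume T: "pre T" "laws T" "is_hom W T g"
    show "g (x, s) (act W x s r (a \<odot>\<^bsub>H x s r\<^esub> f) m) = g (x, s) (a \<odot>\<^bsub>sp W x s\<^esub> act W x s r f m)"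
      using T W x f m by (simp add: linear_map_smult[OF is_hom_linear[OF T(3)]] is_hom_act[OF T(3)] is_hom_closed[OF T(3)] lawsD(3)[OF T(2)])
  qed
  show ?thesis
    unfolding laws_def
  proof (intro conjI ballI)
    fix x r assume x: "x \<in> obj X" "r \<in> lobj (E x)"
    show "comodule K C (sp W x r)"
    proof (rule comodule_inj[OF pre_sp[OF W x]])
      show "comodule K C T' \<and> prehom (sp W x r) T' g'" if "(T', g') \<in> (\<lambda>(T, g). (sp T x r, g (x, r))) ` \<Gamma>" for T' g'
        using that \<Gamma> lawsD(1) x is_hom_prehom by fastforce
      show "m = \<zero>\<^bsub>sp W x r\<^esub>" if "m \<in> carrier (sp W x r)"
        "\<And>T' g'. (T', g') \<in> (\<lambda>(T, g). (sp T x r, g (x, r))) ` \<Gamma> \<Longrightarrow> g' m = \<zero>\<^bsub>T'\<^esub>" for m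
        using that by (intro inj[OF x]) force+
    qed
  next
    fix x s r f m assume x: "x \<in> obj X" "s \<in> lobj (E x)" "r \<in> lobj (E x)" and f: "f \<in> carrier (H x s r)"
      and m: "m \<in> carrier (sp W x r)"
    let ?a = "\<lambda>W. coact (sp W x s)"
    let ?b = "\<lambda>W. entw_side (H x s r) (sp W x r) (sp W x s) (act W x s r) (\<lambda>c. psi K C (E x) s r c f)"
    have bil: "bilinear K (H x s r) (sp W x r) (sp W x s) (act W x s r)"
      by (rule act_bilinear[OF W x]) (use add smult x in auto)
    note Wm = pre_module[OF W x(1,2)]
    note fm = pre_act_closed[OF W x f m]
    have ca: "?a W (act W x s r f m) \<in> carrier (tensor K (sp W x s) C)"
      using precomoduleD(3)[OF pre_sp[OF W x(1,2)] fm] .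
    have cb: "?b W (coact (sp W x r) m) \<in> carrier (tensor K (sp W x s) C)"
      using linear_map_closed[OF entw_side_linear[OF H_module[OF x] psi_linear[OF x f] pre_module[OF W x(1,3)] Wm bil]
          precomoduleD(3)[OF pre_sp[OF W x(1,3)] m]] .
    \<comment> \<open>The entwining condition is an equation in a tensor product; its coordinates
      are elements of the space \<open>sp W x s\<close>, where the family can test them.\<close>
    show "?a W (act W x s r f m) = ?b W (coact (sp W x r) m)"
    proof (rule coord_eqI[OF Wm module basis ca cb])
      fix b assume b: "b \<in> B"
      note l = coord_linear[OF Wm module e_linear[OF b]]
      show "coord K (sp W x s) C (e b) (?a W (act W x s r f m)) = coord K (sp W x s) C (e b) (?b W (coact (sp W x r) m))"
      proof (rule eqI[OF x(1,2) linear_map_closed[OF l ca] linear_map_closed[OF l cb]])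
        fix T g assume T: "pre T" "laws T" "is_hom W T g"
        note cm = coord_map[OF Wm module pre_module[OF T(1) x(1,2)] module is_hom_linear[OF T(3) x(1,2)] linear_map_ident(2) e_linear[OF b]]
        have "g (x, s) (coord K (sp W x s) C (e b) (?a W (act W x s r f m)))
            = coord K (sp T x s) C (e b) (?a T (g (x, s) (act W x s r f m)))"
          using cm[OF ca] prehom_coact[OF pre_sp[OF W x(1,2)] pre_sp[OF T(1) x(1,2)] is_hom_prehom[OF T(3) x(1,2)] fm] by simp
        also have "\<dots> = coord K (sp T x s) C (e b) (?b T (coact (sp T x r) (g (x, r) m)))"
          using is_hom_act[OF T(3) x f m] lawsD(6)[OF T(2) x f is_hom_closed[OF T(3) x(1,3) m]] by simp
        also have "\<dots> = g (x, s) (coord K (sp W x s) C (e b) (?b W (coact (sp W x r) m)))"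
          using cm[OF cb] entw_natural[OF W T(1,3) x f m bil laws_act_bilinear[OF T(1,2) x]] by simp
        finally show "g (x, s) (coord K (sp W x s) C (e b) (?a W (act W x s r f m)))
          = g (x, s) (coord K (sp W x s) C (e b) (?b W (coact (sp W x r) m)))" .
      qed
    qed
  next
    fix x r m assume x: "x \<in> obj X" "r \<in> lobj (E x)" and m: "m \<in> carrier (sp W x r)"
    show "act W x r r (lid (E x) r) m = m"
      by (rule eqI[OF x]) (use W x m in \<open>simp_all add: lawsD(4)\<close>)
    have c: "rmap W x x (ident X x) r m \<in> carrier (sp W x r)"
      using pre_rmap_closed[OF W x(1,1) X_ident x(2) m] x by (simp add: Fo_ident)
    show "rmap W x x (ident X x) r m = m"
    proof (rule eqI[OF x c m])
      fix T g assume T: "pre T" "laws T" "is_hom W T g"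
      show "g (x, r) (rmap W x x (ident X x) r m) = g (x, r) m"
        using is_hom_rmap[OF T(3) x(1,1) X_ident[OF x(1)] x(2) m] lawsD(9)[OF T(2) x is_hom_closed[OF T(3) x m]] x
        by (simp add: Fo_ident del: is_hom_rmap)
    qed
  next
    fix x t s r g f m assume x: "x \<in> obj X" "t \<in> lobj (E x)" "s \<in> lobj (E x)" "r \<in> lobj (E x)"
      and f: "g \<in> carrier (H x t s)" "f \<in> carrier (H x s r)" and m: "m \<in> carrier (sp W x r)"
    show "act W x t r (lcmp (E x) t s r f g) m = act W x t s g (act W x s r f m)"
      by (rule eqI[OF x(1,2)]) (use W x f m in \<open>simp_all add: lawsD(5)\<close>)
  next
    fix x y \<alpha> r m b assume x: "x \<in> obj X" "y \<in> obj X" "\<alpha> \<in> arr X x y" "r \<in> lobj (E x)" and m: "m \<in> carrier (sp W x r)" and b: "b \<in> B"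
    note Fx = Fo_closed[OF x]
    note cl = linear_map_closed[OF cf_linear[OF pre_sp[OF W x(1,4)] b] m]
    note cr = linear_map_closed[OF cf_linear[OF pre_sp[OF W x(2) Fx] b] pre_rmap_closed[OF W x m]]
    show "cf (sp W y (Fo x y \<alpha> r)) b (rmap W x y \<alpha> r m) = rmap W x y \<alpha> r (cf (sp W x r) b m)"
    proof (rule eqI[OF x(2) Fx cr pre_rmap_closed[OF W x cl]])
      fix T g assume T: "pre T" "laws T" "is_hom W T g"
      show "g (y, Fo x y \<alpha> r) (cf (sp W y (Fo x y \<alpha> r)) b (rmap W x y \<alpha> r m)) = g (y, Fo x y \<alpha> r) (rmap W x y \<alpha> r (cf (sp W x r) b m))"
        using is_hom_cf[OF T(3) x(2) Fx b pre_rmap_closed[OF W x m]] is_hom_rmap[OF T(3) x m] is_hom_rmap[OF T(3) x cl]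
          is_hom_cf[OF T(3) x(1,4) b m] lawsD(7)[OF T(2) x is_hom_closed[OF T(3) x(1,4) m] b] by simp
    qed
  next
    fix x y \<alpha> s r f m assume x: "x \<in> obj X" "y \<in> obj X" "\<alpha> \<in> arr X x y" "s \<in> lobj (E x)" "r \<in> lobj (E x)" "f \<in> carrier (H x s r)"
      and m: "m \<in> carrier (sp W x r)"
    show "rmap W x y \<alpha> s (act W x s r f m) = act W y (Fo x y \<alpha> s) (Fo x y \<alpha> r) (Fa x y \<alpha> s r f) (rmap W x y \<alpha> r m)"
      by (rule eqI[OF x(2) Fo_closed[OF x(1-4)]]) (use W x m in \<open>simp_all add: lawsD(8)\<close>)
  next
    fix x y z \<alpha> \<beta> r m assume x: "x \<in> obj X" "y \<in> obj X" "z \<in> obj X" "\<alpha> \<in> arr X x y" "\<beta> \<in> arr X y z" "r \<in> lobj (E x)"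
      and m: "m \<in> carrier (sp W x r)"
    note Fx = Fo_closed[OF x(1,2,4,6)]
    note mx = pre_rmap_closed[OF W x(1,2,4,6) m]
    note Fc = Fo_cmp[OF x]
    have c: "rmap W x z (cmp X x y z \<beta> \<alpha>) r m \<in> carrier (sp W z (Fo y z \<beta> (Fo x y \<alpha> r)))"
      using pre_rmap_closed[OF W x(1,3) X_cmp[OF x(1-5)] x(6) m] Fc by simp
    show "rmap W x z (cmp X x y z \<beta> \<alpha>) r m = rmap W y z \<beta> (Fo x y \<alpha> r) (rmap W x y \<alpha> r m)"
    proof (rule eqI[OF x(3) Fo_closed[OF x(2,3,5) Fx] c pre_rmap_closed[OF W x(2,3,5) Fx mx]])
      fix T g assume T: "pre T" "laws T" "is_hom W T g"
      show "g (z, Fo y z \<beta> (Fo x y \<alpha> r)) (rmap W x z (cmp X x y z \<beta> \<alpha>) r m)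
          = g (z, Fo y z \<beta> (Fo x y \<alpha> r)) (rmap W y z \<beta> (Fo x y \<alpha> r) (rmap W x y \<alpha> r m))"
        using is_hom_rmap[OF T(3) x(1,3) X_cmp[OF x(1-5)] x(6) m] Fc is_hom_rmap[OF T(3) x(2,3,5) Fx mx]
          is_hom_rmap[OF T(3) x(1,2,4,6) m] lawsD(10)[OF T(2) x is_hom_closed[OF T(3) x(1,6) m]] by simp
    qed
  qed (use add smult in auto)
qed

end

section \<open>Objects and arrows of the category in terms of structure and laws\<close>

context entwined_representation begin

lemma restr_simps [simp]:
  "espace (restr_obj F N) r = espace N (fob F r)"
  "eact (restr_obj F N) s r f = eact N (fob F s) (fob F r) (farr F s r f)"
  by (auto simp: restr_obj_def)

text \<open>The definition compares arrows as functions, including their values off the carriers.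
  Extensionality reduces this to elements, and colinearity becomes compatibility with
  coordinates.\<close>

lemma module_over_iff: "module_over U K C X R M \<longleftrightarrow> pre M \<and> laws M"
proof
  assume M: "module_over U K C X R M"
  have em: "entwined_module K C (E x) (rspace M x)" "r \<in> lobj (E x) \<Longrightarrow> small U (carrier (sp M x r))" if "x \<in> obj X" for x r
    using M that by (auto simp: module_over_def Entmod_cat_def)
  have mp: "rmap M x y \<alpha> \<in> (\<Pi>\<^sub>E r\<in>lobj (E x). carrier (sp M x r) \<rightarrow>\<^sub>E carrier (sp M y (Fo x y \<alpha> r)))"
    "entwined_module_map K C (E x) (rspace M x) (restr_obj (farr R x y \<alpha>) (rspace M y)) (rmap M x y \<alpha>)"
    if "x \<in> obj X" "y \<in> obj X" "\<alpha> \<in> arr X x y" for x y \<alpha>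
    using M that unfolding module_over_def by (simp_all add: Entmod_cat_def)
  have comod: "comodule K C (sp M x r)" if "x \<in> obj X" "r \<in> lobj (E x)" for x r
    by (rule entwined_module.comodule[OF em(1)[OF that(1)] that(2)])
  have mp_col: "colinear_map K C (sp M x r) (sp M y (Fo x y \<alpha> r)) (rmap M x y \<alpha> r)"
    if "x \<in> obj X" "y \<in> obj X" "\<alpha> \<in> arr X x y" "r \<in> lobj (E x)" for x y \<alpha> r
    using mp(2)[OF that(1-3)] that(4) unfolding entwined_module_map_def by simp
  have mp_pre: "prehom (sp M x r) (sp M y (Fo x y \<alpha> r)) (rmap M x y \<alpha> r)"
    if "x \<in> obj X" "y \<in> obj X" "\<alpha> \<in> arr X x y" "r \<in> lobj (E x)" for x y \<alpha> r
    using mp_col[OF that] colinear_map_iff_prehom[OF comodule_pre[OF comod[OF that(1,4)]] comodule_pre[OF comod[OF that(2) Fo_closed[OF that]]]]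
    by simp
  have pre: "pre M"
    unfolding pre_def
  proof (intro conjI ballI)
    show "precomodule (sp M x r)" "small U (carrier (sp M x r))" if "x \<in> obj X" "r \<in> lobj (E x)" for x r
      using comodule_pre[OF comod[OF that]] em(2)[OF that] .
    show "linear_map K (sp M x r) (sp M x s) (act M x s r f)"
      if "x \<in> obj X" "s \<in> lobj (E x)" "r \<in> lobj (E x)" "f \<in> carrier (H x s r)" for x s r f
      by (rule entwined_module.eact_linear[OF em(1)[OF that(1)] that(2-4)])
    fix x y \<alpha> assume x: "x \<in> obj X" "y \<in> obj X" "\<alpha> \<in> arr X x y"
    show "rmap M x y \<alpha> \<in> extensional (lobj (E x))" using mp(1)[OF x] by (auto simp: PiE_def)
    show "rmap M x y \<alpha> r \<in> extensional (carrier (sp M x r))" if "r \<in> lobj (E x)" for r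
      using mp(1)[OF x] that by (auto simp: PiE_def)
    show "linear_map K (sp M x r) (sp M y (Fo x y \<alpha> r)) (rmap M x y \<alpha> r)" if "r \<in> lobj (E x)" for r
      using prehom_linear[OF mp_pre[OF x that]] .
  qed
  have "laws M"
    unfolding laws_def
  proof (intro conjI ballI)
    show "comodule K C (sp M x r)" if "x \<in> obj X" "r \<in> lobj (E x)" for x r using comod[OF that] .
  next
    fix x s r m assume x: "x \<in> obj X" "s \<in> lobj (E x)" "r \<in> lobj (E x)" and m: "m \<in> carrier (sp M x r)"
    note l = entwined_module.eact_linear_arr[OF em(1)[OF x(1)] x(2,3) m]
    show "act M x s r (f \<oplus>\<^bsub>H x s r\<^esub> f') m = act M x s r f m \<oplus>\<^bsub>sp M x s\<^esub> act M x s r f' m"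
      if "f \<in> carrier (H x s r)" "f' \<in> carrier (H x s r)" for f f'
      using linear_map_add[OF l that] .
    show "act M x s r (a \<odot>\<^bsub>H x s r\<^esub> f) m = a \<odot>\<^bsub>sp M x s\<^esub> act M x s r f m"
      if "a \<in> carrier K" "f \<in> carrier (H x s r)" for a f
      using linear_map_smult[OF l that] .
  next
    fix x r m assume x: "x \<in> obj X" "r \<in> lobj (E x)" "m \<in> carrier (sp M x r)"
    show "act M x r r (lid (E x) r) m = m" using entwined_module.eact_lid[OF em(1)[OF x(1)] x(2,3)] .
    show "rmap M x x (ident X x) r m = m" using M x by (simp add: module_over_def Entmod_cat_def)
  next
    fix x t s r g f m assume "x \<in> obj X" "t \<in> lobj (E x)" "s \<in> lobj (E x)" "r \<in> lobj (E x)"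
      "g \<in> carrier (H x t s)" "f \<in> carrier (H x s r)" "m \<in> carrier (sp M x r)"
    then show "act M x t r (lcmp (E x) t s r f g) m = act M x t s g (act M x s r f m)"
      by (simp add: entwined_module.eact_lcmp[OF em(1)])
  next
    fix x s r f m assume x: "x \<in> obj X" "s \<in> lobj (E x)" "r \<in> lobj (E x)" "f \<in> carrier (H x s r)" "m \<in> carrier (sp M x r)"
    show "coact (sp M x s) (act M x s r f m) = entw_side (H x s r) (sp M x r) (sp M x s) (act M x s r)
          (\<lambda>c. psi K C (E x) s r c f) (coact (sp M x r) m)"
      unfolding entw_side_def by (rule entwined_module.coact_eact[OF em(1)[OF x(1)] x(2-5)])
  next
    fix x y \<alpha> r m b assume "x \<in> obj X" "y \<in> obj X" "\<alpha> \<in> arr X x y" "r \<in> lobj (E x)" "m \<in> carrier (sp M x r)" "b \<in> B"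
    then show "cf (sp M y (Fo x y \<alpha> r)) b (rmap M x y \<alpha> r m) = rmap M x y \<alpha> r (cf (sp M x r) b m)"
      using mp_pre[of x y \<alpha> r] unfolding prehom_def by simp
  next
    fix x y \<alpha> s r f m assume "x \<in> obj X" "y \<in> obj X" "\<alpha> \<in> arr X x y" "s \<in> lobj (E x)" "r \<in> lobj (E x)"
      "f \<in> carrier (H x s r)" "m \<in> carrier (sp M x r)"
    then show "rmap M x y \<alpha> s (act M x s r f m) = act M y (Fo x y \<alpha> s) (Fo x y \<alpha> r) (Fa x y \<alpha> s r f) (rmap M x y \<alpha> r m)"
      using mp(2)[of x y \<alpha>] unfolding entwined_module_map_def by simp
  next
    fix x y z \<alpha> \<beta> r m assume x: "x \<in> obj X" "y \<in> obj X" "z \<in> obj X" "\<alpha> \<in> arr X x y" "\<beta> \<in> arr X y z" "r \<in> lobj (E x)" "m \<in> carrier (sp M x r)"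
    have "rmap M x z (cmp X x y z \<beta> \<alpha>)
          = cmp (Entmod_cat U K C (fob R x)) (rspace M x)
              (restr_obj (farr R x y \<alpha>) (rspace M y))
              (restr_obj (farr R x y \<alpha>) (restr_obj (farr R y z \<beta>) (rspace M z)))
              (restr_arr (fob R x) (farr R x y \<alpha>) (rmap M y z \<beta>)) (rmap M x y \<alpha>)"
      using M x unfolding module_over_def by blast
    then show "rmap M x z (cmp X x y z \<beta> \<alpha>) r m = rmap M y z \<beta> (Fo x y \<alpha> r) (rmap M x y \<alpha> r m)"
      using x by (simp add: Entmod_cat_def restr_arr_def compose_def)
  qed
  then show "pre M \<and> laws M" using pre by blast
next
  assume "pre M \<and> laws M"
  then have p: "pre M" and l: "laws M" by auto
  note L = lawsD[OF l]
  have em: "entwined_module K C (E x) (rspace M x)" if x: "x \<in> obj X" for x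
  proof (rule entwined_module.intro)
    show "linear_map K (H x s r) (sp M x s) (\<lambda>f. act M x s r f m)"
      if "s \<in> lobj (E x)" "r \<in> lobj (E x)" "m \<in> carrier (sp M x r)" for s r m
      using laws_act_bilinear[OF p l x that(1,2)] that(3) by (simp add: bilinear_def)
  qed (use L(1,4,5) pre_act[OF p] L(6)[unfolded entw_side_def] x in simp_all)
  have mp: "rmap M x y \<alpha> \<in> arr (Entmod_cat U K C (E x)) (rspace M x) (restr_obj (farr R x y \<alpha>) (rspace M y))"
    if x: "x \<in> obj X" "y \<in> obj X" "\<alpha> \<in> arr X x y" for x y \<alpha>
  proof -
    have "rmap M x y \<alpha> \<in> (\<Pi>\<^sub>E r\<in>lobj (E x). carrier (sp M x r) \<rightarrow>\<^sub>E carrier (sp M y (Fo x y \<alpha> r)))"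
      using pre_rmap_ext[OF p x] pre_rmap_closed[OF p x] by (auto simp: PiE_def)
    moreover have "colinear_map K C (sp M x r) (sp M y (Fo x y \<alpha> r)) (rmap M x y \<alpha> r)" if r: "r \<in> lobj (E x)" for r
      using colinear_map_iff_prehom[OF pre_sp[OF p x(1) r] pre_sp[OF p x(2) Fo_closed[OF x r]]]
        pre_rmap[OF p x r] L(7)[OF x r] by (simp add: prehom_def)
    ultimately show ?thesis
      using L(8)[OF x] by (simp add: Entmod_cat_def entwined_module_map_def)
  qed
  show "module_over U K C X R M"
    unfolding module_over_def
  proof (intro conjI ballI mp)
    show "rspace M x \<in> obj (Entmod_cat U K C (E x))" if "x \<in> obj X" for x
      using em[OF that] pre_small[OF p that] by (simp add: Entmod_cat_def)
    fix x assume x: "x \<in> obj X"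
    show "rmap M x x (ident X x) = ident (Entmod_cat U K C (E x)) (rspace M x)"
    proof (rule extensionalityI[of _ "lobj (E x)"])
      fix r assume r: "r \<in> lobj (E x)"
      show "rmap M x x (ident X x) r = ident (Entmod_cat U K C (E x)) (rspace M x) r"
        by (rule extensionalityI[of _ "carrier (sp M x r)"])
          (use pre_rmap_ext(2)[OF p x x X_ident[OF x] r] L(9)[OF x r] r in \<open>simp_all add: Entmod_cat_def\<close>)
    qed (use pre_rmap_ext(1)[OF p x x X_ident[OF x]] in \<open>simp_all add: Entmod_cat_def\<close>)
  next
    fix x y z \<alpha> \<beta> assume x: "x \<in> obj X" "y \<in> obj X" "z \<in> obj X" "\<alpha> \<in> arr X x y" "\<beta> \<in> arr X y z"
    note c = X_cmp[OF x]
    let ?c = "cmp (Entmod_cat U K C (fob R x)) (rspace M x)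
              (restr_obj (farr R x y \<alpha>) (rspace M y))
              (restr_obj (farr R x y \<alpha>) (restr_obj (farr R y z \<beta>) (rspace M z)))
              (restr_arr (fob R x) (farr R x y \<alpha>) (rmap M y z \<beta>)) (rmap M x y \<alpha>)"
    show "rmap M x z (cmp X x y z \<beta> \<alpha>) = ?c"
    proof (rule extensionalityI[of _ "lobj (E x)"])
      fix r assume r: "r \<in> lobj (E x)"
      show "rmap M x z (cmp X x y z \<beta> \<alpha>) r = ?c r"
        by (rule extensionalityI[of _ "carrier (sp M x r)"])
          (use pre_rmap_ext(2)[OF p x(1,3) c r] L(10)[OF x r] r in
            \<open>simp_all add: Entmod_cat_def restr_arr_def compose_def\<close>)
    qed (use pre_rmap_ext(1)[OF p x(1,3) c] in \<open>simp_all add: Entmod_cat_def\<close>)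
  qed
qed

lemma obj_iff: "M \<in> obj Mods \<longleftrightarrow> pre M \<and> laws M"
  using module_over_iff by (simp add: Mod_cat_def)

lemma objD: "M \<in> obj Mods \<Longrightarrow> pre M" "M \<in> obj Mods \<Longrightarrow> laws M"
  using obj_iff by auto

lemma arr_iff:
  assumes M: "pre M" and N: "pre N"
  shows "h \<in> arr Mods M N \<longleftrightarrow> h \<in> extensional (obj X) \<and>
    (\<forall>x\<in>obj X. h x \<in> extensional (lobj (E x)) \<and> (\<forall>r\<in>lobj (E x). h x r \<in> extensional (carrier (sp M x r)))) \<and>
    is_hom M N (\<lambda>(x, r). h x r)"
proof -
  have 1: "h x \<in> arr (Entmod_cat U K C (E x)) (rspace M x) (rspace N x) \<longleftrightarrow>
      h x \<in> extensional (lobj (E x)) \<and> (\<forall>r\<in>lobj (E x). h x r \<in> extensional (carrier (sp M x r))) \<and>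
      (\<forall>r\<in>lobj (E x). prehom (sp M x r) (sp N x r) (h x r)) \<and>
      (\<forall>s\<in>lobj (E x). \<forall>r\<in>lobj (E x). \<forall>f\<in>carrier (H x s r). \<forall>m\<in>carrier (sp M x r).
        h x s (act M x s r f m) = act N x s r f (h x r m))" if x: "x \<in> obj X" for x
  proof -
    have "colinear_map K C (sp M x r) (sp N x r) (h x r) \<longleftrightarrow> prehom (sp M x r) (sp N x r) (h x r)" if "r \<in> lobj (E x)" for r
      by (rule colinear_map_iff_prehom[OF pre_sp[OF M x that] pre_sp[OF N x that]])
    then show ?thesis
      by (auto simp: Entmod_cat_def entwined_module_map_def PiE_def prehom_def linear_map_def)
  qed
  have 2: "cmp (Entmod_cat U K C (E x)) (rspace M x) (rspace N x)
            (restr_obj (farr R x y \<alpha>) (rspace N y)) (rmap N x y \<alpha>) (h x)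
          = cmp (Entmod_cat U K C (E x)) (rspace M x)
              (restr_obj (farr R x y \<alpha>) (rspace M y)) (restr_obj (farr R x y \<alpha>) (rspace N y))
              (restr_arr (E x) (farr R x y \<alpha>) (h y)) (rmap M x y \<alpha>) \<longleftrightarrow>
      (\<forall>r\<in>lobj (E x). \<forall>m\<in>carrier (sp M x r). h y (Fo x y \<alpha> r) (rmap M x y \<alpha> r m) = rmap N x y \<alpha> r (h x r m))" for x y \<alpha>
    by (auto simp: Entmod_cat_def restr_arr_def compose_def fun_eq_iff restrict_def; metis)
  show ?thesis
    unfolding Mod_cat_def module_over_map_def is_hom_def using 1 2 by auto
qed

section \<open>The signature of entwined modules and its representations\<close>

definition Sorts :: "('x \<times> 'o) set" where
  "Sorts = (SIGMA x:obj X. lobj (E x))"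

definition Ops :: "('x, 'a, 'o, 'f, 'c) operator set" where
  "Ops = {Act x s r f | x s r f. x \<in> obj X \<and> s \<in> lobj (E x) \<and> r \<in> lobj (E x) \<and> f \<in> carrier (H x s r)} \<union>
     {Map x y \<alpha> r | x y \<alpha> r. x \<in> obj X \<and> y \<in> obj X \<and> \<alpha> \<in> arr X x y \<and> r \<in> lobj (E x)} \<union>
     {Co x r b | x r b. x \<in> obj X \<and> r \<in> lobj (E x) \<and> b \<in> B}"

text \<open>Right modules are contravariant, so an arrow from \<open>s\<close> to \<open>r\<close>
  acts from the space at \<open>r\<close> to the space at \<open>s\<close>. A structure map starts
  at \<open>r\<close> and ends at the image of \<open>r\<close> under the functor.\<close>

fun src :: "('x, 'a, 'o, 'f, 'c) operator \<Rightarrow> 'x \<times> 'o" where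
  "src (Act x s r f) = (x, r)"
| "src (Map x y \<alpha> r) = (x, r)"
| "src (Co x r b) = (x, r)"

fun tgt :: "('x, 'a, 'o, 'f, 'c) operator \<Rightarrow> 'x \<times> 'o" where
  "tgt (Act x s r f) = (x, s)"
| "tgt (Map x y \<alpha> r) = (y, Fo x y \<alpha> r)"
| "tgt (Co x r b) = (x, r)"

text \<open>Truncation drops the coaction and leaves a bare \<open>module\<close> record, so that an
  object can be built whose space is equal to a given module, not merely isomorphic to it.\<close>

definition V :: "('x, 'a, 'o, 'f, 'k, 'u, 'c) repmod \<Rightarrow> 'x \<times> 'o \<Rightarrow> ('k, 'u) module" where
  "V M = (\<lambda>(x, r). module.truncate (sp M x r))"

fun oper :: "('x, 'a, 'o, 'f, 'k, 'u, 'c) repmod \<Rightarrow> ('x, 'a, 'o, 'f, 'c) operator \<Rightarrow> 'u \<Rightarrow> 'u" where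
  "oper M (Act x s r f) = act M x s r f"
| "oper M (Map x y \<alpha> r) = rmap M x y \<alpha> r"
| "oper M (Co x r b) = cf (sp M x r) b"

abbreviation co :: "'x \<times> 'o \<Rightarrow> 'c \<Rightarrow> ('x, 'a, 'o, 'f, 'c) operator" where
  "co \<equiv> \<lambda>(x, r). Co x r"

lemma Sorts_ball: "(\<forall>s\<in>Sorts. P s) \<longleftrightarrow> (\<forall>x\<in>obj X. \<forall>r\<in>lobj (E x). P (x, r))"
  by (auto simp: Sorts_def)

lemma Ops_ball: "(\<forall>p\<in>Ops. P p) \<longleftrightarrow>
    (\<forall>x\<in>obj X. \<forall>s\<in>lobj (E x). \<forall>r\<in>lobj (E x). \<forall>f\<in>carrier (H x s r). P (Act x s r f)) \<and>
    (\<forall>x\<in>obj X. \<forall>y\<in>obj X. \<forall>\<alpha>\<in>arr X x y. \<forall>r\<in>lobj (E x). P (Map x y \<alpha> r)) \<and>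
    (\<forall>x\<in>obj X. \<forall>r\<in>lobj (E x). \<forall>b\<in>B. P (Co x r b))"
  unfolding Ops_def by auto

lemma Ops_iff [simp]:
  "Act x s r f \<in> Ops \<longleftrightarrow> x \<in> obj X \<and> s \<in> lobj (E x) \<and> r \<in> lobj (E x) \<and> f \<in> carrier (H x s r)"
  "Map x y \<alpha> r \<in> Ops \<longleftrightarrow> x \<in> obj X \<and> y \<in> obj X \<and> \<alpha> \<in> arr X x y \<and> r \<in> lobj (E x)"
  "Co x r b \<in> Ops \<longleftrightarrow> x \<in> obj X \<and> r \<in> lobj (E x) \<and> b \<in> B"
  unfolding Ops_def by auto

lemma Sorts_iff [simp]: "(x, r) \<in> Sorts \<longleftrightarrow> x \<in> obj X \<and> r \<in> lobj (E x)"
  by (simp add: Sorts_def)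

lemma V_simps [simp]: "carrier (V M (x, r)) = carrier (sp M x r)" "\<zero>\<^bsub>V M (x, r)\<^esub> = \<zero>\<^bsub>sp M x r\<^esub>"
    "add (V M (x, r)) = add (sp M x r)" "smult (V M (x, r)) = smult (sp M x r)"
  by (simp_all add: V_def module.truncate_def)

lemma linear_V [simp]: "linear_map K (V M (x, r)) (V N (y, s)) = linear_map K (sp M x r) (sp N y s)"
  by (rule linear_map_module_cong) simp_all

lemma module_V: "pre M \<Longrightarrow> x \<in> obj X \<Longrightarrow> r \<in> lobj (E x) \<Longrightarrow> module K (V M (x, r))"
  by (rule module_cong[OF pre_module]) simp_all

sublocale signature K Sorts Ops src tgt
proof (rule signature.intro)
  show "cring K" using module by (rule module.axioms)
  have "\<forall>p\<in>Ops. src p \<in> Sorts \<and> tgt p \<in> Sorts" by (simp add: Ops_ball Fo_closed)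
  then show "p \<in> Ops \<Longrightarrow> src p \<in> Sorts" "p \<in> Ops \<Longrightarrow> tgt p \<in> Sorts" for p by auto
qed

lemma pre_rep: "pre M \<Longrightarrow> rep (V M) (oper M)"
  unfolding rep_def Ops_ball Sorts_ball
  by (auto simp: module_V pre_act pre_rmap cf_linear pre_sp)

lemma rep_hom_iff:
  assumes "pre M" "pre N"
  shows "rep_hom (V M) (oper M) (V N) (oper N) g \<longleftrightarrow> is_hom M N g"
  unfolding rep_hom_def is_hom_def Ops_ball prehom_def Sorts_ball by auto

text \<open>The coordinate operators have finite support at each element, so
  \<open>coact_exists\<close> assembles them into a coaction. The result is a structure satisfying
  \<open>pre\<close>; its laws are a separate matter.\<close>

lemma create:
  assumes W: "rep W w" and small: "\<And>s. s \<in> Sorts \<Longrightarrow> small U (carrier (W s))"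
    and fin: "\<And>s m. \<lbrakk>s \<in> Sorts; m \<in> carrier (W s)\<rbrakk> \<Longrightarrow> finite {b \<in> B. w (co s b) m \<noteq> \<zero>\<^bsub>W s\<^esub>}"
  obtains M where "pre M" "\<And>s. s \<in> Sorts \<Longrightarrow> V M s = W s"
    "\<And>p m. \<lbrakk>p \<in> Ops; m \<in> carrier (W (src p))\<rbrakk> \<Longrightarrow> oper M p m = w p m"
proof -
  have Wm: "module K (W (x, r))" if "x \<in> obj X" "r \<in> lobj (E x)" for x r
    using rep_module[OF W] that by simp
  have Wl: "linear_map K (W (src p)) (W (tgt p)) (w p)" if "p \<in> Ops" for p
    using rep_linear[OF W that] .
  have "\<exists>\<delta>. linear_map K (W (x, r)) (tensor K (W (x, r)) C) \<delta> \<and>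
      (\<forall>b\<in>B. \<forall>m\<in>carrier (W (x, r)). coord K (W (x, r)) C (e b) (\<delta> m) = w (Co x r b) m)"
    if x: "x \<in> obj X" "r \<in> lobj (E x)" for x r
  proof (rule coact_exists[OF Wm[OF x]])
    show "linear_map K (W (x, r)) (W (x, r)) (w (Co x r b))" if "b \<in> B" for b
      using Wl[of "Co x r b"] x that by simp
    show "finite {b \<in> B. w (Co x r b) m \<noteq> \<zero>\<^bsub>W (x, r)\<^esub>}" if "m \<in> carrier (W (x, r))" for m
      using fin[of "(x, r)" m] x that by simp
  qed
  then obtain \<delta> where \<delta>: "\<And>x r. \<lbrakk>x \<in> obj X; r \<in> lobj (E x)\<rbrakk> \<Longrightarrow> linear_map K (W (x, r)) (tensor K (W (x, r)) C) (\<delta> x r)"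
    "\<And>x r b m. \<lbrakk>x \<in> obj X; r \<in> lobj (E x); b \<in> B; m \<in> carrier (W (x, r))\<rbrakk>
      \<Longrightarrow> coord K (W (x, r)) C (e b) (\<delta> x r m) = w (Co x r b) m" by metis
  \<comment> \<open>The meaningless fields \<open>mult\<close> and \<open>one\<close> are copied as
    well, so that truncating the record returns \<open>W\<close> itself.\<close>
  define M :: "('x, 'a, 'o, 'f, 'k, 'u, 'c) repmod" where
    "M = \<lparr>rspace = (\<lambda>x. \<lparr>espace = (\<lambda>r. \<lparr>carrier = carrier (W (x, r)), monoid.mult = monoid.mult (W (x, r)),
        one = one (W (x, r)), zero = zero (W (x, r)), add = add (W (x, r)), smult = smult (W (x, r)), coact = \<delta> x r\<rparr>),
        eact = (\<lambda>s r f. w (Act x s r f))\<rparr>),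
      rmap = (\<lambda>x y \<alpha>. \<lambda>r\<in>lobj (E x). \<lambda>m\<in>carrier (W (x, r)). w (Map x y \<alpha> r) m)\<rparr>"
  have sp: "carrier (sp M x r) = carrier (W (x, r))" "add (sp M x r) = add (W (x, r))"
    "smult (sp M x r) = smult (W (x, r))" "zero (sp M x r) = zero (W (x, r))" "coact (sp M x r) = \<delta> x r" for x r
    by (simp_all add: M_def)
  have act: "act M x s r f = w (Act x s r f)" for x s r f by (simp add: M_def)
  have rm: "rmap M x y \<alpha> = (\<lambda>r\<in>lobj (E x). \<lambda>m\<in>carrier (W (x, r)). w (Map x y \<alpha> r) m)" for x y \<alpha> by (simp add: M_def)
  have V: "V M (x, r) = W (x, r)" for x r
    by (cases "W (x, r)") (simp add: V_def M_def module.truncate_def)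
  have lin: "linear_map K (sp M x r) (sp M y s) = linear_map K (W (x, r)) (W (y, s))" for x r y s
    by (rule linear_map_module_cong) (simp_all add: sp)
  have pre: "pre M"
    unfolding pre_def
  proof (intro conjI ballI)
    fix x r assume x: "x \<in> obj X" "r \<in> lobj (E x)"
    have "module K (sp M x r)" by (rule module_cong[OF Wm[OF x]]) (simp_all add: sp)
    moreover have "linear_map K (sp M x r) (tensor K (W (x, r)) C) (\<delta> x r)"
      using \<delta>(1)[OF x] by (simp add: linear_map_def sp)
    ultimately show "precomodule (sp M x r)"
      unfolding precomodule_def sp(5) using tensor_module_cong(1)[of "sp M x r" "W (x, r)"] sp by metis
    show "small U (carrier (sp M x r))" using small[of "(x, r)"] x by (simp add: sp)
  next
    show "linear_map K (sp M x r) (sp M x s) (act M x s r f)"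
      if "x \<in> obj X" "s \<in> lobj (E x)" "r \<in> lobj (E x)" "f \<in> carrier (H x s r)" for x s r f
      using Wl[of "Act x s r f"] that by (simp add: lin act)
    fix x y \<alpha> assume x: "x \<in> obj X" "y \<in> obj X" "\<alpha> \<in> arr X x y"
    show "rmap M x y \<alpha> \<in> extensional (lobj (E x))" by (simp add: rm)
    show "rmap M x y \<alpha> r \<in> extensional (carrier (sp M x r))" if "r \<in> lobj (E x)" for r using that by (simp add: rm sp)
    show "linear_map K (sp M x r) (sp M y (Fo x y \<alpha> r)) (rmap M x y \<alpha> r)" if r: "r \<in> lobj (E x)" for r
      unfolding lin
    proof (rule linear_map_congI[OF Wm[OF x(1) r]])
      show "linear_map K (W (x, r)) (W (y, Fo x y \<alpha> r)) (w (Map x y \<alpha> r))"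
        using Wl[of "Map x y \<alpha> r"] x r by simp
    qed (use r in \<open>simp add: rm\<close>)
  qed
  have cfw: "cf (sp M x r) b m = w (Co x r b) m" if "x \<in> obj X" "r \<in> lobj (E x)" "b \<in> B" "m \<in> carrier (W (x, r))" for x r b m
    unfolding cf_def sp(5)
    using \<delta>(2)[OF that] coord_module_cong[of "sp M x r" "W (x, r)"] sp by metis
  have "\<forall>p\<in>Ops. \<forall>m\<in>carrier (W (src p)). oper M p m = w p m"
    unfolding Ops_ball by (simp add: act rm cfw)
  then show thesis using that[OF pre] V by auto
qed

text \<open>For an action the bound comes from the entwining map, for a coordinate operator from the
  comultiplication. A structure map is colinear and does not enlarge the support, so
  \<open>D\<close> itself serves.\<close>

lemma finite_step:
  assumes p: "p \<in> Ops" and D: "finite D" "D \<subseteq> B"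
  shows "\<exists>D'. finite D' \<and> D' \<subseteq> B \<and>
      (\<forall>M\<in>obj Mods. \<forall>m\<in>carrier (V M (src p)).
        {b \<in> B. oper M (co (src p) b) m \<noteq> \<zero>\<^bsub>V M (src p)\<^esub>} \<subseteq> D \<longrightarrow>
        {b \<in> B. oper M (co (tgt p) b) (oper M p m) \<noteq> \<zero>\<^bsub>V M (tgt p)\<^esub>} \<subseteq> D')"
proof (cases p)
  case (Act x s r f)
  then have x: "x \<in> obj X" "s \<in> lobj (E x)" "r \<in> lobj (E x)" and f: "f \<in> carrier (H x s r)" using p by auto
  have "\<exists>D'. finite D' \<and> D' \<subseteq> B \<and> (\<forall>(M :: ('k, 'u, 'c) comodule) (M' :: ('k, 'u, 'c) comodule) a m f0.
      precomodule M \<and> precomodule M' \<and> bilinear K (H x s r) M M' a \<and>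
      m \<in> carrier M \<and> coact M' (a f0 m) = entw_side (H x s r) M M' a (\<lambda>c. psi K C (E x) s r c f) (coact M m) \<and>
      {b \<in> B. cf M b m \<noteq> \<zero>\<^bsub>M\<^esub>} \<subseteq> D \<longrightarrow> {b \<in> B. cf M' b (a f0 m) \<noteq> \<zero>\<^bsub>M'\<^esub>} \<subseteq> D')"
    by (rule entw_side_finite_step[OF H_module[OF x] psi_linear[OF x f] D])
  then obtain D' where D': "finite D' \<and> D' \<subseteq> B \<and> (\<forall>(M :: ('k, 'u, 'c) comodule) (M' :: ('k, 'u, 'c) comodule) a m f0.
      precomodule M \<and> precomodule M' \<and> bilinear K (H x s r) M M' a \<and>
      m \<in> carrier M \<and> coact M' (a f0 m) = entw_side (H x s r) M M' a (\<lambda>c. psi K C (E x) s r c f) (coact M m) \<and>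
      {b \<in> B. cf M b m \<noteq> \<zero>\<^bsub>M\<^esub>} \<subseteq> D \<longrightarrow> {b \<in> B. cf M' b (a f0 m) \<noteq> \<zero>\<^bsub>M'\<^esub>} \<subseteq> D')" ..
  note step = D'[THEN conjunct2, THEN conjunct2, rule_format, OF conjI[OF _ conjI[OF _ conjI[OF _ conjI[OF _ conjI]]]]]
  have "{b \<in> B. cf (sp M x s) b (act M x s r f m) \<noteq> \<zero>\<^bsub>sp M x s\<^esub>} \<subseteq> D'"
    if M: "M \<in> obj Mods" and m: "m \<in> carrier (sp M x r)" and sup: "{b \<in> B. cf (sp M x r) b m \<noteq> \<zero>\<^bsub>sp M x r\<^esub>} \<subseteq> D" for M m
  proof -
    note o = objD[OF M]
    show ?thesis
      by (rule step[OF pre_sp[OF o(1) x(1,3)] pre_sp[OF o(1) x(1,2)] laws_act_bilinear[OF o x] m lawsD(6)[OF o(2) x f m] sup])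
  qed
  then show ?thesis using D' Act by (intro exI[of _ D']) simp
next
  case (Map x y \<alpha> r)
  then have x: "x \<in> obj X" "y \<in> obj X" "\<alpha> \<in> arr X x y" "r \<in> lobj (E x)" using p by auto
  have "{b \<in> B. cf (sp M y (Fo x y \<alpha> r)) b (rmap M x y \<alpha> r m) \<noteq> \<zero>\<^bsub>sp M y (Fo x y \<alpha> r)\<^esub>} \<subseteq> D"
    if M: "M \<in> obj Mods" and m: "m \<in> carrier (sp M x r)" and sup: "{b \<in> B. cf (sp M x r) b m \<noteq> \<zero>\<^bsub>sp M x r\<^esub>} \<subseteq> D" for M m
  proof -
    note o = objD[OF M]
    have "cf (sp M y (Fo x y \<alpha> r)) b (rmap M x y \<alpha> r m) = rmap M x y \<alpha> r (cf (sp M x r) b m)" if "b \<in> B" for b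
      using lawsD(7)[OF o(2) x m that] .
    moreover have "rmap M x y \<alpha> r \<zero>\<^bsub>sp M x r\<^esub> = \<zero>\<^bsub>sp M y (Fo x y \<alpha> r)\<^esub>"
      using linear_map_zero[OF pre_module[OF o(1) x(1,4)] pre_module[OF o(1) x(2) Fo_closed[OF x]] pre_rmap[OF o(1) x]] .
    ultimately show ?thesis using sup by auto
  qed
  then show ?thesis using D Map by (intro exI[of _ D]) simp
next
  case (Co x r j)
  then have x: "x \<in> obj X" "r \<in> lobj (E x)" and j: "j \<in> B" using p by auto
  obtain D' where D': "finite D' \<and> D' \<subseteq> B \<and> (\<forall>(M :: ('k, 'u, 'c) comodule) m. comodule K C M \<and> m \<in> carrier M \<and>
      {b \<in> B. cf M b m \<noteq> \<zero>\<^bsub>M\<^esub>} \<subseteq> D \<longrightarrow> {b \<in> B. cf M b (cf M j m) \<noteq> \<zero>\<^bsub>M\<^esub>} \<subseteq> D')"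
    using cf_finite_step[OF D j] ..
  note step = D'[THEN conjunct2, THEN conjunct2, rule_format, OF conjI[OF _ conjI]]
  have "{b \<in> B. cf (sp M x r) b (cf (sp M x r) j m) \<noteq> \<zero>\<^bsub>sp M x r\<^esub>} \<subseteq> D'"
    if M: "M \<in> obj Mods" and m: "m \<in> carrier (sp M x r)" and sup: "{b \<in> B. cf (sp M x r) b m \<noteq> \<zero>\<^bsub>sp M x r\<^esub>} \<subseteq> D" for M m
    by (rule step[OF lawsD(1)[OF objD(2)[OF M] x] m sup])
  then show ?thesis using D' Co by (intro exI[of _ D']) simp
qed

lemma small_Ops: "small U Ops"
proof -
  have sX: "small U (obj X)" "\<And>x y. \<lbrakk>x \<in> obj X; y \<in> obj X\<rbrakk> \<Longrightarrow> small U (arr X x y)"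
    using small_X by (auto simp: small_category_def)
  have sE: "small U (lobj (E x))" "\<And>s r. \<lbrakk>s \<in> lobj (E x); r \<in> lobj (E x)\<rbrakk> \<Longrightarrow> small U (carrier (H x s r))" if "x \<in> obj X" for x
    using E_small[OF that] by (auto simp: small_category_def underlying_def)
  have sB: "small U B" using small_subset[OF univ small_C] is_basis_mem[OF basis] by blast
  note S = small_image[OF univ] small_UNION[OF univ]
  have "small U (\<Union>x\<in>obj X. \<Union>s\<in>lobj (E x). \<Union>r\<in>lobj (E x). Act x s r ` carrier (H x s r))"
    by (intro S sX sE)
  then have 1: "small U {Act x s r f | x s r f. x \<in> obj X \<and> s \<in> lobj (E x) \<and> r \<in> lobj (E x) \<and> f \<in> carrier (H x s r)}"
    by (rule small_subset[OF univ]) auto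
  have "small U (\<Union>x\<in>obj X. \<Union>y\<in>obj X. \<Union>\<alpha>\<in>arr X x y. Map x y \<alpha> ` lobj (E x))"
    by (intro S sX sE)
  then have 2: "small U {Map x y \<alpha> r | x y \<alpha> r. x \<in> obj X \<and> y \<in> obj X \<and> \<alpha> \<in> arr X x y \<and> r \<in> lobj (E x)}"
    by (rule small_subset[OF univ]) auto
  have "small U (\<Union>x\<in>obj X. \<Union>r\<in>lobj (E x). Co x r ` B)"
    by (intro S sX sE sB)
  then have "small U {Co x r b | x r b. x \<in> obj X \<and> r \<in> lobj (E x) \<and> b \<in> B}"
    by (rule small_subset[OF univ]) auto
  then show ?thesis
    unfolding Ops_def by (intro small_Un[OF univ] 1 2)
qed

text \<open>For \<open>create_inj\<close> and \<open>create_surj\<close>, the bare structure is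
  built by \<open>create\<close>, and its laws are then transferred by \<open>laws_inj\<close> and
  \<open>laws_surj\<close>.\<close>

lemma Mods_operator_category:
  "operator_category K Sorts Ops src tgt U B co Mods V oper (\<lambda>h (x, r). h x r)"
proof (intro operator_category.intro operator_category_axioms.intro signature_axioms univ small_K small_Ops)
  show "small U Sorts"
    unfolding Sorts_def using small_X E_small
    by (intro small_Sigma[OF univ]) (auto simp: small_category_def underlying_def)
  show "small U B" using small_subset[OF univ small_C] is_basis_mem[OF basis] by blast
  show "co s b \<in> Ops \<and> src (co s b) = s \<and> tgt (co s b) = s" if "s \<in> Sorts" "b \<in> B" for s b
    using that by (cases s) auto
  show "rep (V M) (oper M)" if "M \<in> obj Mods" for M using pre_rep[OF objD(1)[OF that]] .
  show "small U (carrier (V M s))" if "M \<in> obj Mods" "s \<in> Sorts" for M s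
    using that pre_small[OF objD(1)] by (cases s) auto
  show "finite {b \<in> B. oper M (co s b) m \<noteq> \<zero>\<^bsub>V M s\<^esub>}" if "M \<in> obj Mods" "s \<in> Sorts" "m \<in> carrier (V M s)" for M s m
    using that cf_finite[OF pre_sp[OF objD(1)]] by (cases s) auto
  show "\<exists>D'. finite D' \<and> D' \<subseteq> B \<and> (\<forall>M\<in>obj Mods. \<forall>m\<in>carrier (V M (src p)).
        {b \<in> B. oper M (co (src p) b) m \<noteq> \<zero>\<^bsub>V M (src p)\<^esub>} \<subseteq> D \<longrightarrow>
        {b \<in> B. oper M (co (tgt p) b) (oper M p m) \<noteq> \<zero>\<^bsub>V M (tgt p)\<^esub>} \<subseteq> D')"
    if "p \<in> Ops" "finite D" "D \<subseteq> B" for p D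
    using finite_step[OF that] .
  show "rep_hom (V M) (oper M) (V N) (oper N) (\<lambda>(x, r). h x r)"
    if "M \<in> obj Mods" "N \<in> obj Mods" "h \<in> arr Mods M N" for M N h
    using that rep_hom_iff arr_iff objD by blast
next
  fix M N h h' assume o: "M \<in> obj Mods" "N \<in> obj Mods" and h: "h \<in> arr Mods M N" "h' \<in> arr Mods M N"
    and eq: "\<And>s m. \<lbrakk>s \<in> Sorts; m \<in> carrier (V M s)\<rbrakk> \<Longrightarrow> (\<lambda>(x, r). h x r) s m = (\<lambda>(x, r). h' x r) s m"
  note a = arr_iff[OF objD(1)[OF o(1)] objD(1)[OF o(2)]]
  show "h = h'"
  proof (rule extensionalityI[of _ "obj X"])
    fix x assume x: "x \<in> obj X"
    show "h x = h' x"
    proof (rule extensionalityI[of _ "lobj (E x)"])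
      fix r assume r: "r \<in> lobj (E x)"
      show "h x r = h' x r"
        by (rule extensionalityI[of _ "carrier (sp M x r)"]) (use h a x r eq[of "(x, r)"] in auto)
    qed (use h a x in auto)
  qed (use h a in auto)
next
  fix M N g assume o: "M \<in> obj Mods" "N \<in> obj Mods" and g: "rep_hom (V M) (oper M) (V N) (oper N) g"
  note p = objD(1)[OF o(1)] objD(1)[OF o(2)]
  have g: "is_hom M N g" using g rep_hom_iff[OF p] by blast
  \<comment> \<open>Arrows are undefined off the carriers, so the given family of maps is restricted
    to them.\<close>
  let ?h = "\<lambda>x\<in>obj X. \<lambda>r\<in>lobj (E x). \<lambda>m\<in>carrier (sp M x r). g (x, r) m"
  have "is_hom M N (\<lambda>(x, r). ?h x r)"
    unfolding is_hom_def
  proof (intro conjI ballI)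
    fix x r assume x: "x \<in> obj X" "r \<in> lobj (E x)"
    show "prehom (sp M x r) (sp N x r) ((\<lambda>(x, r). ?h x r) (x, r))"
      unfolding prehom_def
    proof (intro conjI ballI)
      show "linear_map K (sp M x r) (sp N x r) ((\<lambda>(x, r). ?h x r) (x, r))"
        by (rule linear_map_congI[OF pre_module[OF p(1) x] is_hom_linear[OF g x]]) (use x in simp)
      show "cf (sp N x r) b ((\<lambda>(x, r). ?h x r) (x, r) m) = (\<lambda>(x, r). ?h x r) (x, r) (cf (sp M x r) b m)"
        if "b \<in> B" "m \<in> carrier (sp M x r)" for b m
        using is_hom_cf[OF g x that] linear_map_closed[OF cf_linear[OF pre_sp[OF p(1) x] that(1)] that(2)] x that by simp
    qed
  qed (use is_hom_act[OF g] is_hom_rmap[OF g] pre_act_closed[OF p(1)] pre_rmap_closed[OF p(1)] Fo_closed in auto)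
  then have "?h \<in> arr Mods M N" using arr_iff[OF p] by simp
  then show "\<exists>h\<in>arr Mods M N. \<forall>s\<in>Sorts. \<forall>m\<in>carrier (V M s). (\<lambda>(x, r). h x r) s m = g s m"
    by (rule bexI[rotated]) (auto simp: Sorts_def)
next
  fix M assume M: "M \<in> obj Mods"
  note p = objD(1)[OF M]
  have id: "ident Mods M = (\<lambda>x\<in>obj X. \<lambda>r\<in>lobj (E x). \<lambda>m\<in>carrier (sp M x r). m)"
    by (auto simp: Mod_cat_def Entmod_cat_def)
  show "(\<lambda>(x, r). ident Mods M x r) s m = m" if "s \<in> Sorts" "m \<in> carrier (V M s)" for s m
    using that unfolding id by (cases s) auto
  have "is_hom M M (\<lambda>(x, r). ident Mods M x r)"
    unfolding is_hom_def
  proof (intro conjI ballI)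
    fix x r assume x: "x \<in> obj X" "r \<in> lobj (E x)"
    show "prehom (sp M x r) (sp M x r) ((\<lambda>(x, r). ident Mods M x r) (x, r))"
      unfolding prehom_def
    proof (intro conjI ballI)
      show "linear_map K (sp M x r) (sp M x r) ((\<lambda>(x, r). ident Mods M x r) (x, r))"
        by (rule linear_map_congI[OF pre_module[OF p x] linear_map_ident(1)]) (use x in \<open>simp add: id\<close>)
      show "cf (sp M x r) b ((\<lambda>(x, r). ident Mods M x r) (x, r) m) = (\<lambda>(x, r). ident Mods M x r) (x, r) (cf (sp M x r) b m)"
        if "b \<in> B" "m \<in> carrier (sp M x r)" for b m
        using linear_map_closed[OF cf_linear[OF pre_sp[OF p x] that(1)] that(2)] x that by (simp add: id)
    qed
  qed (use pre_act_closed[OF p] pre_rmap_closed[OF p] Fo_closed in \<open>auto simp: id\<close>)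
  then show "ident Mods M \<in> arr Mods M M" using arr_iff[OF p p] by (simp add: id)
next
  fix L M N u v assume o: "L \<in> obj Mods" "M \<in> obj Mods" "N \<in> obj Mods" and uv: "u \<in> arr Mods L M" "v \<in> arr Mods M N"
  note p = objD(1)[OF o(1)] objD(1)[OF o(2)] objD(1)[OF o(3)]
  have c: "cmp Mods L M N v u = (\<lambda>x\<in>obj X. \<lambda>r\<in>lobj (E x). \<lambda>m\<in>carrier (sp L x r). v x r (u x r m))"
    by (auto simp: Mod_cat_def Entmod_cat_def compose_def)
  have u: "is_hom L M (\<lambda>(x, r). u x r)" and v: "is_hom M N (\<lambda>(x, r). v x r)"
    using uv arr_iff[OF p(1,2)] arr_iff[OF p(2,3)] by auto
  show "(\<lambda>(x, r). cmp Mods L M N v u x r) s m = (\<lambda>(x, r). v x r) s ((\<lambda>(x, r). u x r) s m)"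
    if "s \<in> Sorts" "m \<in> carrier (V L s)" for s m
    using that unfolding c by (cases s) auto
  have "is_hom L N (\<lambda>(x, r). cmp Mods L M N v u x r)"
    unfolding is_hom_def
  proof (intro conjI ballI)
    fix x r assume x: "x \<in> obj X" "r \<in> lobj (E x)"
    show "prehom (sp L x r) (sp N x r) ((\<lambda>(x, r). cmp Mods L M N v u x r) (x, r))"
      unfolding prehom_def
    proof (intro conjI ballI)
      show "linear_map K (sp L x r) (sp N x r) ((\<lambda>(x, r). cmp Mods L M N v u x r) (x, r))"
        by (rule linear_map_congI[OF pre_module[OF p(1) x] linear_map_comp[OF is_hom_linear[OF u x] is_hom_linear[OF v x]]])
          (use x in \<open>simp add: c\<close>)
      show "cf (sp N x r) b ((\<lambda>(x, r). cmp Mods L M N v u x r) (x, r) m) = (\<lambda>(x, r). cmp Mods L M N v u x r) (x, r) (cf (sp L x r) b m)"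
        if b: "b \<in> B" and m: "m \<in> carrier (sp L x r)" for b m
        using is_hom_cf[OF u x b m] is_hom_cf[OF v x b is_hom_closed[OF u x m]]
          linear_map_closed[OF cf_linear[OF pre_sp[OF p(1) x] b] m] x m by (simp add: c)
    qed
  next
    fix x s r f m assume x: "x \<in> obj X" "s \<in> lobj (E x)" "r \<in> lobj (E x)" and f: "f \<in> carrier (H x s r)" and m: "m \<in> carrier (sp L x r)"
    show "(\<lambda>(x, r). cmp Mods L M N v u x r) (x, s) (act L x s r f m) = act N x s r f ((\<lambda>(x, r). cmp Mods L M N v u x r) (x, r) m)"
      using is_hom_act[OF u x f m] is_hom_act[OF v x f is_hom_closed[OF u x(1,3) m]] pre_act_closed[OF p(1) x f m] x m
      by (simp add: c)
  next
    fix x y \<alpha> r m assume x: "x \<in> obj X" "y \<in> obj X" "\<alpha> \<in> arr X x y" "r \<in> lobj (E x)" and m: "m \<in> carrier (sp L x r)"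
    show "(\<lambda>(x, r). cmp Mods L M N v u x r) (y, Fo x y \<alpha> r) (rmap L x y \<alpha> r m) = rmap N x y \<alpha> r ((\<lambda>(x, r). cmp Mods L M N v u x r) (x, r) m)"
      using is_hom_rmap[OF u x m] is_hom_rmap[OF v x is_hom_closed[OF u x(1,4) m]] pre_rmap_closed[OF p(1) x m] x m Fo_closed[OF x]
      by (simp add: c)
  qed
  then show "cmp Mods L M N v u \<in> arr Mods L N" using arr_iff[OF p(1,3)] by (simp add: c)
next
  fix W :: "'x \<times> 'o \<Rightarrow> ('k, 'u) module" and w and \<Gamma> :: "(('x, 'a, 'o, 'f, 'k, 'u, 'c) repmod \<times> ('x \<times> 'o \<Rightarrow> 'u \<Rightarrow> 'u)) set"
  assume W: "rep W w" and small: "\<And>s. s \<in> Sorts \<Longrightarrow> small U (carrier (W s))"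
    and \<Gamma>: "\<And>T g. (T, g) \<in> \<Gamma> \<Longrightarrow> T \<in> obj Mods \<and> rep_hom W w (V T) (oper T) g"
    and inj: "\<And>s x. \<lbrakk>s \<in> Sorts; x \<in> carrier (W s); \<And>T g. (T, g) \<in> \<Gamma> \<Longrightarrow> g s x = \<zero>\<^bsub>V T s\<^esub>\<rbrakk> \<Longrightarrow> x = \<zero>\<^bsub>W s\<^esub>"
    and fin: "\<And>s x. \<lbrakk>s \<in> Sorts; x \<in> carrier (W s)\<rbrakk> \<Longrightarrow> finite {b \<in> B. w (co s b) x \<noteq> \<zero>\<^bsub>W s\<^esub>}"
  obtain M where M: "pre M" "\<And>s. s \<in> Sorts \<Longrightarrow> V M s = W s"
    "\<And>p m. \<lbrakk>p \<in> Ops; m \<in> carrier (W (src p))\<rbrakk> \<Longrightarrow> oper M p m = w p m"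
    using create[OF W small fin] by blast
  have "rep_hom (V M) (oper M) (V T) (oper T) g" if "(T, g) \<in> \<Gamma>" for T g
    using \<Gamma>[OF that] M(2,3) src_sort unfolding rep_hom_def by simp
  then have hom: "is_hom M T g" if "(T, g) \<in> \<Gamma>" for T g
    using rep_hom_iff[OF M(1) objD(1)] \<Gamma> that by blast
  have "laws M"
  proof (rule laws_inj[OF M(1), of \<Gamma>])
    show "pre T \<and> laws T \<and> is_hom M T g" if "(T, g) \<in> \<Gamma>" for T g
      using hom[OF that] \<Gamma>[OF that] objD by blast
    fix x r m assume x: "x \<in> obj X" "r \<in> lobj (E x)" and m: "m \<in> carrier (sp M x r)"
      and z: "\<And>T g. (T, g) \<in> \<Gamma> \<Longrightarrow> g (x, r) m = \<zero>\<^bsub>sp T x r\<^esub>"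
    have eq: "V M (x, r) = W (x, r)" using M(2) x by simp
    have "m = \<zero>\<^bsub>W (x, r)\<^esub>" by (rule inj) (use x m z eq[symmetric] in auto)
    then show "m = \<zero>\<^bsub>sp M x r\<^esub>" using eq[symmetric] by simp
  qed
  then show "\<exists>M\<in>obj Mods. (\<forall>s\<in>Sorts. V M s = W s) \<and> (\<forall>p\<in>Ops. \<forall>x\<in>carrier (W (src p)). oper M p x = w p x)"
    using M obj_iff by blast
next
  fix W :: "'x \<times> 'o \<Rightarrow> ('k, 'u) module" and w T q
  assume W: "rep W w" and T: "T \<in> obj Mods" and q: "rep_hom (V T) (oper T) W w q"
    and surj: "\<And>s. s \<in> Sorts \<Longrightarrow> q s ` carrier (V T s) = carrier (W s)"
  note p = objD(1)[OF T]
  have small: "small U (carrier (W s))" if "s \<in> Sorts" for s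
  proof (cases s)
    case (Pair x r)
    have "small U (q s ` carrier (V T s))"
      using that Pair pre_small[OF p] by (intro small_image[OF univ]) simp
    then show ?thesis using surj[OF that] by simp
  qed
  \<comment> \<open>The coordinates of \<open>q n\<close> are the images of the coordinates of
    \<open>n\<close>, so the support does not grow.\<close>
  have fin: "finite {b \<in> B. w (co s b) y \<noteq> \<zero>\<^bsub>W s\<^esub>}" if s: "s \<in> Sorts" and y: "y \<in> carrier (W s)" for s y
  proof (cases s)
    case (Pair x r)
    then have x: "x \<in> obj X" "r \<in> lobj (E x)" using s by auto
    obtain n where n: "n \<in> carrier (sp T x r)" "y = q (x, r) n" using surj[OF s] y Pair by auto
    have "q (x, r) \<zero>\<^bsub>V T (x, r)\<^esub> = \<zero>\<^bsub>W (x, r)\<^esub>"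
      using linear_map_zero[OF module_V[OF p x] rep_module[OF W] rep_hom_linear[OF q]] x by simp
    moreover have "w (Co x r b) (q (x, r) n) = q (x, r) (cf (sp T x r) b n)" if "b \<in> B" for b
      using rep_hom_op[OF q, of "Co x r b" n] that x n by simp
    ultimately have "{b \<in> B. w (co s b) y \<noteq> \<zero>\<^bsub>W s\<^esub>} \<subseteq> {b \<in> B. cf (sp T x r) b n \<noteq> \<zero>\<^bsub>sp T x r\<^esub>}"
      using Pair n by auto
    then show ?thesis using cf_finite[OF pre_sp[OF p x] n(1)] finite_subset by blast
  qed
  obtain M where M: "pre M" "\<And>s. s \<in> Sorts \<Longrightarrow> V M s = W s"
    "\<And>p m. \<lbrakk>p \<in> Ops; m \<in> carrier (W (src p))\<rbrakk> \<Longrightarrow> oper M p m = w p m"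
    using create[OF W small fin] by blast
  have "rep_hom (V T) (oper T) (V M) (oper M) q"
    unfolding rep_hom_def
  proof (intro conjI ballI)
    show "linear_map K (V T s) (V M s) (q s)" if "s \<in> Sorts" for s using rep_hom_linear[OF q that] M(2)[OF that] by simp
    fix p m assume om: "p \<in> Ops" "m \<in> carrier (V T (src p))"
    then show "q (tgt p) (oper T p m) = oper M p (q (src p) m)"
      using rep_hom_op[OF q om] M(3)[OF om(1)] linear_map_closed[OF rep_hom_linear[OF q src_sort[OF om(1)]]] by simp
  qed
  then have "is_hom T M q" using rep_hom_iff[OF p M(1)] by blast
  then have "laws M"
  proof (rule laws_surj[OF p objD(2)[OF T] M(1)])
    show "q (x, r) ` carrier (sp T x r) = carrier (sp M x r)" if "x \<in> obj X" "r \<in> lobj (E x)" for x r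
      using surj[of "(x, r)"] M(2)[of "(x, r)", symmetric] that by simp
  qed
  then show "\<exists>M\<in>obj Mods. (\<forall>s\<in>Sorts. V M s = W s) \<and> (\<forall>p\<in>Ops. \<forall>x\<in>carrier (W (src p)). oper M p x = w p x)"
    using M obj_iff by blast
qed

end

theorem theorem3:
  fixes K :: "'k ring" and C :: "('k, 'c) coalgebra" and X :: "('x, 'a) cat"
    and R :: "('x, 'a, 'o, 'f, 'k, 'c) representation"
  assumes "universe TYPE('u)"
    and "field K" and "small TYPE('u) (carrier K)"
    and "coalgebra K C" and "small TYPE('u) (carrier C)"
    and "right_semiperfect TYPE('u) K C"
    and "small_category TYPE('u) X"
    and "is_representation TYPE('u) K C X R"
  shows "grothendieck_category TYPE('u) (Mod_cat TYPE('u) K C X R)"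
proof -
  \<comment> \<open>Over a field \<open>C\<close> has a basis; it fixes the coordinates in which the
    category becomes an \<open>operator_category\<close>.\<close>
  obtain B e where basis: "is_basis K C B e"
    using basis_exists[OF assms(2) coalgebra.module[OF assms(4)]] by blast
  interpret entwined_representation K C B e "TYPE('u)" X R
    using assms basis
    by (intro entwined_representation.intro entwined_representation_axioms.intro
        coalgebra_basis.intro coalgebra_basis_axioms.intro)
  show ?thesis by (rule operator_category.grothendieck[OF Mods_operator_category])
qed

end
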